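(* Let $\mathbf x\in L^2(P;H)$ be independent of $\mathbf w$, and for $\gamma\ge 0$ let $\mathbf y=\sqrt\gamma\,\mathbf x+\mathbf w$. Denote $\widehat\varepsilon^2(\gamma)=E|\mathbf x-\widehat{\mathbf x}^{\mathbf y}|_H^2$ and $\widetilde\varepsilon^2(\gamma)=E|\mathbf x-\widetilde{\mathbf x}^{\mathbf y}|_H^2$ (causal and noncausal least mean square errors). Then for $\gamma>0$ $$\widetilde\varepsilon^2(\gamma)=\frac{d\big(\gamma\,\widehat\varepsilon^2(\gamma)\big)}{d\gamma},$$ that is, $$\widehat\varepsilon^2(\gamma)=\frac{\gamma_0\,\widehat\varepsilon^2(\gamma_0)}{\gamma}+\frac1\gamma\int_{\gamma_0}^{\gamma}\widetilde\varepsilon^2(\beta)\,d\beta\qquad\text{for all }\gamma_0\ge 0 .$$ In addition, $\eta\mapsto\widehat\varepsilon^2(1/\eta)$ is a concave function of $\eta\in(0,\infty)$.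
   Context: $(\Theta,\mathcal F,P)$ is a complete probability space; measurability is understood modulo $P$-null sets. $\mathbf w$ is a centered nondegenerate Gaussian random variable with values in a Banach space $\Omega$, law $\mu_{\mathbf w}$, and separable reproducing kernel Hilbert space $H$ densely embedded in $\Omega$; thus $(\Omega,H,\mu_{\mathbf w})$ is an abstract Wiener space, $\Omega^*\subset H\subset\Omega$ densely, and $E\,{}_\Omega\langle\mathbf w,l_1\rangle_{\Omega^*}\,{}_\Omega\langle\mathbf w,l_2\rangle_{\Omega^*}=(l_1,l_2)_H$ for $l_1,l_2\in\Omega^*$. $\{\pi_t\}_{0\le t\le1}$ is a continuous, strictly increasing family of orthogonal projections on $H$ with $\pi_0=0$, $\pi_1=\mathrm{Id}_H$ and $\pi_t\Omega^*\subset\Omega^*$ for all $t$. The filtration induced by the $\Omega$-valued random variable $\mathbf y$ is $\mathcal F^{\mathbf y}_t=\sigma({}_\Omega\langle\mathbf y,\pi_t l\rangle_{\Omega^*},\,l\in\Omega^* )$, $0\le t\le1$. An $H$-valued random variable $\mathbf z$ is $(\pi_\cdot,\mathcal F^{\mathbf y}_\cdot)$-adapted if $(\mathbf z,\pi_t l)_H$ is $\mathcal F^{\mathbf y}_t$-measurable for all $t\in[0,1]$, $l\in\Omega^*$. For $\mathbf h\in L^2(P;H)$, the causal least mean square estimator $\widehat{\mathbf h}^{\mathbf y}$ is the orthogonal projection in $L^2(P;H)$ of $\mathbf h$ on the closed subspace of $(\pi_\cdot,\mathcal F^{\mathbf y}_\cdot)$-adapted elements, and the noncausal one is $\widetilde{\mathbf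 h}^{\mathbf y}=E(\mathbf h\mid\mathcal F^{\mathbf y}_1)$. *)

theory Defs
  imports "HOL-Probability.Probability"
begin

subsection \<open>Abstract Wiener space\<close>

text \<open>
  The inclusion of \<open>H\<close> into \<open>\<Omega>\<close> is a map \<open>\<iota>\<close>.  By the Riesz theorem, a functional
  \<open>l\<close> in \<open>\<Omega>*\<close> is identified with the unique vector of \<open>H\<close> that represents the restriction of
  \<open>l\<close> to \<open>H\<close>.  If \<open>\<iota>\<close> has dense range, this identification is injective.
\<close>

definition dual_to_H ::
  "('h::real_inner \<Rightarrow> 'o::real_normed_vector) \<Rightarrow> ('o \<Rightarrow>\<^sub>L real) \<Rightarrow> 'h" where
  "dual_to_H \<iota> l = (THE k. \<forall>h. k \<bullet> h = blinfun_apply l (\<iota> h))"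

definition centered_nondegenerate_gaussian ::
  "'a measure \<Rightarrow> ('a \<Rightarrow> 'o::real_normed_vector) \<Rightarrow> bool" where
  "centered_nondegenerate_gaussian M w \<longleftrightarrow>
     w \<in> borel_measurable M \<and>
     (\<forall>l :: 'o \<Rightarrow>\<^sub>L real. l \<noteq> 0 \<longrightarrow>
        (\<exists>\<sigma>>0. distributed M lborel (\<lambda>\<theta>. blinfun_apply l (w \<theta>)) (normal_density 0 \<sigma>)))"

definition abstract_wiener_space ::
  "'a measure \<Rightarrow> ('a \<Rightarrow> 'o::real_normed_vector) \<Rightarrow> ('h::real_inner \<Rightarrow> 'o) \<Rightarrow> bool" where
  "abstract_wiener_space M w \<iota> \<longleftrightarrow>
     bounded_linear \<iota> \<and> inj \<iota> \<and> closure (range \<iota>) = UNIV \<and>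
     centered_nondegenerate_gaussian M w \<and>
     (\<forall>l1 l2. (\<integral>\<theta>. blinfun_apply l1 (w \<theta>) * blinfun_apply l2 (w \<theta>) \<partial>M)
                = dual_to_H \<iota> l1 \<bullet> dual_to_H \<iota> l2)"

subsection \<open>Families of projections\<close>

definition orthogonal_projection :: "('h::real_inner \<Rightarrow> 'h) \<Rightarrow> bool" where
  "orthogonal_projection p \<longleftrightarrow>
     bounded_linear p \<and> (\<forall>u. p (p u) = p u) \<and> (\<forall>u v. p u \<bullet> v = u \<bullet> p v)"

text \<open>
  Continuity is meant in the strong operator topology: distinct nested projections are at operator
  norm distance one, so a strictly increasing family is never norm continuous.
\<close>

definition projection_family ::
  "('h::real_inner \<Rightarrow> 'o::real_normed_vector) \<Rightarrow> (real \<Rightarrow> 'h \<Rightarrow> 'h) \<Rightarrow> bool" where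
  "projection_family \<iota> \<pi> \<longleftrightarrow>
     (\<forall>t\<in>{0..1}. orthogonal_projection (\<pi> t)) \<and>
     (\<forall>s\<in>{0..1}. \<forall>t\<in>{0..1}. s < t \<longrightarrow> range (\<pi> s) \<subset> range (\<pi> t)) \<and>
     (\<forall>h. continuous_on {0..1} (\<lambda>t. \<pi> t h)) \<and>
     (\<forall>h. \<pi> 0 h = 0) \<and> (\<forall>h. \<pi> 1 h = h) \<and>
     (\<forall>t\<in>{0..1}. \<forall>l. \<pi> t (dual_to_H \<iota> l) \<in> range (dual_to_H \<iota>))"

text \<open>The vector \<open>\<pi>\<^sub>t l\<close>, an element of \<open>\<Omega>*\<close> inside \<open>H\<close>, as a functional on \<open>\<Omega>\<close>.\<close>

definition dual_proj ::
  "('h::real_inner \<Rightarrow> 'o::real_normed_vector) \<Rightarrow> (real \<Rightarrow> 'h \<Rightarrow> 'h) \<Rightarrow> real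
     \<Rightarrow> ('o \<Rightarrow>\<^sub>L real) \<Rightarrow> ('o \<Rightarrow>\<^sub>L real)" where
  "dual_proj \<iota> \<pi> t l = (THE l'. dual_to_H \<iota> l' = \<pi> t (dual_to_H \<iota> l))"

subsection \<open>Filtration and adapted elements\<close>

text \<open>
  The null sets are added to the generators because measurability is understood modulo null sets.
\<close>

definition filtration ::
  "'a measure \<Rightarrow> ('h::real_inner \<Rightarrow> 'o::real_normed_vector) \<Rightarrow> (real \<Rightarrow> 'h \<Rightarrow> 'h)
     \<Rightarrow> ('a \<Rightarrow> 'o) \<Rightarrow> real \<Rightarrow> 'a measure" where
  "filtration M \<iota> \<pi> y t =
     sigma (space M)
       ({(\<lambda>\<theta>. blinfun_apply (dual_proj \<iota> \<pi> t l) (y \<theta>)) -` B \<inter> space M | l B. B \<in> sets borel}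
        \<union> null_sets M)"

definition L2 :: "'a measure \<Rightarrow> ('a \<Rightarrow> 'h::real_normed_vector) set" where
  "L2 M = {z \<in> borel_measurable M. integrable M (\<lambda>\<theta>. (norm (z \<theta>))\<^sup>2)}"

definition adapted ::
  "'a measure \<Rightarrow> ('h::real_inner \<Rightarrow> 'o::real_normed_vector) \<Rightarrow> (real \<Rightarrow> 'h \<Rightarrow> 'h)
     \<Rightarrow> ('a \<Rightarrow> 'o) \<Rightarrow> ('a \<Rightarrow> 'h) \<Rightarrow> bool" where
  "adapted M \<iota> \<pi> y z \<longleftrightarrow>
     (\<forall>t\<in>{0..1}. \<forall>l. (\<lambda>\<theta>. z \<theta> \<bullet> \<pi> t (dual_to_H \<iota> l)) \<in> borel_measurable (filtration M \<iota> \<pi> y t))"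

subsection \<open>Estimators\<close>

definition is_L2_projection ::
  "'a measure \<Rightarrow> ('a \<Rightarrow> 'h::real_inner) set \<Rightarrow> ('a \<Rightarrow> 'h) \<Rightarrow> ('a \<Rightarrow> 'h) \<Rightarrow> bool" where
  "is_L2_projection M K h z \<longleftrightarrow> z \<in> K \<and> (\<forall>u\<in>K. (\<integral>\<theta>. (h \<theta> - z \<theta>) \<bullet> u \<theta> \<partial>M) = 0)"

definition is_cond_exp ::
  "'a measure \<Rightarrow> 'a measure \<Rightarrow> ('a \<Rightarrow> 'h::{banach, second_countable_topology}) \<Rightarrow> ('a \<Rightarrow> 'h) \<Rightarrow> bool"
  where
  "is_cond_exp M F h z \<longleftrightarrow>
     z \<in> borel_measurable F \<and> integrable M z \<and>
     (\<forall>A\<in>sets F. set_lebesgue_integral M A z = set_lebesgue_integral M A h)"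

text \<open>
  Both estimators are determined up to null sets only; \<open>SOME\<close> picks a version, and the errors below
  do not depend on the choice.
\<close>

definition causal_estimator ::
  "'a measure \<Rightarrow> ('h::real_inner \<Rightarrow> 'o::real_normed_vector) \<Rightarrow> (real \<Rightarrow> 'h \<Rightarrow> 'h)
     \<Rightarrow> ('a \<Rightarrow> 'o) \<Rightarrow> ('a \<Rightarrow> 'h) \<Rightarrow> 'a \<Rightarrow> 'h" where
  "causal_estimator M \<iota> \<pi> y h = (SOME z. is_L2_projection M {u \<in> L2 M. adapted M \<iota> \<pi> y u} h z)"

definition noncausal_estimator ::
  "'a measure \<Rightarrow> ('h::{banach, real_inner, second_countable_topology} \<Rightarrow> 'o::real_normed_vector)
     \<Rightarrow> (real \<Rightarrow> 'h \<Rightarrow> 'h) \<Rightarrow> ('a \<Rightarrow> 'o) \<Rightarrow> ('a \<Rightarrow> 'h) \<Rightarrow> 'a \<Rightarrow> 'h" where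
  "noncausal_estimator M \<iota> \<pi> y h = (SOME z. is_cond_exp M (filtration M \<iota> \<pi> y 1) h z)"

definition observation ::
  "('h \<Rightarrow> 'o::real_normed_vector) \<Rightarrow> ('a \<Rightarrow> 'h) \<Rightarrow> ('a \<Rightarrow> 'o) \<Rightarrow> real \<Rightarrow> 'a \<Rightarrow> 'o" where
  "observation \<iota> x w \<gamma> = (\<lambda>\<theta>. sqrt \<gamma> *\<^sub>R \<iota> (x \<theta>) + w \<theta>)"

definition causal_error ::
  "'a measure \<Rightarrow> ('h::real_inner \<Rightarrow> 'o::real_normed_vector) \<Rightarrow> (real \<Rightarrow> 'h \<Rightarrow> 'h)
     \<Rightarrow> ('a \<Rightarrow> 'h) \<Rightarrow> ('a \<Rightarrow> 'o) \<Rightarrow> real \<Rightarrow> real" where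
  "causal_error M \<iota> \<pi> x w \<gamma> =
     (\<integral>\<theta>. (norm (x \<theta> - causal_estimator M \<iota> \<pi> (observation \<iota> x w \<gamma>) x \<theta>))\<^sup>2 \<partial>M)"

definition noncausal_error ::
  "'a measure \<Rightarrow> ('h::{banach, real_inner, second_countable_topology} \<Rightarrow> 'o::real_normed_vector)
     \<Rightarrow> (real \<Rightarrow> 'h \<Rightarrow> 'h) \<Rightarrow> ('a \<Rightarrow> 'h) \<Rightarrow> ('a \<Rightarrow> 'o) \<Rightarrow> real \<Rightarrow> real" where
  "noncausal_error M \<iota> \<pi> x w \<gamma> =
     (\<integral>\<theta>. (norm (x \<theta> - noncausal_estimator M \<iota> \<pi> (observation \<iota> x w \<gamma>) x \<theta>))\<^sup>2 \<partial>M)"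

text \<open>
  The constant \<open>indep_var\<close> of the library needs random variables with the same range type.
\<close>

definition independent_rvs ::
  "'a measure \<Rightarrow> ('a \<Rightarrow> 'b::topological_space) \<Rightarrow> ('a \<Rightarrow> 'c::topological_space) \<Rightarrow> bool" where
  "independent_rvs M X Y \<longleftrightarrow>
     prob_space.indep_set M {X -` A \<inter> space M | A. A \<in> sets borel}
                            {Y -` B \<inter> space M | B. B \<in> sets borel}"

end

theory Submission
  imports Defs
begin

text \<open>
  The causal error at the signal-to-noise ratio \<open>\<gamma>\<close> is the average of the
  noncausal errors over \<open>0..\<gamma>\<close>. Once this is known, the theorem is calculus: the
  noncausal error is continuous, so the average can be differentiated, and it is decreasing, so
  \<open>\<gamma>\<close> times the average is a concave function, whose perspective is the causal
  error as a function of \<open>1 / \<gamma>\<close>. By Pythagoras the statement about errors is one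
  about the second moments of the estimates, and in this form it is \<open>causal_eq_average\<close>.

  Consider first finitely many coordinates \<open>X j\<close>, bounded and observed with independent
  signal-to-noise ratios \<open>a j\<close>. The relative entropy of the observed vector is a function
  of the vector \<open>a\<close> whose partial derivative in \<open>a j\<close> is half the second
  moment of the conditional mean of \<open>X j\<close> (\<open>entropy_increment\<close>). Hence its
  increment from zero to the constant \<open>\<gamma>\<close> can be computed along two paths. Raising
  all coordinates together gives the integral of the noncausal second moments. Raising the coordinates
  block by block gives a sum in which each block is estimated from the blocks before it, that is, from
  its past, and partly from itself. As observing more helps, the sum lies between two sums of
  estimates given the strict past and given the past including the block
  (\<open>blocks_sandwich\<close>). This argument replaces the stochastic calculus of filtering
  theory.

  On the other hand the causal estimate itself lies between the same kind of sums for the cells of a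
  partition of the time interval (\<open>causal_lower\<close>, \<open>causal_upper\<close>): the sum
  over the cells of the powers of the cell components of the noncausal estimates at the beginnings,
  respectively the ends, of the cells. The difference of the two sums is the power of the innovations
  within the cells. It vanishes as the partition is refined, since the projections are continuous and
  a signal can be approximated by one with finitely many values (\<open>gap_tendsto\<close>).

  It remains to pass from finite systems to the Hilbert space. An orthonormal system adapted to the
  cells turns the channel into a finite Gaussian observation, in which the analytic second moments are
  those of conditional expectations (\<open>explained_eq_cond_exp\<close>); martingale convergence
  exhausts the past (\<open>filt_cond_exp_tendsto\<close>). Square integrable signals are truncated;
  the error is bounded by the tail of the second moment uniformly in the number of coordinates
  (\<open>quotient_perturbation\<close>), so that the modulus of continuity of the noncausal error
  also survives the limit. In the abstract Wiener space the functionals on the large space, as vectors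
  of the Hilbert space, form the dense subspace on which the noise is defined; the Riesz and
  Hahn-Banach theorems provide this identification.

  Throughout, \<open>th\<close> denotes a sample point.
\<close>

section \<open>Square integrable vectors\<close>

lemmas lint_nonneg = Bochner_Integration.integral_nonneg
  and lint_cong = Bochner_Integration.integral_cong
  and lint_bound = Bochner_Integration.integrable_bound
  and lint_sum = Bochner_Integration.integral_sum

lemma L2_measurable: "u \<in> L2 M \<Longrightarrow> u \<in> borel_measurable M"
  and L2_integrable: "u \<in> L2 M \<Longrightarrow> integrable M (\<lambda>th. (norm (u th))\<^sup>2)"
  by (auto simp: L2_def)

lemma L2_inner_integrable:
  fixes u v :: "'a \<Rightarrow> 'h::{real_inner, second_countable_topology}"
  assumes "u \<in> L2 M" "v \<in> L2 M"
  shows "integrable M (\<lambda>th. u th \<bullet> v th)"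
proof -
  have [measurable]: "u \<in> borel_measurable M" "v \<in> borel_measurable M"
    using assms by (auto simp: L2_def)
  have *: "\<bar>a \<bullet> b\<bar> \<le> (norm a)\<^sup>2 + (norm b)\<^sup>2" for a b :: 'h
  proof -
    have "\<bar>a \<bullet> b\<bar> \<le> norm a * norm b" by (rule Cauchy_Schwarz_ineq2)
    also have "\<dots> \<le> (norm a)\<^sup>2 + (norm b)\<^sup>2"
      using sum_squares_bound[of "norm a" "norm b"] mult_nonneg_nonneg[OF norm_ge_zero norm_ge_zero, of a b]
      by linarith
    finally show ?thesis .
  qed
  show ?thesis
    by (rule lint_bound
        [OF Bochner_Integration.integrable_add[OF L2_integrable[OF assms(1)] L2_integrable[OF assms(2)]]])
      (use * in \<open>auto intro!: AE_I2\<close>)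
qed

lemma L2_scaleR:
  fixes u :: "'a \<Rightarrow> 'h::{real_inner, second_countable_topology}"
  assumes "u \<in> L2 M"
  shows "(\<lambda>th. c *\<^sub>R u th) \<in> L2 M"
  using assms by (auto simp: L2_def power_mult_distrib)

lemma L2_add:
  fixes u v :: "'a \<Rightarrow> 'h::{real_inner, second_countable_topology}"
  assumes "u \<in> L2 M" "v \<in> L2 M"
  shows "(\<lambda>th. u th + v th) \<in> L2 M"
proof -
  have "(norm (a + b))\<^sup>2 = (norm a)\<^sup>2 + 2 * (a \<bullet> b) + (norm b)\<^sup>2" for a b :: 'h
    by (simp add: power2_norm_eq_inner inner_add inner_commute)
  then show ?thesis
    using assms L2_inner_integrable[OF assms]
    by (auto simp: L2_def)
qed

lemma L2_diff:
  fixes u v :: "'a \<Rightarrow> 'h::{real_inner, second_countable_topology}"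
  assumes "u \<in> L2 M" "v \<in> L2 M"
  shows "(\<lambda>th. u th - v th) \<in> L2 M"
  using L2_add[OF assms(1) L2_scaleR[OF assms(2), of "-1"]] by simp

lemma L2_sum:
  fixes u :: "'i \<Rightarrow> 'a \<Rightarrow> 'h::{real_inner, second_countable_topology}"
  assumes "\<And>i. i \<in> I \<Longrightarrow> u i \<in> L2 M"
  shows "(\<lambda>th. \<Sum>i\<in>I. u i th) \<in> L2 M"
proof (cases "finite I")
  case True
  then show ?thesis using assms
  proof (induction I)
    case empty
    then show ?case by (simp add: L2_def)
  next
    case (insert i I)
    then show ?case by (simp add: L2_add)
  qed
next
  case False
  then show ?thesis by (simp add: L2_def)
qed

lemma L2_bounded_linear:
  fixes u :: "'a \<Rightarrow> 'h::{real_inner, second_countable_topology}"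
    and T :: "'h \<Rightarrow> 'k::{real_inner, second_countable_topology}"
  assumes T: "bounded_linear T" and u: "u \<in> L2 M"
  shows "(\<lambda>th. T (u th)) \<in> L2 M"
proof -
  have [measurable]: "u \<in> borel_measurable M" using u by (rule L2_measurable)
  have [measurable]: "T \<in> borel_measurable borel"
    using T by (intro borel_measurable_continuous_onI linear_continuous_on)
  obtain K where K: "\<And>v. norm (T v) \<le> norm v * K" using bounded_linear.bounded[OF T] by blast
  have "integrable M (\<lambda>th. (norm (T (u th)))\<^sup>2)"
  proof (rule lint_bound)
    show "integrable M (\<lambda>th. K\<^sup>2 * (norm (u th))\<^sup>2)" using L2_integrable[OF u] by simp
    show "AE th in M. norm ((norm (T (u th)))\<^sup>2) \<le> norm (K\<^sup>2 * (norm (u th))\<^sup>2)"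
    proof (rule AE_I2)
      fix th
      have "(norm (T (u th)))\<^sup>2 \<le> (norm (u th) * K)\<^sup>2" using K by (intro power_mono) auto
      then show "norm ((norm (T (u th)))\<^sup>2) \<le> norm (K\<^sup>2 * (norm (u th))\<^sup>2)"
        by (simp add: power_mult_distrib mult.commute)
    qed
  qed measurable
  then show ?thesis by (simp add: L2_def)
qed

lemma L2_AE_cong:
  fixes u v :: "'a \<Rightarrow> 'h::{real_inner, second_countable_topology}"
  assumes "u \<in> L2 M" "v \<in> borel_measurable M" "AE th in M. u th = v th"
  shows "v \<in> L2 M"
proof -
  have [measurable]: "u \<in> borel_measurable M" "v \<in> borel_measurable M" using assms by (auto simp: L2_def)
  have "integrable M (\<lambda>th. (norm (v th))\<^sup>2)"
    by (rule integrable_cong_AE_imp[OF L2_integrable[OF assms(1)]]) (use assms(3) in auto)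
  then show ?thesis by (simp add: L2_def)
qed

lemma (in finite_measure) L2_imp_integrable:
  fixes u :: "'a \<Rightarrow> 'h::{banach, real_inner, second_countable_topology}"
  assumes "u \<in> L2 M"
  shows "integrable M u"
proof -
  have [measurable]: "u \<in> borel_measurable M" using assms by (auto simp: L2_def)
  have "integrable M (\<lambda>th. norm (u th))"
    by (rule square_integrable_imp_integrable) (use L2_integrable[OF assms] in auto)
  then show ?thesis by (simp add: integrable_norm_iff)
qed

text \<open>
  Fatou: a bound on second moments passes to almost sure limits.
\<close>

lemma L2_limit_bound:
  fixes v :: "nat \<Rightarrow> 'a \<Rightarrow> 'h::{real_inner, second_countable_topology}"
  assumes v: "\<And>n. v n \<in> L2 M" and [measurable]: "l \<in> borel_measurable M"
    and lim: "AE th in M. (\<lambda>n. v n th) \<longlonglongrightarrow> l th"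
    and C: "\<forall>\<^sub>F n in sequentially. (LINT th|M. (norm (v n th))\<^sup>2) \<le> C"
  shows "l \<in> L2 M" "(LINT th|M. (norm (l th))\<^sup>2) \<le> C"
proof -
  have [measurable]: "v n \<in> borel_measurable M" for n using v L2_measurable by blast
  have C0: "C \<ge> 0"
  proof -
    obtain n where "(LINT th|M. (norm (v n th))\<^sup>2) \<le> C"
      using C by (auto simp: eventually_sequentially)
    moreover have "0 \<le> (LINT th|M. (norm (v n th))\<^sup>2)" by (rule lint_nonneg) simp
    ultimately show ?thesis by linarith
  qed
  have "(\<integral>\<^sup>+th. ennreal ((norm (l th))\<^sup>2) \<partial>M) = (\<integral>\<^sup>+th. liminf (\<lambda>n. ennreal ((norm (v n th))\<^sup>2)) \<partial>M)"
  proof (rule nn_integral_cong_AE, use lim in eventually_elim)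
    case (elim th)
    have "(\<lambda>n. ennreal ((norm (v n th))\<^sup>2)) \<longlonglongrightarrow> ennreal ((norm (l th))\<^sup>2)"
      by (intro tendsto_ennrealI tendsto_intros elim)
    then show ?case by (rule lim_imp_Liminf[OF sequentially_bot, symmetric])
  qed
  also have "\<dots> \<le> liminf (\<lambda>n. \<integral>\<^sup>+th. ennreal ((norm (v n th))\<^sup>2) \<partial>M)"
    by (rule nn_integral_liminf) simp
  also have "\<dots> \<le> ennreal C"
  proof (rule Liminf_le)
    show "\<forall>\<^sub>F n in sequentially. (\<integral>\<^sup>+th. ennreal ((norm (v n th))\<^sup>2) \<partial>M) \<le> ennreal C"
      using C
    proof eventually_elim
      case (elim n)
      then show ?case
        by (subst nn_integral_eq_integral) (auto intro: L2_integrable v ennreal_leI)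
    qed
  qed simp
  finally have *: "(\<integral>\<^sup>+th. ennreal ((norm (l th))\<^sup>2) \<partial>M) \<le> ennreal C" .
  then have "integrable M (\<lambda>th. (norm (l th))\<^sup>2)"
    by (intro integrableI_bounded) (auto intro: le_less_trans[OF _ ennreal_less_top])
  then show "l \<in> L2 M" by (simp add: L2_def)
  then have "ennreal (LINT th|M. (norm (l th))\<^sup>2) \<le> ennreal C"
    using * by (subst (asm) nn_integral_eq_integral) (auto intro: L2_integrable)
  then show "(LINT th|M. (norm (l th))\<^sup>2) \<le> C" using C0 by simp
qed

text \<open>
  Completeness of the square integrable functions. On a finite measure an \<open>L\<^sup>2\<close>
  Cauchy sequence is also \<open>L\<^sup>1\<close> Cauchy, hence has an almost everywhere convergent
  subsequence; Fatou upgrades its limit to an \<open>L\<^sup>2\<close> limit of the whole sequence.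
\<close>

lemma (in finite_measure) L2_Cauchy_AE_subseq:
  fixes u :: "nat \<Rightarrow> 'a \<Rightarrow> 'h::{banach, real_inner, second_countable_topology}"
  assumes u: "\<And>n. u n \<in> L2 M"
    and cau: "\<And>e. e > 0 \<Longrightarrow> \<exists>N. \<forall>m\<ge>N. \<forall>n\<ge>N. (LINT th|M. (norm (u m th - u n th))\<^sup>2) < e"
  obtains z r where "z \<in> L2 M" "strict_mono r" "AE th in M. (\<lambda>n. u (r n) th) \<longlonglongrightarrow> z th"
    "(\<lambda>n. \<integral>th. (norm (u n th - z th))\<^sup>2 \<partial>M) \<longlonglongrightarrow> 0"
proof -
  have [measurable]: "u n \<in> borel_measurable M" for n using u L2_measurable by blast
  have norm_le: "(LINT th|M. norm (v th)) \<le> d / 2 * measure M (space M) + (LINT th|M. (norm (v th))\<^sup>2) / (2 * d)"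
    if v: "v \<in> L2 M" and d: "d > 0" for v :: "'a \<Rightarrow> 'h" and d :: real
  proof -
    have "(LINT th|M. norm (v th)) \<le> (LINT th|M. d / 2 + (norm (v th))\<^sup>2 / (2 * d))"
    proof (rule integral_mono)
      show "integrable M (\<lambda>th. norm (v th))" using L2_imp_integrable[OF v] by simp
      show "integrable M (\<lambda>th. d / 2 + (norm (v th))\<^sup>2 / (2 * d))" using L2_integrable[OF v] by simp
      show "norm (v th) \<le> d / 2 + (norm (v th))\<^sup>2 / (2 * d)" for th
        using d sum_squares_bound[of d "norm (v th)"]
        by (simp add: field_simps power2_eq_square)
    qed
    also have "\<dots> = d / 2 * measure M (space M) + (LINT th|M. (norm (v th))\<^sup>2) / (2 * d)"
      using L2_integrable[OF v] by simp
    finally show ?thesis .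
  qed
  obtain r where r: "strict_mono r" "AE th in M. Cauchy (\<lambda>i. u (r i) th)"
  proof (rule cauchy_L1_AE_cauchy_subseq[of M u])
    show "integrable M (u n)" for n using u by (rule L2_imp_integrable)
    fix e :: real assume e: "e > 0"
    define m0 where "m0 = measure M (space M) + 1"
    have m0: "m0 > 0" "measure M (space M) < m0" unfolding m0_def by (auto simp: add_nonneg_pos)
    define d where "d = e / m0"
    have d: "d > 0" using e m0 by (simp add: d_def)
    obtain N where N: "\<And>m n. m \<ge> N \<Longrightarrow> n \<ge> N \<Longrightarrow> (LINT th|M. (norm (u m th - u n th))\<^sup>2) < d * e"
      using cau[of "d * e"] d e by auto
    show "\<exists>N. \<forall>i\<ge>N. \<forall>j\<ge>N. (LINT th|M. norm (u i th - u j th)) < e"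
    proof (intro exI[of _ N] allI impI)
      fix i j assume ij: "i \<ge> N" "j \<ge> N"
      have "(LINT th|M. norm (u i th - u j th)) \<le> d / 2 * measure M (space M)
         + (LINT th|M. (norm (u i th - u j th))\<^sup>2) / (2 * d)"
        by (rule norm_le) (auto intro!: L2_diff u d)
      also have "\<dots> < d / 2 * m0 + d * e / (2 * d)"
        using d m0 N[OF ij] by (intro add_strict_mono mult_strict_left_mono divide_strict_right_mono) auto
      also have "\<dots> = e" using d m0 by (simp add: d_def)
      finally show "(LINT th|M. norm (u i th - u j th)) < e" .
    qed
  qed
  define z where "z th = lim (\<lambda>n. u (r n) th)" for th
  have z[measurable]: "z \<in> borel_measurable M"
    unfolding z_def by (rule borel_measurable_lim_metric) simp
  have lim: "AE th in M. (\<lambda>n. u (r n) th) \<longlonglongrightarrow> z th"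
    using r(2) by eventually_elim (simp add: z_def Cauchy_convergent_iff convergent_LIMSEQ_iff)
  have le: "(\<lambda>th. u m th - z th) \<in> L2 M \<and> (LINT th|M. (norm (u m th - z th))\<^sup>2) \<le> e"
    if N: "\<forall>m\<ge>N. \<forall>n\<ge>N. (LINT th|M. (norm (u m th - u n th))\<^sup>2) < e" and m: "m \<ge> N" for m N e
  proof -
    have ev: "\<forall>\<^sub>F n in sequentially. (LINT th|M. (norm (u m th - u (r n) th))\<^sup>2) \<le> e"
      unfolding eventually_sequentially
    proof (intro exI[of _ N] allI impI)
      fix n assume "n \<ge> N"
      then have "r n \<ge> N" using seq_suble[OF r(1), of n] by linarith
      then show "(LINT th|M. (norm (u m th - u (r n) th))\<^sup>2) \<le> e" using N m by (simp add: less_imp_le)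
    qed
    have l: "AE th in M. (\<lambda>n. u m th - u (r n) th) \<longlonglongrightarrow> u m th - z th"
      using lim by eventually_elim (intro tendsto_intros)
    show ?thesis
      using L2_limit_bound[OF L2_diff[OF u u] _ l ev] by simp
  qed
  obtain N1 where N1: "\<forall>m\<ge>N1. \<forall>n\<ge>N1. (LINT th|M. (norm (u m th - u n th))\<^sup>2) < 1"
    using cau[of 1] by auto
  have zL: "z \<in> L2 M"
    using L2_diff[OF u[of N1] conjunct1[OF le[OF N1 order_refl]]] by simp
  have "(\<lambda>n. \<integral>th. (norm (u n th - z th))\<^sup>2 \<partial>M) \<longlonglongrightarrow> 0"
  proof (rule LIMSEQ_I)
    fix e :: real assume "e > 0"
    then obtain N where N: "\<forall>m\<ge>N. \<forall>n\<ge>N. (LINT th|M. (norm (u m th - u n th))\<^sup>2) < e / 2"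
      using cau[of "e/2"] by auto
    show "\<exists>no. \<forall>n\<ge>no. norm ((LINT th|M. (norm (u n th - z th))\<^sup>2) - 0) < e"
    proof (intro exI[of _ N] allI impI)
      fix n assume "n \<ge> N"
      then have "(LINT th|M. (norm (u n th - z th))\<^sup>2) \<le> e / 2" using le[OF N] by blast
      moreover have "0 \<le> (LINT th|M. (norm (u n th - z th))\<^sup>2)" by (rule lint_nonneg) simp
      ultimately show "norm ((LINT th|M. (norm (u n th - z th))\<^sup>2) - 0) < e" using \<open>e > 0\<close> by simp
    qed
  qed
  with zL r(1) lim show ?thesis by (rule that)
qed

text \<open>
  The projection theorem, for classes of functions rather than of equivalence classes: closedness is
  required under almost everywhere limits. A minimising sequence is Cauchy by the parallelogram
  identity, and a minimiser satisfies the orthogonality relation by varying it along \<open>v\<close>.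
\<close>

lemma (in finite_measure) L2_projection_exists:
  fixes h :: "'a \<Rightarrow> 'h::{banach, real_inner, second_countable_topology}"
  assumes K: "K \<subseteq> L2 M" "K \<noteq> {}"
    and add: "\<And>u v. u \<in> K \<Longrightarrow> v \<in> K \<Longrightarrow> (\<lambda>th. u th + v th) \<in> K"
    and scale: "\<And>c u. u \<in> K \<Longrightarrow> (\<lambda>th. c *\<^sub>R u th) \<in> K"
    and closed: "\<And>s l. (\<And>n. s n \<in> K) \<Longrightarrow> l \<in> L2 M \<Longrightarrow> AE th in M. (\<lambda>n. s n th) \<longlonglongrightarrow> l th \<Longrightarrow> l \<in> K"
    and h: "h \<in> L2 M"
  shows "\<exists>z. is_L2_projection M K h z"
proof -
  define D where "D u = (LINT th|M. (norm (h th - u th))\<^sup>2)" for u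
  define d where "d = Inf (D ` K)"
  have D0: "D u \<ge> 0" for u unfolding D_def by (rule lint_nonneg) simp
  have bdd: "bdd_below (D ` K)" using D0 by (auto intro!: bdd_belowI[of _ 0])
  have dle: "d \<le> D u" if "u \<in> K" for u unfolding d_def using bdd that by (auto intro: cInf_lower)
  have "\<exists>u\<in>K. D u < d + 1 / Suc n" for n
    using cInf_less_iff[OF _ bdd, of "d + 1 / Suc n"] K(2) by (auto simp: d_def)
  then obtain u where u: "\<And>n. u n \<in> K" "\<And>n. D (u n) < d + 1 / Suc n" by metis
  have uL: "u n \<in> L2 M" for n using u K by auto
  have par: "(LINT th|M. (norm (u m th - u n th))\<^sup>2) \<le> 2 / Suc m + 2 / Suc n" for m n
  proof -
    define a where "a th = (1/2) *\<^sub>R (u m th + u n th)" for th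
    have aK: "a \<in> K" unfolding a_def using scale[OF add[OF u(1) u(1)]] .
    have aL: "a \<in> L2 M" using aK K by auto
    have "(norm (p - q))\<^sup>2 = 2 * (norm (g - p))\<^sup>2 + 2 * (norm (g - q))\<^sup>2 - 4 * (norm (g - (1/2) *\<^sub>R (p + q)))\<^sup>2" for p q g :: 'h
      unfolding power2_norm_eq_inner by (simp add: inner_simps inner_commute algebra_simps)
    then have "(LINT th|M. (norm (u m th - u n th))\<^sup>2)
        = (LINT th|M. 2 * (norm (h th - u m th))\<^sup>2 + 2 * (norm (h th - u n th))\<^sup>2 - 4 * (norm (h th - a th))\<^sup>2)"
      unfolding a_def by (intro lint_cong) auto
    also have "\<dots> = 2 * D (u m) + 2 * D (u n) - 4 * D a"
      unfolding D_def
      using L2_integrable[OF L2_diff[OF h uL[of m]]] L2_integrable[OF L2_diff[OF h uL[of n]]]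
        L2_integrable[OF L2_diff[OF h aL]]
      by simp
    also have "\<dots> \<le> 2 / Suc m + 2 / Suc n" using u(2)[of m] u(2)[of n] dle[OF aK] by simp
    finally show ?thesis .
  qed
  obtain z r where z: "z \<in> L2 M" and r: "strict_mono r"
    and lim: "AE th in M. (\<lambda>n. u (r n) th) \<longlonglongrightarrow> z th"
  proof (rule L2_Cauchy_AE_subseq[of u])
    show "u n \<in> L2 M" for n by (rule uL)
    fix e :: real assume e: "e > 0"
    obtain N where N: "1 / Suc N < e / 4" using nat_approx_posE[of "e/4"] e by auto
    show "\<exists>N. \<forall>m\<ge>N. \<forall>n\<ge>N. (LINT th|M. (norm (u m th - u n th))\<^sup>2) < e"
    proof (intro exI[of _ N] allI impI)
      fix m n assume mn: "m \<ge> N" "n \<ge> N"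
      have "1 / Suc m \<le> 1 / Suc N" "1 / Suc n \<le> 1 / Suc N" using mn by (auto simp: divide_simps)
      with N par[of m n] show "(LINT th|M. (norm (u m th - u n th))\<^sup>2) < e" by simp
    qed
  qed
  have zK: "z \<in> K" by (rule closed[OF _ z lim]) (rule u)
  have Dz: "D z \<le> d + e" if e: "e > 0" for e
  proof -
    have "AE th in M. (\<lambda>n. h th - u (r n) th) \<longlonglongrightarrow> h th - z th"
      using lim by eventually_elim (intro tendsto_intros)
    moreover have "\<forall>\<^sub>F n in sequentially. D (u (r n)) \<le> d + e"
    proof -
      obtain N where N: "1 / Suc N < e" using nat_approx_posE[OF e] by auto
      show ?thesis unfolding eventually_sequentially
      proof (intro exI[of _ N] allI impI)
        fix n assume "n \<ge> N"
        then have "r n \<ge> N" using seq_suble[OF r(1), of n] by linarith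
        then have "1 / Suc (r n) \<le> 1 / Suc N" by (auto simp: divide_simps)
        then show "D (u (r n)) \<le> d + e" using u(2)[of "r n"] N by simp
      qed
    qed
    ultimately show ?thesis unfolding D_def
      by (intro L2_limit_bound(2)[of "\<lambda>n th. h th - u (r n) th"] L2_diff h uL L2_measurable z)
  qed
  then have Dz: "D z = d" using dle[OF zK] by (meson antisym field_le_epsilon)
  have "(LINT th|M. (h th - z th) \<bullet> v th) = 0" if v: "v \<in> K" for v
  proof -
    have vL: "v \<in> L2 M" using v K by auto
    define b where "b = (LINT th|M. (h th - z th) \<bullet> v th)"
    define c where "c = (LINT th|M. (norm (v th))\<^sup>2)"
    have ineq: "2 * t * b \<le> t\<^sup>2 * c" for t
    proof -
      have "(norm (p - (q + t *\<^sub>R w)))\<^sup>2 = (norm (p - q))\<^sup>2 - 2 * t * ((p - q) \<bullet> w) + t\<^sup>2 * (norm w)\<^sup>2" for p q w :: 'h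
        unfolding power2_norm_eq_inner by (simp add: inner_simps inner_commute power2_eq_square algebra_simps)
      then have "D (\<lambda>th. z th + t *\<^sub>R v th) = (LINT th|M. (norm (h th - z th))\<^sup>2 - 2 * t * ((h th - z th) \<bullet> v th) + t\<^sup>2 * (norm (v th))\<^sup>2)"
        unfolding D_def by simp
      also have "\<dots> = D z - 2 * t * b + t\<^sup>2 * c"
        unfolding D_def b_def c_def
        using L2_integrable[OF L2_diff[OF h z]] L2_inner_integrable[OF L2_diff[OF h z] vL] L2_integrable[OF vL]
        by simp
      finally show ?thesis using dle[OF add[OF zK scale[OF v, of t]]] Dz by simp
    qed
    have c0: "c \<ge> 0" unfolding c_def by (rule lint_nonneg) simp
    define t where "t = b / (c + 1)"
    have b: "b = t * (c + 1)" using c0 by (simp add: t_def)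
    have "2 * t * b \<le> t\<^sup>2 * c" by (rule ineq)
    then have "t\<^sup>2 * (c + 2) \<le> 0" unfolding b by (simp add: power2_eq_square algebra_simps)
    then have "t = 0" using c0 by (simp add: mult_le_0_iff)
    then have "b = 0" by (simp add: b)
    then show ?thesis by (simp add: b_def)
  qed
  with zK show ?thesis by (auto simp: is_L2_projection_def)
qed

section \<open>Functionals, projections and orthonormal sequences\<close>

text \<open>
  The Hahn-Banach theorem is needed only to find one functional that does not vanish at a given
  vector. It is a minimal element, by Zorn, among the sublinear functionals below a suitable one.
\<close>

definition sublinear_below_norm :: "('o::real_normed_vector \<Rightarrow> real) \<Rightarrow> bool" where
  "sublinear_below_norm q \<longleftrightarrow> (\<forall>x. q x \<le> norm x) \<and> (\<forall>x y. q (x + y) \<le> q x + q y) \<and>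
     (\<forall>c x. c > 0 \<longrightarrow> q (c *\<^sub>R x) = c * q x)"

lemma sublinear_zero: "sublinear_below_norm q \<Longrightarrow> q 0 = 0"
proof -
  assume "sublinear_below_norm q"
  then have "q (2 *\<^sub>R 0) = 2 * q 0" unfolding sublinear_below_norm_def by (metis zero_less_numeral)
  then show ?thesis by simp
qed

lemma sublinear_minus: "sublinear_below_norm q \<Longrightarrow> - q (- x) \<le> q x"
  using sublinear_zero[of q] unfolding sublinear_below_norm_def
  by (metis add.commute add.right_inverse neg_le_iff_le le_minus_iff minus_le_iff add_le_same_cancel1 diff_0 diff_le_eq)

text \<open>
  The largest sublinear functional below \<open>q\<close> whose value at \<open>- y\<close> is at most
  \<open>- q y\<close>. If \<open>q\<close> is minimal then \<open>steepest q y = q\<close> for every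
  \<open>y\<close>, which makes \<open>q\<close> odd and so linear.
\<close>

definition steepest :: "('o::real_normed_vector \<Rightarrow> real) \<Rightarrow> 'o \<Rightarrow> 'o \<Rightarrow> real" where
  "steepest q y x = (INF t\<in>{0..}. q (x + t *\<^sub>R y) - t * q y)"

lemma
  assumes q: "sublinear_below_norm q"
  shows sublinear_steepest: "sublinear_below_norm (steepest q y)"
    and steepest_le: "steepest q y x \<le> q x"
    and steepest_minus_le: "steepest q y (- y) \<le> - q y"
proof -
  have q1: "q (a + b) \<le> q a + q b" and q2: "c > 0 \<Longrightarrow> q (c *\<^sub>R a) = c * q a" and q3: "q a \<le> norm a" for a b c
    using q unfolding sublinear_below_norm_def by auto
  note q0 = sublinear_zero[OF q] and qm = sublinear_minus[OF q]
  have q2': "q (t *\<^sub>R a) = t * q a" if "t \<ge> 0" for t a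
    using that q2[of t a] q0 by (cases "t = 0") auto
  have low: "- q (- x) \<le> q (x + t *\<^sub>R y) - t * q y" if "t \<ge> 0" for t x
    using q1[of "- x" "x + t *\<^sub>R y"] q2'[OF that, of y] by simp
  have bdd: "bdd_below ((\<lambda>t. q (x + t *\<^sub>R y) - t * q y) ` {0..})" for x
    using low[of _ x] by (intro bdd_belowI[of _ "- q (- x)"]) auto
  have up: "steepest q y x \<le> q (x + t *\<^sub>R y) - t * q y" if "t \<ge> 0" for t x
    unfolding steepest_def using that by (intro cINF_lower bdd) auto
  have great: "m \<le> steepest q y x" if "\<And>t. t \<ge> 0 \<Longrightarrow> m \<le> q (x + t *\<^sub>R y) - t * q y" for m x
    unfolding steepest_def using that by (intro cINF_greatest) auto
  show le: "steepest q y x \<le> q x" for x using up[of 0 x] by simp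
  show "steepest q y (- y) \<le> - q y" using up[of 1 "- y"] q0 by simp
  have add: "steepest q y (a + b) \<le> steepest q y a + steepest q y b" for a b
  proof -
    have *: "steepest q y (a + b) \<le> (q (a + s *\<^sub>R y) - s * q y) + (q (b + t *\<^sub>R y) - t * q y)"
      if "s \<ge> 0" "t \<ge> 0" for s t
      using up[of "s + t" "a + b"] that q1[of "a + s *\<^sub>R y" "b + t *\<^sub>R y"]
      by (simp add: algebra_simps)
    have "steepest q y (a + b) - (q (a + s *\<^sub>R y) - s * q y) \<le> steepest q y b" if "s \<ge> 0" for s
      by (rule great) (use *[OF that] in \<open>simp add: algebra_simps\<close>)
    then have "steepest q y (a + b) - steepest q y b \<le> steepest q y a"
      by (intro great) (simp add: algebra_simps)
    then show ?thesis by simp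
  qed
  have scale_le: "c * steepest q y a \<le> steepest q y (c *\<^sub>R a)" if c: "c > 0" for c a
  proof (rule great)
    fix t :: real assume t: "t \<ge> 0"
    have "steepest q y a \<le> q (a + (t / c) *\<^sub>R y) - (t / c) * q y" using c t by (intro up) simp
    then have "c * steepest q y a \<le> c * q (a + (t / c) *\<^sub>R y) - t * q y"
      using c by (simp add: field_simps)
    also have "c * q (a + (t / c) *\<^sub>R y) = q (c *\<^sub>R a + t *\<^sub>R y)"
      using c q2[OF c, of "a + (t / c) *\<^sub>R y"] by (simp add: scaleR_add_right)
    finally show "c * steepest q y a \<le> q (c *\<^sub>R a + t *\<^sub>R y) - t * q y" .
  qed
  have scale: "steepest q y (c *\<^sub>R a) = c * steepest q y a" if c: "c > 0" for c a
  proof (rule antisym)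
    have "(1 / c) * steepest q y (c *\<^sub>R a) \<le> steepest q y a"
      using scale_le[of "1/c" "c *\<^sub>R a"] c by simp
    then show "steepest q y (c *\<^sub>R a) \<le> c * steepest q y a" using c by (simp add: field_simps)
  qed (rule scale_le[OF c])
  show "sublinear_below_norm (steepest q y)"
    unfolding sublinear_below_norm_def using add scale le q3 by (meson order_trans)
qed

lemma exists_functional_nonzero:
  fixes v :: "'o::real_normed_vector"
  assumes v: "v \<noteq> 0"
  shows "\<exists>l :: 'o \<Rightarrow>\<^sub>L real. blinfun_apply l v \<noteq> 0"
proof -
  define S where "S = {q :: 'o \<Rightarrow> real. sublinear_below_norm q \<and> q \<le> steepest norm v}"
  have normS: "sublinear_below_norm (norm :: 'o \<Rightarrow> real)"
    by (auto simp: sublinear_below_norm_def norm_triangle_ineq)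
  have S0: "steepest norm v \<in> S" using sublinear_steepest[OF normS] by (simp add: S_def)
  have "\<exists>m\<in>S. \<forall>q\<in>S. q \<le> m \<longrightarrow> q = m"
  proof (rule predicate_Zorn)
    show "partial_order_on S (relation_of (\<lambda>a b. b \<le> a) S)"
      by (rule partial_order_on_relation_ofI) auto
    fix C assume C: "C \<in> Chains (relation_of (\<lambda>a b. b \<le> a) S)"
    show "\<exists>u\<in>S. \<forall>a\<in>C. u \<le> a"
    proof (cases "C = {}")
      case True
      then show ?thesis using S0 by auto
    next
      case ne: False
      have CS: "C \<subseteq> S" using C unfolding Chains_def relation_of_def by auto
      have tot: "a \<le> b \<or> b \<le> a" if "a \<in> C" "b \<in> C" for a b
        using C that unfolding Chains_def relation_of_def by auto
      define u where "u x = (INF q\<in>C. q x)" for x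
      have sub: "sublinear_below_norm q" if "q \<in> C" for q using CS that by (auto simp: S_def)
      have bdd: "bdd_below ((\<lambda>q. q x) ` C)" for x
      proof (rule bdd_belowI)
        fix r assume "r \<in> (\<lambda>q. q x) ` C"
        then obtain q where q: "q \<in> C" "r = q x" by auto
        have "q (- x) \<le> norm x" using sub[OF q(1)] unfolding sublinear_below_norm_def by (metis norm_minus_cancel)
        then show "- norm x \<le> r" using sublinear_minus[OF sub[OF q(1)], of x] q by simp
      qed
      have le: "u x \<le> q x" if "q \<in> C" for q x unfolding u_def using that bdd by (intro cINF_lower)
      have gr: "m \<le> u x" if "\<And>q. q \<in> C \<Longrightarrow> m \<le> q x" for m x unfolding u_def using that ne by (intro cINF_greatest)
      have add: "u (x + y) \<le> u x + u y" for x y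
      proof -
        have *: "u (x + y) \<le> a x + b y" if ab: "a \<in> C" "b \<in> C" for a b
        proof -
          obtain c where c: "c \<in> C" "c \<le> a" "c \<le> b" using tot[OF ab] ab by auto
          have "u (x + y) \<le> c (x + y)" by (rule le[OF c(1)])
          also have "\<dots> \<le> c x + c y" using sub[OF c(1)] by (auto simp: sublinear_below_norm_def)
          also have "\<dots> \<le> a x + b y" using c by (intro add_mono) (auto simp: le_fun_def)
          finally show ?thesis .
        qed
        have "u (x + y) - a x \<le> u y" if "a \<in> C" for a
          by (rule gr) (use *[OF that] in \<open>simp add: algebra_simps\<close>)
        then have "u (x + y) - u y \<le> u x" by (intro gr) (simp add: algebra_simps)
        then show ?thesis by simp
      qed
      have scale_le: "c * u x \<le> u (c *\<^sub>R x)" if c: "c > 0" for c x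
      proof (rule gr)
        fix q assume q: "q \<in> C"
        have "q (c *\<^sub>R x) = c * q x" using sub[OF q] c by (auto simp: sublinear_below_norm_def)
        then show "c * u x \<le> q (c *\<^sub>R x)" using le[OF q, of x] c by simp
      qed
      have scale: "u (c *\<^sub>R x) = c * u x" if c: "c > 0" for c x
      proof (rule antisym)
        have "(1 / c) * u (c *\<^sub>R x) \<le> u x" using scale_le[of "1/c" "c *\<^sub>R x"] c by simp
        then show "u (c *\<^sub>R x) \<le> c * u x" using c by (simp add: field_simps)
      qed (rule scale_le[OF c])
      obtain q0 where q0: "q0 \<in> C" using ne by auto
      have "u x \<le> norm x" for x
        using le[OF q0, of x] sub[OF q0] unfolding sublinear_below_norm_def by (meson order_trans)
      then have "sublinear_below_norm u" using add scale by (auto simp: sublinear_below_norm_def)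
      moreover have "u \<le> steepest norm v"
        using le[OF q0] CS q0 by (auto simp: S_def le_fun_def intro: order_trans)
      ultimately have "u \<in> S" by (simp add: S_def)
      then show ?thesis using le by (auto simp: le_fun_def)
    qed
  qed
  then obtain m where mS: "m \<in> S" and min: "\<And>q. q \<in> S \<Longrightarrow> q \<le> m \<Longrightarrow> q = m" by blast
  have m: "sublinear_below_norm m" using mS by (simp add: S_def)
  have neg: "m (- y) = - m y" for y
  proof -
    have "steepest m y \<le> m" using steepest_le[OF m] by (auto simp: le_fun_def)
    then have "steepest m y = m"
      using min[of "steepest m y"] sublinear_steepest[OF m] mS by (auto simp: S_def)
    then have "m (- y) \<le> - m y" using steepest_minus_le[OF m, of y] by simp
    then show ?thesis using sublinear_minus[OF m, of y] by simp
  qed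
  have add: "m (x + y) = m x + m y" for x y
  proof (rule antisym)
    show "m (x + y) \<le> m x + m y" using m by (auto simp: sublinear_below_norm_def)
    have "m ((- x) + (- y)) \<le> m (- x) + m (- y)" using m unfolding sublinear_below_norm_def by blast
    then show "m x + m y \<le> m (x + y)" using neg[of "x + y"] by (simp add: neg)
  qed
  have scale: "m (c *\<^sub>R x) = c * m x" for c x
  proof -
    have pos: "m (c *\<^sub>R x) = c * m x" if "c > 0" for c x using m that by (auto simp: sublinear_below_norm_def)
    consider "c > 0" | "c = 0" | "c < 0" by linarith
    then show ?thesis
    proof cases
      case 3
      then show ?thesis using pos[of "- c" x] neg[of "c *\<^sub>R x"] by simp
    qed (use pos sublinear_zero[OF m] in auto)
  qed
  have "bounded_linear m"
  proof (rule bounded_linear_intro[of _ 1])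
    fix x
    have "m x \<le> norm x" "m (- x) \<le> norm (- x)" using m unfolding sublinear_below_norm_def by blast+
    then show "norm (m x) \<le> norm x * 1" by (simp add: neg)
  qed (auto simp: add scale)
  then have app: "blinfun_apply (Blinfun m) = m" by (rule bounded_linear_Blinfun_apply)
  have "m (- v) \<le> steepest norm v (- v)" using mS by (auto simp: S_def le_fun_def)
  also have "\<dots> \<le> - norm v" by (rule steepest_minus_le[OF normS])
  finally have "norm v \<le> m v" by (simp add: neg)
  then have "m v \<noteq> 0" using v by (metis norm_le_zero_iff)
  then show ?thesis using app by metis
qed

lemma subspace_closure:
  fixes S :: "'h::real_normed_vector set"
  assumes S: "subspace S"
  shows "subspace (closure S)"
proof -
  have "u + v \<in> closure S" if u: "u \<in> closure S" and v: "v \<in> closure S" for u v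
  proof -
    obtain a where a: "\<And>n. a n \<in> S" "a \<longlonglongrightarrow> u" using u unfolding closure_sequential by blast
    obtain b where b: "\<And>n. b n \<in> S" "b \<longlonglongrightarrow> v" using v unfolding closure_sequential by blast
    have "a n + b n \<in> S" for n by (rule subspace_add[OF S a(1) b(1)])
    moreover have "(\<lambda>n. a n + b n) \<longlonglongrightarrow> u + v" by (rule tendsto_add[OF a(2) b(2)])
    ultimately show ?thesis unfolding closure_sequential by (intro exI[of _ "\<lambda>n. a n + b n"]) simp
  qed
  moreover have "c *\<^sub>R u \<in> closure S" if u: "u \<in> closure S" for c u
  proof -
    obtain a where a: "\<And>n. a n \<in> S" "a \<longlonglongrightarrow> u" using u unfolding closure_sequential by blast
    have "c *\<^sub>R a n \<in> S" for n by (rule subspace_scale[OF S a(1)])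
    moreover have "(\<lambda>n. c *\<^sub>R a n) \<longlonglongrightarrow> c *\<^sub>R u" by (intro tendsto_intros a(2))
    ultimately show ?thesis unfolding closure_sequential by (intro exI[of _ "\<lambda>n. c *\<^sub>R a n"]) simp
  qed
  moreover have "0 \<in> closure S" using subspace_0[OF S] closure_subset by blast
  ultimately show ?thesis by (simp add: subspace_def)
qed

text \<open>
  The orthogonal projection in the Hilbert space itself is the case of a one-point measure space of
  the \<open>L\<^sup>2\<close> projection theorem.
\<close>

lemma closed_subspace_projection:
  fixes S :: "'h::{banach, real_inner, second_countable_topology} set"
  assumes S: "subspace S" "closed S"
  shows "\<exists>p\<in>S. \<forall>v\<in>S. (a - p) \<bullet> v = 0"
proof -
  define U where "U = count_space (UNIV :: unit set)"
  interpret U: finite_measure U unfolding U_def by (rule finite_measure_count_space) simp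
  have int: "integral\<^sup>L U f = f ()" for f :: "unit \<Rightarrow> real"
    unfolding U_def by (simp add: lebesgue_integral_count_space_finite UNIV_unit)
  have L2: "u \<in> L2 U" for u :: "unit \<Rightarrow> 'h"
    unfolding L2_def U_def by (simp add: integrable_count_space)
  have AE: "(AE t in U. P t) \<longleftrightarrow> P ()" for P
    unfolding U_def by (auto simp: AE_count_space)
  have "\<exists>z. is_L2_projection U {u. u () \<in> S} (\<lambda>_. a) z"
  proof (rule U.L2_projection_exists)
    show "{u. u () \<in> S} \<noteq> {}" using subspace_0[OF S(1)] by (auto intro!: exI[of _ "\<lambda>_. 0"])
    fix s :: "nat \<Rightarrow> unit \<Rightarrow> 'h" and l
    assume s: "\<And>n. s n \<in> {u. u () \<in> S}" and lim: "AE t in U. (\<lambda>n. s n t) \<longlonglongrightarrow> l t"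
    show "l \<in> {u. u () \<in> S}"
      using closed_sequentially[OF S(2), of "\<lambda>n. s n ()" "l ()"] s lim by (simp add: AE)
  qed (auto simp: L2 subspace_add[OF S(1)] subspace_scale[OF S(1)])
  then obtain z where "z () \<in> S" "\<And>u :: unit \<Rightarrow> 'h. u () \<in> S \<Longrightarrow> (a - z ()) \<bullet> u () = 0"
    by (auto simp: is_L2_projection_def int simp del: lebesgue_integral_const)
  then show ?thesis by (intro bexI[of _ "z ()"] ballI) (use \<open>\<And>u. u () \<in> S \<Longrightarrow> (a - z ()) \<bullet> u () = 0\<close>[of "\<lambda>_. _"] in auto)
qed

lemma riesz_representation:
  fixes \<phi> :: "'h::{banach, real_inner, second_countable_topology} \<Rightarrow> real"
  assumes "bounded_linear \<phi>"
  shows "\<exists>k. \<forall>h. k \<bullet> h = \<phi> h"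
proof (cases "\<forall>h. \<phi> h = 0")
  case True
  then show ?thesis by (intro exI[of _ 0]) simp
next
  case False
  then obtain a where a: "\<phi> a \<noteq> 0" by blast
  interpret \<phi>: bounded_linear \<phi> by fact
  have "subspace {h. \<phi> h = 0}" by (simp add: subspace_def \<phi>.zero \<phi>.add \<phi>.scaleR)
  moreover have "closed {h. \<phi> h = 0}"
    by (intro closed_Collect_eq continuous_on_const linear_continuous_on assms)
  ultimately obtain p where p: "\<phi> p = 0" "\<And>h. \<phi> h = 0 \<Longrightarrow> (a - p) \<bullet> h = 0"
    using closed_subspace_projection[of "{h. \<phi> h = 0}" a] by blast
  define n where "n = a - p"
  have perp: "n \<bullet> h = 0" if "\<phi> h = 0" for h using p(2)[OF that] by (simp add: n_def)
  have \<phi>n: "\<phi> n \<noteq> 0" using a p(1) by (simp add: n_def \<phi>.diff)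
  then have n0: "n \<noteq> 0" using \<phi>.zero by auto
  have "((\<phi> n / (n \<bullet> n)) *\<^sub>R n) \<bullet> h = \<phi> h" for h
  proof -
    have "n \<bullet> (h - (\<phi> h / \<phi> n) *\<^sub>R n) = 0" using \<phi>n by (intro perp) (simp add: \<phi>.diff \<phi>.scaleR)
    then have "n \<bullet> h = (\<phi> h / \<phi> n) * (n \<bullet> n)" by (simp add: inner_diff_right)
    then show ?thesis using \<phi>n n0 by simp
  qed
  then show ?thesis by blast
qed

text \<open>
  Allowing zero vectors lets one sequence serve every subspace, finite dimensional or not, and makes
  Gram-Schmidt total: a vector that depends on its predecessors is sent to zero by \<open>sgn\<close>.
\<close>

definition orthonormal_or_zero :: "(nat \<Rightarrow> 'h::real_inner) \<Rightarrow> bool" where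
  "orthonormal_or_zero g \<longleftrightarrow> (\<forall>m n. m \<noteq> n \<longrightarrow> g m \<bullet> g n = 0) \<and> (\<forall>n. g n = 0 \<or> norm (g n) = 1)"

fun gram_schmidt :: "(nat \<Rightarrow> 'h::real_inner) \<Rightarrow> nat \<Rightarrow> 'h" where
  "gram_schmidt d n = sgn (d n - (\<Sum>k<n. (d n \<bullet> gram_schmidt d k) *\<^sub>R gram_schmidt d k))"

declare gram_schmidt.simps [simp del]

lemma gram_schmidt_norm: "gram_schmidt d n = 0 \<or> norm (gram_schmidt d n) = 1"
  by (subst (1 2) gram_schmidt.simps) (simp add: norm_sgn sgn_zero_iff)

lemma gram_schmidt_orthogonal: "m < n \<Longrightarrow> gram_schmidt d n \<bullet> gram_schmidt d m = 0"
proof (induction n arbitrary: m rule: less_induct)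
  case (less n)
  let ?g = "gram_schmidt d"
  have orth: "?g k \<bullet> ?g m = 0" if "k < n" "k \<noteq> m" for k
    using less.IH[of k m] less.IH[of m k] that less.prems
    by (metis inner_commute linorder_neqE_nat)
  have "(\<Sum>k<n. (d n \<bullet> ?g k) * (?g k \<bullet> ?g m)) = (\<Sum>k\<in>{m}. (d n \<bullet> ?g k) * (?g k \<bullet> ?g m))"
    using less.prems orth by (intro sum.mono_neutral_right) auto
  also have "\<dots> = d n \<bullet> ?g m"
    using gram_schmidt_norm[of d m] by (auto simp: norm_eq_1)
  finally have "(d n - (\<Sum>k<n. (d n \<bullet> ?g k) *\<^sub>R ?g k)) \<bullet> ?g m = 0"
    by (simp add: inner_diff_left inner_sum_left)
  then show ?case
    by (subst gram_schmidt.simps) (simp add: sgn_div_norm)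
qed

lemma gram_schmidt_orthonormal: "orthonormal_or_zero (gram_schmidt d)"
  unfolding orthonormal_or_zero_def
  using gram_schmidt_norm gram_schmidt_orthogonal by (metis inner_commute linorder_neqE_nat)

lemma gram_schmidt_in_subspace:
  assumes "subspace D" "\<And>n. d n \<in> D"
  shows "gram_schmidt d n \<in> D"
proof (induction n rule: less_induct)
  case (less n)
  have "(\<Sum>k<n. (d n \<bullet> gram_schmidt d k) *\<^sub>R gram_schmidt d k) \<in> D"
    using less assms by (intro subspace_sum subspace_scale) auto
  then show ?case
    using assms by (subst gram_schmidt.simps) (simp add: sgn_div_norm subspace_scale subspace_diff)
qed

lemma gram_schmidt_expand:
  "d n = (\<Sum>k<Suc n. (d n \<bullet> gram_schmidt d k) *\<^sub>R gram_schmidt d k)"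
proof -
  let ?g = "gram_schmidt d"
  define r where "r = d n - (\<Sum>k<n. (d n \<bullet> ?g k) *\<^sub>R ?g k)"
  have g: "?g n = sgn r" by (subst gram_schmidt.simps) (simp add: r_def)
  have dn: "d n = r + (\<Sum>k<n. (d n \<bullet> ?g k) *\<^sub>R ?g k)" by (simp add: r_def)
  have "(\<Sum>k<n. (d n \<bullet> ?g k) *\<^sub>R ?g k) \<bullet> ?g n = 0"
    unfolding inner_sum_left
    by (intro sum.neutral) (auto simp: gram_schmidt_orthogonal inner_commute[of _ "?g n"])
  then have "d n \<bullet> ?g n = r \<bullet> sgn r" by (subst dn) (simp add: inner_add_left g)
  then have "(d n \<bullet> ?g n) *\<^sub>R ?g n = r"
    by (cases "r = 0") (simp_all add: g sgn_div_norm dot_square_norm power2_eq_square field_simps)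
  then show ?thesis using dn by (simp add: add.commute)
qed

lemma orthonormal_or_zero_partial_norm:
  assumes "orthonormal_or_zero g"
  shows "(norm (\<Sum>k<n. (h \<bullet> g k) *\<^sub>R g k))\<^sup>2 = (\<Sum>k<n. (h \<bullet> g k)\<^sup>2)"
    and "h \<bullet> (\<Sum>k<n. (h \<bullet> g k) *\<^sub>R g k) = (\<Sum>k<n. (h \<bullet> g k)\<^sup>2)"
proof -
  have *: "(h \<bullet> g k) * (h \<bullet> g k) * (g k \<bullet> g k) = (h \<bullet> g k)\<^sup>2" for k
    using assms unfolding orthonormal_or_zero_def
    by (cases "g k = 0") (auto simp: power2_eq_square norm_eq_1)
  have "(norm (\<Sum>k<n. (h \<bullet> g k) *\<^sub>R g k))\<^sup>2 = (\<Sum>j<n. \<Sum>k<n. (h \<bullet> g j) * (h \<bullet> g k) * (g j \<bullet> g k))"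
    by (subst sum.swap) (simp add: power2_norm_eq_inner inner_sum_left inner_sum_right sum_distrib_left ac_simps)
  also have "\<dots> = (\<Sum>j<n. \<Sum>k\<in>{j}. (h \<bullet> g j) * (h \<bullet> g k) * (g j \<bullet> g k))"
    using assms by (intro sum.cong sum.mono_neutral_right) (auto simp: orthonormal_or_zero_def)
  finally show "(norm (\<Sum>k<n. (h \<bullet> g k) *\<^sub>R g k))\<^sup>2 = (\<Sum>k<n. (h \<bullet> g k)\<^sup>2)" by (simp add: *)
  show "h \<bullet> (\<Sum>k<n. (h \<bullet> g k) *\<^sub>R g k) = (\<Sum>k<n. (h \<bullet> g k)\<^sup>2)"
    by (simp add: inner_sum_right power2_eq_square)
qed

lemma orthonormal_or_zero_contraction:
  assumes "orthonormal_or_zero g"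
  shows "norm (h - (\<Sum>k<n. (h \<bullet> g k) *\<^sub>R g k)) \<le> norm h"
proof -
  let ?p = "\<Sum>k<n. (h \<bullet> g k) *\<^sub>R g k"
  have "(norm (h - ?p))\<^sup>2 = (norm h)\<^sup>2 - 2 * (h \<bullet> ?p) + (norm ?p)\<^sup>2"
    by (simp add: power2_norm_eq_inner inner_diff_left inner_diff_right inner_commute)
  also have "\<dots> = (norm h)\<^sup>2 - (\<Sum>k<n. (h \<bullet> g k)\<^sup>2)"
    using orthonormal_or_zero_partial_norm[OF assms, of h n] by simp
  also have "\<dots> \<le> (norm h)\<^sup>2" by (simp add: sum_nonneg)
  finally show ?thesis by (rule power2_le_imp_le) simp
qed

text \<open>
  Gram-Schmidt applied to a countable dense subset of \<open>D\<close>. Vectors of the subset are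
  eventually equal to their expansions, and partial expansions are contractions, so the expansion
  converges on the closure of \<open>D\<close>.
\<close>

lemma exists_complete_orthonormal_in_subspace:
  fixes D :: "'h::{real_inner, second_countable_topology} set"
  assumes D: "subspace D"
  obtains g where "orthonormal_or_zero g" "\<And>n. g n \<in> D"
    "\<And>h. h \<in> closure D \<Longrightarrow> (\<lambda>n. \<Sum>k<n. (h \<bullet> g k) *\<^sub>R g k) \<longlonglongrightarrow> h"
proof -
  obtain T where T: "countable T" "T \<subseteq> D" "D \<subseteq> closure T" using separable by blast
  have Tne: "T \<noteq> {}" using T(3) subspace_0[OF D] by auto
  define d where "d = from_nat_into T"
  have d: "range d = T" using T(1) Tne by (simp add: d_def range_from_nat_into)
  let ?g = "gram_schmidt d"
  note orth = gram_schmidt_orthonormal[of d]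
  have "(\<lambda>n. \<Sum>k<n. (h \<bullet> ?g k) *\<^sub>R ?g k) \<longlonglongrightarrow> h" if h: "h \<in> closure D" for h
  proof (rule LIMSEQ_I)
    fix e :: real assume e: "e > 0"
    have "h \<in> closure T" using h T(3) closure_mono[OF T(3)] by auto
    then obtain v where v: "v \<in> T" "dist v h < e" using e by (auto simp: closure_approachable)
    obtain m where m: "v = d m" using v d by auto
    have "norm ((\<Sum>k<n. (h \<bullet> ?g k) *\<^sub>R ?g k) - h) < e" if n: "n \<ge> Suc m" for n
    proof -
      have "(\<Sum>k<n. (v \<bullet> ?g k) *\<^sub>R ?g k) = (\<Sum>k<Suc m. (v \<bullet> ?g k) *\<^sub>R ?g k)"
      proof (rule sum.mono_neutral_right)
        show "\<forall>k\<in>{..<n} - {..<Suc m}. (v \<bullet> ?g k) *\<^sub>R ?g k = 0"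
        proof
          fix k assume "k \<in> {..<n} - {..<Suc m}"
          then have k: "\<And>j. j < Suc m \<Longrightarrow> ?g j \<bullet> ?g k = 0"
            using gram_schmidt_orthogonal[of _ k d] by (auto simp: inner_commute)
          have "v \<bullet> ?g k = (\<Sum>j<Suc m. (d m \<bullet> ?g j) *\<^sub>R ?g j) \<bullet> ?g k"
            unfolding m using gram_schmidt_expand[of d m] by simp
          also have "\<dots> = 0" unfolding inner_sum_left by (intro sum.neutral) (use k in auto)
          finally show "(v \<bullet> ?g k) *\<^sub>R ?g k = 0" by simp
        qed
      qed (use n in auto)
      then have vexp: "(\<Sum>k<n. (v \<bullet> ?g k) *\<^sub>R ?g k) = v" unfolding m using gram_schmidt_expand[of d m] by simp
      have "h - (\<Sum>k<n. (h \<bullet> ?g k) *\<^sub>R ?g k) = (h - v) - (\<Sum>k<n. ((h - v) \<bullet> ?g k) *\<^sub>R ?g k)"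
        by (simp add: inner_diff_left scaleR_diff_left sum_subtractf vexp)
      then have "norm (h - (\<Sum>k<n. (h \<bullet> ?g k) *\<^sub>R ?g k)) \<le> norm (h - v)"
        using orthonormal_or_zero_contraction[OF orth, of "h - v" n] by (simp only:)
      then show ?thesis using v(2) by (simp add: dist_norm norm_minus_commute)
    qed
    then show "\<exists>no. \<forall>n\<ge>no. norm ((\<Sum>k<n. (h \<bullet> ?g k) *\<^sub>R ?g k) - h) < e" by blast
  qed
  moreover have "?g n \<in> D" for n using gram_schmidt_in_subspace[OF D, of d] d T(2) by auto
  ultimately show ?thesis using that orth by blast
qed

lemma weakly_measurable_imp_measurable:
  fixes u :: "'a \<Rightarrow> 'h::{real_inner, second_countable_topology}"
  assumes "\<And>h. (\<lambda>th. u th \<bullet> h) \<in> borel_measurable F"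
  shows "u \<in> borel_measurable F"
proof -
  obtain g :: "nat \<Rightarrow> 'h" where g: "\<And>h. (\<lambda>n. \<Sum>k<n. (h \<bullet> g k) *\<^sub>R g k) \<longlonglongrightarrow> h"
    using exists_complete_orthonormal_in_subspace[OF subspace_UNIV] by (metis UNIV_I closure_UNIV)
  show ?thesis
  proof (rule borel_measurable_LIMSEQ_metric)
    show "(\<lambda>th. \<Sum>k<n. (u th \<bullet> g k) *\<^sub>R g k) \<in> borel_measurable F" for n
      using assms by (intro borel_measurable_sum borel_measurable_scaleR) auto
    show "(\<lambda>n. \<Sum>k<n. (u th \<bullet> g k) *\<^sub>R g k) \<longlonglongrightarrow> u th" for th by (rule g)
  qed
qed

section \<open>Gaussian product measures\<close>

text \<open>
  The centered normal law with variance \<open>s\<close>; as an image of the standard law it also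
  makes sense for \<open>s = 0\<close>, where it is the point mass at zero.
\<close>

definition gau1 :: "real \<Rightarrow> real measure" where
  "gau1 s = distr std_normal_distribution borel (\<lambda>x. sqrt s * x)"

lemma prob_space_gau1: "prob_space (gau1 s)"
  unfolding gau1_def using prob_space_normal_density[of 1 0]
  by (intro prob_space.prob_space_distr) auto

lemma sets_gau1 [simp, measurable_cong]: "sets (gau1 s) = sets borel"
  and space_gau1 [simp]: "space (gau1 s) = UNIV"
  by (auto simp: gau1_def)

lemma std_normal_shift:
  "distr std_normal_distribution borel (\<lambda>x. x + k)
     = density std_normal_distribution (\<lambda>x. ennreal (exp (k * x - k\<^sup>2 / 2)))"
proof -
  interpret prob_space std_normal_distribution using prob_space_normal_density[of 1 0] by simp
  have "distributed std_normal_distribution lborel (\<lambda>x. x) std_normal_density"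
    unfolding distributed_def by (auto intro!: distr_id2)
  then have "distributed std_normal_distribution lborel (\<lambda>x. k + 1 * x) (normal_density (k + 1 * 0) (\<bar>1\<bar> * 1))"
    by (intro normal_density_affine) auto
  then have "distr std_normal_distribution lborel (\<lambda>x. x + k) = density lborel (normal_density k 1)"
    unfolding distributed_def by (simp add: add.commute)
  moreover have "distr std_normal_distribution borel (\<lambda>x. x + k) = distr std_normal_distribution lborel (\<lambda>x. x + k)"
    by (intro distr_cong) auto
  moreover have "density std_normal_distribution (\<lambda>x. ennreal (exp (k * x - k\<^sup>2 / 2))) = density lborel (normal_density k 1)"
  proof -
    have *: "std_normal_density x * exp (k * x - k\<^sup>2 / 2) = normal_density k 1 x" for x
      by (simp add: normal_density_def exp_add[symmetric] power2_eq_square field_simps)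
    show ?thesis
      by (subst density_density_eq) (auto simp: ennreal_mult'[symmetric] * simp del: ennreal_mult')
  qed
  ultimately show ?thesis by simp
qed

lemma gau1_shift:
  assumes "s \<ge> 0"
  shows "distr (gau1 s) borel (\<lambda>v. v + s * c) = density (gau1 s) (\<lambda>v. ennreal (exp (c * v - s * c\<^sup>2 / 2)))"
proof -
  have ss: "sqrt s * (sqrt s * r) = s * r" for r using assms by (simp add: mult.assoc[symmetric])
  have "distr (gau1 s) borel (\<lambda>v. v + s * c) = distr std_normal_distribution borel (\<lambda>x. sqrt s * x + s * c)"
    unfolding gau1_def by (subst distr_distr) (auto simp: comp_def)
  also have "\<dots> = distr (distr std_normal_distribution borel (\<lambda>x. x + sqrt s * c)) borel (\<lambda>x. sqrt s * x)"
    by (subst distr_distr) (auto simp: comp_def distrib_left ss)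
  also have "\<dots> = density (gau1 s) (\<lambda>v. ennreal (exp (c * v - s * c\<^sup>2 / 2)))"
    unfolding std_normal_shift gau1_def using assms
    by (subst density_distr) (auto intro!: arg_cong2[where f="\<lambda>D f. distr D borel f"] density_cong
        simp: power_mult_distrib mult_ac)
  finally show ?thesis .
qed

lemma char_gau1: "s \<ge> 0 \<Longrightarrow> char (gau1 s) u = complex_of_real (exp (- s * u\<^sup>2 / 2))"
proof -
  assume s: "s \<ge> 0"
  have "char (gau1 s) u = char std_normal_distribution (sqrt s * u)"
    unfolding char_def gau1_def by (subst integral_distr) (auto simp: mult_ac)
  then show ?thesis using s by (simp add: char_std_normal_distribution power_mult_distrib)
qed

lemma real_distribution_gau1: "real_distribution (gau1 s)"
  using prob_space_gau1[of s] by (auto simp: real_distribution_def real_distribution_axioms_def)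

text \<open>
  The characteristic functions multiply.
\<close>

lemma gau1_convolution:
  assumes "s \<ge> 0" "t \<ge> 0"
  shows "distr (gau1 s \<Otimes>\<^sub>M gau1 t) borel (\<lambda>(x, y). x + y) = gau1 (s + t)"
proof (rule Levy_uniqueness)
  interpret S: prob_space "gau1 s" by (rule prob_space_gau1)
  interpret T: prob_space "gau1 t" by (rule prob_space_gau1)
  interpret P: pair_prob_space "gau1 s" "gau1 t" ..
  show "real_distribution (distr (gau1 s \<Otimes>\<^sub>M gau1 t) borel (\<lambda>(x, y). x + y))"
    by (intro P.real_distribution_distr) simp
  show "char (distr (gau1 s \<Otimes>\<^sub>M gau1 t) borel (\<lambda>(x, y). x + y)) = char (gau1 (s + t))"
  proof
    fix u
    have "char (distr (gau1 s \<Otimes>\<^sub>M gau1 t) borel (\<lambda>(x, y). x + y)) u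
      = (LINT p|((gau1 s \<Otimes>\<^sub>M gau1 t)). iexp (u * (fst p + snd p)))"
      unfolding char_def by (subst integral_distr) (auto simp: case_prod_beta)
    also have "\<dots> = (LINT x|(gau1 s). (LINT y|(gau1 t). iexp (u * (x + y))))"
      by (subst P.integral_fst'[symmetric]) (auto intro!: P.integrable_const_bound[where B=1])
    also have "\<dots> = (LINT x|(gau1 s). iexp (u * x) * char (gau1 t) u)"
      unfolding char_def by (simp add: distrib_left exp_add)
    also have "\<dots> = char (gau1 s) u * char (gau1 t) u"
      unfolding char_def by simp
    also have "\<dots> = char (gau1 (s + t)) u"
      using assms by (simp add: char_gau1 exp_add[symmetric] of_real_mult[symmetric] field_simps del: of_real_mult)
    finally show "char (distr (gau1 s \<Otimes>\<^sub>M gau1 t) borel (\<lambda>(x, y). x + y)) u = char (gau1 (s + t)) u" .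
  qed
qed (rule real_distribution_gau1)

lemma
  assumes s: "s \<ge> 0"
  shows gau1_exp_nn_integral: "(\<integral>\<^sup>+v. ennreal (exp (c * v)) \<partial>gau1 s) = ennreal (exp (s * c\<^sup>2 / 2))"
    and gau1_exp_integrable: "integrable (gau1 s) (\<lambda>v. exp (c * v))"
proof -
  interpret prob_space "gau1 s" by (rule prob_space_gau1)
  interpret D: prob_space "distr (gau1 s) borel (\<lambda>v. v + s * c)" by (intro prob_space_distr) simp
  have "1 = emeasure (density (gau1 s) (\<lambda>v. ennreal (exp (c * v - s * c\<^sup>2 / 2)))) UNIV"
    using D.emeasure_space_1 unfolding gau1_shift[OF s] by simp
  also have "\<dots> = (\<integral>\<^sup>+v. ennreal (exp (c * v - s * c\<^sup>2 / 2)) \<partial>gau1 s)"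
    by (subst emeasure_density) auto
  finally have 1: "(\<integral>\<^sup>+v. ennreal (exp (c * v - s * c\<^sup>2 / 2)) \<partial>gau1 s) = 1" by simp
  have "(\<integral>\<^sup>+v. ennreal (exp (c * v)) \<partial>gau1 s)
     = (\<integral>\<^sup>+v. ennreal (exp (s * c\<^sup>2 / 2)) * ennreal (exp (c * v - s * c\<^sup>2 / 2)) \<partial>gau1 s)"
    by (intro nn_integral_cong) (simp add: ennreal_mult'[symmetric] exp_add[symmetric])
  also have "\<dots> = ennreal (exp (s * c\<^sup>2 / 2))"
    by (subst nn_integral_cmult) (auto simp: 1)
  finally show *: "(\<integral>\<^sup>+v. ennreal (exp (c * v)) \<partial>gau1 s) = ennreal (exp (s * c\<^sup>2 / 2))" .
  show "integrable (gau1 s) (\<lambda>v. exp (c * v))"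
    by (intro integrableI_bounded) (auto simp: * )
qed

text \<open>
  Independent centered normal coordinates with variances \<open>a j\<close>. The vector
  \<open>a\<close> is the family of signal-to-noise ratios of a Gaussian observation.
\<close>

definition gau :: "'i set \<Rightarrow> ('i \<Rightarrow> real) \<Rightarrow> ('i \<Rightarrow> real) measure" where
  "gau J a = (\<Pi>\<^sub>M j\<in>J. gau1 (a j))"

abbreviation coords :: "'i set \<Rightarrow> ('i \<Rightarrow> real) measure" where
  "coords J \<equiv> (\<Pi>\<^sub>M j\<in>J. (borel :: real measure))"

lemma product_prob_space_gau1: "product_prob_space (\<lambda>j. gau1 (a j))"
  by (intro product_prob_spaceI prob_space_gau1)

lemma prob_space_gau: "prob_space (gau J a)"
  unfolding gau_def by (intro prob_space_PiM prob_space_gau1)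

lemma sets_gau [measurable_cong, simp]: "sets (gau J a) = sets (coords J)"
  unfolding gau_def by (intro sets_PiM_cong) auto

lemma space_gau: "space (gau J a) = space (coords J)"
  by (rule sets_eq_imp_space_eq) simp

text \<open>
  The Cameron-Martin formula in finitely many coordinates: translating \<open>gau J a\<close> by
  \<open>a j * c j\<close> gives it an exponential density. With \<open>c\<close> a value of the
  signal, this density is the likelihood of an observation.
\<close>

lemma gau_shift:
  assumes J: "finite J" and a: "\<forall>j\<in>J. 0 \<le> a j"
  shows "distr (gau J a) (coords J) (\<lambda>v. \<lambda>j\<in>J. v j + a j * c j)
    = density (gau J a) (\<lambda>v. ennreal (exp (\<Sum>j\<in>J. c j * v j - a j * (c j)\<^sup>2 / 2)))"
proof -
  define N where "N j = density (gau1 (a j)) (\<lambda>v. ennreal (exp (c j * v - a j * (c j)\<^sup>2 / 2)))" for j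
  have N: "N j = distr (gau1 (a j)) borel (\<lambda>v. v + a j * c j)" if "j \<in> J" for j
    unfolding N_def using gau1_shift[OF a[rule_format, OF that]] by simp
  interpret G: product_prob_space "\<lambda>j. gau1 (a j)" by (rule product_prob_space_gau1)
  define N' where "N' j = (if j \<in> J then N j else gau1 (a j))" for j
  have N'prob: "prob_space (N' j)" for j
    unfolding N'_def using N by (auto intro!: prob_space.prob_space_distr prob_space_gau1)
  interpret N': product_prob_space N' by (intro product_prob_spaceI N'prob)
  have sets_N': "sets (N' j) = sets borel" for j by (simp add: N'_def N_def)
  have sets_PiN': "sets (PiM J N') = sets (coords J)" by (intro sets_PiM_cong) (auto simp: sets_N')
  have meas: "(\<lambda>v. \<lambda>j\<in>J. v j + a j * c j) \<in> measurable (gau J a) (coords J)"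
    by (intro measurable_restrict) (auto simp: measurable_cong_sets[OF sets_gau refl])
  have "distr (gau J a) (coords J) (\<lambda>v. \<lambda>j\<in>J. v j + a j * c j) = PiM J N'"
  proof (rule N'.PiM_eqI[OF J])
    fix A assume A: "\<And>j. j \<in> J \<Longrightarrow> A j \<in> sets (N' j)"
    then have A': "A j \<in> sets borel" if "j \<in> J" for j using that sets_N' by auto
    have "emeasure (distr (gau J a) (coords J) (\<lambda>v. \<lambda>j\<in>J. v j + a j * c j)) (Pi\<^sub>E J A)
       = emeasure (gau J a) ((\<lambda>v. \<lambda>j\<in>J. v j + a j * c j) -` (Pi\<^sub>E J A) \<inter> space (gau J a))"
      using meas J A' by (intro emeasure_distr) (auto intro!: sets_PiM_I_finite)
    also have "(\<lambda>v. \<lambda>j\<in>J. v j + a j * c j) -` (Pi\<^sub>E J A) \<inter> space (gau J a)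
       = Pi\<^sub>E J (\<lambda>j. (\<lambda>v. v + a j * c j) -` A j)"
      by (auto simp: space_gau space_PiM PiE_iff extensional_def)
    also have "emeasure (gau J a) \<dots> = (\<Prod>j\<in>J. emeasure (gau1 (a j)) ((\<lambda>v. v + a j * c j) -` A j))"
      unfolding gau_def using J A' 
      by (intro G.emeasure_PiM) (auto intro!: measurable_sets_borel[where M=borel])
    also have "\<dots> = (\<Prod>j\<in>J. emeasure (N' j) (A j))"
      using A' by (intro prod.cong refl) (simp add: N'_def N emeasure_distr)
    finally show "emeasure (distr (gau J a) (coords J) (\<lambda>v. \<lambda>j\<in>J. v j + a j * c j)) (Pi\<^sub>E J A)
       = (\<Prod>j\<in>J. emeasure (N' j) (A j))" .
  qed (simp add: sets_PiN')
  moreover have "density (gau J a) (\<lambda>v. ennreal (exp (\<Sum>j\<in>J. c j * v j - a j * (c j)\<^sup>2 / 2))) = PiM J N'"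
  proof (rule N'.PiM_eqI[OF J])
    fix A assume A: "\<And>j. j \<in> J \<Longrightarrow> A j \<in> sets (N' j)"
    then have A' [measurable]: "A j \<in> sets borel" if "j \<in> J" for j using that sets_N' by auto
    have "emeasure (density (gau J a) (\<lambda>v. ennreal (exp (\<Sum>j\<in>J. c j * v j - a j * (c j)\<^sup>2 / 2)))) (Pi\<^sub>E J A)
      = (\<integral>\<^sup>+v. ennreal (exp (\<Sum>j\<in>J. c j * v j - a j * (c j)\<^sup>2 / 2)) * indicator (Pi\<^sub>E J A) v \<partial>gau J a)"
      using J A' by (intro emeasure_density) (auto intro!: sets_PiM_I_finite)
    also have "\<dots> = (\<integral>\<^sup>+v. (\<Prod>j\<in>J. ennreal (exp (c j * v j - a j * (c j)\<^sup>2 / 2)) * indicator (A j) (v j)) \<partial>gau J a)"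
    proof (rule nn_integral_cong)
      fix v assume "v \<in> space (gau J a)"
      then have "indicator (Pi\<^sub>E J A) v = (\<Prod>j\<in>J. indicator (A j) (v j) :: ennreal)"
        using J by (auto simp: space_gau space_PiM PiE_iff indicator_def split: if_splits)
      then show "ennreal (exp (\<Sum>j\<in>J. c j * v j - a j * (c j)\<^sup>2 / 2)) * indicator (Pi\<^sub>E J A) v
        = (\<Prod>j\<in>J. ennreal (exp (c j * v j - a j * (c j)\<^sup>2 / 2)) * indicator (A j) (v j))"
        using J by (simp add: exp_sum prod.distrib prod_ennreal)
    qed
    also have "\<dots> = (\<Prod>j\<in>J. \<integral>\<^sup>+v. ennreal (exp (c j * v - a j * (c j)\<^sup>2 / 2)) * indicator (A j) v \<partial>gau1 (a j))"
      unfolding gau_def using J by (intro G.product_nn_integral_prod) auto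
    also have "\<dots> = (\<Prod>j\<in>J. emeasure (N' j) (A j))"
      by (intro prod.cong refl) (simp add: N'_def N_def emeasure_density)
    finally show "emeasure (density (gau J a) (\<lambda>v. ennreal (exp (\<Sum>j\<in>J. c j * v j - a j * (c j)\<^sup>2 / 2)))) (Pi\<^sub>E J A)
      = (\<Prod>j\<in>J. emeasure (N' j) (A j))" .
  qed (simp add: sets_PiN')
  ultimately show ?thesis by simp
qed

lemma gau_convolution:
  assumes J: "finite J" and a: "\<forall>j\<in>J. 0 \<le> a j" and b: "\<forall>j\<in>J. 0 \<le> b j"
  shows "distr (gau J a \<Otimes>\<^sub>M gau J b) (coords J) (\<lambda>(v, v'). \<lambda>j\<in>J. v j + v' j) = gau J (\<lambda>j. a j + b j)"
proof -
  interpret A: product_prob_space "\<lambda>j. gau1 (a j)" by (rule product_prob_space_gau1)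
  interpret B: product_prob_space "\<lambda>j. gau1 (b j)" by (rule product_prob_space_gau1)
  interpret AB: product_prob_space "\<lambda>j. gau1 (a j + b j)" by (rule product_prob_space_gau1)
  interpret GA: prob_space "gau J a" by (rule prob_space_gau)
  interpret GB: prob_space "gau J b" by (rule prob_space_gau)
  have meas: "(\<lambda>(v, v'). \<lambda>j\<in>J. v j + v' j) \<in> measurable (gau J a \<Otimes>\<^sub>M gau J b) (coords J)"
    unfolding case_prod_beta by (intro measurable_restrict) measurable
  show ?thesis unfolding gau_def[of J "\<lambda>j. a j + b j"]
  proof (rule AB.PiM_eqI[OF J])
    fix S assume "\<And>j. j \<in> J \<Longrightarrow> S j \<in> sets (gau1 (a j + b j))"
    then have S [measurable]: "S j \<in> sets borel" if "j \<in> J" for j using that by auto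
    have PS [measurable]: "Pi\<^sub>E J S \<in> sets (coords J)" using J S by (auto intro!: sets_PiM_I_finite)
    have ind: "(indicator (Pi\<^sub>E J S) (\<lambda>j\<in>J. v j + v' j) :: ennreal) = (\<Prod>j\<in>J. indicator (S j) (v j + v' j))" for v v'
      using J by (auto simp: PiE_iff indicator_def split: if_splits)
    have "emeasure (distr (gau J a \<Otimes>\<^sub>M gau J b) (coords J) (\<lambda>(v, v'). \<lambda>j\<in>J. v j + v' j)) (Pi\<^sub>E J S)
       = (\<integral>\<^sup>+p. indicator (Pi\<^sub>E J S) (\<lambda>j\<in>J. fst p j + snd p j) \<partial>(gau J a \<Otimes>\<^sub>M gau J b))"
      using nn_integral_distr[OF meas, of "indicator (Pi\<^sub>E J S)"] PS by (simp add: case_prod_beta)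
    also have "\<dots> = (\<integral>\<^sup>+p. (\<Prod>j\<in>J. indicator (S j) (fst p j + snd p j)) \<partial>(gau J a \<Otimes>\<^sub>M gau J b))"
      by (simp add: ind)
    also have "\<dots> = (\<integral>\<^sup>+v. \<integral>\<^sup>+v'. (\<Prod>j\<in>J. indicator (S j) (v j + v' j)) \<partial>gau J b \<partial>gau J a)"
      by (subst GB.nn_integral_fst[symmetric]) auto
    also have "\<dots> = (\<integral>\<^sup>+v. (\<Prod>j\<in>J. \<integral>\<^sup>+y. indicator (S j) (v j + y) \<partial>gau1 (b j)) \<partial>gau J a)"
      unfolding gau_def[of J b] using J by (intro nn_integral_cong B.product_nn_integral_prod) auto
    also have "\<dots> = (\<Prod>j\<in>J. \<integral>\<^sup>+x. \<integral>\<^sup>+y. indicator (S j) (x + y) \<partial>gau1 (b j) \<partial>gau1 (a j))"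
    proof -
      have "(\<lambda>x. \<integral>\<^sup>+y. indicator (S j) (x + y) \<partial>gau1 (b j)) \<in> borel_measurable (gau1 (a j))" if [measurable]: "j \<in> J" for j
      proof -
        interpret prob_space "gau1 (b j)" by (rule prob_space_gau1)
        show ?thesis by measurable
      qed
      then show ?thesis
        unfolding gau_def[of J a] using J by (intro A.product_nn_integral_prod) auto
    qed
    also have "\<dots> = (\<Prod>j\<in>J. emeasure (gau1 (a j + b j)) (S j))"
    proof (rule prod.cong[OF refl])
      fix j assume j [measurable]: "j \<in> J"
      have "emeasure (gau1 (a j + b j)) (S j) = emeasure (distr (gau1 (a j) \<Otimes>\<^sub>M gau1 (b j)) borel (\<lambda>(x, y). x + y)) (S j)"
        by (simp add: gau1_convolution a[rule_format, OF j] b[rule_format, OF j])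
      also have "\<dots> = (\<integral>\<^sup>+p. indicator (S j) (fst p + snd p) \<partial>(gau1 (a j) \<Otimes>\<^sub>M gau1 (b j)))"
        using nn_integral_distr[of "\<lambda>(x, y). x + y" "gau1 (a j) \<Otimes>\<^sub>M gau1 (b j)" borel "indicator (S j)"] S[OF j]
        by (simp add: case_prod_beta)
      also have "\<dots> = (\<integral>\<^sup>+x. \<integral>\<^sup>+y. indicator (S j) (x + y) \<partial>gau1 (b j) \<partial>gau1 (a j))"
        by (subst sigma_finite_measure.nn_integral_fst[OF prob_space_imp_sigma_finite[OF prob_space_gau1], symmetric]) auto
      finally show "(\<integral>\<^sup>+x. \<integral>\<^sup>+y. indicator (S j) (x + y) \<partial>gau1 (b j) \<partial>gau1 (a j)) = emeasure (gau1 (a j + b j)) (S j)" by simp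
    qed
    finally show "emeasure (distr (gau J a \<Otimes>\<^sub>M gau J b) (coords J) (\<lambda>(v, v'). \<lambda>j\<in>J. v j + v' j)) (Pi\<^sub>E J S)
       = (\<Prod>j\<in>J. emeasure (gau1 (a j + b j)) (S j))" .
  qed (simp add: gau_def[symmetric])
qed

lemma gau_exp_abs_integrable:
  assumes J: "finite J" and a: "\<forall>j\<in>J. 0 \<le> a j"
  shows "integrable (gau J a) (\<lambda>v. exp (K * (\<Sum>j\<in>J. \<bar>v j\<bar>)))"
proof -
  interpret A: product_prob_space "\<lambda>j. gau1 (a j)" by (rule product_prob_space_gau1)
  have "integrable (gau1 (a j)) (\<lambda>v. exp (K * \<bar>v\<bar>))" if j: "j \<in> J" for j
  proof (rule lint_bound)
    show "integrable (gau1 (a j)) (\<lambda>v. exp (K * v) + exp ((- K) * v))"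
      using a[rule_format, OF j] by (intro Bochner_Integration.integrable_add gau1_exp_integrable)
    have "norm (exp (K * v) + exp (- K * v)) = exp (K * v) + exp (- K * v)" for v
      by (simp add: abs_of_pos add_pos_pos)
    then show "AE v in gau1 (a j). norm (exp (K * \<bar>v\<bar>)) \<le> norm (exp (K * v) + exp (- K * v))"
      by (intro AE_I2) (auto simp: abs_if)
  qed simp
  then have "integrable (gau J a) (\<lambda>v. \<Prod>j\<in>J. exp (K * \<bar>v j\<bar>))"
    unfolding gau_def using J by (intro A.product_integrable_prod)
  then show ?thesis using J by (simp add: exp_sum sum_distrib_left)
qed

section \<open>Recognising a standard normal vector\<close>

text \<open>
  A joint law can be probed with one-dimensional characteristic functions by reweighting: under the
  probability with density \<open>h / c\<close> the variable \<open>X\<close> has the standard normal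
  characteristic function, so the uniqueness theorem applies to it.
\<close>

lemma (in prob_space) weighted_law_standard_normal:
  fixes X h :: "'a \<Rightarrow> real"
  assumes [measurable]: "X \<in> borel_measurable M" "h \<in> borel_measurable M"
    and h0: "\<And>th. h th \<ge> 0" and hC: "\<And>th. h th \<le> C"
    and c: "expectation h = c"
    and cos: "\<And>t. expectation (\<lambda>th. h th * cos (t * X th)) = c * exp (- t\<^sup>2 / 2)"
    and sin: "\<And>t. expectation (\<lambda>th. h th * sin (t * X th)) = 0"
    and B [measurable]: "B \<in> sets borel"
  shows "expectation (\<lambda>th. h th * indicator B (X th)) = c * measure (gau1 1) B"
proof -
  have inth: "integrable M (\<lambda>th. h th * f th)" if [measurable]: "f \<in> borel_measurable M" and f: "\<And>th. \<bar>f th\<bar> \<le> 1" for f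
  proof (rule integrable_const_bound[where B=C])
    show "AE th in M. norm (h th * f th) \<le> C"
    proof (rule AE_I2)
      fix th
      have "h th * \<bar>f th\<bar> \<le> C * 1" using h0[of th] hC[of th] f[of th] by (intro mult_mono) auto
      then show "norm (h th * f th) \<le> C" using h0[of th] by (simp add: abs_mult)
    qed
  qed measurable
  have inth1: "integrable M h" using inth[of "\<lambda>_. 1"] by simp
  have c0: "c \<ge> 0" unfolding c[symmetric] using h0 by (intro lint_nonneg)
  show ?thesis
  proof (cases "c = 0")
    case True
    have "expectation (\<lambda>th. h th * indicator B (X th)) \<le> expectation h"
      using h0 by (intro integral_mono inth inth1) (auto simp: indicator_def)
    moreover have "0 \<le> expectation (\<lambda>th. h th * indicator B (X th))"
      using h0 by (intro lint_nonneg) auto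
    ultimately show ?thesis using True c by simp
  next
    case False
    with c0 have c1: "c > 0" by simp
    define D where "D = density M (\<lambda>th. ennreal (h th / c))"
    have emeasD: "emeasure D A = ennreal (expectation (\<lambda>th. h th * indicator A th) / c)" if [measurable]: "A \<in> sets M" for A
    proof -
      have "emeasure D A = (\<integral>\<^sup>+th. ennreal (h th * indicator A th / c) \<partial>M)"
        unfolding D_def using h0 c0
        by (subst emeasure_density) (auto intro!: nn_integral_cong simp: indicator_def)
      also have "\<dots> = ennreal (LINT th|M. h th * indicator A th / c)"
        using h0 c0 by (intro nn_integral_eq_integral integrable_divide inth AE_I2) (auto simp: indicator_def)
      finally show ?thesis by simp
    qed
    have probD: "prob_space D"
    proof
      have "expectation (\<lambda>th. h th * indicator (space M) th) = c"
        unfolding c[symmetric] by (intro lint_cong) auto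
      then show "emeasure D (space D) = 1"
        using c1 emeasD[of "space M"] by (simp add: D_def)
    qed
    interpret D: prob_space D by (rule probD)
    have [measurable]: "X \<in> borel_measurable D" by (simp add: D_def)
    have "distr D borel X = gau1 1"
    proof (rule Levy_uniqueness)
      show "char (distr D borel X) = char (gau1 1)"
      proof
        fix t
        have ie: "iexp r = complex_of_real (cos r) + \<i> * complex_of_real (sin r)" for r
          by (simp add: cis_conv_exp[symmetric] cis.ctr complex_eq_iff)
        have "char (distr D borel X) t = (LINT th|D. iexp (t * X th))"
          unfolding char_def by (subst integral_distr) auto
        also have "\<dots> = (LINT th|M. (h th / c) *\<^sub>R iexp (t * X th))"
          unfolding D_def using h0 c0 by (intro integral_density) auto
        also have "\<dots> = (LINT th|M. complex_of_real (h th * cos (t * X th) / c) + \<i> * complex_of_real (h th * sin (t * X th) / c))"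
          by (intro lint_cong refl) (simp only: ie scaleR_conv_of_real, simp add: algebra_simps add_divide_distrib)
        also have "\<dots> = complex_of_real (expectation (\<lambda>th. h th * cos (t * X th)) / c)
            + \<i> * complex_of_real (expectation (\<lambda>th. h th * sin (t * X th)) / c)"
          using inth[of "\<lambda>th. cos (t * X th)"] inth[of "\<lambda>th. sin (t * X th)"]
          by (subst Bochner_Integration.integral_add) (auto simp del: of_real_mult of_real_divide)
        also have "\<dots> = char (gau1 1) t"
          using c1 by (simp add: cos sin char_gau1)
        finally show "char (distr D borel X) t = char (gau1 1) t" .
      qed
    qed (auto intro!: real_distribution_gau1 D.real_distribution_distr)
    then have "measure (gau1 1) B = measure (distr D borel X) B" by simp
    also have "\<dots> = measure D (X -` B \<inter> space M)"
      by (subst measure_distr) (auto simp: D_def)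
    also have "\<dots> = expectation (\<lambda>th. h th * indicator (X -` B \<inter> space M) th) / c"
      using c1 h0 by (simp add: measure_def emeasD lint_nonneg)
    also have "expectation (\<lambda>th. h th * indicator (X -` B \<inter> space M) th) = expectation (\<lambda>th. h th * indicator B (X th))"
      by (intro lint_cong) (auto simp: indicator_def)
    finally show ?thesis using c1 by simp
  qed
qed

text \<open>
  Induction on the coordinates. To split off the coordinate \<open>i\<close>, the probability is
  conditioned on \<open>W i \<in> A i\<close>; the remaining coordinates still have the standard
  normal characteristic function under the conditioned measure. This follows from the preceding lemma
  with the nonnegative weights \<open>1 + cos\<close> and \<open>1 + sin\<close> of the linear
  combination \<open>S s\<close> of the remaining coordinates.
\<close>

lemma standard_normal_boxes:
  fixes W :: "'i \<Rightarrow> 'a \<Rightarrow> real"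
  assumes "finite J" "prob_space M"
    and "\<And>j. j \<in> J \<Longrightarrow> W j \<in> borel_measurable M"
    and "\<And>t. (LINT th|M. cos (\<Sum>j\<in>J. t j * W j th)) = exp (- (\<Sum>j\<in>J. (t j)\<^sup>2) / 2)"
    and "\<And>t. (LINT th|M. sin (\<Sum>j\<in>J. t j * W j th)) = 0"
    and "\<And>j. j \<in> J \<Longrightarrow> A j \<in> sets borel"
  shows "measure M {th \<in> space M. \<forall>j\<in>J. W j th \<in> A j} = (\<Prod>j\<in>J. measure (gau1 1) (A j))"
  using assms
proof (induction J arbitrary: M rule: finite_induct)
  case empty
  then interpret prob_space M by simp
  show ?case by (simp add: prob_space)
next
  case (insert i J)
  interpret prob_space M by fact
  have Wi [measurable]: "W i \<in> borel_measurable M" and WJ [measurable]: "\<And>j. j \<in> J \<Longrightarrow> W j \<in> borel_measurable M"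
    and Ai [measurable]: "A i \<in> sets borel" and AJ [measurable]: "\<And>j. j \<in> J \<Longrightarrow> A j \<in> sets borel"
    using insert.prems by auto
  define S where "S s th = (\<Sum>j\<in>J. s j * W j th)" for s th
  define e where "e s = exp (- (\<Sum>j\<in>J. (s j)\<^sup>2) / 2)" for s :: "'i \<Rightarrow> real"
  have S [measurable]: "S s \<in> borel_measurable M" for s unfolding S_def by measurable
  have sumi: "(\<Sum>j\<in>J. (if j = i then u else s j) * W j th) = S s th"
    "(\<Sum>j\<in>J. (if j = i then u else s j)\<^sup>2) = (\<Sum>j\<in>J. (s j)\<^sup>2)" for s u th
    using insert.hyps by (auto simp: S_def intro!: sum.cong)
  have C: "expectation (\<lambda>th. cos (S s th + u * W i th)) = e s * exp (- u\<^sup>2 / 2)" for s u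
    using insert.prems(3)[of "\<lambda>j. if j = i then u else s j"] insert.hyps
    by (simp add: sumi e_def exp_add[symmetric] add.commute add_divide_distrib)
  have Sn: "expectation (\<lambda>th. sin (S s th + u * W i th)) = 0" for s u
    using insert.prems(4)[of "\<lambda>j. if j = i then u else s j"] insert.hyps
    by (simp add: sumi add.commute)
  have ic: "integrable M (\<lambda>th. cos (f th))" and isn: "integrable M (\<lambda>th. sin (f th))"
    if [measurable]: "f \<in> borel_measurable M" for f :: "'a \<Rightarrow> real"
    by (auto intro!: integrable_const_bound[where B=1])
  define g where "g = measure (gau1 1) (A i)"
  let ?I = "\<lambda>th. indicator (A i) (W i th) :: real"
  have iI: "integrable M (\<lambda>th. f th * ?I th)" if [measurable]: "f \<in> borel_measurable M" and "\<And>th. \<bar>f th\<bar> \<le> 1" for f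
    using that(2) by (intro integrable_const_bound[where B=1]) (auto simp: indicator_def)
  have 1: "expectation ?I = g"
    using weighted_law_standard_normal[of "W i" "\<lambda>_. 1" 1 1 "A i"] C[of "\<lambda>_. 0"] Sn[of "\<lambda>_. 0"]
    by (simp add: g_def S_def e_def prob_space)
  have 2: "expectation (\<lambda>th. cos (S s th) * ?I th) = e s * g" for s
  proof -
    have "expectation (\<lambda>th. (1 + cos (S s th)) * ?I th) = (1 + e s) * g"
      unfolding g_def
    proof (rule weighted_law_standard_normal[where C=2])
      show "0 \<le> 1 + cos (S s th)" "1 + cos (S s th) \<le> 2" for th
        using cos_ge_minus_one[of "S s th"] cos_le_one[of "S s th"] by linarith+
      show "expectation (\<lambda>th. 1 + cos (S s th)) = 1 + e s"
        using C[of s 0] ic[OF S[of s]] by (simp add: prob_space)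
      fix t
      have "(1 + cos a) * cos b = cos (0 + b) + (cos (a + b) + cos (a + (- b))) / 2" for a b :: real
        by (simp add: cos_add cos_diff algebra_simps)
      then have "expectation (\<lambda>th. (1 + cos (S s th)) * cos (t * W i th))
         = expectation (\<lambda>th. cos (S (\<lambda>_. 0) th + t * W i th) + (cos (S s th + t * W i th) + cos (S s th + (- t) * W i th)) / 2)"
        by (simp add: S_def)
      also have "\<dots> = (1 + e s) * exp (- t\<^sup>2 / 2)"
        using C[of "\<lambda>_. 0" t] C[of s t] C[of s "- t"] by (simp add: ic e_def algebra_simps)
      finally show "expectation (\<lambda>th. (1 + cos (S s th)) * cos (t * W i th)) = (1 + e s) * exp (- t\<^sup>2 / 2)" .
      have "(1 + cos a) * sin b = sin (0 + b) + (sin (a + b) - sin (a + (- b))) / 2" for a b :: real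
        by (simp add: sin_add sin_diff algebra_simps)
      then have "expectation (\<lambda>th. (1 + cos (S s th)) * sin (t * W i th))
         = expectation (\<lambda>th. sin (S (\<lambda>_. 0) th + t * W i th) + (sin (S s th + t * W i th) - sin (S s th + (- t) * W i th)) / 2)"
        by (simp add: S_def)
      also have "\<dots> = 0"
        using Sn[of "\<lambda>_. 0" t] Sn[of s t] Sn[of s "- t"] by (simp add: isn)
      finally show "expectation (\<lambda>th. (1 + cos (S s th)) * sin (t * W i th)) = 0" .
    qed measurable
    moreover have "expectation (\<lambda>th. (1 + cos (S s th)) * ?I th) = expectation ?I + expectation (\<lambda>th. cos (S s th) * ?I th)"
      using iI[of "\<lambda>_. 1"] iI[of "\<lambda>th. cos (S s th)"] by (simp add: distrib_right)
    ultimately show ?thesis using 1 by (simp add: algebra_simps)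
  qed
  have 3: "expectation (\<lambda>th. sin (S s th) * ?I th) = 0" for s
  proof -
    have "expectation (\<lambda>th. (1 + sin (S s th)) * ?I th) = 1 * g"
      unfolding g_def
    proof (rule weighted_law_standard_normal[where C=2])
      show "0 \<le> 1 + sin (S s th)" "1 + sin (S s th) \<le> 2" for th
        using sin_ge_minus_one[of "S s th"] sin_le_one[of "S s th"] by linarith+
      show "expectation (\<lambda>th. 1 + sin (S s th)) = 1"
        using Sn[of s 0] isn[OF S[of s]] by (simp add: prob_space)
      fix t
      have "(1 + sin a) * cos b = cos (0 + b) + (sin (a + b) + sin (a + (- b))) / 2" for a b :: real
        by (simp add: sin_add sin_diff algebra_simps)
      then have "expectation (\<lambda>th. (1 + sin (S s th)) * cos (t * W i th))
         = expectation (\<lambda>th. cos (S (\<lambda>_. 0) th + t * W i th) + (sin (S s th + t * W i th) + sin (S s th + (- t) * W i th)) / 2)"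
        by (simp add: S_def)
      also have "\<dots> = 1 * exp (- t\<^sup>2 / 2)"
        using C[of "\<lambda>_. 0" t] Sn[of s t] Sn[of s "- t"] by (simp add: ic isn e_def)
      finally show "expectation (\<lambda>th. (1 + sin (S s th)) * cos (t * W i th)) = 1 * exp (- t\<^sup>2 / 2)" .
      have "(1 + sin a) * sin b = sin (0 + b) + (cos (a + (- b)) - cos (a + b)) / 2" for a b :: real
        by (simp add: cos_add cos_diff algebra_simps)
      then have "expectation (\<lambda>th. (1 + sin (S s th)) * sin (t * W i th))
         = expectation (\<lambda>th. sin (S (\<lambda>_. 0) th + t * W i th) + (cos (S s th + (- t) * W i th) - cos (S s th + t * W i th)) / 2)"
        by (simp add: S_def)
      also have "\<dots> = 0"
        using Sn[of "\<lambda>_. 0" t] C[of s t] C[of s "- t"] by (simp add: isn ic)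
      finally show "expectation (\<lambda>th. (1 + sin (S s th)) * sin (t * W i th)) = 0" .
    qed measurable
    moreover have "expectation (\<lambda>th. (1 + sin (S s th)) * ?I th) = expectation ?I + expectation (\<lambda>th. sin (S s th) * ?I th)"
      using iI[of "\<lambda>_. 1"] iI[of "\<lambda>th. sin (S s th)"] by (simp add: distrib_right)
    ultimately show ?thesis using 1 by (simp add: algebra_simps)
  qed
  have g0: "g \<ge> 0" by (simp add: g_def)
  define EJ where "EJ = {th \<in> space M. \<forall>j\<in>J. W j th \<in> A j}"
  have EJ [measurable]: "EJ \<in> sets M" unfolding EJ_def using insert.hyps by measurable
  have goal: "measure M {th \<in> space M. \<forall>j\<in>insert i J. W j th \<in> A j} = expectation (\<lambda>th. indicator EJ th * ?I th)"
  proof -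
    have "expectation (\<lambda>th. indicator EJ th * ?I th) = expectation (indicator {th \<in> space M. \<forall>j\<in>insert i J. W j th \<in> A j})"
      by (intro lint_cong) (auto simp: indicator_def EJ_def)
    also have "\<dots> = measure M {th \<in> space M. \<forall>j\<in>insert i J. W j th \<in> A j}"
      using insert.hyps by (subst Bochner_Integration.integral_indicator) (auto intro!: arg_cong[where f="measure M"])
    finally show ?thesis by simp
  qed
  show ?case
  proof (cases "g = 0")
    case True
    have "expectation (\<lambda>th. indicator EJ th * ?I th) \<le> expectation ?I"
      using iI[of "indicator EJ"] iI[of "\<lambda>_. 1"] by (intro integral_mono) (auto simp: indicator_def)
    moreover have "0 \<le> expectation (\<lambda>th. indicator EJ th * ?I th)"
      by (intro lint_nonneg) auto
    ultimately have "expectation (\<lambda>th. indicator EJ th * ?I th) = 0" using 1 True by simp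
    then show ?thesis using goal insert.hyps True by (simp add: g_def[symmetric])
  next
    case False
    with g0 have g1: "g > 0" by simp
    define N where "N = density M (\<lambda>th. ennreal (?I th / g))"
    have intN: "integral\<^sup>L N f = expectation (\<lambda>th. f th * ?I th) / g" if [measurable]: "f \<in> borel_measurable M" for f :: "'a \<Rightarrow> real"
    proof -
      have "integral\<^sup>L N f = expectation (\<lambda>th. (?I th / g) *\<^sub>R f th)"
        unfolding N_def using g0 by (intro integral_density) auto
      also have "\<dots> = expectation (\<lambda>th. f th * ?I th / g)" by (simp add: mult.commute)
      finally show ?thesis by simp
    qed
    have emeasN: "emeasure N (space N) = 1"
    proof -
      have "emeasure N (space N) = (\<integral>\<^sup>+th. ennreal (?I th / g) \<partial>M)"
        unfolding N_def by (subst emeasure_density) (auto intro!: nn_integral_cong)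
      also have "\<dots> = ennreal (expectation (\<lambda>th. ?I th / g))"
        using iI[of "\<lambda>_. 1"] g0 by (intro nn_integral_eq_integral) auto
      finally show ?thesis using 1 g1 by simp
    qed
    have probN: "prob_space N" by (rule prob_spaceI) (rule emeasN)
    have setsN: "sets N = sets M" "space N = space M" by (auto simp: N_def)
    have "measure N {th \<in> space N. \<forall>j\<in>J. W j th \<in> A j} = (\<Prod>j\<in>J. measure (gau1 1) (A j))"
    proof (rule insert.IH)
      show "W j \<in> borel_measurable N" if "j \<in> J" for j using that by (simp add: N_def)
      show "(LINT th|N. cos (\<Sum>j\<in>J. t j * W j th)) = exp (- (\<Sum>j\<in>J. (t j)\<^sup>2) / 2)" for t
        using intN[of "\<lambda>th. cos (S t th)"] 2[of t] g1 by (simp add: S_def e_def)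
      show "(LINT th|N. sin (\<Sum>j\<in>J. t j * W j th)) = 0" for t
        using intN[of "\<lambda>th. sin (S t th)"] 3[of t] by (simp add: S_def)
    qed (use probN AJ in auto)
    moreover have "measure N {th \<in> space N. \<forall>j\<in>J. W j th \<in> A j} = integral\<^sup>L N (indicator EJ)"
      using EJ by (simp add: setsN EJ_def[symmetric])
    moreover have "integral\<^sup>L N (indicator EJ) = expectation (\<lambda>th. indicator EJ th * ?I th) / g"
      by (rule intN) simp
    ultimately have "expectation (\<lambda>th. indicator EJ th * ?I th) = g * (\<Prod>j\<in>J. measure (gau1 1) (A j))"
      using g1 by (simp add: field_simps)
    then show ?thesis using goal insert.hyps by (simp add: g_def)
  qed
qed

lemma standard_normal_vector_law:
  fixes W :: "'i \<Rightarrow> 'a \<Rightarrow> real"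
  assumes J: "finite J" and M: "prob_space M"
    and W: "\<And>j. j \<in> J \<Longrightarrow> W j \<in> borel_measurable M"
    and cos: "\<And>t. (LINT th|M. cos (\<Sum>j\<in>J. t j * W j th)) = exp (- (\<Sum>j\<in>J. (t j)\<^sup>2) / 2)"
    and sin: "\<And>t. (LINT th|M. sin (\<Sum>j\<in>J. t j * W j th)) = 0"
  shows "distr M (coords J) (\<lambda>th. \<lambda>j\<in>J. W j th) = gau J (\<lambda>_. 1)"
proof -
  interpret prob_space M by fact
  interpret G: product_prob_space "\<lambda>j::'i. gau1 1" by (rule product_prob_space_gau1)
  have meas: "(\<lambda>th. \<lambda>j\<in>J. W j th) \<in> measurable M (coords J)"
    using W by (intro measurable_restrict)
  show ?thesis unfolding gau_def
  proof (rule G.PiM_eqI[OF J])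
    show "sets (distr M (coords J) (\<lambda>th. \<lambda>j\<in>J. W j th)) = sets (Pi\<^sub>M J (\<lambda>j. gau1 1))"
      by (simp add: gau_def[symmetric])
    fix A :: "'i \<Rightarrow> real set" assume A: "\<And>j. j \<in> J \<Longrightarrow> A j \<in> sets (gau1 1)"
    have "emeasure (distr M (coords J) (\<lambda>th. \<lambda>j\<in>J. W j th)) (Pi\<^sub>E J A)
      = emeasure M ((\<lambda>th. \<lambda>j\<in>J. W j th) -` (Pi\<^sub>E J A) \<inter> space M)"
      using J A meas by (intro emeasure_distr) (auto intro!: sets_PiM_I_finite)
    also have "(\<lambda>th. \<lambda>j\<in>J. W j th) -` (Pi\<^sub>E J A) \<inter> space M = {th \<in> space M. \<forall>j\<in>J. W j th \<in> A j}"
      by (auto simp: PiE_iff)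
    also have "emeasure M \<dots> = ennreal (\<Prod>j\<in>J. measure (gau1 1) (A j))"
      using standard_normal_boxes[OF J M W cos sin, of A] A by (simp add: emeasure_eq_measure)
    also have "\<dots> = (\<Prod>j\<in>J. emeasure (gau1 1) (A j))"
      by (subst G.M.emeasure_eq_measure) (simp add: prod_ennreal)
    finally show "emeasure (distr M (coords J) (\<lambda>th. \<lambda>j\<in>J. W j th)) (Pi\<^sub>E J A) = (\<Prod>j\<in>J. emeasure (gau1 1) (A j))" .
  qed
qed

section \<open>Relative entropy of a finite Gaussian observation\<close>

text \<open>
  The shift formula as an identity of integrals.
\<close>

lemma gau_tilt:
  fixes h :: "('i \<Rightarrow> real) \<Rightarrow> real"
  assumes J: "finite J" and a: "\<forall>j\<in>J. 0 \<le> a j" and [measurable]: "h \<in> borel_measurable (coords J)"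
  shows "(LINT v|(gau J a). exp (\<Sum>j\<in>J. c j * v j - a j * (c j)\<^sup>2 / 2) * h v) = (LINT v|(gau J a). h (\<lambda>j\<in>J. v j + a j * c j))"
proof -
  have meas: "(\<lambda>v. \<lambda>j\<in>J. v j + a j * c j) \<in> measurable (gau J a) (coords J)"
    by (intro measurable_restrict) (auto simp: measurable_cong_sets[OF sets_gau refl])
  have "(LINT v|(gau J a). h (\<lambda>j\<in>J. v j + a j * c j)) = integral\<^sup>L (distr (gau J a) (coords J) (\<lambda>v. \<lambda>j\<in>J. v j + a j * c j)) h"
    by (rule integral_distr[symmetric, OF meas]) simp
  also have "distr (gau J a) (coords J) (\<lambda>v. \<lambda>j\<in>J. v j + a j * c j)
      = density (gau J a) (\<lambda>v. ennreal (exp (\<Sum>j\<in>J. c j * v j - a j * (c j)\<^sup>2 / 2)))"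
    by (rule gau_shift) (use J a in auto)
  also have "integral\<^sup>L \<dots> h = (LINT v|(gau J a). exp (\<Sum>j\<in>J. c j * v j - a j * (c j)\<^sup>2 / 2) *\<^sub>R h v)"
    by (intro integral_density) auto
  finally show ?thesis unfolding real_scaleR_def by (rule sym)
qed

lemma gau_tilt_one:
  assumes J: "finite J" and a: "\<forall>j\<in>J. 0 \<le> a j"
  shows "(LINT v|(gau J a). exp (\<Sum>j\<in>J. c j * v j - a j * (c j)\<^sup>2 / 2)) = 1"
proof -
  interpret prob_space "gau J a" by (rule prob_space_gau)
  show ?thesis using gau_tilt[where J=J and a=a and h="\<lambda>_. 1" and c=c] J a by (simp add: prob_space)
qed

lemma gau1_mean: "integrable (gau1 s) (\<lambda>x. x)" "(LINT x|(gau1 s). x) = 0"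
proof -
  have 1: "integrable std_normal_distribution (\<lambda>x. x)"
    using integrable_std_normal_distribution_moment[of 1] by simp
  have 2: "integrable std_normal_distribution (\<lambda>x. sqrt s * x)" by (rule integrable_mult_right[OF 1])
  have m: "(\<lambda>x. sqrt s * x) \<in> measurable std_normal_distribution borel" by simp
  have borel_measurable_id: "(\<lambda>x. x) \<in> borel_measurable (borel :: real measure)" by simp
  show "integrable (gau1 s) (\<lambda>x. x)" unfolding gau1_def
    by (rule integrable_distr_eq[OF m borel_measurable_id, THEN iffD2]) (rule 2)
  have "(LINT x|std_normal_distribution. x) = 0"
    using integral_std_normal_distribution_moment_odd[of 1] by simp
  then have "(LINT x|std_normal_distribution. sqrt s * x) = 0" by (simp only: integral_mult_right_zero mult_zero_right)
  then show "(LINT x|(gau1 s). x) = 0" unfolding gau1_def by (subst integral_distr[OF m]) simp_all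
qed

lemma gau_coordinate_mean:
  assumes J: "finite J" "i \<in> J"
  shows "integrable (gau J a) (\<lambda>v. v i)" "(LINT v|(gau J a). v i) = 0"
proof -
  interpret G: product_prob_space "\<lambda>j. gau1 (a j)" by (rule product_prob_space_gau1)
  have d: "distr (gau J a) (gau1 (a i)) (\<lambda>v. v i) = gau1 (a i)"
    unfolding gau_def using J by (intro distr_PiM_component prob_space_gau1) auto
  have [measurable]: "(\<lambda>v. v i) \<in> measurable (gau J a) (gau1 (a i))"
    using J by (auto simp: measurable_cong_sets[OF sets_gau sets_gau1])
  show "integrable (gau J a) (\<lambda>v. v i)"
    using gau1_mean(1)[of "a i"] by (subst (asm) d[symmetric], subst (asm) integrable_distr_eq) auto
  show "(LINT v|(gau J a). v i) = 0"
    using gau1_mean(2)[of "a i"] by (subst (asm) d[symmetric], subst (asm) integral_distr) auto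
qed

text \<open>
  The density at \<open>v\<close> of the vector with coordinates \<open>a j * X j th + sqrt (a j) *
  noise\<close> relative to its law for the zero signal, \<open>gau J a\<close>. In this normalisation
  the observations at the levels \<open>a\<close> and \<open>b\<close> add up to the observation at
  the level \<open>a + b\<close>, so that raising a level means observing more.
\<close>

definition lik :: "'i set \<Rightarrow> ('i \<Rightarrow> 'a \<Rightarrow> real) \<Rightarrow> ('i \<Rightarrow> real) \<Rightarrow> ('i \<Rightarrow> real) \<Rightarrow> 'a \<Rightarrow> real" where
  "lik J X a v th = exp (\<Sum>j\<in>J. X j th * v j - a j * (X j th)\<^sup>2 / 2)"

text \<open>
  The density of the observed vector relative to \<open>gau J a\<close>.
\<close>

definition evidence :: "'a measure \<Rightarrow> 'i set \<Rightarrow> ('i \<Rightarrow> 'a \<Rightarrow> real) \<Rightarrow> ('i \<Rightarrow> real) \<Rightarrow> ('i \<Rightarrow> real) \<Rightarrow> real" where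
  "evidence M J X a v = (LINT th|M. lik J X a v th)"

text \<open>
  By Bayes, \<open>numer / evidence\<close> is the conditional mean of \<open>X i\<close> given the
  observed vector \<open>v\<close>.
\<close>

definition numer :: "'a measure \<Rightarrow> 'i set \<Rightarrow> ('i \<Rightarrow> 'a \<Rightarrow> real) \<Rightarrow> ('i \<Rightarrow> real) \<Rightarrow> 'i \<Rightarrow> ('i \<Rightarrow> real) \<Rightarrow> real" where
  "numer M J X a i v = (LINT th|M. X i th * lik J X a v th)"

text \<open>
  The relative entropy of the law of the observed vector with respect to \<open>gau J a\<close>. Its
  sum with the mutual information of signal and observation is linear in \<open>a\<close>. It is the
  potential whose partial derivatives are half the explained powers.
\<close>

definition entropy_gain :: "'a measure \<Rightarrow> 'i set \<Rightarrow> ('i \<Rightarrow> 'a \<Rightarrow> real) \<Rightarrow> ('i \<Rightarrow> real) \<Rightarrow> real" where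
  "entropy_gain M J X a = (LINT v|(gau J a). evidence M J X a v * ln (evidence M J X a v))"

text \<open>
  The second moment of the conditional means of the coordinates in \<open>S\<close>, given an
  observation of all coordinates in \<open>J\<close> with signal-to-noise ratios \<open>a\<close>; see
  \<open>explained_eq_sum_estimate_sq\<close>.
\<close>

definition explained :: "'a measure \<Rightarrow> 'i set \<Rightarrow> ('i \<Rightarrow> 'a \<Rightarrow> real) \<Rightarrow> 'i set \<Rightarrow> ('i \<Rightarrow> real) \<Rightarrow> real" where
  "explained M J X S a = (LINT v|(gau J a). (\<Sum>i\<in>S. (numer M J X a i v)\<^sup>2) / evidence M J X a v)"

text \<open>
  The conditional law of the sample point given the observed vector \<open>v\<close>.
\<close>

definition posterior :: "'a measure \<Rightarrow> 'i set \<Rightarrow> ('i \<Rightarrow> 'a \<Rightarrow> real) \<Rightarrow> ('i \<Rightarrow> real) \<Rightarrow> ('i \<Rightarrow> real) \<Rightarrow> 'a measure" where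
  "posterior M J X a v = density M (\<lambda>th. ennreal (lik J X a v th / evidence M J X a v))"

lemma lik_restrict [simp]: "lik J X a (restrict v J) th = lik J X a v th"
  unfolding lik_def by (intro arg_cong[where f=exp] sum.cong) auto

lemma evidence_restrict [simp]: "evidence M J X a (restrict v J) = evidence M J X a v"
  by (simp add: evidence_def)

lemma numer_restrict [simp]: "numer M J X a i (restrict v J) = numer M J X a i v"
  by (simp add: numer_def)

lemma lik_add: "lik J X (\<lambda>j. a j + b j) (\<lambda>j. v j + u j) th = lik J X a v th * lik J X b u th"
  unfolding lik_def exp_add[symmetric] sum.distrib[symmetric]
  by (intro arg_cong[where f=exp] sum.cong) (auto simp: algebra_simps add_divide_distrib)

lemma lik_pos: "lik J X a v th > 0" by (simp add: lik_def)

lemma lik_measurable [measurable]: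
  assumes [measurable]: "\<And>j. j \<in> J \<Longrightarrow> X j \<in> borel_measurable M"
  shows "(\<lambda>p. lik J X a (fst p) (snd p)) \<in> borel_measurable (coords J \<Otimes>\<^sub>M M)"
  unfolding lik_def by measurable

text \<open>
  For bounded signals all integrands below are dominated by exponentials of \<open>\<Sum>j\<in>J.
  \<bar>v j\<bar>\<close>, which have Gaussian moments. The bound is on the Euclidean norm, so that
  later constants do not depend on the number of coordinates.
\<close>

locale bounded_signal = prob_space M for M :: "'a measure" +
  fixes J :: "'i set" and X :: "'i \<Rightarrow> 'a \<Rightarrow> real" and K :: real
  assumes finJ: "finite J"
    and XM [measurable]: "\<And>j. j \<in> J \<Longrightarrow> X j \<in> borel_measurable M"
    and K0: "K \<ge> 0"
    and XK: "\<And>th. (\<Sum>j\<in>J. (X j th)\<^sup>2) \<le> K\<^sup>2"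
begin

lemma X_bound: "j \<in> J \<Longrightarrow> \<bar>X j th\<bar> \<le> K"
proof -
  assume "j \<in> J"
  then have "(X j th)\<^sup>2 \<le> (\<Sum>j\<in>J. (X j th)\<^sup>2)" using finJ by (intro member_le_sum) auto
  also have "\<dots> \<le> K\<^sup>2" by (rule XK)
  finally show ?thesis using K0 abs_le_square_iff[of "X j th" K] by simp
qed

lemma bounded_integrable:
  fixes f :: "'a \<Rightarrow> real"
  assumes "f \<in> borel_measurable M" "\<And>th. \<bar>f th\<bar> \<le> C"
  shows "integrable M f"
  using assms by (intro integrable_const_bound[where B=C]) auto

lemma X_integrable: "j \<in> J \<Longrightarrow> integrable M (X j)"
  by (intro bounded_integrable[of _ K] XM X_bound)

definition growth :: "real \<Rightarrow> ('i \<Rightarrow> real) \<Rightarrow> real" where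
  "growth c v = exp (c * (\<Sum>j\<in>J. \<bar>v j\<bar>))"

lemma growth_measurable [measurable]: "growth c \<in> borel_measurable (coords J)"
  unfolding growth_def by measurable

lemma growth_integrable: "\<forall>j\<in>J. 0 \<le> a j \<Longrightarrow> integrable (gau J a) (growth c)"
  unfolding growth_def by (rule gau_exp_abs_integrable[OF finJ])

lemma growth_add: "growth c v * growth d v = growth (c + d) v"
  by (simp add: growth_def exp_add[symmetric] distrib_right)

lemma growth_ge1: "c \<ge> 0 \<Longrightarrow> 1 \<le> growth c v" "c \<ge> 0 \<Longrightarrow> c * (\<Sum>j\<in>J. \<bar>v j\<bar>) \<le> growth c v" "growth c v > 0"
proof -
  show "c \<ge> 0 \<Longrightarrow> 1 \<le> growth c v" by (simp add: growth_def sum_nonneg)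
  show "c \<ge> 0 \<Longrightarrow> c * (\<Sum>j\<in>J. \<bar>v j\<bar>) \<le> growth c v"
    using exp_ge_add_one_self[of "c * (\<Sum>j\<in>J. \<bar>v j\<bar>)"] unfolding growth_def by linarith
qed (simp add: growth_def)

context
  fixes a :: "'i \<Rightarrow> real"
  assumes a: "\<forall>j\<in>J. 0 \<le> a j"
begin

definition damp :: real where "damp = K\<^sup>2 * (\<Sum>j\<in>J. a j) / 2"

lemma lik_upper: "lik J X a v th \<le> growth K v"
proof -
  have "(\<Sum>j\<in>J. X j th * v j - a j * (X j th)\<^sup>2 / 2) \<le> (\<Sum>j\<in>J. K * \<bar>v j\<bar>)"
  proof (rule sum_mono)
    fix j assume j: "j \<in> J"
    have "X j th * v j \<le> \<bar>X j th\<bar> * \<bar>v j\<bar>" by (metis abs_ge_self abs_mult)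
    also have "\<dots> \<le> K * \<bar>v j\<bar>" using X_bound[OF j] by (intro mult_right_mono) auto
    finally show "X j th * v j - a j * (X j th)\<^sup>2 / 2 \<le> K * \<bar>v j\<bar>"
      using a[rule_format, OF j] mult_nonneg_nonneg[OF a[rule_format, OF j] zero_le_power2[of "X j th"]] by linarith
  qed
  then show ?thesis by (simp add: lik_def growth_def sum_distrib_left)
qed

lemma lik_lower: "exp (- damp) * growth (- K) v \<le> lik J X a v th"
proof -
  have "(\<Sum>j\<in>J. - (K * \<bar>v j\<bar>) - a j * K\<^sup>2 / 2) \<le> (\<Sum>j\<in>J. X j th * v j - a j * (X j th)\<^sup>2 / 2)"
  proof (rule sum_mono)
    fix j assume j: "j \<in> J"
    have "\<bar>X j th * v j\<bar> \<le> K * \<bar>v j\<bar>" unfolding abs_mult using X_bound[OF j] by (intro mult_right_mono) auto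
    moreover have "(X j th)\<^sup>2 \<le> K\<^sup>2" using X_bound[OF j] K0 abs_le_square_iff[of "X j th" K] by simp
    then have "a j * (X j th)\<^sup>2 \<le> a j * K\<^sup>2" using a[rule_format, OF j] by (intro mult_left_mono)
    ultimately show "- (K * \<bar>v j\<bar>) - a j * K\<^sup>2 / 2 \<le> X j th * v j - a j * (X j th)\<^sup>2 / 2" by linarith
  qed
  moreover have "(\<Sum>j\<in>J. - (K * \<bar>v j\<bar>) - a j * K\<^sup>2 / 2) = - damp + - K * (\<Sum>j\<in>J. \<bar>v j\<bar>)"
    by (simp add: damp_def sum_subtractf sum_negf sum_distrib_left sum_divide_distrib sum_distrib_right mult_ac)
  ultimately show ?thesis unfolding lik_def growth_def exp_add[symmetric] by simp
qed

lemma lik_meas [measurable]: "(\<lambda>th. lik J X a v th) \<in> borel_measurable M"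
  unfolding lik_def by measurable

lemma lik_integrable: "integrable M (\<lambda>th. lik J X a v th)"
  by (rule bounded_integrable[of _ "growth K v"]) (simp_all add: abs_of_pos lik_pos lik_upper)

lemma weighted_lik_integrable:
  assumes [measurable]: "f \<in> borel_measurable M" and f: "\<And>th. \<bar>f th\<bar> \<le> C"
  shows "integrable M (\<lambda>th. f th * lik J X a v th)"
proof (rule bounded_integrable[of _ "C * growth K v"])
  fix th
  have "0 \<le> C" using f[of th] by linarith
  then show "\<bar>f th * lik J X a v th\<bar> \<le> C * growth K v"
    unfolding abs_mult using f[of th] lik_upper[of v th] lik_pos[of J X a v th] by (intro mult_mono) auto
qed measurable

lemma evidence_upper: "evidence M J X a v \<le> growth K v"
  unfolding evidence_def using integral_mono[OF lik_integrable, of "\<lambda>_. growth K v"] lik_upper by (simp add: prob_space)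

lemma evidence_lower: "exp (- damp) * growth (- K) v \<le> evidence M J X a v"
  unfolding evidence_def using integral_mono[OF _ lik_integrable, of "\<lambda>_. exp (- damp) * growth (- K) v"] lik_lower
  by (simp add: prob_space)

lemma evidence_pos: "evidence M J X a v > 0"
  using evidence_lower[of v] growth_ge1(3)[of "- K" v] by (meson exp_gt_zero less_le_trans mult_pos_pos)

lemma evidence_measurable [measurable]: "evidence M J X a \<in> borel_measurable (coords J)"
proof -
  have [measurable]: "(\<lambda>p. lik J X a (fst p) (snd p)) \<in> borel_measurable (coords J \<Otimes>\<^sub>M M)"
    by (rule lik_measurable[OF XM])
  show ?thesis unfolding evidence_def
    by (rule borel_measurable_lebesgue_integral) (simp add: case_prod_beta)
qed

lemma numer_measurable [measurable]: "i \<in> J \<Longrightarrow> numer M J X a i \<in> borel_measurable (coords J)"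
proof -
  assume [measurable]: "i \<in> J"
  have [measurable]: "(\<lambda>p. lik J X a (fst p) (snd p)) \<in> borel_measurable (coords J \<Otimes>\<^sub>M M)"
    by (rule lik_measurable[OF XM])
  show ?thesis unfolding numer_def
    by (rule borel_measurable_lebesgue_integral) (simp add: case_prod_beta)
qed

lemma numer_bound: "i \<in> J \<Longrightarrow> \<bar>numer M J X a i v\<bar> \<le> K * evidence M J X a v"
proof -
  assume i: "i \<in> J"
  have int: "integrable M (\<lambda>th. X i th * lik J X a v th)"
    using i by (intro weighted_lik_integrable[of _ K] XM X_bound)
  have "\<bar>numer M J X a i v\<bar> \<le> (LINT th|M. \<bar>X i th * lik J X a v th\<bar>)"
    unfolding numer_def by (rule integral_abs_bound)
  also have "\<dots> \<le> (LINT th|M. K * lik J X a v th)"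
  proof (intro integral_mono integrable_abs[OF int])
    show "\<bar>X i th * lik J X a v th\<bar> \<le> K * lik J X a v th" for th
      unfolding abs_mult using X_bound[OF i, of th] lik_pos[of J X a v th] by (intro mult_mono) auto
  qed (use lik_integrable in auto)
  finally show ?thesis by (simp add: evidence_def)
qed

lemma abs_ln_evidence: "\<bar>ln (evidence M J X a v)\<bar> \<le> (1 + damp) * growth K v"
proof -
  have d: "damp \<ge> 0" using a by (auto simp: damp_def intro!: mult_nonneg_nonneg sum_nonneg)
  have "ln (evidence M J X a v) \<le> ln (growth K v)"
    using evidence_upper evidence_pos by (simp add: growth_ge1(3))
  then have 1: "ln (evidence M J X a v) \<le> K * (\<Sum>j\<in>J. \<bar>v j\<bar>)" by (simp add: growth_def)
  have "ln (exp (- damp) * growth (- K) v) \<le> ln (evidence M J X a v)"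
    using evidence_lower evidence_pos growth_ge1(3) by (subst ln_le_cancel_iff) auto
  then have 2: "- damp - K * (\<Sum>j\<in>J. \<bar>v j\<bar>) \<le> ln (evidence M J X a v)"
    by (simp add: growth_def exp_add[symmetric])
  have "damp * 1 \<le> damp * growth K v" using d growth_ge1(1)[OF K0] by (intro mult_left_mono)
  moreover note growth_ge1(2)[OF K0, of v]
  ultimately show ?thesis using 1 2 d by (auto simp: abs_le_iff distrib_right)
qed

lemma integrable_by_growth:
  assumes [measurable]: "h \<in> borel_measurable (coords J)" and "\<And>v. \<bar>h v\<bar> \<le> C * growth c v"
  shows "integrable (gau J a) h"
proof (rule lint_bound)
  show "integrable (gau J a) (\<lambda>v. C * growth c v)" using growth_integrable[OF a, of c] by simp
  show "AE v in gau J a. norm (h v) \<le> norm (C * growth c v)"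
    using order_trans[OF assms(2) abs_ge_self] by (intro AE_I2) simp
qed simp

lemma evidence_integrable: "integrable (gau J a) (evidence M J X a)"
  by (rule integrable_by_growth[where C=1 and c=K]) (simp_all add: abs_of_pos[OF evidence_pos] evidence_upper)

lemma entropy_integrable: "integrable (gau J a) (\<lambda>v. evidence M J X a v * ln (evidence M J X a v))"
proof (rule integrable_by_growth[where C="1 + damp" and c="K + K"])
  show "\<bar>evidence M J X a v * ln (evidence M J X a v)\<bar> \<le> (1 + damp) * growth (K + K) v" for v
  proof -
    have "\<bar>evidence M J X a v * ln (evidence M J X a v)\<bar> \<le> growth K v * ((1 + damp) * growth K v)"
      unfolding abs_mult using evidence_upper[of v] evidence_pos[of v] abs_ln_evidence[of v]
      by (intro mult_mono) auto
    then show ?thesis unfolding growth_add[symmetric] by (simp only: mult_ac)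
  qed
qed measurable

lemma explained_integrable:
  assumes S: "S \<subseteq> J"
  shows "integrable (gau J a) (\<lambda>v. (\<Sum>i\<in>S. (numer M J X a i v)\<^sup>2) / evidence M J X a v)"
proof (rule integrable_by_growth[where C="real (card S) * K\<^sup>2" and c=K])
  have [measurable]: "i \<in> S \<Longrightarrow> numer M J X a i \<in> borel_measurable (coords J)" for i using S by auto
  show "(\<lambda>v. (\<Sum>i\<in>S. (numer M J X a i v)\<^sup>2) / evidence M J X a v) \<in> borel_measurable (coords J)"
    by measurable
  fix v
  have "(\<Sum>i\<in>S. (numer M J X a i v)\<^sup>2) \<le> (\<Sum>i\<in>S. (K * evidence M J X a v)\<^sup>2)"
  proof (rule sum_mono)
    fix i assume "i \<in> S"
    then have "\<bar>numer M J X a i v\<bar> \<le> \<bar>K * evidence M J X a v\<bar>"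
      using S order_trans[OF numer_bound[of i v] abs_ge_self] by auto
    then show "(numer M J X a i v)\<^sup>2 \<le> (K * evidence M J X a v)\<^sup>2" by (simp add: abs_le_square_iff)
  qed
  then have "(\<Sum>i\<in>S. (numer M J X a i v)\<^sup>2) / evidence M J X a v \<le> (\<Sum>i\<in>S. (K * evidence M J X a v)\<^sup>2) / evidence M J X a v"
    using evidence_pos[of v] by (intro divide_right_mono) auto
  also have "\<dots> = real (card S) * K\<^sup>2 * evidence M J X a v"
    using evidence_pos[of v] by (simp add: power2_eq_square)
  also have "\<dots> \<le> real (card S) * K\<^sup>2 * growth K v" using evidence_upper by (intro mult_left_mono) auto
  finally show "\<bar>(\<Sum>i\<in>S. (numer M J X a i v)\<^sup>2) / evidence M J X a v\<bar> \<le> real (card S) * K\<^sup>2 * growth K v"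
    using evidence_pos[of v] by (subst abs_of_nonneg) (auto intro!: sum_nonneg divide_nonneg_pos)
qed

lemma fubini_growth:
  assumes [measurable]: "(\<lambda>p. h (fst p) (snd p)) \<in> borel_measurable (coords J \<Otimes>\<^sub>M M)"
    and h: "\<And>v th. \<bar>h v th\<bar> \<le> C * growth c v"
  shows "(LINT v|(gau J a). (LINT th|M. h v th)) = (LINT th|M. (LINT v|(gau J a). h v th))"
proof -
  interpret G: prob_space "gau J a" by (rule prob_space_gau)
  interpret P: pair_prob_space "gau J a" M ..
  have "integrable (gau J a \<Otimes>\<^sub>M M) (\<lambda>p. C * growth c (fst p))"
    using growth_integrable[OF a, of c]
    by (intro P.Fubini_integrable) (simp_all add: prob_space abs_mult)
  then have "integrable (gau J a \<Otimes>\<^sub>M M) (\<lambda>p. h (fst p) (snd p))"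
    by (rule lint_bound) (use order_trans[OF h abs_ge_self] in \<open>simp_all add: AE_I2\<close>)
  then show ?thesis using P.Fubini_integral[of h] by (simp add: case_prod_beta')
qed

end

end

text \<open>
  The quadratic remainder in this estimate makes the entropy differentiable along a level.
\<close>

lemma exp_le_quadratic: "\<bar>s\<bar> \<le> 1 \<Longrightarrow> exp s \<le> 1 + s + s\<^sup>2" for s :: real
proof (cases "s \<ge> 0")
  case True
  moreover assume "\<bar>s\<bar> \<le> 1"
  ultimately show ?thesis by (intro exp_bound) auto
next
  case False
  have "(1 - s) * exp s \<le> exp (- s) * exp s"
    using exp_ge_add_one_self[of "- s"] by (intro mult_right_mono) auto
  also have "\<dots> = 1" by (simp add: exp_add[symmetric])
  also have "\<dots> \<le> (1 - s) * (1 + s + s\<^sup>2)"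
  proof -
    have "s * s * s \<le> 0" using False by (intro mult_nonneg_nonpos) auto
    then show ?thesis by (simp add: algebra_simps power2_eq_square)
  qed
  finally show ?thesis using False by (simp add: mult_le_cancel_left)
qed

lemma gau_convolution_integral:
  fixes h :: "('i \<Rightarrow> real) \<Rightarrow> real"
  assumes J: "finite J" and a: "\<forall>j\<in>J. 0 \<le> a j" and b: "\<forall>j\<in>J. 0 \<le> b j"
    and h: "integrable (gau J (\<lambda>j. a j + b j)) h"
  shows "integrable (gau J a) (\<lambda>v. \<integral>u. h (\<lambda>j\<in>J. v j + u j) \<partial>gau J b)"
    and "(LINT v|(gau J (\<lambda>j. a j + b j)). h v) = (LINT v|(gau J a). (LINT u|(gau J b). h (\<lambda>j\<in>J. v j + u j)))"
proof -
  interpret A: prob_space "gau J a" by (rule prob_space_gau)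
  interpret B: prob_space "gau J b" by (rule prob_space_gau)
  interpret P: pair_prob_space "gau J a" "gau J b" ..
  have meas: "(\<lambda>(v, u). \<lambda>j\<in>J. v j + u j) \<in> measurable (gau J a \<Otimes>\<^sub>M gau J b) (coords J)"
    unfolding case_prod_beta by (intro measurable_restrict) measurable
  have conv: "gau J (\<lambda>j. a j + b j) = distr (gau J a \<Otimes>\<^sub>M gau J b) (coords J) (\<lambda>(v, u). \<lambda>j\<in>J. v j + u j)"
    by (rule gau_convolution[symmetric]) (use J a b in auto)
  have hm: "h \<in> borel_measurable (coords J)" using borel_measurable_integrable[OF h] by simp
  have int: "integrable (gau J a \<Otimes>\<^sub>M gau J b) (\<lambda>(v, u). h (\<lambda>j\<in>J. v j + u j))"
    using integrable_distr[OF meas h[unfolded conv]] by (simp add: case_prod_beta')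
  show "integrable (gau J a) (\<lambda>v. \<integral>u. h (\<lambda>j\<in>J. v j + u j) \<partial>gau J b)"
    using P.integrable_fst[OF int] .
  have "(LINT v|(gau J (\<lambda>j. a j + b j)). h v) = (LINT p|((gau J a \<Otimes>\<^sub>M gau J b)). h (\<lambda>j\<in>J. fst p j + snd p j))"
    unfolding conv using integral_distr[OF meas hm] by (simp add: case_prod_beta')
  also have "\<dots> = (LINT v|(gau J a). (LINT u|(gau J b). h (\<lambda>j\<in>J. v j + u j)))"
    using P.integral_fst[OF int] by (simp add: case_prod_beta')
  finally show "(LINT v|(gau J (\<lambda>j. a j + b j)). h v) = (LINT v|(gau J a). (LINT u|(gau J b). h (\<lambda>j\<in>J. v j + u j)))" .
qed

context bounded_signal
begin

lemma lik_total: "\<forall>j\<in>J. 0 \<le> a j \<Longrightarrow> (LINT v|(gau J a). lik J X a v th) = 1"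
  unfolding lik_def by (rule gau_tilt_one[OF finJ])

lemma coordinate_growth: "j \<in> J \<Longrightarrow> \<bar>v j\<bar> \<le> growth 1 v"
proof -
  assume "j \<in> J"
  then have "\<bar>v j\<bar> \<le> (\<Sum>j\<in>J. \<bar>v j\<bar>)" using finJ by (intro member_le_sum) auto
  then show ?thesis using growth_ge1(2)[of 1 v] by simp
qed

lemma lik_pair_measurable [measurable]: "(\<lambda>p. lik J X a (fst p) (snd p)) \<in> borel_measurable (coords J \<Otimes>\<^sub>M M)"
  by (rule lik_measurable[OF XM])

lemma weighted_evidence_total:
  assumes a: "\<forall>j\<in>J. 0 \<le> a j"
    and [measurable]: "f \<in> borel_measurable M" and f: "\<And>th. \<bar>f th\<bar> \<le> C"
  shows "(LINT v|(gau J a). (LINT th|M. f th * lik J X a v th)) = expectation f"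
proof -
  have "(LINT v|(gau J a). (LINT th|M. f th * lik J X a v th)) = (LINT th|M. (LINT v|(gau J a). f th * lik J X a v th))"
  proof (rule fubini_growth[where C=C and c=K])
    fix v th
    have "0 \<le> C" using f[of th] by linarith
    then show "\<bar>f th * lik J X a v th\<bar> \<le> C * growth K v"
      unfolding abs_mult using f[of th] lik_upper[OF a, of v th] lik_pos[of J X a v th] by (intro mult_mono) auto
  qed (use a in auto)
  then show ?thesis by (simp add: lik_total[OF a])
qed

lemma evidence_total: "\<forall>j\<in>J. 0 \<le> a j \<Longrightarrow> (LINT v|(gau J a). evidence M J X a v) = 1"
  using weighted_evidence_total[of a "\<lambda>_. 1" 1] by (simp add: evidence_def prob_space)

lemma numer_total: "\<forall>j\<in>J. 0 \<le> a j \<Longrightarrow> i \<in> J \<Longrightarrow> (LINT v|(gau J a). numer M J X a i v) = expectation (X i)"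
  using weighted_evidence_total[of a "X i" K] X_bound by (simp add: numer_def)

text \<open>
  Tilting \<open>gau J a\<close> by the likelihood turns \<open>v i\<close> into \<open>v i + a i * X
  i\<close>.
\<close>

lemma evidence_first_moment:
  assumes a: "\<forall>j\<in>J. 0 \<le> a j" and i: "i \<in> J"
  shows "integrable (gau J a) (\<lambda>v. v i * evidence M J X a v)"
    and "(LINT v|(gau J a). v i * evidence M J X a v) = a i * expectation (X i)"
proof -
  interpret G: prob_space "gau J a" by (rule prob_space_gau)
  have [measurable]: "evidence M J X a \<in> borel_measurable (coords J)" by (rule evidence_measurable) (rule a)
  show "integrable (gau J a) (\<lambda>v. v i * evidence M J X a v)"
  proof (rule integrable_by_growth[where C=1 and c="1 + K"])
    show "(\<lambda>v. v i * evidence M J X a v) \<in> borel_measurable (coords J)" using i by measurable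
    show "\<bar>v i * evidence M J X a v\<bar> \<le> 1 * growth (1 + K) v" for v
      unfolding abs_mult growth_add[symmetric] mult_1_left
      using coordinate_growth[OF i] evidence_upper[OF a] evidence_pos[OF a, of v] growth_ge1(3)[of 1 v]
      by (intro mult_mono) (auto simp: abs_of_pos)
  qed (rule a)
  have "(LINT v|(gau J a). v i * evidence M J X a v) = (LINT v|(gau J a). (LINT th|M. v i * lik J X a v th))"
    by (simp add: evidence_def)
  also have "\<dots> = (LINT th|M. (LINT v|(gau J a). v i * lik J X a v th))"
  proof (rule fubini_growth[where C=1 and c="1 + K"])
    show "\<bar>v i * lik J X a v th\<bar> \<le> 1 * growth (1 + K) v" for v th
      unfolding abs_mult growth_add[symmetric] mult_1_left
      using coordinate_growth[OF i] lik_upper[OF a] lik_pos[of J X a v th] growth_ge1(3)[of 1 v]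
      by (intro mult_mono) (auto simp: abs_of_pos)
    show "(\<lambda>p. fst p i * lik J X a (fst p) (snd p)) \<in> borel_measurable (coords J \<Otimes>\<^sub>M M)"
      using i by measurable
  qed (rule a)
  also have "\<dots> = (LINT th|M. a i * X i th)"
  proof (rule lint_cong[OF refl])
    fix th
    have "(LINT v|(gau J a). v i * lik J X a v th) = (LINT v|(gau J a). (\<lambda>j\<in>J. v j + a j * X j th) i)"
      unfolding lik_def
      by (subst mult.commute, rule gau_tilt[where J=J and a=a and h="\<lambda>v. v i"]) (use finJ a i in auto)
    also have "\<dots> = a i * X i th"
      using i gau_coordinate_mean[OF finJ i, of a] by (simp add: G.prob_space)
    finally show "(LINT v|(gau J a). v i * lik J X a v th) = a i * X i th" .
  qed
  finally show "(LINT v|(gau J a). v i * evidence M J X a v) = a i * expectation (X i)" by simp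
qed

lemma mean_sq_le: "(\<Sum>j\<in>J. (expectation (X j))\<^sup>2) \<le> K\<^sup>2"
proof -
  have "(\<Sum>j\<in>J. (expectation (X j))\<^sup>2) \<le> (\<Sum>j\<in>J. expectation (\<lambda>th. (X j th)\<^sup>2))"
  proof (rule sum_mono)
    fix j assume j: "j \<in> J"
    have "integrable M (\<lambda>th. (X j th)\<^sup>2)"
      using X_bound[OF j] XM[OF j] K0 
      by (intro bounded_integrable[of _ "K\<^sup>2"]) (auto simp: abs_le_square_iff[symmetric])
    then have "0 \<le> expectation (\<lambda>th. (X j th)\<^sup>2) - (expectation (X j))\<^sup>2"
      using variance_positive[of "X j"] variance_eq[OF X_integrable[OF j]] by simp
    then show "(expectation (X j))\<^sup>2 \<le> expectation (\<lambda>th. (X j th)\<^sup>2)" by simp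
  qed
  also have "\<dots> = expectation (\<lambda>th. \<Sum>j\<in>J. (X j th)\<^sup>2)"
    using X_bound XM K0
    by (intro lint_sum[symmetric] bounded_integrable[of _ "K\<^sup>2"]) (auto simp: abs_le_square_iff[symmetric])
  also have "\<dots> \<le> expectation (\<lambda>th. K\<^sup>2)"
    using XK finJ by (intro integral_mono bounded_integrable[of _ "K\<^sup>2"]) (auto simp: sum_nonneg)
  finally show ?thesis by (simp add: prob_space)
qed

lemma mean_signal: "bounded_signal M J (\<lambda>j _. expectation (X j)) K"
  by unfold_locales (use finJ K0 mean_sq_le in auto)

text \<open>
  Dividing by the likelihood of a deterministic signal \<open>m\<close> completes the square: only the
  product of the two deviations from \<open>m\<close> remains in the exponent.
\<close>

lemma lik_ratio_total:
  assumes b: "\<forall>j\<in>J. 0 \<le> b j"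
  shows "(LINT v|(gau J b). lik J X b v th * lik J X b v th' / lik J (\<lambda>j _. m j) b v th0)
    = exp (\<Sum>j\<in>J. b j * ((X j th - m j) * (X j th' - m j)))"
proof -
  have "lik J X b v th * lik J X b v th' / lik J (\<lambda>j _. m j) b v th0
     = exp (\<Sum>j\<in>J. (X j th + X j th' - m j) * v j - b j * (X j th + X j th' - m j)\<^sup>2 / 2)
       * exp (\<Sum>j\<in>J. b j * ((X j th - m j) * (X j th' - m j)))" for v
    unfolding lik_def exp_add[symmetric] exp_diff[symmetric] sum.distrib[symmetric] sum_subtractf[symmetric]
    by (intro arg_cong[where f=exp] sum.cong refl) (simp add: power2_eq_square field_simps)
  then show ?thesis using gau_tilt_one[where J=J and a=b, OF finJ b] by simp
qed

context
  fixes b :: "'i \<Rightarrow> real" 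
  assumes b: "\<forall>j\<in>J. 0 \<le> b j"
begin

text \<open>
  To first order the entropy gain of a weak observation is that of its mean. Let \<open>g\<close> be
  the likelihood of the deterministic signal \<open>m\<close>, the mean of \<open>X\<close>. Replacing
  \<open>ln Z\<close> by \<open>ln g\<close> in the entropy gives the term \<open>\<Sum>j\<in>J. b j *
  (m j)\<^sup>2 / 2\<close>; the error is the relative entropy of \<open>Z\<close> with respect to
  \<open>g\<close>. This is nonnegative and at most the chi-square divergence, which is the mean of
  \<open>exp s - 1\<close> for a centered \<open>s\<close> of size \<open>\<rho>\<close>, hence at
  most \<open>\<rho>\<^sup>2\<close>.
\<close>

lemma
  shows entropy_one_step_lower: "(\<Sum>j\<in>J. b j * (expectation (X j))\<^sup>2) / 2 \<le> entropy_gain M J X b"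
    and entropy_one_step_upper: 
      "\<lbrakk>\<And>th th'. \<bar>\<Sum>j\<in>J. b j * ((X j th - expectation (X j)) * (X j th' - expectation (X j)))\<bar> \<le> \<rho>; \<rho> \<le> 1\<rbrakk>
        \<Longrightarrow> entropy_gain M J X b \<le> (\<Sum>j\<in>J. b j * (expectation (X j))\<^sup>2) / 2 + \<rho>\<^sup>2"
proof -
  define m where "m j = expectation (X j)" for j
  obtain th0 where "th0 \<in> space M" using not_empty by auto
  define g where "g v = lik J (\<lambda>j _. m j) b v th0" for v
  interpret C: bounded_signal M J "\<lambda>j _. m j" K unfolding m_def by (rule mean_signal)
  interpret G: prob_space "gau J b" by (rule prob_space_gau)
  let ?Z = "evidence M J X b"
  note Zpos = evidence_pos[OF b]
  have gpos: "g v > 0" for v by (simp add: g_def lik_pos)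
  have Zm [measurable]: "?Z \<in> borel_measurable (coords J)" by (rule evidence_measurable) (rule b)
  have gm [measurable]: "g \<in> borel_measurable (coords J)" unfolding g_def lik_def by measurable
  have gup: "g v \<le> growth K v" for v unfolding g_def using C.lik_upper[OF b] by (simp add: growth_def C.growth_def)
  have gint: "integrable (gau J b) g"
    by (rule integrable_by_growth[where C=1 and c=K]) (simp_all add: abs_of_pos[OF gpos] gup b)
  have g1: "(LINT v|(gau J b). g v) = 1" unfolding g_def by (rule C.lik_total) (rule b)
  define B where "B = (\<Sum>j\<in>J. b j * (m j)\<^sup>2) / 2"
  have lng: "ln (g v) = (\<Sum>j\<in>J. m j * v j) - B" for v
    by (simp add: g_def lik_def B_def sum_subtractf sum_divide_distrib)
  have Zlng: "?Z v * ln (g v) = (\<Sum>j\<in>J. m j * (v j * ?Z v)) - B * ?Z v" for v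
    by (simp add: lng algebra_simps sum_distrib_left)
  have intZ: "integrable (gau J b) ?Z" by (rule evidence_integrable) (rule b)
  have intZlng: "integrable (gau J b) (\<lambda>v. ?Z v * ln (g v))"
    unfolding Zlng using intZ evidence_first_moment(1)[OF b] by auto
  have EZlng: "(LINT v|(gau J b). ?Z v * ln (g v)) = B"
  proof -
    have "(LINT v|(gau J b). ?Z v * ln (g v)) = (\<Sum>j\<in>J. m j * (b j * m j)) - B * 1"
      unfolding Zlng using intZ evidence_first_moment[OF b] evidence_total[OF b] by (simp add: m_def)
    also have "(\<Sum>j\<in>J. m j * (b j * m j)) = 2 * B" by (simp add: B_def power2_eq_square mult_ac)
    finally show ?thesis by simp
  qed
  have intZZ: "integrable (gau J b) (\<lambda>v. ?Z v * ln (?Z v))" by (rule entropy_integrable) (rule b)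
  have "?Z v * ln (g v) + ?Z v - g v \<le> ?Z v * ln (?Z v)" for v
  proof -
    have "ln (g v / ?Z v) \<le> g v / ?Z v - 1" using gpos[of v] Zpos[of v] by (intro ln_le_minus_one) auto
    then have "?Z v * (ln (g v) - ln (?Z v)) \<le> ?Z v * (g v / ?Z v - 1)"
      using gpos[of v] Zpos[of v] by (intro mult_left_mono) (auto simp: ln_div)
    also have "\<dots> = g v - ?Z v" using Zpos[of v] by (simp add: field_simps)
    finally show ?thesis by (simp add: algebra_simps)
  qed
  then have "(LINT v|(gau J b). ?Z v * ln (g v) + ?Z v - g v) \<le> (LINT v|(gau J b). ?Z v * ln (?Z v))"
    by (intro integral_mono intZZ) (use intZlng intZ gint in auto)
  also have "(LINT v|(gau J b). ?Z v * ln (g v) + ?Z v - g v) = B"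
    using intZlng intZ gint EZlng g1 evidence_total[OF b] by simp
  finally show "(\<Sum>j\<in>J. b j * (expectation (X j))\<^sup>2) / 2 \<le> entropy_gain M J X b"
    by (simp add: entropy_gain_def B_def m_def)
  assume \<rho>: "\<And>th th'. \<bar>\<Sum>j\<in>J. b j * ((X j th - expectation (X j)) * (X j th' - expectation (X j)))\<bar> \<le> \<rho>" "\<rho> \<le> 1"
  define s where "s th th' = (\<Sum>j\<in>J. b j * ((X j th - m j) * (X j th' - m j)))" for th th'
  have s: "\<bar>s th th'\<bar> \<le> \<rho>" for th th' unfolding s_def m_def by (rule \<rho>)
  have \<rho>0: "\<rho> \<ge> 0" using s[of undefined undefined] by linarith
  have sm [measurable]: "s th \<in> borel_measurable M" for th unfolding s_def by measurable
  have Es: "expectation (s th) = 0" for th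
  proof -
    have "expectation (s th) = (\<Sum>j\<in>J. b j * ((X j th - m j) * (expectation (X j) - m j)))"
      unfolding s_def using X_integrable by (subst lint_sum) (auto simp: prob_space)
    then show ?thesis by (simp add: m_def)
  qed
  define D where "D = exp (C.damp b)"
  have ginv: "1 / g v \<le> D * growth K v" for v
  proof -
    have "exp (- C.damp b) * growth (- K) v \<le> g v"
      unfolding g_def using C.lik_lower[OF b] by (simp add: growth_def C.growth_def)
    then have "1 / g v \<le> 1 / (exp (- C.damp b) * growth (- K) v)"
      using gpos growth_ge1(3) by (intro divide_left_mono mult_pos_pos) auto
    also have "\<dots> = D * growth K v" by (simp add: D_def growth_def exp_minus field_simps)
    finally show ?thesis .
  qed
  have bound: "\<bar>p * (q / g v)\<bar> \<le> D * growth (3 * K) v"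
    if "0 \<le> p" "p \<le> growth K v" "0 \<le> q" "q \<le> growth K v" for p q v
  proof -
    have "\<bar>p * (q / g v)\<bar> = p * (q * (1 / g v))" using that gpos[of v] by simp
    also have "\<dots> \<le> growth K v * (growth K v * (D * growth K v))"
      using that ginv[of v] gpos[of v] growth_ge1(3)[of K v]
      by (intro mult_mono) auto
    also have "\<dots> = D * (growth K v * (growth K v * growth K v))" by (simp only: mult_ac)
    also have "\<dots> = D * growth (3 * K) v" by (simp add: growth_add)
    finally show ?thesis .
  qed
  note likb = less_imp_le[OF lik_pos] lik_upper[OF b] less_imp_le[OF Zpos] evidence_upper[OF b]
  have "(LINT v|(gau J b). ?Z v * (?Z v / g v)) = (LINT v|(gau J b). (LINT th|M. lik J X b v th * (?Z v / g v)))"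
    by (simp add: evidence_def)
  also have "\<dots> = (LINT th|M. (LINT v|(gau J b). lik J X b v th * (?Z v / g v)))"
  proof (rule fubini_growth[OF b, where C=D and c="3 * K"])
    show "\<bar>lik J X b v th * (?Z v / g v)\<bar> \<le> D * growth (3 * K) v" for v th by (intro bound likb)
  qed measurable
  also have "\<dots> = (LINT th|M. (LINT v|(gau J b). (LINT th'|M. lik J X b v th * (lik J X b v th' / g v))))"
    by (simp add: evidence_def)
  also have "\<dots> = (LINT th|M. (LINT th'|M. (LINT v|(gau J b). lik J X b v th * (lik J X b v th' / g v))))"
  proof (rule lint_cong[OF refl])
    fix th
    have [measurable]: "(\<lambda>v. lik J X b v th) \<in> borel_measurable (coords J)" unfolding lik_def by measurable
    show "(LINT v|(gau J b). (LINT th'|M. lik J X b v th * (lik J X b v th' / g v)))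
      = (LINT th'|M. (LINT v|(gau J b). lik J X b v th * (lik J X b v th' / g v)))"
    proof (rule fubini_growth[OF b, where C=D and c="3 * K"])
      show "\<bar>lik J X b v th * (lik J X b v th' / g v)\<bar> \<le> D * growth (3 * K) v" for v th' by (intro bound likb)
    qed measurable
  qed
  also have "\<dots> = (LINT th|M. (LINT th'|M. exp (s th th')))"
    unfolding g_def s_def using lik_ratio_total[OF b, of _ _ m th0] by simp
  also have "\<dots> \<le> (LINT th|M. 1 + \<rho>\<^sup>2)"
  proof (rule integral_mono')
    show "integrable M (\<lambda>th. 1 + \<rho>\<^sup>2)" by simp
    fix th
    have "(LINT th'|M. exp (s th th')) \<le> (LINT th'|M. 1 + s th th' + \<rho>\<^sup>2)"
    proof (rule integral_mono)
      show "integrable M (\<lambda>th'. exp (s th th'))"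
        using s[of th] by (intro bounded_integrable[of _ "exp \<rho>"]) (auto intro: order_trans[OF abs_ge_self])
      show "integrable M (\<lambda>th'. 1 + s th th' + \<rho>\<^sup>2)"
        using s[of th] bounded_integrable[of "s th" \<rho>] by auto
      fix th'
      have "exp (s th th') \<le> 1 + s th th' + (s th th')\<^sup>2"
        using s[of th th'] \<rho>(2) by (intro exp_le_quadratic) linarith
      also have "(s th th')\<^sup>2 \<le> \<rho>\<^sup>2" using s[of th th'] \<rho>0 by (simp add: abs_le_square_iff[symmetric])
      finally show "exp (s th th') \<le> 1 + s th th' + \<rho>\<^sup>2" by simp
    qed
    also have "\<dots> = 1 + \<rho>\<^sup>2"
      using s[of th] bounded_integrable[of "s th" \<rho>] Es[of th] by (simp add: prob_space)
    finally show "(LINT th'|M. exp (s th th')) \<le> 1 + \<rho>\<^sup>2" .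
  qed simp
  finally have Z2: "(LINT v|(gau J b). ?Z v * (?Z v / g v)) \<le> 1 + \<rho>\<^sup>2" by (simp add: prob_space)
  have intZ2: "integrable (gau J b) (\<lambda>v. ?Z v * (?Z v / g v))"
  proof (rule integrable_by_growth[OF b, where C=D and c="3 * K"])
    show "\<bar>?Z v * (?Z v / g v)\<bar> \<le> D * growth (3 * K) v" for v by (intro bound likb)
  qed measurable
  have "?Z v * ln (?Z v) \<le> ?Z v * ln (g v) + ?Z v * (?Z v / g v) - ?Z v" for v
  proof -
    have "ln (?Z v / g v) \<le> ?Z v / g v - 1" using gpos[of v] Zpos[of v] by (intro ln_le_minus_one) auto
    then have "?Z v * (ln (?Z v) - ln (g v)) \<le> ?Z v * (?Z v / g v - 1)"
      using gpos[of v] Zpos[of v] by (intro mult_left_mono) (auto simp: ln_div)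
    then show ?thesis by (simp add: algebra_simps)
  qed
  then have "(LINT v|(gau J b). ?Z v * ln (?Z v)) \<le> (LINT v|(gau J b). ?Z v * ln (g v) + ?Z v * (?Z v / g v) - ?Z v)"
    by (intro integral_mono intZZ) (use intZlng intZ intZ2 in auto)
  also have "\<dots> = B + (LINT v|(gau J b). ?Z v * (?Z v / g v)) - 1"
    using intZlng intZ intZ2 EZlng evidence_total[OF b] by simp
  finally show "entropy_gain M J X b \<le> (\<Sum>j\<in>J. b j * (expectation (X j))\<^sup>2) / 2 + \<rho>\<^sup>2"
    using Z2 by (simp add: entropy_gain_def B_def m_def)
qed

text \<open>
  An observation can only add to the power of the means: expand \<open>(N - m * Z)\<^sup>2 / Z \<ge>
  0\<close>.
\<close>

lemma explained_ge_mean: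
  assumes S: "S \<subseteq> J"
  shows "(\<Sum>i\<in>S. (expectation (X i))\<^sup>2) \<le> explained M J X S b"
proof -
  let ?Z = "evidence M J X b" and ?N = "numer M J X b"
  define m where "m j = expectation (X j)" for j
  have intN: "integrable (gau J b) (?N i)" if i: "i \<in> S" for i
  proof (rule integrable_by_growth[where C=K and c=K])
    show "?N i \<in> borel_measurable (coords J)" using i S b by (intro numer_measurable) auto
    show "\<bar>?N i v\<bar> \<le> K * growth K v" for v
      using numer_bound[OF b, of i v] i S mult_left_mono[OF evidence_upper[OF b, of v] K0] by auto
  qed (rule b)
  have intZ: "integrable (gau J b) ?Z" by (rule evidence_integrable) (rule b)
  have "(LINT v|(gau J b). (\<Sum>i\<in>S. 2 * m i * ?N i v - (m i)\<^sup>2 * ?Z v)) \<le> explained M J X S b"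
    unfolding explained_def
  proof (rule integral_mono)
    show "integrable (gau J b) (\<lambda>v. \<Sum>i\<in>S. 2 * m i * ?N i v - (m i)\<^sup>2 * ?Z v)" using intN intZ by auto
    show "integrable (gau J b) (\<lambda>v. (\<Sum>i\<in>S. (?N i v)\<^sup>2) / ?Z v)" by (rule explained_integrable[OF b S])
    fix v
    have "2 * m i * ?N i v - (m i)\<^sup>2 * ?Z v \<le> (?N i v)\<^sup>2 / ?Z v" for i
    proof -
      have "0 \<le> (?N i v - m i * ?Z v)\<^sup>2 / ?Z v" using evidence_pos[OF b, of v] by simp
      also have "\<dots> = (?N i v)\<^sup>2 / ?Z v - 2 * m i * ?N i v + (m i)\<^sup>2 * ?Z v"
        using evidence_pos[OF b, of v] by (simp add: power2_eq_square field_simps)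
      finally show ?thesis by simp
    qed
    then show "(\<Sum>i\<in>S. 2 * m i * ?N i v - (m i)\<^sup>2 * ?Z v) \<le> (\<Sum>i\<in>S. (?N i v)\<^sup>2) / ?Z v"
      by (simp add: sum_divide_distrib sum_mono)
  qed
  also have "(LINT v|(gau J b). (\<Sum>i\<in>S. 2 * m i * ?N i v - (m i)\<^sup>2 * ?Z v)) = (\<Sum>i\<in>S. 2 * m i * m i - (m i)\<^sup>2 * 1)"
    using intN intZ S numer_total[OF b] evidence_total[OF b]
    by (subst lint_sum) (auto intro!: sum.cong simp: m_def subset_eq)
  also have "\<dots> = (\<Sum>i\<in>S. (m i)\<^sup>2)" by (simp add: power2_eq_square)
  finally show ?thesis by (simp add: m_def)
qed

end

end

context bounded_signal
begin

lemma lik_slice_measurable [measurable]: "lik J X a v \<in> borel_measurable M"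
  unfolding lik_def by measurable

context
  fixes a :: "'i \<Rightarrow> real"
  assumes a: "\<forall>j\<in>J. 0 \<le> a j"
begin

lemma posterior_integral:
  fixes f :: "'a \<Rightarrow> real"
  assumes [measurable]: "f \<in> borel_measurable M"
  shows "integral\<^sup>L (posterior M J X a v) f = (LINT th|M. f th * lik J X a v th) / evidence M J X a v"
proof -
  have "integral\<^sup>L (posterior M J X a v) f = (LINT th|M. (lik J X a v th / evidence M J X a v) *\<^sub>R f th)"
    unfolding posterior_def
    by (intro integral_density AE_I2 divide_nonneg_nonneg less_imp_le[OF lik_pos] less_imp_le[OF evidence_pos[OF a]]) simp_all
  also have "\<dots> = (LINT th|M. f th * lik J X a v th / evidence M J X a v)"
    by (simp add: mult.commute)
  finally show ?thesis by simp
qed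

lemma sets_posterior [simp]: "sets (posterior M J X a v) = sets M" "space (posterior M J X a v) = space M"
  by (auto simp: posterior_def)

lemma posterior_signal: "bounded_signal (posterior M J X a v) J X K"
proof -
  have "emeasure (posterior M J X a v) (space M) = (\<integral>\<^sup>+th. ennreal (lik J X a v th / evidence M J X a v) \<partial>M)"
    unfolding posterior_def by (subst emeasure_density) (auto intro!: nn_integral_cong)
  also have "\<dots> = ennreal (LINT th|M. lik J X a v th / evidence M J X a v)"
    using lik_integrable[OF a, of v]
    by (intro nn_integral_eq_integral AE_I2 divide_nonneg_nonneg less_imp_le[OF lik_pos] less_imp_le[OF evidence_pos[OF a]]) simp
  also have "(LINT th|M. lik J X a v th / evidence M J X a v) = 1"
    using evidence_pos[OF a, of v] by (simp add: evidence_def)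
  finally have "prob_space (posterior M J X a v)" by (intro prob_spaceI) simp
  then show ?thesis
    unfolding bounded_signal_def bounded_signal_axioms_def
    using finJ XM K0 XK by (auto simp: posterior_def)
qed

lemma posterior_mean: "i \<in> J \<Longrightarrow> integral\<^sup>L (posterior M J X a v) (X i) = numer M J X a i v / evidence M J X a v"
  by (simp add: posterior_integral XM numer_def)

text \<open>
  An observation at the level \<open>a + b\<close> is an observation at the level \<open>a\<close>
  followed by one at the level \<open>b\<close> of the signal under its posterior law.
\<close>

lemma evidence_add:
  "evidence M J X (\<lambda>j. a j + b j) (\<lambda>j. v j + u j) = evidence M J X a v * evidence (posterior M J X a v) J X b u"
proof -
  have "evidence (posterior M J X a v) J X b u = (LINT th|M. lik J X b u th * lik J X a v th) / evidence M J X a v"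
    unfolding evidence_def[of "posterior M J X a v"] by (intro posterior_integral) simp
  then show ?thesis using evidence_pos[OF a, of v]
    unfolding evidence_def[of M J X "\<lambda>j. a j + b j"] lik_add by (simp add: mult.commute)
qed

lemma numer_add:
  assumes i: "i \<in> J"
  shows "numer M J X (\<lambda>j. a j + b j) i (\<lambda>j. v j + u j) = evidence M J X a v * numer (posterior M J X a v) J X b i u"
proof -
  have "numer (posterior M J X a v) J X b i u = (LINT th|M. (X i th * lik J X b u th) * lik J X a v th) / evidence M J X a v"
    unfolding numer_def[of "posterior M J X a v"] using XM[OF i] by (intro posterior_integral) simp
  then show ?thesis using evidence_pos[OF a, of v]
    unfolding numer_def[of M J X "\<lambda>j. a j + b j"] lik_add by (simp add: mult_ac)
qed

lemma weighted_posterior_mean_sq: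
  assumes S: "S \<subseteq> J"
  shows "evidence M J X a v * (\<Sum>i\<in>S. c i * (integral\<^sup>L (posterior M J X a v) (X i))\<^sup>2)
    = (\<Sum>i\<in>S. c i * (numer M J X a i v)\<^sup>2) / evidence M J X a v"
proof -
  have "(\<Sum>i\<in>S. c i * (integral\<^sup>L (posterior M J X a v) (X i))\<^sup>2) = (\<Sum>i\<in>S. c i * (numer M J X a i v)\<^sup>2) / (evidence M J X a v)\<^sup>2"
    using S by (subst sum_divide_distrib, intro sum.cong refl) (auto simp: posterior_mean power_divide)
  then show ?thesis using evidence_pos[OF a, of v] by (simp add: power2_eq_square)
qed

context
  fixes b :: "'i \<Rightarrow> real"
  assumes b: "\<forall>j\<in>J. 0 \<le> b j"
begin

lemma ab: "\<forall>j\<in>J. 0 \<le> a j + b j" using a b by auto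

text \<open>
  The chain rule of relative entropy for the two successive observations.
\<close>

lemma
  shows entropy_chain_integrable: 
      "integrable (gau J a) (\<lambda>v. evidence M J X a v * entropy_gain (posterior M J X a v) J X b)"
    and entropy_chain: "entropy_gain M J X (\<lambda>j. a j + b j) = entropy_gain M J X a
      + (LINT v|(gau J a). evidence M J X a v * entropy_gain (posterior M J X a v) J X b)"
proof -
  let ?Z = "evidence M J X a" and ?Zab = "evidence M J X (\<lambda>j. a j + b j)"
  have inner: "(LINT u|(gau J b). ?Zab (\<lambda>j\<in>J. v j + u j) * ln (?Zab (\<lambda>j\<in>J. v j + u j)))
      = ?Z v * ln (?Z v) + ?Z v * entropy_gain (posterior M J X a v) J X b" for v
  proof -
    interpret P: bounded_signal "posterior M J X a v" J X K by (rule posterior_signal)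
    let ?P = "evidence (posterior M J X a v) J X b"
    have "(LINT u|(gau J b). ?Zab (\<lambda>j\<in>J. v j + u j) * ln (?Zab (\<lambda>j\<in>J. v j + u j)))
      = (LINT u|(gau J b). ?Z v * ln (?Z v) * ?P u + ?Z v * (?P u * ln (?P u)))"
      using evidence_pos[OF a, of v] P.evidence_pos[OF b]
      by (intro lint_cong refl)
        (simp only: evidence_restrict evidence_add, simp add: ln_mult algebra_simps)
    also have "\<dots> = ?Z v * ln (?Z v) + ?Z v * entropy_gain (posterior M J X a v) J X b"
      using P.evidence_integrable[OF b] P.entropy_integrable[OF b] P.evidence_total[OF b]
      by (simp add: entropy_gain_def)
    finally show ?thesis .
  qed
  note conv = gau_convolution_integral[OF finJ a b entropy_integrable[OF ab], unfolded inner]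
  have eq: "?Z v * entropy_gain (posterior M J X a v) J X b
     = (?Z v * ln (?Z v) + ?Z v * entropy_gain (posterior M J X a v) J X b) - ?Z v * ln (?Z v)" for v by simp
  show 1: "integrable (gau J a) (\<lambda>v. ?Z v * entropy_gain (posterior M J X a v) J X b)"
    by (subst eq) (rule Bochner_Integration.integrable_diff[OF conv(1) entropy_integrable[OF a]])
  show "entropy_gain M J X (\<lambda>j. a j + b j) = entropy_gain M J X a
      + (LINT v|(gau J a). ?Z v * entropy_gain (posterior M J X a v) J X b)"
    unfolding entropy_gain_def[of M] conv(2) using entropy_integrable[OF a] 1 by simp
qed

lemma
  assumes S: "S \<subseteq> J"
  shows explained_chain_integrable: 
      "integrable (gau J a) (\<lambda>v. evidence M J X a v * explained (posterior M J X a v) J X S b)"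
    and explained_chain: "explained M J X S (\<lambda>j. a j + b j)
      = (LINT v|(gau J a). evidence M J X a v * explained (posterior M J X a v) J X S b)"
proof -
  let ?Z = "evidence M J X a" and ?Zab = "evidence M J X (\<lambda>j. a j + b j)" and ?Nab = "numer M J X (\<lambda>j. a j + b j)"
  have inner: "(LINT u|(gau J b). (\<Sum>i\<in>S. (?Nab i (\<lambda>j\<in>J. v j + u j))\<^sup>2) / ?Zab (\<lambda>j\<in>J. v j + u j))
      = ?Z v * explained (posterior M J X a v) J X S b" for v
  proof -
    have "(\<Sum>i\<in>S. (?Nab i (\<lambda>j\<in>J. v j + u j))\<^sup>2) / ?Zab (\<lambda>j\<in>J. v j + u j)
      = ?Z v * ((\<Sum>i\<in>S. (numer (posterior M J X a v) J X b i u)\<^sup>2) / evidence (posterior M J X a v) J X b u)" for u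
    proof -
      have "(\<Sum>i\<in>S. (?Nab i (\<lambda>j\<in>J. v j + u j))\<^sup>2) = (\<Sum>i\<in>S. (?Z v)\<^sup>2 * (numer (posterior M J X a v) J X b i u)\<^sup>2)"
        using S by (intro sum.cong refl) (auto simp: numer_add power_mult_distrib)
      then show ?thesis using evidence_pos[OF a, of v]
        by (simp add: evidence_add sum_distrib_left[symmetric] power2_eq_square)
    qed
    then show ?thesis unfolding explained_def by (simp only: integral_mult_right_zero)
  qed
  note conv = gau_convolution_integral[OF finJ a b explained_integrable[OF ab S], unfolded inner]
  show "integrable (gau J a) (\<lambda>v. ?Z v * explained (posterior M J X a v) J X S b)" by (rule conv(1))
  show "explained M J X S (\<lambda>j. a j + b j) = (LINT v|(gau J a). ?Z v * explained (posterior M J X a v) J X S b)"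
    unfolding explained_def[of M] by (rule conv(2))
qed

text \<open>
  The chain rule for the explained power, together with the fact that each further observation adds to
  the power of the means.
\<close>

lemma explained_mono:
  assumes S: "S \<subseteq> J"
  shows "explained M J X S a \<le> explained M J X S (\<lambda>j. a j + b j)"
  unfolding explained_chain[OF S] explained_def[of M J X S a]
proof (rule integral_mono[OF explained_integrable[OF a S] explained_chain_integrable[OF S]])
  fix v
  interpret P: bounded_signal "posterior M J X a v" J X K by (rule posterior_signal)
  have "(\<Sum>i\<in>S. (numer M J X a i v)\<^sup>2) / evidence M J X a v
     = evidence M J X a v * (\<Sum>i\<in>S. (integral\<^sup>L (posterior M J X a v) (X i))\<^sup>2)"
    using weighted_posterior_mean_sq[OF S, of v "\<lambda>_. 1"] by simp
  also have "\<dots> \<le> evidence M J X a v * explained (posterior M J X a v) J X S b"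
    using P.explained_ge_mean[OF b S] evidence_pos[OF a, of v] by (intro mult_left_mono) auto
  finally show "(\<Sum>i\<in>S. (numer M J X a i v)\<^sup>2) / evidence M J X a v
      \<le> evidence M J X a v * explained (posterior M J X a v) J X S b" .
qed

end

end

definition boost :: "('i \<Rightarrow> real) \<Rightarrow> 'i set \<Rightarrow> real \<Rightarrow> 'i \<Rightarrow> real" where
  "boost a S \<delta> j = a j + (if j \<in> S then \<delta> else 0)"

text \<open>
  The one-step estimates under the posterior law, averaged over the observed vector. Since the
  deviations of the signal from its posterior mean have squared norm at most \<open>4 *
  K\<^sup>2\<close>, the remainder is quadratic in \<open>\<delta>\<close> with a constant that is
  independent of \<open>J\<close>.
\<close>

lemma entropy_increment:
  assumes a: "\<forall>j\<in>J. 0 \<le> a j" and S: "S \<subseteq> J" and \<delta>: "0 \<le> \<delta>"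
  shows "\<delta> * explained M J X S a \<le> 2 * (entropy_gain M J X (boost a S \<delta>) - entropy_gain M J X a)"
    and "4 * K\<^sup>2 * \<delta> \<le> 1 \<Longrightarrow>
      2 * (entropy_gain M J X (boost a S \<delta>) - entropy_gain M J X a) \<le> \<delta> * explained M J X S a + 2 * (4 * K\<^sup>2 * \<delta>)\<^sup>2"
proof -
  define b where "b j = (if j \<in> S then \<delta> else 0)" for j
  have b: "\<forall>j\<in>J. 0 \<le> b j" using \<delta> by (auto simp: b_def)
  have bo: "boost a S \<delta> = (\<lambda>j. a j + b j)" by (simp add: boost_def b_def fun_eq_iff)
  have finS: "finite S" using S finJ by (rule finite_subset)
  have sum_b: "(\<Sum>j\<in>J. b j * f j) = \<delta> * (\<Sum>j\<in>S. f j)" for f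
  proof -
    have "(\<Sum>j\<in>J. b j * f j) = (\<Sum>j\<in>S. b j * f j)"
      using S finJ by (intro sum.mono_neutral_right) (auto simp: b_def)
    then show ?thesis by (simp add: b_def sum_distrib_left)
  qed
  define D where "D = (LINT v|(gau J a). evidence M J X a v * entropy_gain (posterior M J X a v) J X b)"
  have D: "entropy_gain M J X (boost a S \<delta>) - entropy_gain M J X a = D"
    unfolding bo D_def by (simp add: entropy_chain[OF a b])
  define Q where "Q v = (\<Sum>i\<in>S. (numer M J X a i v)\<^sup>2) / evidence M J X a v" for v
  have Qint: "integrable (gau J a) Q" unfolding Q_def by (rule explained_integrable[OF a S])
  have Q: "explained M J X S a = (LINT v|(gau J a). Q v)" by (simp add: explained_def Q_def)
  note int = entropy_chain_integrable[OF a b] Qint evidence_integrable[OF a]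
  have mean: "evidence M J X a v * ((\<Sum>j\<in>J. b j * (integral\<^sup>L (posterior M J X a v) (X j))\<^sup>2) / 2)
     = \<delta> * Q v / 2" for v
    using weighted_posterior_mean_sq[OF a S, of v "\<lambda>_. 1"] by (simp add: sum_b Q_def field_simps)
  have "\<delta> * explained M J X S a / 2 = (LINT v|(gau J a). \<delta> * Q v / 2)"
    unfolding Q by (simp only: integral_divide_zero integral_mult_right_zero)
  also have "\<dots> \<le> D"
    unfolding D_def
  proof (rule integral_mono)
    fix v
    interpret P: bounded_signal "posterior M J X a v" J X K by (rule posterior_signal[OF a])
    show "\<delta> * Q v / 2
       \<le> evidence M J X a v * entropy_gain (posterior M J X a v) J X b"
      unfolding mean[symmetric] using P.entropy_one_step_lower[OF b] evidence_pos[OF a, of v]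
      by (intro mult_left_mono) auto
  qed (use int in auto)
  finally show "\<delta> * explained M J X S a \<le> 2 * (entropy_gain M J X (boost a S \<delta>) - entropy_gain M J X a)"
    by (simp add: D)
  assume small: "4 * K\<^sup>2 * \<delta> \<le> 1"
  have "D \<le> (LINT v|(gau J a). \<delta> * Q v / 2 + (4 * K\<^sup>2 * \<delta>)\<^sup>2 * evidence M J X a v)"
    unfolding D_def
  proof (rule integral_mono)
    fix v
    interpret P: bounded_signal "posterior M J X a v" J X K by (rule posterior_signal[OF a])
    define m where "m j = P.expectation (X j)" for j
    have sq: "(\<Sum>j\<in>S. (X j th - m j)\<^sup>2) \<le> 4 * K\<^sup>2" for th
    proof -
      have "(p - q)\<^sup>2 \<le> 2 * p\<^sup>2 + 2 * q\<^sup>2" for p q :: real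
        using zero_le_power2[of "p + q"] by (simp add: power2_eq_square algebra_simps)
      then have "(\<Sum>j\<in>S. (X j th - m j)\<^sup>2) \<le> (\<Sum>j\<in>S. 2 * (X j th)\<^sup>2 + 2 * (m j)\<^sup>2)" by (rule sum_mono)
      also have "\<dots> \<le> (\<Sum>j\<in>J. 2 * (X j th)\<^sup>2 + 2 * (m j)\<^sup>2)" using S finJ by (intro sum_mono2) auto
      also have "\<dots> = 2 * (\<Sum>j\<in>J. (X j th)\<^sup>2) + 2 * (\<Sum>j\<in>J. (m j)\<^sup>2)" by (simp add: sum.distrib sum_distrib_left)
      also have "\<dots> \<le> 4 * K\<^sup>2" using XK[of th] P.mean_sq_le by (simp add: m_def)
      finally show ?thesis .
    qed
    have \<rho>: "\<bar>\<Sum>j\<in>J. b j * ((X j th - m j) * (X j th' - m j))\<bar> \<le> 4 * K\<^sup>2 * \<delta>" for th th'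
    proof -
      have pq: "\<bar>p * q\<bar> \<le> p\<^sup>2 / 2 + q\<^sup>2 / 2" for p q :: real
        using sum_squares_bound[of "\<bar>p\<bar>" "\<bar>q\<bar>"] by (simp add: abs_mult)
      have "\<bar>\<Sum>j\<in>S. (X j th - m j) * (X j th' - m j)\<bar> \<le> (\<Sum>j\<in>S. \<bar>(X j th - m j) * (X j th' - m j)\<bar>)"
        by (rule sum_abs)
      also have "\<dots> \<le> (\<Sum>j\<in>S. (X j th - m j)\<^sup>2 / 2 + (X j th' - m j)\<^sup>2 / 2)" by (intro sum_mono pq)
      also have "\<dots> \<le> 4 * K\<^sup>2" using sq[of th] sq[of th'] by (simp add: sum.distrib sum_divide_distrib[symmetric])
      finally have "\<delta> * \<bar>\<Sum>j\<in>S. (X j th - m j) * (X j th' - m j)\<bar> \<le> \<delta> * (4 * K\<^sup>2)" using \<delta> by (intro mult_left_mono)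
      then show ?thesis unfolding sum_b using \<delta> by (simp add: abs_mult mult_ac)
    qed
    have "entropy_gain (posterior M J X a v) J X b
       \<le> (\<Sum>j\<in>J. b j * (P.expectation (X j))\<^sup>2) / 2 + (4 * K\<^sup>2 * \<delta>)\<^sup>2"
      by (rule P.entropy_one_step_upper[OF b]) (use \<rho> small in \<open>auto simp: m_def\<close>)
    then have "evidence M J X a v * entropy_gain (posterior M J X a v) J X b
       \<le> evidence M J X a v * ((\<Sum>j\<in>J. b j * (P.expectation (X j))\<^sup>2) / 2 + (4 * K\<^sup>2 * \<delta>)\<^sup>2)"
      using evidence_pos[OF a, of v] by (intro mult_left_mono) auto
    then show "evidence M J X a v * entropy_gain (posterior M J X a v) J X b
       \<le> \<delta> * Q v / 2 + (4 * K\<^sup>2 * \<delta>)\<^sup>2 * evidence M J X a v"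
      unfolding distrib_left mean by (simp add: mult.commute)
  qed (use int in auto)
  also have "\<dots> = \<delta> * explained M J X S a / 2 + (4 * K\<^sup>2 * \<delta>)\<^sup>2"
    using int evidence_total[OF a] by (simp add: Q)
  finally show "2 * (entropy_gain M J X (boost a S \<delta>) - entropy_gain M J X a) \<le> \<delta> * explained M J X S a + 2 * (4 * K\<^sup>2 * \<delta>)\<^sup>2"
    by (simp add: D)
qed

end

section \<open>The entropy as a potential\<close>

text \<open>
  If the increments of \<open>G\<close> agree with \<open>f\<close> at the left end point up to a
  quadratic error, then \<open>f\<close> is Lipschitz and is the derivative of \<open>G\<close>.
\<close>

lemma increment_calculus:
  fixes f G :: "real \<Rightarrow> real"
  assumes mono: "\<And>s t. 0 \<le> s \<Longrightarrow> s \<le> t \<Longrightarrow> f s \<le> f t"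
    and low: "\<And>s t. 0 \<le> s \<Longrightarrow> s \<le> t \<Longrightarrow> (t - s) * f s \<le> G t - G s"
    and up: "\<And>s t. 0 \<le> s \<Longrightarrow> s \<le> t \<Longrightarrow> c * (t - s) \<le> 1 \<Longrightarrow> G t - G s \<le> (t - s) * f s + 2 * (c * (t - s))\<^sup>2"
    and c: "c \<ge> 0"
  shows increment_lipschitz: "\<And>s t. 0 \<le> s \<Longrightarrow> s \<le> t \<Longrightarrow> 2 * c * (t - s) \<le> 1 \<Longrightarrow> f t - f s \<le> 8 * c\<^sup>2 * (t - s)"
    and increment_has_integral: "\<And>s t. 0 \<le> s \<Longrightarrow> s \<le> t \<Longrightarrow> (f has_integral (G t - G s)) {s..t}"
    and increment_upper: "\<And>s t. 0 \<le> s \<Longrightarrow> s \<le> t \<Longrightarrow> G t - G s \<le> (t - s) * f t"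
proof -
  show lip: "f t - f s \<le> 8 * c\<^sup>2 * (t - s)" if st: "0 \<le> s" "s \<le> t" "2 * c * (t - s) \<le> 1" for s t
  proof (cases "s = t")
    case False
    then have d: "t - s > 0" using st by simp
    define r where "r = 2 * t - s"
    have r: "r - t = t - s" "r - s = 2 * (t - s)" by (auto simp: r_def)
    have "(r - t) * f t \<le> G r - G t" using st by (intro low) (auto simp: r_def)
    then have 1: "(t - s) * f t \<le> G r - G t" unfolding r .
    have "G r - G s \<le> (r - s) * f s + 2 * (c * (r - s))\<^sup>2" using st by (intro up) (auto simp: r_def algebra_simps)
    then have 2: "G r - G s \<le> 2 * ((t - s) * f s) + 2 * (c * (2 * (t - s)))\<^sup>2" unfolding r by (simp only: mult.assoc)
    have 3: "(t - s) * f s \<le> G t - G s" using st by (intro low)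
    from 1 2 3 have "(t - s) * f t \<le> (t - s) * f s + 2 * (c * (2 * (t - s)))\<^sup>2" by linarith
    then have "(t - s) * (f t - f s) \<le> (t - s) * (8 * c\<^sup>2 * (t - s))"
      by (simp add: power2_eq_square algebra_simps)
    then show ?thesis using d by simp
  qed simp
  have quad: "\<bar>G y - G x - (y - x) * f x\<bar> \<le> 10 * c\<^sup>2 * (y - x)\<^sup>2"
    if xy: "0 \<le> x" "0 \<le> y" "2 * c * \<bar>y - x\<bar> \<le> 1" for x y
  proof (cases "x \<le> y")
    case True
    have "c * (y - x) \<ge> 0" using True c by simp
    then have "c * (y - x) \<le> 1" using xy True by simp
    then have "G y - G x \<le> (y - x) * f x + 2 * (c * (y - x))\<^sup>2" using xy True by (intro up)
    moreover have "(y - x) * f x \<le> G y - G x" using xy True by (intro low)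
    moreover have "2 * (c * (y - x))\<^sup>2 \<le> 10 * c\<^sup>2 * (y - x)\<^sup>2" by (simp add: power_mult_distrib)
    ultimately show ?thesis by linarith
  next
    case False
    then have lt: "y \<le> x" by simp
    have "c * (x - y) \<ge> 0" using lt c by simp
    then have c1: "c * (x - y) \<le> 1" "2 * c * (x - y) \<le> 1" using xy lt by simp_all
    have 1: "G x - G y \<le> (x - y) * f y + 2 * (c * (x - y))\<^sup>2" using xy lt c1 by (intro up)
    have 2: "(x - y) * f y \<le> G x - G y" using xy lt by (intro low)
    have "f x - f y \<le> 8 * c\<^sup>2 * (x - y)" using xy lt c1 by (intro lip)
    then have 3: "(x - y) * (f x - f y) \<le> (x - y) * (8 * c\<^sup>2 * (x - y))" using lt by (intro mult_left_mono) auto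
    have 4: "(x - y) * f y \<le> (x - y) * f x" using mono[of y x] xy lt by (intro mult_left_mono) auto
    have 5: "2 * (c * (x - y))\<^sup>2 = 2 * c\<^sup>2 * (y - x)\<^sup>2" "(x - y) * (8 * c\<^sup>2 * (x - y)) = 8 * c\<^sup>2 * (y - x)\<^sup>2"
      by (auto simp: power2_eq_square algebra_simps)
    have 6: "G y - G x - (y - x) * f x = (x - y) * f x - (G x - G y)" by (simp add: algebra_simps)
    have 7: "c\<^sup>2 * (y - x)\<^sup>2 \<ge> 0" by simp
    from 1 2 3 4 5 6 7 show ?thesis by (simp add: abs_le_iff right_diff_distrib)
  qed
  have deriv: "(G has_real_derivative f x) (at x within {0..})" if x: "0 \<le> x" for x
  proof -
    have "((\<lambda>y. (G y - G x) / (y - x) - f x) \<longlongrightarrow> 0) (at x within {0..})"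
    proof (rule Lim_null_comparison)
      have "((\<lambda>y. 10 * c\<^sup>2 * \<bar>y - x\<bar>) \<longlongrightarrow> 10 * c\<^sup>2 * \<bar>x - x\<bar>) (at x within {0..})"
        by (intro tendsto_intros)
      then show "((\<lambda>y. 10 * c\<^sup>2 * \<bar>y - x\<bar>) \<longlongrightarrow> 0) (at x within {0..})" by simp
      define d where "d = 1 / (2 * c + 1)"
      have d: "d > 0" using c by (simp add: d_def)
      show "\<forall>\<^sub>F y in at x within {0..}. norm ((G y - G x) / (y - x) - f x) \<le> 10 * c\<^sup>2 * \<bar>y - x\<bar>"
        unfolding eventually_at
      proof (intro exI[of _ d] conjI ballI impI d)
        fix y assume y: "y \<in> {0..}" "y \<noteq> x \<and> dist y x < d"
        have "2 * c * \<bar>y - x\<bar> \<le> 2 * c * d" using y c by (intro mult_left_mono) (auto simp: dist_real_def)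
        also have "\<dots> \<le> 1" using c by (simp add: d_def)
        finally have q: "\<bar>G y - G x - (y - x) * f x\<bar> \<le> 10 * c\<^sup>2 * (y - x)\<^sup>2" using x y by (intro quad) auto
        have "(G y - G x) / (y - x) - f x = (G y - G x - (y - x) * f x) / (y - x)"
          using y by (simp add: diff_divide_distrib)
        then have "norm ((G y - G x) / (y - x) - f x) = \<bar>G y - G x - (y - x) * f x\<bar> / \<bar>y - x\<bar>"
          by (simp only: real_norm_def abs_divide)
        also have "\<dots> \<le> 10 * c\<^sup>2 * (y - x)\<^sup>2 / \<bar>y - x\<bar>" using q by (intro divide_right_mono) auto
        also have "\<dots> = 10 * c\<^sup>2 * (\<bar>y - x\<bar> * \<bar>y - x\<bar>) / \<bar>y - x\<bar>" by (simp add: power2_eq_square)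
        also have "\<dots> = 10 * c\<^sup>2 * \<bar>y - x\<bar>"
        proof -
          have "10 * c\<^sup>2 * (p * p) / p = 10 * c\<^sup>2 * p" if "p \<noteq> 0" for p :: real using that by simp
          then show ?thesis using y by (metis abs_eq_0 eq_iff_diff_eq_0)
        qed
        finally show "norm ((G y - G x) / (y - x) - f x) \<le> 10 * c\<^sup>2 * \<bar>y - x\<bar>" .
      qed
    qed
    then show ?thesis by (simp add: has_field_derivative_iff LIM_zero_iff)
  qed
  show int: "(f has_integral (G t - G s)) {s..t}" if st: "0 \<le> s" "s \<le> t" for s t
  proof (rule fundamental_theorem_of_calculus[OF st(2)])
    fix x assume "x \<in> {s..t}"
    then have "(G has_real_derivative f x) (at x within {s..t})"
      using st by (intro DERIV_subset[OF deriv]) auto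
    then show "(G has_vector_derivative f x) (at x within {s..t})"
      by (simp add: has_real_derivative_iff_has_vector_derivative)
  qed
  show "G t - G s \<le> (t - s) * f t" if st: "0 \<le> s" "s \<le> t" for s t
  proof (rule has_integral_le[OF int[OF st]])
    show "((\<lambda>_. f t) has_integral (t - s) * f t) {s..t}"
      using has_integral_const_real[of "f t" s t] st by simp
  qed (use st mono in auto)
qed

text \<open>
  All coordinates in \<open>T\<close> are observed with the same signal-to-noise ratio, the others not
  at all.
\<close>

definition level :: "'i set \<Rightarrow> real \<Rightarrow> 'i \<Rightarrow> real" where
  "level T \<beta> j = (if j \<in> T then \<beta> else 0)"

context bounded_signal
begin

lemma boost_boost: "boost (boost a S s) S t = boost a S (s + t)"
  by (auto simp: boost_def fun_eq_iff)

context
  fixes a :: "'i \<Rightarrow> real" and S :: "'i set"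
  assumes a: "\<forall>j\<in>J. 0 \<le> a j" and S: "S \<subseteq> J"
begin

lemma boost_nonneg: "0 \<le> s \<Longrightarrow> \<forall>j\<in>J. 0 \<le> boost a S s j"
  using a by (auto simp: boost_def)

lemma explained_boost_mono:
  assumes "0 \<le> s" "s \<le> t" "T \<subseteq> J"
  shows "explained M J X T (boost a S s) \<le> explained M J X T (boost a S t)"
proof -
  have "explained M J X T (boost a S s) \<le> explained M J X T (\<lambda>j. boost a S s j + level S (t - s) j)"
    using assms by (intro explained_mono boost_nonneg) (auto simp: level_def)
  also have "(\<lambda>j. boost a S s j + level S (t - s) j) = boost a S t"
    by (auto simp: boost_def level_def fun_eq_iff)
  finally show ?thesis .
qed

lemma
  shows explained_lipschitz: "\<And>s t. 0 \<le> s \<Longrightarrow> s \<le> t \<Longrightarrow> 8 * K\<^sup>2 * (t - s) \<le> 1 \<Longrightarrow>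
      explained M J X S (boost a S t) - explained M J X S (boost a S s) \<le> 128 * K ^ 4 * (t - s)"
    and entropy_has_integral: "\<And>s t. 0 \<le> s \<Longrightarrow> s \<le> t \<Longrightarrow>
      ((\<lambda>\<beta>. explained M J X S (boost a S \<beta>)) has_integral
        (2 * entropy_gain M J X (boost a S t) - 2 * entropy_gain M J X (boost a S s))) {s..t}"
    and entropy_upper: "\<And>s t. 0 \<le> s \<Longrightarrow> s \<le> t \<Longrightarrow>
      2 * entropy_gain M J X (boost a S t) - 2 * entropy_gain M J X (boost a S s) \<le> (t - s) * explained M J X S (boost a S t)"
    and entropy_lower: "\<And>s t. 0 \<le> s \<Longrightarrow> s \<le> t \<Longrightarrow>
      (t - s) * explained M J X S (boost a S s) \<le> 2 * entropy_gain M J X (boost a S t) - 2 * entropy_gain M J X (boost a S s)"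
proof -
  have step: "boost (boost a S s) S (t - s) = boost a S t" for s t by (simp add: boost_boost)
  have mono: "explained M J X S (boost a S s) \<le> explained M J X S (boost a S t)" if "0 \<le> s" "s \<le> t" for s t
    using that S by (intro explained_boost_mono)
  have low: "(t - s) * explained M J X S (boost a S s) \<le> 2 * entropy_gain M J X (boost a S t) - 2 * entropy_gain M J X (boost a S s)"
    if "0 \<le> s" "s \<le> t" for s t
    using entropy_increment(1)[OF boost_nonneg[OF that(1)] S, of "t - s"] that by (simp add: step)
  have up: "2 * entropy_gain M J X (boost a S t) - 2 * entropy_gain M J X (boost a S s)
      \<le> (t - s) * explained M J X S (boost a S s) + 2 * (4 * K\<^sup>2 * (t - s))\<^sup>2"
    if "0 \<le> s" "s \<le> t" "4 * K\<^sup>2 * (t - s) \<le> 1" for s t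
    using entropy_increment(2)[OF boost_nonneg[OF that(1)] S, of "t - s"] that by (simp add: step)
  note calc = increment_calculus[of "\<lambda>s. explained M J X S (boost a S s)" "\<lambda>s. 2 * entropy_gain M J X (boost a S s)" "4 * K\<^sup>2",
      OF mono low up]
  show "\<And>s t. 0 \<le> s \<Longrightarrow> s \<le> t \<Longrightarrow> 8 * K\<^sup>2 * (t - s) \<le> 1 \<Longrightarrow>
      explained M J X S (boost a S t) - explained M J X S (boost a S s) \<le> 128 * K ^ 4 * (t - s)"
    using calc(1) by (simp add: power_mult_distrib)
  show "\<And>s t. 0 \<le> s \<Longrightarrow> s \<le> t \<Longrightarrow>
      ((\<lambda>\<beta>. explained M J X S (boost a S \<beta>)) has_integral
        (2 * entropy_gain M J X (boost a S t) - 2 * entropy_gain M J X (boost a S s))) {s..t}"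
    using calc(2) by simp
  show "\<And>s t. 0 \<le> s \<Longrightarrow> s \<le> t \<Longrightarrow>
      2 * entropy_gain M J X (boost a S t) - 2 * entropy_gain M J X (boost a S s) \<le> (t - s) * explained M J X S (boost a S t)"
    using calc(3) by simp
  show "\<And>s t. 0 \<le> s \<Longrightarrow> s \<le> t \<Longrightarrow>
      (t - s) * explained M J X S (boost a S s) \<le> 2 * entropy_gain M J X (boost a S t) - 2 * entropy_gain M J X (boost a S s)"
    by (rule low)
qed

end

lemma level_eq_boost: "level T \<beta> = boost (\<lambda>_. 0) T \<beta>"
  by (simp add: level_def boost_def fun_eq_iff)

text \<open>
  The entropy is a potential, so its total increment does not depend on the path in the space of
  signal-to-noise ratios. Raising all coordinates simultaneously from \<open>0\<close> to
  \<open>\<gamma>\<close> gives the integral; raising the blocks one after the other gives a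
  telescoping sum. In the second path the increment of a block is between \<open>\<gamma>\<close>
  times its explained power at the beginning and at the end of its turn, by monotonicity. This is
  where causal and noncausal estimation meet: the blocks already raised are the past.
\<close>

lemma blocks_sandwich:
  fixes B :: "nat \<Rightarrow> 'i set"
  assumes disj: "\<And>i k. i < k \<Longrightarrow> k < n \<Longrightarrow> B i \<inter> B k = {}" and J: "(\<Union>k<n. B k) = J" and \<gamma>: "0 \<le> \<gamma>"
  shows "(\<lambda>\<beta>. explained M J X J (level J \<beta>)) integrable_on {0..\<gamma>}"
    and "\<gamma> * (\<Sum>k<n. explained M J X (B k) (level (\<Union>i<k. B i) \<gamma>)) \<le> integral {0..\<gamma>} (\<lambda>\<beta>. explained M J X J (level J \<beta>))"
    and "integral {0..\<gamma>} (\<lambda>\<beta>. explained M J X J (level J \<beta>)) \<le> \<gamma> * (\<Sum>k<n. explained M J X (B k) (level (\<Union>i\<le>k. B i) \<gamma>))"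
proof -
  define L where "L k = level (\<Union>i<k. B i) \<gamma>" for k
  define P where "P k = 2 * entropy_gain M J X (L k)" for k
  have L: "L (Suc k) = boost (L k) (B k) \<gamma>" "L k = boost (L k) (B k) 0" if "k < n" for k
    using disj[OF _ that] by (auto simp: L_def level_def boost_def fun_eq_iff lessThan_Suc)
  have Lnn: "\<forall>j\<in>J. 0 \<le> L k j" for k using \<gamma> by (auto simp: L_def level_def)
  have BJ: "B k \<subseteq> J" if "k < n" for k using J that by auto
  have int: "((\<lambda>\<beta>. explained M J X J (level J \<beta>)) has_integral (P n - P 0)) {0..\<gamma>}"
  proof -
    have "L n = boost (\<lambda>_. 0) J \<gamma>" "L 0 = boost (\<lambda>_. 0) J 0"
      by (auto simp: L_def J level_eq_boost[symmetric]) (auto simp: level_def fun_eq_iff)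
    then show ?thesis
      using entropy_has_integral[of "\<lambda>_. 0" J 0 \<gamma>] \<gamma> by (simp add: P_def level_eq_boost)
  qed
  then show "(\<lambda>\<beta>. explained M J X J (level J \<beta>)) integrable_on {0..\<gamma>}" by blast
  have tele: "P n - P 0 = (\<Sum>k<n. P (Suc k) - P k)" by (simp add: sum_lessThan_telescope)
  have "\<gamma> * (\<Sum>k<n. explained M J X (B k) (L k)) \<le> P n - P 0"
    unfolding tele sum_distrib_left
  proof (rule sum_mono)
    fix k assume "k \<in> {..<n}"
    then have k: "k < n" by simp
    show "\<gamma> * explained M J X (B k) (L k) \<le> P (Suc k) - P k"
      using entropy_lower[OF Lnn BJ[OF k], of 0 \<gamma> k] \<gamma> by (simp add: P_def L(1)[OF k] L(2)[OF k, symmetric])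
  qed
  then show "\<gamma> * (\<Sum>k<n. explained M J X (B k) (level (\<Union>i<k. B i) \<gamma>)) \<le> integral {0..\<gamma>} (\<lambda>\<beta>. explained M J X J (level J \<beta>))"
    using integral_unique[OF int] by (simp add: L_def)
  have "P n - P 0 \<le> \<gamma> * (\<Sum>k<n. explained M J X (B k) (L (Suc k)))"
    unfolding tele sum_distrib_left
  proof (rule sum_mono)
    fix k assume "k \<in> {..<n}"
    then have k: "k < n" by simp
    show "P (Suc k) - P k \<le> \<gamma> * explained M J X (B k) (L (Suc k))"
      using entropy_upper[OF Lnn BJ[OF k], of 0 \<gamma> k] \<gamma> by (simp add: P_def L(1)[OF k] L(2)[OF k, symmetric])
  qed
  then show "integral {0..\<gamma>} (\<lambda>\<beta>. explained M J X J (level J \<beta>)) \<le> \<gamma> * (\<Sum>k<n. explained M J X (B k) (level (\<Union>i\<le>k. B i) \<gamma>))"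
    using integral_unique[OF int] by (simp add: L_def lessThan_Suc_atMost)
qed

end

section \<open>Truncation of an unbounded signal\<close>

text \<open>
  Removing the part of the sample space where the signal is large changes the explained power by at
  most the second moment \<open>T\<close> of the removed part, whatever the number of coordinates. The
  quotient is a supremum, \<open>\<bar>N\<bar>\<^sup>2 / Z = sup\<^sub>w (2 w \<bullet> N -
  \<bar>w\<bar>\<^sup>2 Z)\<close>, of expressions that are additive over the parts of the sample
  space. Inserting the optimal \<open>w\<close> of the one quotient into the other gives each of the
  two bounds; on \<open>D\<close> the optimal \<open>w\<close> is a conditional mean, hence of norm at
  most \<open>K\<close>.
\<close>

lemma quotient_perturbation:
  fixes X :: "'i \<Rightarrow> 'a \<Rightarrow> real" and L R :: "'a \<Rightarrow> real"
  assumes S: "finite S" and XM: "\<And>i. i \<in> S \<Longrightarrow> X i \<in> borel_measurable M"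
    and D [measurable]: "D \<in> sets M"
    and XR: "\<And>th. (\<Sum>i\<in>S. (X i th)\<^sup>2) \<le> (R th)\<^sup>2"
    and RD: "\<And>th. th \<in> D \<Longrightarrow> (R th)\<^sup>2 \<le> K\<^sup>2" and RDc: "\<And>th. th \<in> space M \<Longrightarrow> th \<notin> D \<Longrightarrow> K\<^sup>2 \<le> (R th)\<^sup>2"
    and L: "integrable M L" and RL: "integrable M (\<lambda>th. (R th)\<^sup>2 * L th)" and L0: "\<And>th. 0 \<le> L th"
    and Zd: "0 < (LINT th|M. indicator D th * L th)"
  defines "T \<equiv> (LINT th|M. indicator (- D) th * ((R th)\<^sup>2 * L th))"
    and "q \<equiv> (\<Sum>i\<in>S. (LINT th|M. X i th * L th)\<^sup>2) / (LINT th|M. L th)"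
    and "qd \<equiv> (\<Sum>i\<in>S. (LINT th|M. indicator D th * (X i th * L th))\<^sup>2) / (LINT th|M. indicator D th * L th)"
  shows "q \<le> qd + T" "qd - 3 * T \<le> q"
proof -
  note [measurable] = XM borel_measurable_integrable[OF L]
  define N where "N i = (LINT th|M. X i th * L th)" for i
  define Nd where "Nd i = (LINT th|M. indicator D th * (X i th * L th))" for i
  define Nc where "Nc i = (LINT th|M. indicator (- D) th * (X i th * L th))" for i
  define Z where "Z = (LINT th|M. L th)"
  define Zd' where "Zd' = (LINT th|M. indicator D th * L th)"
  define Zc where "Zc = (LINT th|M. indicator (- D) th * L th)"
  have part: "integrable M (\<lambda>th. indicator D th * f th)" "integrable M (\<lambda>th. indicator (- D) th * f th)"
    "(LINT th|M. f th) = (LINT th|M. indicator D th * f th) + (LINT th|M. indicator (- D) th * f th)"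
    if f: "integrable M f" for f :: "'a \<Rightarrow> real"
  proof -
    show 1: "integrable M (\<lambda>th. indicator D th * f th)"
      using integrable_mult_indicator[OF D f] by simp
    have *: "indicator (- D) th * f th = f th - indicator D th * f th" for th by (simp add: indicator_def)
    show 2: "integrable M (\<lambda>th. indicator (- D) th * f th)" unfolding * using f 1 by simp
    show "(LINT th|M. f th) = (LINT th|M. indicator D th * f th) + (LINT th|M. indicator (- D) th * f th)"
      unfolding * using f 1 by simp
  qed
  have X2: "(X i th)\<^sup>2 \<le> (R th)\<^sup>2" if "i \<in> S" for i th
    using XR[of th] member_le_sum[OF that, of "\<lambda>i. (X i th)\<^sup>2"] S by simp
  have XL: "integrable M (\<lambda>th. X i th * L th)" if i: "i \<in> S" for i
  proof (rule lint_bound)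
    show "integrable M (\<lambda>th. L th + (R th)\<^sup>2 * L th)" using L RL by simp
    show "(\<lambda>th. X i th * L th) \<in> borel_measurable M" using i by measurable
    show "AE th in M. norm (X i th * L th) \<le> norm (L th + (R th)\<^sup>2 * L th)"
    proof (rule AE_I2)
      fix th
      have "\<bar>X i th\<bar> \<le> 1 + (X i th)\<^sup>2"
      proof -
        have "0 \<le> (\<bar>X i th\<bar> - 1)\<^sup>2" by simp
        then show ?thesis by (simp add: power2_diff)
      qed
      also have "\<dots> \<le> 1 + (R th)\<^sup>2" using X2[OF i] by simp
      finally have "\<bar>X i th\<bar> * L th \<le> (1 + (R th)\<^sup>2) * L th" using L0 by (intro mult_right_mono)
      moreover have "0 \<le> L th + (R th)\<^sup>2 * L th" using L0 by simp
      ultimately show "norm (X i th * L th) \<le> norm (L th + (R th)\<^sup>2 * L th)"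
        using L0 by (simp add: abs_mult distrib_right)
    qed
  qed
  have Zsplit: "Z = Zd' + Zc" unfolding Z_def Zd'_def Zc_def by (rule part(3)[OF L])
  have Nsplit: "N i = Nd i + Nc i" if "i \<in> S" for i
    unfolding N_def Nd_def Nc_def by (rule part(3)[OF XL[OF that]])
  have Zd0: "0 < Zd'" using Zd by (simp add: Zd'_def)
  have Zc0: "0 \<le> Zc" unfolding Zc_def using L0 by (intro lint_nonneg) simp
  have Z0: "0 < Z" using Zsplit Zd0 Zc0 by simp
  have lin: "(\<Sum>i\<in>S. 2 * w i * Nc i) - (\<Sum>i\<in>S. (w i)\<^sup>2) * Zc
     = (LINT th|M. indicator (- D) th * (((\<Sum>i\<in>S. 2 * w i * X i th) - (\<Sum>i\<in>S. (w i)\<^sup>2)) * L th))"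
    "integrable M (\<lambda>th. indicator (- D) th * (((\<Sum>i\<in>S. 2 * w i * X i th) - (\<Sum>i\<in>S. (w i)\<^sup>2)) * L th))" for w
  proof -
    have *: "indicator (- D) th * (((\<Sum>i\<in>S. 2 * w i * X i th) - (\<Sum>i\<in>S. (w i)\<^sup>2)) * L th)
       = (\<Sum>i\<in>S. 2 * w i * (indicator (- D) th * (X i th * L th))) - (\<Sum>i\<in>S. (w i)\<^sup>2) * (indicator (- D) th * L th)" for th
      by (cases "th \<in> D") (simp_all add: left_diff_distrib sum_distrib_right mult.assoc)
    show "integrable M (\<lambda>th. indicator (- D) th * (((\<Sum>i\<in>S. 2 * w i * X i th) - (\<Sum>i\<in>S. (w i)\<^sup>2)) * L th))"
      unfolding * using part(2)[OF XL] part(2)[OF L] by auto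
    show "(\<Sum>i\<in>S. 2 * w i * Nc i) - (\<Sum>i\<in>S. (w i)\<^sup>2) * Zc
     = (LINT th|M. indicator (- D) th * (((\<Sum>i\<in>S. 2 * w i * X i th) - (\<Sum>i\<in>S. (w i)\<^sup>2)) * L th))"
      unfolding * using part(2)[OF XL] part(2)[OF L] by (simp add: Nc_def Zc_def)
  qed
  note RLc = part(2)[OF RL]
  have cross: "\<bar>\<Sum>i\<in>S. 2 * w i * X i th\<bar> \<le> (\<Sum>i\<in>S. (w i)\<^sup>2) + (R th)\<^sup>2" for w th
  proof -
    have "\<bar>\<Sum>i\<in>S. 2 * w i * X i th\<bar> \<le> (\<Sum>i\<in>S. \<bar>2 * w i * X i th\<bar>)" by (rule sum_abs)
    also have "\<dots> \<le> (\<Sum>i\<in>S. (w i)\<^sup>2 + (X i th)\<^sup>2)"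
    proof (rule sum_mono)
      fix i show "\<bar>2 * w i * X i th\<bar> \<le> (w i)\<^sup>2 + (X i th)\<^sup>2"
        using sum_squares_bound[of "\<bar>w i\<bar>" "\<bar>X i th\<bar>"] by (simp add: abs_mult)
    qed
    also have "\<dots> \<le> (\<Sum>i\<in>S. (w i)\<^sup>2) + (R th)\<^sup>2" using XR[of th] by (simp add: sum.distrib)
    finally show ?thesis .
  qed
  have C1: "(\<Sum>i\<in>S. 2 * w i * Nc i) - (\<Sum>i\<in>S. (w i)\<^sup>2) * Zc \<le> T" for w
    unfolding lin(1) T_def
  proof (rule integral_mono[OF lin(2) RLc])
    fix th
    have "(\<Sum>i\<in>S. 2 * w i * X i th) - (\<Sum>i\<in>S. (w i)\<^sup>2) \<le> (R th)\<^sup>2" using cross[of w th] by linarith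
    then have "((\<Sum>i\<in>S. 2 * w i * X i th) - (\<Sum>i\<in>S. (w i)\<^sup>2)) * L th \<le> (R th)\<^sup>2 * L th" using L0 by (intro mult_right_mono)
    then show "indicator (- D) th * (((\<Sum>i\<in>S. 2 * w i * X i th) - (\<Sum>i\<in>S. (w i)\<^sup>2)) * L th)
      \<le> indicator (- D) th * ((R th)\<^sup>2 * L th)" by (intro mult_left_mono) auto
  qed
  have C2: "- 3 * T \<le> (\<Sum>i\<in>S. 2 * w i * Nc i) - (\<Sum>i\<in>S. (w i)\<^sup>2) * Zc" if w: "(\<Sum>i\<in>S. (w i)\<^sup>2) \<le> K\<^sup>2" for w
  proof -
    have "- 3 * T = (LINT th|M. - 3 * (indicator (- D) th * ((R th)\<^sup>2 * L th)))" unfolding T_def by simp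
    also have "\<dots> \<le> (LINT th|M. indicator (- D) th * (((\<Sum>i\<in>S. 2 * w i * X i th) - (\<Sum>i\<in>S. (w i)\<^sup>2)) * L th))"
    proof (rule integral_mono[OF _ lin(2)])
      show "integrable M (\<lambda>th. - 3 * (indicator (- D) th * ((R th)\<^sup>2 * L th)))" using RLc by simp
      fix th assume th: "th \<in> space M"
      show "- 3 * (indicator (- D) th * ((R th)\<^sup>2 * L th)) \<le> indicator (- D) th * (((\<Sum>i\<in>S. 2 * w i * X i th) - (\<Sum>i\<in>S. (w i)\<^sup>2)) * L th)"
      proof (cases "th \<in> D")
        case False
        have "- 3 * (R th)\<^sup>2 \<le> (\<Sum>i\<in>S. 2 * w i * X i th) - (\<Sum>i\<in>S. (w i)\<^sup>2)"
          using cross[of w th] w RDc[OF th False] by linarith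
        then have "- 3 * (R th)\<^sup>2 * L th \<le> ((\<Sum>i\<in>S. 2 * w i * X i th) - (\<Sum>i\<in>S. (w i)\<^sup>2)) * L th"
          using L0 by (intro mult_right_mono)
        then show ?thesis using False by simp
      qed simp
    qed
    finally show ?thesis unfolding lin(1) .
  qed
  have dual: "(\<Sum>i\<in>S. 2 * w i * n i) - (\<Sum>i\<in>S. (w i)\<^sup>2) * z \<le> (\<Sum>i\<in>S. (n i)\<^sup>2) / z" if z: "0 < z" for w n :: "'i \<Rightarrow> real" and z
  proof -
    have "2 * w i * n i - (w i)\<^sup>2 * z \<le> (n i)\<^sup>2 / z" for i
    proof -
      have "0 \<le> (n i - w i * z)\<^sup>2 / z" using z by simp
      also have "\<dots> = (n i)\<^sup>2 / z - 2 * w i * n i + (w i)\<^sup>2 * z" using z by (simp add: power2_eq_square field_simps)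
      finally show ?thesis by simp
    qed
    then have "(\<Sum>i\<in>S. 2 * w i * n i - (w i)\<^sup>2 * z) \<le> (\<Sum>i\<in>S. (n i)\<^sup>2 / z)" by (rule sum_mono)
    then show ?thesis by (simp add: sum_subtractf sum_distrib_right sum_divide_distrib)
  qed
  have attain: "(\<Sum>i\<in>S. 2 * (n i / z) * n i) - (\<Sum>i\<in>S. (n i / z)\<^sup>2) * z = (\<Sum>i\<in>S. (n i)\<^sup>2) / z" if z: "0 < z" for n :: "'i \<Rightarrow> real" and z
  proof -
    have "2 * (n i / z) * n i - (n i / z)\<^sup>2 * z = (n i)\<^sup>2 / z" for i using z by (simp add: power2_eq_square field_simps)
    then have "(\<Sum>i\<in>S. 2 * (n i / z) * n i - (n i / z)\<^sup>2 * z) = (\<Sum>i\<in>S. (n i)\<^sup>2 / z)" by simp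
    then show ?thesis by (simp add: sum_subtractf sum_distrib_right sum_divide_distrib)
  qed
  have split: "(\<Sum>i\<in>S. 2 * w i * N i) - (\<Sum>i\<in>S. (w i)\<^sup>2) * Z
     = ((\<Sum>i\<in>S. 2 * w i * Nd i) - (\<Sum>i\<in>S. (w i)\<^sup>2) * Zd') + ((\<Sum>i\<in>S. 2 * w i * Nc i) - (\<Sum>i\<in>S. (w i)\<^sup>2) * Zc)" for w
  proof -
    have "(\<Sum>i\<in>S. 2 * w i * N i) = (\<Sum>i\<in>S. 2 * w i * Nd i) + (\<Sum>i\<in>S. 2 * w i * Nc i)"
      unfolding sum.distrib[symmetric] by (intro sum.cong refl) (simp add: Nsplit algebra_simps)
    then show ?thesis by (simp add: Zsplit algebra_simps)
  qed
  have q: "q = (\<Sum>i\<in>S. (N i)\<^sup>2) / Z" and qd: "qd = (\<Sum>i\<in>S. (Nd i)\<^sup>2) / Zd'"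
    by (simp_all add: q_def qd_def N_def Nd_def Z_def Zd'_def)
  show "q \<le> qd + T"
    using attain[OF Z0, of N] split[of "\<lambda>i. N i / Z"] dual[OF Zd0, of "\<lambda>i. N i / Z" Nd] C1[of "\<lambda>i. N i / Z"]
    unfolding q qd by linarith
  define w where "w i = Nd i / Zd'" for i
  have "(\<Sum>i\<in>S. (w i)\<^sup>2) \<le> K\<^sup>2"
  proof -
    let ?W = "\<Sum>i\<in>S. (w i)\<^sup>2"
    have "2 * ?W * Zd' = (\<Sum>i\<in>S. 2 * w i * Nd i)"
      using Zd0 by (simp add: w_def power2_eq_square sum_distrib_right sum_distrib_left mult_ac)
    also have "\<dots> = (LINT th|M. (\<Sum>i\<in>S. 2 * w i * (indicator D th * (X i th * L th))))"
      using part(1)[OF XL] by (simp add: Nd_def)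
    also have "\<dots> \<le> (LINT th|M. (?W + K\<^sup>2) * (indicator D th * L th))"
    proof (rule integral_mono)
      show "integrable M (\<lambda>th. \<Sum>i\<in>S. 2 * w i * (indicator D th * (X i th * L th)))" using part(1)[OF XL] by auto
      show "integrable M (\<lambda>th. (?W + K\<^sup>2) * (indicator D th * L th))" using part(1)[OF L] by simp
      fix th
      have eq: "(\<Sum>i\<in>S. 2 * w i * (indicator D th * (X i th * L th))) = (\<Sum>i\<in>S. 2 * w i * X i th) * (indicator D th * L th)"
        unfolding sum_distrib_right by (intro sum.cong refl) (simp only: mult_ac)
      show "(\<Sum>i\<in>S. 2 * w i * (indicator D th * (X i th * L th))) \<le> (?W + K\<^sup>2) * (indicator D th * L th)"
      proof (cases "th \<in> D")
        case True
        have "(\<Sum>i\<in>S. 2 * w i * X i th) \<le> ?W + K\<^sup>2" using cross[of w th] RD[OF True] by linarith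
        then show ?thesis unfolding eq using L0[of th] by (intro mult_right_mono) auto
      qed simp
    qed
    also have "\<dots> = (?W + K\<^sup>2) * Zd'" by (simp add: Zd'_def)
    finally show ?thesis using Zd0 by simp
  qed
  then show "qd - 3 * T \<le> q"
    using attain[OF Zd0, of Nd] split[of w] dual[OF Z0, of w N] C2[of w]
    unfolding q qd w_def[symmetric] by linarith
qed

text \<open>
  The signal is now only square integrable. The majorant \<open>R\<close> will be the norm of the
  whole Hilbert space valued signal, so that it is common to all finite systems of coordinates.
\<close>

locale square_signal = prob_space M for M :: "'a measure" +
  fixes J :: "'i set" and X :: "'i \<Rightarrow> 'a \<Rightarrow> real" and R :: "'a \<Rightarrow> real"
  assumes finJ: "finite J"
    and XM [measurable]: "\<And>j. j \<in> J \<Longrightarrow> X j \<in> borel_measurable M"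
    and RM [measurable]: "R \<in> borel_measurable M"
    and R0: "\<And>th. 0 \<le> R th"
    and R2: "integrable M (\<lambda>th. (R th)\<^sup>2)"
    and XR: "\<And>th. (\<Sum>j\<in>J. (X j th)\<^sup>2) \<le> (R th)\<^sup>2"
begin

lemma X_integrable: "i \<in> J \<Longrightarrow> integrable M (X i)" "i \<in> J \<Longrightarrow> integrable M (\<lambda>th. (X i th)\<^sup>2)"
proof -
  assume i: "i \<in> J"
  show 1: "integrable M (\<lambda>th. (X i th)\<^sup>2)"
  proof (rule lint_bound[OF R2])
    show "AE th in M. norm ((X i th)\<^sup>2) \<le> norm ((R th)\<^sup>2)"
    proof (rule AE_I2)
      fix th
      have "(X i th)\<^sup>2 \<le> (\<Sum>j\<in>J. (X j th)\<^sup>2)" using i finJ by (intro member_le_sum) auto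
      then show "norm ((X i th)\<^sup>2) \<le> norm ((R th)\<^sup>2)" using XR[of th] by simp
    qed
  qed (use i in measurable)
  show "integrable M (X i)" by (rule square_integrable_imp_integrable[OF XM[OF i] 1])
qed

lemma lik_pair_measurable [measurable]: "(\<lambda>p. lik J X a (fst p) (snd p)) \<in> borel_measurable (coords J \<Otimes>\<^sub>M M)"
  by (rule lik_measurable[OF XM])

lemma lik_slice_measurable [measurable]: "lik J X a v \<in> borel_measurable M"
  unfolding lik_def by measurable

context
  fixes a :: "'i \<Rightarrow> real"
  assumes a: "\<forall>j\<in>J. 0 \<le> a j"
begin

lemma lik_total: "integrable (gau J a) (\<lambda>v. lik J X a v th)" "(LINT v|(gau J a). lik J X a v th) = 1"
proof -
  show 1: "(LINT v|(gau J a). lik J X a v th) = 1" unfolding lik_def by (rule gau_tilt_one[OF finJ a])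
  show "integrable (gau J a) (\<lambda>v. lik J X a v th)" using 1 not_integrable_integral_eq by fastforce
qed

lemma weighted_lik_pair:
  fixes f :: "'a \<Rightarrow> real" and h :: "('i \<Rightarrow> real) \<Rightarrow> real"
  assumes f: "integrable M f" and [measurable]: "h \<in> borel_measurable (coords J)" and h: "\<And>v. \<bar>h v\<bar> \<le> C"
  shows "AE v in gau J a. integrable M (\<lambda>th. h v * (f th * lik J X a v th))"
    and "integrable (gau J a) (\<lambda>v. \<integral>th. h v * (f th * lik J X a v th) \<partial>M)"
    and "(LINT v|(gau J a). (LINT th|M. h v * (f th * lik J X a v th))) = (LINT th|M. (LINT v|(gau J a). h v * (f th * lik J X a v th)))"
proof -
  interpret G: prob_space "gau J a" by (rule prob_space_gau)
  interpret P: pair_prob_space M "gau J a" ..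
  note [measurable] = borel_measurable_integrable[OF f]
  have likm [measurable]: "(\<lambda>p. lik J X a (snd p) (fst p)) \<in> borel_measurable (M \<Otimes>\<^sub>M gau J a)"
    unfolding lik_def by measurable
  have likv [measurable]: "(\<lambda>v. lik J X a v th) \<in> borel_measurable (gau J a)" for th unfolding lik_def by measurable
  have inner: "integrable (gau J a) (\<lambda>v. h v * (f th * lik J X a v th))" for th
  proof (rule lint_bound)
    show "integrable (gau J a) (\<lambda>v. C * \<bar>f th\<bar> * lik J X a v th)" using lik_total(1) by simp
    have "\<bar>h v * (f th * lik J X a v th)\<bar> \<le> \<bar>C * \<bar>f th\<bar> * lik J X a v th\<bar>" for v
      unfolding abs_mult mult.assoc using h[of v] by (intro mult_mono) auto
    then show "AE v in gau J a. norm (h v * (f th * lik J X a v th)) \<le> norm (C * \<bar>f th\<bar> * lik J X a v th)" by simp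
  qed measurable
  have "integrable (M \<Otimes>\<^sub>M gau J a) (\<lambda>p. h (snd p) * (f (fst p) * lik J X a (snd p) (fst p)))"
  proof (rule P.Fubini_integrable)
    show "integrable M (\<lambda>th. \<integral>v. norm (h (snd (th, v)) * (f (fst (th, v)) * lik J X a (snd (th, v)) (fst (th, v)))) \<partial>gau J a)"
    proof (rule lint_bound)
      show "integrable M (\<lambda>th. C * \<bar>f th\<bar>)" using f by simp
      have "(LINT v|(gau J a). \<bar>h v * (f th * lik J X a v th)\<bar>) \<le> (LINT v|(gau J a). C * \<bar>f th\<bar> * lik J X a v th)" for th
      proof (rule integral_mono)
        show "\<bar>h v * (f th * lik J X a v th)\<bar> \<le> C * \<bar>f th\<bar> * lik J X a v th" for v
          unfolding abs_mult mult.assoc using h[of v] lik_pos[of J X a v th] by (simp add: abs_of_pos mult_right_mono)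
      qed (use inner[of th] lik_total(1) in auto)
      then have "(LINT v|(gau J a). \<bar>h v * (f th * lik J X a v th)\<bar>) \<le> C * \<bar>f th\<bar>" for th by (simp add: lik_total(2))
      then have "(LINT v|(gau J a). \<bar>h v * (f th * lik J X a v th)\<bar>) \<le> \<bar>C * \<bar>f th\<bar>\<bar>" for th
        by (rule order_trans[OF _ abs_ge_self])
      moreover have "0 \<le> (LINT v|(gau J a). \<bar>h v * (f th * lik J X a v th)\<bar>)" for th
        by (intro lint_nonneg) auto
      ultimately show "AE th in M. norm (LINT v|(gau J a). norm (h (snd (th, v)) * (f (fst (th, v)) * lik J X a (snd (th, v)) (fst (th, v))))) \<le> norm (C * \<bar>f th\<bar>)"
        by (intro AE_I2) auto
    qed measurable
  qed (use inner in auto)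
  then have int: "integrable (M \<Otimes>\<^sub>M gau J a) (\<lambda>(th, v). h v * (f th * lik J X a v th))" by (simp add: case_prod_beta')
  show "AE v in gau J a. integrable M (\<lambda>th. h v * (f th * lik J X a v th))" using P.AE_integrable_snd[OF int] .
  show "integrable (gau J a) (\<lambda>v. \<integral>th. h v * (f th * lik J X a v th) \<partial>M)" using P.integrable_snd[OF int] .
  show "(LINT v|(gau J a). (LINT th|M. h v * (f th * lik J X a v th))) = (LINT th|M. (LINT v|(gau J a). h v * (f th * lik J X a v th)))"
    using P.Fubini_integral[OF int] by simp
qed

lemma weighted_lik:
  fixes f :: "'a \<Rightarrow> real"
  assumes f: "integrable M f"
  shows "AE v in gau J a. integrable M (\<lambda>th. f th * lik J X a v th)"
    and "integrable (gau J a) (\<lambda>v. \<integral>th. f th * lik J X a v th \<partial>M)"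
    and "(LINT v|(gau J a). (LINT th|M. f th * lik J X a v th)) = expectation f"
  using weighted_lik_pair[OF f, of "\<lambda>_. 1" 1] by (simp_all add: lik_total)

lemma evidence_measurable [measurable]: "evidence M J X a \<in> borel_measurable (coords J)"
  unfolding evidence_def by (rule borel_measurable_lebesgue_integral) (simp add: case_prod_beta)

lemma numer_measurable [measurable]: "i \<in> J \<Longrightarrow> numer M J X a i \<in> borel_measurable (coords J)"
proof -
  assume [measurable]: "i \<in> J"
  show ?thesis unfolding numer_def by (rule borel_measurable_lebesgue_integral) (simp add: case_prod_beta)
qed

end

end

text \<open>
  A modulus for ordered pairs suffices, as every pair is ordered one way or the other.
\<close>

lemma one_sided_modulus_imp_continuous_on:
  fixes F :: "real \<Rightarrow> real"
  assumes "\<And>e. 0 < e \<Longrightarrow> \<exists>d>0. \<forall>s\<in>A. \<forall>t\<in>A. s \<le> t \<longrightarrow> t - s < d \<longrightarrow> \<bar>F t - F s\<bar> < e"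
  shows "continuous_on A F"
  unfolding continuous_on_iff
proof (intro ballI allI impI)
  fix a e :: real assume a: "a \<in> A" and "0 < e"
  then obtain d where d: "0 < d" "\<And>s t. s \<in> A \<Longrightarrow> t \<in> A \<Longrightarrow> s \<le> t \<Longrightarrow> t - s < d \<Longrightarrow> \<bar>F t - F s\<bar> < e"
    using assms[of e] by blast
  show "\<exists>d>0. \<forall>b\<in>A. dist b a < d \<longrightarrow> dist (F b) (F a) < e"
  proof (intro exI[of _ d] conjI d(1) ballI impI)
    fix b assume b: "b \<in> A" "dist b a < d"
    show "dist (F b) (F a) < e"
      using d(2)[of a b] d(2)[of b a] a b by (cases "a \<le> b") (auto simp: dist_real_def abs_minus_commute)
  qed
qed

context square_signal
begin

definition trunc :: "real \<Rightarrow> 'a set" where "trunc K = {th \<in> space M. R th \<le> K}"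

definition tail :: "real \<Rightarrow> real" where "tail K = (LINT th|M. indicator (- trunc K) th * (R th)\<^sup>2)"

definition truncated :: "real \<Rightarrow> 'i \<Rightarrow> 'a \<Rightarrow> real" where "truncated K j th = indicator (trunc K) th * X j th"

text \<open>
  The probability conditioned on the event \<open>R \<le> K\<close>, under which the signal is
  bounded.
\<close>

definition conditioned :: "real \<Rightarrow> 'a measure" where
  "conditioned K = density M (\<lambda>th. ennreal (indicator (trunc K) th / prob (trunc K)))"

lemma trunc_sets [measurable]: "trunc K \<in> sets M" unfolding trunc_def by measurable

lemma tail_integrable: "integrable M (\<lambda>th. indicator (- trunc K) th * (R th)\<^sup>2)"
proof -
  have "integrable M (\<lambda>th. indicator (space M - trunc K) th *\<^sub>R (R th)\<^sup>2)"
    by (intro integrable_mult_indicator R2) measurable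
  then show ?thesis
    by (rule Bochner_Integration.integrable_cong[OF refl, THEN iffD1, rotated]) (auto simp: indicator_def)
qed

lemma tail_tendsto: "(\<lambda>n. tail (real n)) \<longlonglongrightarrow> 0"
proof -
  have "(\<lambda>n. \<integral>th. indicator (- trunc (real n)) th * (R th)\<^sup>2 \<partial>M) \<longlonglongrightarrow> (LINT th|M. 0)"
  proof (rule integral_dominated_convergence[OF _ _ R2])
    show "AE th in M. (\<lambda>n. indicator (- trunc (real n)) th * (R th)\<^sup>2) \<longlonglongrightarrow> 0"
    proof (rule AE_I2)
      fix th assume th: "th \<in> space M"
      obtain N where "R th \<le> real N" using real_arch_simple by blast
      then have "\<forall>\<^sub>F n in sequentially. indicator (- trunc (real n)) th * (R th)\<^sup>2 = 0"
        using th by (auto simp: eventually_sequentially trunc_def intro!: exI[of _ N])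
      then show "(\<lambda>n. indicator (- trunc (real n)) th * (R th)\<^sup>2) \<longlonglongrightarrow> 0" by (rule tendsto_eventually)
    qed
    show "(\<lambda>th. indicator (- trunc (real n)) th * (R th)\<^sup>2) \<in> borel_measurable M" for n
      using tail_integrable[of "real n"] by (rule borel_measurable_integrable)
  qed (auto simp: indicator_def)
  then show ?thesis by (simp add: tail_def)
qed

lemma trunc_prob_tendsto: "(\<lambda>n. prob (trunc (real n))) \<longlonglongrightarrow> 1"
proof -
  have "(\<lambda>n. prob (trunc (real n))) \<longlonglongrightarrow> prob (\<Union>n. trunc (real n))"
    by (rule finite_Lim_measure_incseq) (auto simp: trunc_def incseq_def)
  moreover have "(\<Union>n. trunc (real n)) = space M"
    using real_arch_simple by (auto simp: trunc_def)
  ultimately show ?thesis by (simp add: prob_space)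
qed

lemma conditioned_integral:
  fixes f :: "'a \<Rightarrow> real"
  assumes [measurable]: "f \<in> borel_measurable M"
  shows "integral\<^sup>L (conditioned K) f = (LINT th|M. indicator (trunc K) th * f th) / prob (trunc K)"
proof -
  have "integral\<^sup>L (conditioned K) f = (LINT th|M. (indicator (trunc K) th / prob (trunc K)) *\<^sub>R f th)"
    unfolding conditioned_def by (intro integral_density) auto
  also have "\<dots> = (LINT th|M. indicator (trunc K) th * f th / prob (trunc K))" by simp
  finally show ?thesis by simp
qed

context
  fixes K :: real
  assumes K: "0 \<le> K" and p: "0 < prob (trunc K)"
begin

lemma conditioned_signal: "bounded_signal (conditioned K) J (truncated K) K"
proof -
  have "emeasure (conditioned K) (space (conditioned K)) = (\<integral>\<^sup>+th. ennreal (indicator (trunc K) th / prob (trunc K)) \<partial>M)"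
    unfolding conditioned_def by (subst emeasure_density) (auto intro!: nn_integral_cong)
  also have "\<dots> = ennreal (LINT th|M. indicator (trunc K) th / prob (trunc K))"
    using p by (intro nn_integral_eq_integral) (auto simp: emeasure_eq_measure)
  also have "(LINT th|M. indicator (trunc K) th / prob (trunc K)) = 1" using p by simp
  finally have "prob_space (conditioned K)" by (intro prob_spaceI) simp
  moreover have "(\<Sum>j\<in>J. (truncated K j th)\<^sup>2) \<le> K\<^sup>2" for th
  proof (cases "th \<in> trunc K")
    case True
    then have "(R th)\<^sup>2 \<le> K\<^sup>2" using R0[of th] by (intro power_mono) (auto simp: trunc_def)
    then show ?thesis using XR[of th] True by (simp add: truncated_def)
  qed (simp add: truncated_def)
  moreover have "truncated K j \<in> borel_measurable (conditioned K)" if [measurable]: "j \<in> J" for j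
    unfolding truncated_def conditioned_def by measurable
  ultimately show ?thesis
    unfolding bounded_signal_def bounded_signal_axioms_def using finJ K by auto
qed

lemma lik_truncated: "th \<in> trunc K \<Longrightarrow> lik J (truncated K) a v th = lik J X a v th"
  by (simp add: lik_def truncated_def)

lemma evidence_conditioned:
  "evidence (conditioned K) J (truncated K) a v = (LINT th|M. indicator (trunc K) th * lik J X a v th) / prob (trunc K)"
proof -
  have [measurable]: "lik J (truncated K) a v \<in> borel_measurable M"
    unfolding lik_def truncated_def by measurable
  have "(LINT th|M. indicator (trunc K) th * lik J (truncated K) a v th) = (LINT th|M. indicator (trunc K) th * lik J X a v th)"
    by (intro lint_cong refl) (auto simp: indicator_def lik_truncated)
  then show ?thesis unfolding evidence_def by (simp add: conditioned_integral)
qed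

lemma numer_conditioned:
  assumes [measurable]: "i \<in> J"
  shows "numer (conditioned K) J (truncated K) a i v = (LINT th|M. indicator (trunc K) th * (X i th * lik J X a v th)) / prob (trunc K)"
proof -
  have [measurable]: "lik J (truncated K) a v \<in> borel_measurable M" "truncated K i \<in> borel_measurable M"
    unfolding lik_def truncated_def by measurable
  have "(LINT th|M. indicator (trunc K) th * (truncated K i th * lik J (truncated K) a v th))
     = (LINT th|M. indicator (trunc K) th * (X i th * lik J X a v th))"
    by (intro lint_cong refl) (auto simp: indicator_def lik_truncated truncated_def)
  then show ?thesis unfolding numer_def by (simp add: conditioned_integral)
qed

text \<open>
  The perturbation bound for each observed vector \<open>v\<close>, integrated over \<open>v\<close>:
  the likelihoods have total mass one, so the removed second moments average to \<open>tail K\<close>.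
\<close>

lemma
  assumes a: "\<forall>j\<in>J. 0 \<le> a j" and S: "S \<subseteq> J"
  shows explained_integrable: "integrable (gau J a) (\<lambda>v. (\<Sum>i\<in>S. (numer M J X a i v)\<^sup>2) / evidence M J X a v)"
    and explained_truncation: "\<bar>explained M J X S a - prob (trunc K) * explained (conditioned K) J (truncated K) S a\<bar> \<le> 3 * tail K"
proof -
  interpret C: bounded_signal "conditioned K" J "truncated K" K by (rule conditioned_signal)
  define T where "T v = (LINT th|M. indicator (- trunc K) th * ((R th)\<^sup>2 * lik J X a v th))" for v
  define q where "q v = (\<Sum>i\<in>S. (numer M J X a i v)\<^sup>2) / evidence M J X a v" for v
  define qd where "qd v = prob (trunc K) * ((\<Sum>i\<in>S. (numer (conditioned K) J (truncated K) a i v)\<^sup>2) / evidence (conditioned K) J (truncated K) a v)" for v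
  have [measurable]: "numer M J X a i \<in> borel_measurable (coords J)" if "i \<in> S" for i
    using that S by (intro numer_measurable[OF a]) auto
  have [measurable]: "evidence M J X a \<in> borel_measurable (coords J)" by (rule evidence_measurable[OF a])
  have qm [measurable]: "q \<in> borel_measurable (coords J)" unfolding q_def by measurable
  have finS: "finite S" using S finJ by (rule finite_subset)
  have XRS: "(\<Sum>i\<in>S. (X i th)\<^sup>2) \<le> (R th)\<^sup>2" for th
    using XR[of th] sum_mono2[OF finJ S, of "\<lambda>i. (X i th)\<^sup>2"] by simp
  have ae1: "AE v in gau J a. integrable M (lik J X a v)"
    using weighted_lik(1)[OF a, of "\<lambda>_. 1"] by simp
  have ae2: "AE v in gau J a. integrable M (\<lambda>th. (R th)\<^sup>2 * lik J X a v th)"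
    by (rule weighted_lik(1)[OF a R2])
  have ae: "AE v in gau J a. q v \<le> qd v + T v \<and> qd v - 3 * T v \<le> q v"
    using ae1 ae2
  proof eventually_elim
    case (elim v)
    define Zd where "Zd = (LINT th|M. indicator (trunc K) th * lik J X a v th)"
    have Zd: "0 < Zd" using C.evidence_pos[OF a, of v] p by (simp add: evidence_conditioned Zd_def zero_less_divide_iff)
    have qd: "qd v = (\<Sum>i\<in>S. (LINT th|M. indicator (trunc K) th * (X i th * lik J X a v th))\<^sup>2) / Zd"
    proof -
      have "(\<Sum>i\<in>S. (numer (conditioned K) J (truncated K) a i v)\<^sup>2)
        = (\<Sum>i\<in>S. (LINT th|M. indicator (trunc K) th * (X i th * lik J X a v th))\<^sup>2) / (prob (trunc K))\<^sup>2"
        unfolding sum_divide_distrib using S by (intro sum.cong refl) (auto simp: numer_conditioned power_divide)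
      then show ?thesis using p Zd by (simp add: qd_def evidence_conditioned Zd_def power2_eq_square)
    qed
    have *: "q v = (\<Sum>i\<in>S. (LINT th|M. X i th * lik J X a v th)\<^sup>2) / (LINT th|M. lik J X a v th)"
      by (simp add: q_def numer_def evidence_def)
    have RD: "th \<in> trunc K \<Longrightarrow> (R th)\<^sup>2 \<le> K\<^sup>2" for th
      using R0[of th] by (intro power_mono) (auto simp: trunc_def)
    have RDc: "th \<in> space M \<Longrightarrow> th \<notin> trunc K \<Longrightarrow> K\<^sup>2 \<le> (R th)\<^sup>2" for th
      using K by (intro power_mono) (auto simp: trunc_def)
    have "i \<in> S \<Longrightarrow> X i \<in> borel_measurable M" for i using S by auto
    note pert = quotient_perturbation[of S X M "trunc K" R K "lik J X a v",
        OF finS this trunc_sets XRS RD RDc elim less_imp_le[OF lik_pos] Zd[unfolded Zd_def]]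
    show ?case unfolding qd * T_def Zd_def using pert by simp
  qed
  have assoc: "indicator (- trunc K) th * ((R th)\<^sup>2 * lik J X a v th) = indicator (- trunc K) th * (R th)\<^sup>2 * lik J X a v th" for th v
    by (simp only: mult.assoc)
  have Tint: "integrable (gau J a) T" and ET: "(LINT v|(gau J a). T v) = tail K"
    unfolding T_def assoc tail_def using weighted_lik(2,3)[OF a tail_integrable[of K]] by simp_all
  have qdint: "integrable (gau J a) qd" and Eqd: "(LINT v|(gau J a). qd v) = prob (trunc K) * explained (conditioned K) J (truncated K) S a"
    unfolding qd_def explained_def using C.explained_integrable[OF a S] by (auto simp only: integrable_mult_right integral_mult_right_zero)
  have ev0: "0 \<le> evidence M J X a v" for v
    unfolding evidence_def by (intro lint_nonneg less_imp_le[OF lik_pos])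
  have qint: "integrable (gau J a) q"
  proof (rule lint_bound)
    show "integrable (gau J a) (\<lambda>v. qd v + T v)" using qdint Tint by simp
    have "0 \<le> q v" for v unfolding q_def using ev0 by (intro divide_nonneg_nonneg sum_nonneg) auto
    then show "AE v in gau J a. norm (q v) \<le> norm (qd v + T v)"
      using ae by (auto elim!: eventually_mono)
  qed simp
  then show "integrable (gau J a) (\<lambda>v. (\<Sum>i\<in>S. (numer M J X a i v)\<^sup>2) / evidence M J X a v)" by (simp add: q_def[abs_def])
  have Eq: "(LINT v|(gau J a). q v) = explained M J X S a" by (simp add: explained_def q_def)
  have "(LINT v|(gau J a). q v) \<le> (LINT v|(gau J a). qd v + T v)"
    using ae qint qdint Tint by (intro integral_mono_AE) (auto elim!: eventually_mono)
  then have up: "explained M J X S a \<le> prob (trunc K) * explained (conditioned K) J (truncated K) S a + tail K"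
    using qdint Tint by (simp add: Eq Eqd ET)
  have "(LINT v|(gau J a). qd v - 3 * T v) \<le> (LINT v|(gau J a). q v)"
    using ae qint qdint Tint by (intro integral_mono_AE) (auto elim!: eventually_mono)
  then have lo: "prob (trunc K) * explained (conditioned K) J (truncated K) S a - 3 * tail K \<le> explained M J X S a"
    using qdint Tint by (simp add: Eq Eqd ET)
  have "0 \<le> tail K" unfolding tail_def by (intro lint_nonneg) simp
  then show "\<bar>explained M J X S a - prob (trunc K) * explained (conditioned K) J (truncated K) S a\<bar> \<le> 3 * tail K"
    using up lo by (simp add: abs_le_iff)
qed

text \<open>
  This modulus depends on the signal only through the law of \<open>R\<close>, so it is shared by all
  finite systems of coordinates and survives the passage to infinitely many.
\<close>

lemma explained_modulus:
  assumes st: "0 \<le> s" "s \<le> t" "8 * K\<^sup>2 * (t - s) \<le> 1"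
  shows "explained M J X J (level J t) - explained M J X J (level J s) \<le> 6 * tail K + 128 * K ^ 4 * (t - s)"
proof -
  interpret C: bounded_signal "conditioned K" J "truncated K" K by (rule conditioned_signal)
  let ?e = "\<lambda>s. explained (conditioned K) J (truncated K) J (level J s)"
  have lev: "\<forall>j\<in>J. 0 \<le> level J r j" if "0 \<le> r" for r using that by (simp add: level_def)
  have "?e t - ?e s \<le> 128 * K ^ 4 * (t - s)"
    using C.explained_lipschitz[of "\<lambda>_. 0" J s t] st by (simp add: C.level_eq_boost)
  then have "prob (trunc K) * (?e t - ?e s) \<le> prob (trunc K) * (128 * K ^ 4 * (t - s))"
    by (intro mult_left_mono) auto
  also have "\<dots> \<le> 1 * (128 * K ^ 4 * (t - s))" using st by (intro mult_right_mono) auto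
  finally have "prob (trunc K) * ?e t - prob (trunc K) * ?e s \<le> 128 * K ^ 4 * (t - s)" by (simp add: right_diff_distrib)
  moreover have "\<bar>explained M J X J (level J t) - prob (trunc K) * ?e t\<bar> \<le> 3 * tail K"
    "\<bar>explained M J X J (level J s) - prob (trunc K) * ?e s\<bar> \<le> 3 * tail K"
    using st by (auto intro!: explained_truncation lev)
  ultimately show ?thesis by linarith
qed

end

lemma trunc_prob_eventually: "\<forall>\<^sub>F n in sequentially. 0 < prob (trunc (real n))"
  using order_tendstoD(1)[OF trunc_prob_tendsto, of 0] by simp

lemma truncation_tendsto:
  assumes a: "\<forall>j\<in>J. 0 \<le> a j" and S: "S \<subseteq> J"
  shows "(\<lambda>n. prob (trunc (real n)) * explained (conditioned (real n)) J (truncated (real n)) S a) \<longlonglongrightarrow> explained M J X S a"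
proof -
  have "(\<lambda>n. explained M J X S a - prob (trunc (real n)) * explained (conditioned (real n)) J (truncated (real n)) S a) \<longlonglongrightarrow> 0"
  proof (rule Lim_null_comparison)
    show "(\<lambda>n. 3 * tail (real n)) \<longlonglongrightarrow> 0" using tendsto_mult_right_zero[OF tail_tendsto] by simp
    show "\<forall>\<^sub>F n in sequentially. norm (explained M J X S a - prob (trunc (real n)) * explained (conditioned (real n)) J (truncated (real n)) S a) \<le> 3 * tail (real n)"
      using trunc_prob_eventually by eventually_elim (simp add: explained_truncation[OF _ _ a S])
  qed
  from tendsto_diff[OF tendsto_const this, of "explained M J X S a"] show ?thesis by simp
qed

lemma explained_mono:
  assumes a: "\<forall>j\<in>J. 0 \<le> a j" and ab: "\<forall>j\<in>J. a j \<le> b j" and S: "S \<subseteq> J"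
  shows "explained M J X S a \<le> explained M J X S b"
proof -
  have b: "\<forall>j\<in>J. 0 \<le> b j" using a ab by force
  show ?thesis
  proof (rule tendsto_le[OF _ truncation_tendsto[OF b S] truncation_tendsto[OF a S]])
    show "\<forall>\<^sub>F n in sequentially. prob (trunc (real n)) * explained (conditioned (real n)) J (truncated (real n)) S a
      \<le> prob (trunc (real n)) * explained (conditioned (real n)) J (truncated (real n)) S b"
      using trunc_prob_eventually
    proof eventually_elim
      case (elim n)
      interpret C: bounded_signal "conditioned (real n)" J "truncated (real n)" "real n"
        by (rule conditioned_signal) (use elim in auto)
      have "explained (conditioned (real n)) J (truncated (real n)) S a
         \<le> explained (conditioned (real n)) J (truncated (real n)) S (\<lambda>j. a j + (b j - a j))"
        using ab by (intro C.explained_mono[OF a _ S]) auto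
      then show ?case by (intro mult_left_mono) auto
    qed
  qed simp
qed

lemma level_nonneg: "0 \<le> \<gamma> \<Longrightarrow> \<forall>j\<in>J. 0 \<le> level T \<gamma> j"
  by (simp add: level_def)

lemma explained_level_mono:
  assumes "0 \<le> s" "s \<le> t" "S \<subseteq> J"
  shows "explained M J X S (level J s) \<le> explained M J X S (level J t)"
  using assms by (intro explained_mono level_nonneg) (auto simp: level_def)

lemma modulus_exists:
  assumes e: "0 < e"
  shows "\<exists>K d. 0 \<le> K \<and> 0 < prob (trunc K) \<and> 0 < d \<and> 8 * K\<^sup>2 * d \<le> 1 \<and> 6 * tail K + 128 * K ^ 4 * d < e"
proof -
  have "\<forall>\<^sub>F n in sequentially. 6 * tail (real n) < e / 2"
    using order_tendstoD(2)[OF tendsto_mult_right_zero[OF tail_tendsto, of 6], of "e/2"] e by simp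
  then obtain n where n: "6 * tail (real n) < e / 2" "0 < prob (trunc (real n))"
    using eventually_happens'[OF _ eventually_conj[OF _ trunc_prob_eventually]] by fastforce
  define K where "K = real n"
  define d where "d = min (1 / (8 * K\<^sup>2 + 1)) (e / 2 / (128 * K ^ 4 + 1))"
  have pos: "0 < 8 * K\<^sup>2 + 1" "0 < 128 * K ^ 4 + 1" by (auto intro!: add_nonneg_pos simp: K_def)
  have d: "0 < d" using e pos by (simp add: d_def)
  have "d \<le> 1 / (8 * K\<^sup>2 + 1)" "d \<le> e / 2 / (128 * K ^ 4 + 1)" by (auto simp: d_def)
  then have "(8 * K\<^sup>2 + 1) * d \<le> 1" "(128 * K ^ 4 + 1) * d \<le> e / 2"
    unfolding pos_le_divide_eq[OF pos(1)] pos_le_divide_eq[OF pos(2)] by (simp_all only: mult.commute)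
  then have "8 * K\<^sup>2 * d \<le> 1" "128 * K ^ 4 * d \<le> e / 2" using d by (auto simp: distrib_right)
  then show ?thesis using n d by (intro exI[of _ K] exI[of _ d]) (auto simp: K_def)
qed

lemma explained_level_continuous: "continuous_on {0..\<gamma>} (\<lambda>\<beta>. explained M J X J (level J \<beta>))"
proof (rule one_sided_modulus_imp_continuous_on)
  fix e :: real assume "0 < e"
  then obtain K d where K: "0 \<le> K" "0 < prob (trunc K)" "0 < d" "8 * K\<^sup>2 * d \<le> 1" "6 * tail K + 128 * K ^ 4 * d < e"
    using modulus_exists by blast
  have "\<bar>explained M J X J (level J t) - explained M J X J (level J s)\<bar> < e" if st: "0 \<le> s" "s \<le> t" "t - s < d" for s t
  proof -
    have "8 * K\<^sup>2 * (t - s) \<le> 8 * K\<^sup>2 * d" "128 * K ^ 4 * (t - s) \<le> 128 * K ^ 4 * d"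
      using st K(1) by (auto intro!: mult_left_mono)
    then show ?thesis using explained_modulus[OF K(1,2), of s t] explained_level_mono[of s t J] st K by simp
  qed
  then show "\<exists>d>0. \<forall>s\<in>{0..\<gamma>}. \<forall>t\<in>{0..\<gamma>}. s \<le> t \<longrightarrow> t - s < d \<longrightarrow> \<bar>explained M J X J (level J t) - explained M J X J (level J s)\<bar> < e"
    using K(3) by (intro exI[of _ d]) auto
qed

lemma explained_level_integrable: "(\<lambda>\<beta>. explained M J X J (level J \<beta>)) integrable_on {0..\<gamma>}"
  by (intro integrable_continuous_real explained_level_continuous)

text \<open>
  The block inequalities for bounded signals, in the limit of increasing truncation bounds.
\<close>

lemma
  fixes B :: "nat \<Rightarrow> 'i set"
  assumes disj: "\<And>i k. i < k \<Longrightarrow> k < n \<Longrightarrow> B i \<inter> B k = {}" and J: "(\<Union>k<n. B k) = J" and \<gamma>: "0 \<le> \<gamma>"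
  shows explained_blocks_lower: 
      "\<gamma> * (\<Sum>k<n. explained M J X (B k) (level (\<Union>i<k. B i) \<gamma>)) \<le> integral {0..\<gamma>} (\<lambda>\<beta>. explained M J X J (level J \<beta>))"
    and explained_blocks_upper: 
      "integral {0..\<gamma>} (\<lambda>\<beta>. explained M J X J (level J \<beta>)) \<le> \<gamma> * (\<Sum>k<n. explained M J X (B k) (level (\<Union>i\<le>k. B i) \<gamma>))"
proof -
  have BJ: "B k \<subseteq> J" if "k < n" for k using J that by auto
  let ?p = "\<lambda>m. prob (trunc (real m))" and ?e = "\<lambda>m. explained (conditioned (real m)) J (truncated (real m))"
  define I where "I = integral {0..\<gamma>} (\<lambda>\<beta>. explained M J X J (level J \<beta>))"
  have conv: "(\<lambda>m. \<gamma> * (\<Sum>k<n. ?p m * ?e m (B k) (L k))) \<longlonglongrightarrow> \<gamma> * (\<Sum>k<n. explained M J X (B k) (L k))"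
    if "\<And>k. \<forall>j\<in>J. 0 \<le> L k j" for L
    using that BJ by (intro tendsto_intros truncation_tendsto) auto
  have tail3: "(\<lambda>m. I + \<gamma> * (3 * tail (real m))) \<longlonglongrightarrow> I + \<gamma> * 0" "(\<lambda>m. I - \<gamma> * (3 * tail (real m))) \<longlonglongrightarrow> I - \<gamma> * 0"
    using tendsto_mult_right_zero[OF tail_tendsto, of 3] by (intro tendsto_intros; simp)+
  have int: "\<gamma> * (\<Sum>k<n. ?p m * ?e m (B k) (level (\<Union>i<k. B i) \<gamma>)) \<le> I + \<gamma> * (3 * tail (real m))"
      "I - \<gamma> * (3 * tail (real m)) \<le> \<gamma> * (\<Sum>k<n. ?p m * ?e m (B k) (level (\<Union>i\<le>k. B i) \<gamma>))" if m: "0 < ?p m" for m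
  proof -
    interpret C: bounded_signal "conditioned (real m)" J "truncated (real m)" "real m"
      by (rule conditioned_signal) (use m in auto)
    note s = C.blocks_sandwich[OF disj J \<gamma>]
    have near: "\<bar>explained M J X J (level J \<beta>) - ?p m * ?e m J (level J \<beta>)\<bar> \<le> 3 * tail (real m)" if "0 \<le> \<beta>" for \<beta>
      using explained_truncation[OF _ m level_nonneg[OF that], of J] by simp
    have near': "?p m * ?e m J (level J \<beta>) \<le> explained M J X J (level J \<beta>) + 3 * tail (real m)"
        "explained M J X J (level J \<beta>) - 3 * tail (real m) \<le> ?p m * ?e m J (level J \<beta>)" if "0 \<le> \<beta>" for \<beta>
      using near[OF that] by linarith+
    have c: "((\<lambda>_. 3 * tail (real m)) has_integral \<gamma> * (3 * tail (real m))) {0..\<gamma>}"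
      using has_integral_const_real[of "3 * tail (real m)" 0 \<gamma>] \<gamma> by simp
    have I: "((\<lambda>\<beta>. explained M J X J (level J \<beta>)) has_integral I) {0..\<gamma>}"
      unfolding I_def using explained_level_integrable by (rule integrable_integral)
    have E: "((\<lambda>\<beta>. ?p m * ?e m J (level J \<beta>)) has_integral ?p m * integral {0..\<gamma>} (\<lambda>\<beta>. ?e m J (level J \<beta>))) {0..\<gamma>}"
      using has_integral_mult_right[OF integrable_integral[OF s(1)]] .
    have "?p m * integral {0..\<gamma>} (\<lambda>\<beta>. ?e m J (level J \<beta>)) \<le> I + \<gamma> * (3 * tail (real m))"
      using near'(1) by (intro has_integral_le[OF E has_integral_add[OF I c]]) auto
    moreover have "?p m * (\<gamma> * (\<Sum>k<n. ?e m (B k) (level (\<Union>i<k. B i) \<gamma>))) \<le> ?p m * integral {0..\<gamma>} (\<lambda>\<beta>. ?e m J (level J \<beta>))"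
      using s(2) m by (intro mult_left_mono) auto
    ultimately show "\<gamma> * (\<Sum>k<n. ?p m * ?e m (B k) (level (\<Union>i<k. B i) \<gamma>)) \<le> I + \<gamma> * (3 * tail (real m))"
      by (simp add: sum_distrib_left[symmetric] mult.left_commute)
    have "I - \<gamma> * (3 * tail (real m)) \<le> ?p m * integral {0..\<gamma>} (\<lambda>\<beta>. ?e m J (level J \<beta>))"
      using near'(2) by (intro has_integral_le[OF has_integral_diff[OF I c] E]) auto
    moreover have "?p m * integral {0..\<gamma>} (\<lambda>\<beta>. ?e m J (level J \<beta>)) \<le> ?p m * (\<gamma> * (\<Sum>k<n. ?e m (B k) (level (\<Union>i\<le>k. B i) \<gamma>)))"
      using s(3) m by (intro mult_left_mono) auto
    ultimately show "I - \<gamma> * (3 * tail (real m)) \<le> \<gamma> * (\<Sum>k<n. ?p m * ?e m (B k) (level (\<Union>i\<le>k. B i) \<gamma>))"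
      by (simp add: sum_distrib_left[symmetric] mult.left_commute)
  qed
  show "\<gamma> * (\<Sum>k<n. explained M J X (B k) (level (\<Union>i<k. B i) \<gamma>)) \<le> integral {0..\<gamma>} (\<lambda>\<beta>. explained M J X J (level J \<beta>))"
    unfolding I_def[symmetric]
    using tendsto_le[OF _ tail3(1) conv, of "\<lambda>k. level (\<Union>i<k. B i) \<gamma>"] int(1) level_nonneg[OF \<gamma>]
      eventually_mono[OF trunc_prob_eventually] by simp
  show "integral {0..\<gamma>} (\<lambda>\<beta>. explained M J X J (level J \<beta>)) \<le> \<gamma> * (\<Sum>k<n. explained M J X (B k) (level (\<Union>i\<le>k. B i) \<gamma>))"
    unfolding I_def[symmetric]
    using tendsto_le[OF _ conv tail3(2), of "\<lambda>k. level (\<Union>i\<le>k. B i) \<gamma>"] int(2) level_nonneg[OF \<gamma>]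
      eventually_mono[OF trunc_prob_eventually] by simp
qed

end

section \<open>Conditional means from a finite observation\<close>

lemma gau_scaling:
  fixes J :: "'i set"
  assumes J: "finite J"
  shows "distr (gau J (\<lambda>_. 1)) (coords J) (\<lambda>u. \<lambda>j\<in>J. sqrt (a j) * u j) = gau J a"
proof -
  interpret G: product_prob_space "\<lambda>j::'i. gau1 1" by (rule product_prob_space_gau1)
  interpret A: product_prob_space "\<lambda>j. gau1 (a j)" by (rule product_prob_space_gau1)
  have one: "gau1 (a j) = distr (gau1 1) borel (\<lambda>x. sqrt (a j) * x)" for j
    unfolding gau1_def by (subst distr_distr) (auto simp: comp_def)
  have meas: "(\<lambda>u. \<lambda>j\<in>J. sqrt (a j) * u j) \<in> measurable (gau J (\<lambda>_. 1)) (coords J)"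
    by (intro measurable_restrict) (auto simp: measurable_cong_sets[OF sets_gau refl])
  show ?thesis unfolding gau_def[of J a]
  proof (rule A.PiM_eqI[OF J])
    fix S assume S: "\<And>j. j \<in> J \<Longrightarrow> S j \<in> sets (gau1 (a j))"
    have "emeasure (distr (gau J (\<lambda>_. 1)) (coords J) (\<lambda>u. \<lambda>j\<in>J. sqrt (a j) * u j)) (Pi\<^sub>E J S)
      = emeasure (gau J (\<lambda>_. 1)) ((\<lambda>u. \<lambda>j\<in>J. sqrt (a j) * u j) -` (Pi\<^sub>E J S) \<inter> space (gau J (\<lambda>_. 1)))"
      using meas J S by (intro emeasure_distr) (auto intro!: sets_PiM_I_finite)
    also have "(\<lambda>u. \<lambda>j\<in>J. sqrt (a j) * u j) -` (Pi\<^sub>E J S) \<inter> space (gau J (\<lambda>_. 1))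
       = Pi\<^sub>E J (\<lambda>j. (\<lambda>x. sqrt (a j) * x) -` S j)"
      by (auto simp: space_gau space_PiM PiE_iff extensional_def)
    also have "emeasure (gau J (\<lambda>_. 1)) \<dots> = (\<Prod>j\<in>J. emeasure (gau1 1) ((\<lambda>x. sqrt (a j) * x) -` S j))"
      unfolding gau_def using J S
      by (intro G.emeasure_PiM) (auto intro!: measurable_sets_borel[where M=borel])
    also have "\<dots> = (\<Prod>j\<in>J. emeasure (gau1 (a j)) (S j))"
      using S by (intro prod.cong refl) (subst one, simp add: emeasure_distr)
    finally show "emeasure (distr (gau J (\<lambda>_. 1)) (coords J) (\<lambda>u. \<lambda>j\<in>J. sqrt (a j) * u j)) (Pi\<^sub>E J S)
       = (\<Prod>j\<in>J. emeasure (gau1 (a j)) (S j))" .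
  qed (simp add: gau_def[symmetric])
qed

text \<open>
  A signal with independent standard normal noise. The variable \<open>x\<close> carries the whole
  signal, of which the observed \<open>X j\<close> are functions.
\<close>

locale gaussian_observation = square_signal M J X R
  for M :: "'a measure" and J :: "'i set" and X :: "'i \<Rightarrow> 'a \<Rightarrow> real" and R :: "'a \<Rightarrow> real" +
  fixes x :: "'a \<Rightarrow> 'h::second_countable_topology" and \<xi> :: "'i \<Rightarrow> 'h \<Rightarrow> real" and W :: "'i \<Rightarrow> 'a \<Rightarrow> real"
  assumes xM [measurable]: "x \<in> borel_measurable M"
    and WM [measurable]: "\<And>j. j \<in> J \<Longrightarrow> W j \<in> borel_measurable M"
    and \<xi> [measurable]: "\<And>j. j \<in> J \<Longrightarrow> \<xi> j \<in> borel_measurable borel"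
    and X_eq: "\<And>j th. j \<in> J \<Longrightarrow> X j th = \<xi> j (x th)"
    and joint: "distr M (borel \<Otimes>\<^sub>M coords J) (\<lambda>th. (x th, \<lambda>j\<in>J. W j th)) = distr M borel x \<Otimes>\<^sub>M gau J (\<lambda>_. 1)"
begin

definition outcome :: "('i \<Rightarrow> real) \<Rightarrow> 'a \<Rightarrow> 'i \<Rightarrow> real" where
  "outcome a th = (\<lambda>j\<in>J. a j * X j th + sqrt (a j) * W j th)"

definition estimate :: "('i \<Rightarrow> real) \<Rightarrow> 'i \<Rightarrow> 'a \<Rightarrow> real" where
  "estimate a i th = numer M J X a i (outcome a th) / evidence M J X a (outcome a th)"

lemma outcome_measurable [measurable]: "outcome a \<in> measurable M (coords J)"
  unfolding outcome_def by (intro measurable_restrict) measurable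

context
  fixes a :: "'i \<Rightarrow> real"
  assumes a: "\<forall>j\<in>J. 0 \<le> a j"
begin

text \<open>
  By independence the integral over the noise may be taken first; the Cameron-Martin formula turns the
  shift by the signal into the likelihood.
\<close>

lemma outcome_integral:
  fixes f :: "'h \<Rightarrow> real" and h :: "('i \<Rightarrow> real) \<Rightarrow> real"
  assumes fm [measurable]: "f \<in> borel_measurable borel" and f: "integrable M (\<lambda>th. f (x th))"
    and hm [measurable]: "h \<in> borel_measurable (coords J)" and h: "\<And>v. \<bar>h v\<bar> \<le> C"
  shows "expectation (\<lambda>th. f (x th) * h (outcome a th)) = (LINT v|(gau J a). h v * (LINT th|M. f (x th) * lik J X a v th))"
proof -
  interpret G: prob_space "gau J (\<lambda>_. 1)" by (rule prob_space_gau)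
  interpret Dx: prob_space "distr M borel x" by (rule prob_space_distr) simp
  interpret P: pair_prob_space "distr M borel x" "gau J (\<lambda>_. 1)" ..
  define F where "F p = f (fst p) * h (\<lambda>j\<in>J. a j * \<xi> j (fst p) + sqrt (a j) * snd p j)" for p
  have inner_meas: "(\<lambda>p. \<lambda>j\<in>J. a j * \<xi> j (fst p) + sqrt (a j) * snd p j) \<in> measurable (borel \<Otimes>\<^sub>M coords J) (coords J)"
    by (intro measurable_restrict) measurable
  have Fm [measurable]: "F \<in> borel_measurable (borel \<Otimes>\<^sub>M coords J)"
    unfolding F_def using measurable_compose[OF inner_meas hm] by measurable
  have sets_eq: "sets (distr M borel x \<Otimes>\<^sub>M gau J (\<lambda>_. 1)) = sets (borel \<Otimes>\<^sub>M coords J)"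
    by (intro sets_pair_measure_cong) auto
  have jm: "(\<lambda>th. (x th, \<lambda>j\<in>J. W j th)) \<in> measurable M (borel \<Otimes>\<^sub>M coords J)"
    by (intro measurable_Pair measurable_restrict) measurable
  have out: "outcome a th = (\<lambda>j\<in>J. a j * \<xi> j (x th) + sqrt (a j) * (\<lambda>j\<in>J. W j th) j)" for th
    by (auto simp: outcome_def X_eq fun_eq_iff)
  have FE: "f (x th) * h (outcome a th) = F (x th, \<lambda>j\<in>J. W j th)" for th
    by (simp add: F_def out del: restrict_apply)
  have int0: "integrable M (\<lambda>th. f (x th) * h (outcome a th))"
  proof (rule lint_bound)
    show "integrable M (\<lambda>th. C * f (x th))" using f by simp
    have "\<bar>f (x th) * h (outcome a th)\<bar> \<le> \<bar>C * f (x th)\<bar>" for th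
      unfolding abs_mult mult.commute[of "\<bar>f (x th)\<bar>"] using h[of "outcome a th"] by (intro mult_right_mono) auto
    then show "AE th in M. norm (f (x th) * h (outcome a th)) \<le> norm (C * f (x th))" by simp
  qed measurable
  have "integrable (distr M (borel \<Otimes>\<^sub>M coords J) (\<lambda>th. (x th, \<lambda>j\<in>J. W j th))) F"
    by (rule integrable_distr_eq[OF jm Fm, THEN iffD2]) (use int0 in \<open>simp only: FE\<close>)
  then have intF: "integrable (distr M borel x \<Otimes>\<^sub>M gau J (\<lambda>_. 1)) F" unfolding joint .
  have "expectation (\<lambda>th. f (x th) * h (outcome a th)) = integral\<^sup>L (distr M (borel \<Otimes>\<^sub>M coords J) (\<lambda>th. (x th, \<lambda>j\<in>J. W j th))) F"
    unfolding FE by (rule integral_distr[OF jm Fm, symmetric])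
  also have "\<dots> = (LINT p|((distr M borel x \<Otimes>\<^sub>M gau J (\<lambda>_. 1))). F p)" unfolding joint ..
  also have "\<dots> = (LINT y|(distr M borel x). (LINT u|(gau J (\<lambda>_. 1)). F (y, u)))"
    by (rule P.integral_fst'[OF intF, symmetric])
  also have "\<dots> = (LINT th|M. (LINT u|(gau J (\<lambda>_. 1)). F (x th, u)))"
    by (rule integral_distr[OF xM]) (intro G.borel_measurable_lebesgue_integral, simp add: measurable_cong_sets[OF sets_eq refl] Fm)
  also have "\<dots> = (LINT th|M. (LINT v|(gau J a). h v * (f (x th) * lik J X a v th)))"
  proof (rule lint_cong[OF refl])
    fix th
    have shift: "(\<lambda>v. \<lambda>j\<in>J. v j + a j * X j th) \<in> measurable (coords J) (coords J)"
      by (intro measurable_restrict) measurable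
    have scale: "(\<lambda>u. \<lambda>j\<in>J. sqrt (a j) * u j) \<in> measurable (gau J (\<lambda>_. 1)) (coords J)"
      by (intro measurable_restrict) (auto simp: measurable_cong_sets[OF sets_gau refl])
    have "(LINT u|(gau J (\<lambda>_. 1)). F (x th, u))
       = (LINT u|(gau J (\<lambda>_. 1)). f (x th) * h (\<lambda>j\<in>J. (\<lambda>j\<in>J. sqrt (a j) * u j) j + a j * X j th))"
      unfolding F_def
      by (intro lint_cong refl arg_cong2[where f="(*)"] arg_cong[where f=h])
        (auto simp: X_eq fun_eq_iff)
    also have "\<dots> = (LINT v|(gau J a). f (x th) * h (\<lambda>j\<in>J. v j + a j * X j th))"
      unfolding gau_scaling[OF finJ, of a, symmetric]
      by (rule integral_distr[OF scale, symmetric]) (intro borel_measurable_times borel_measurable_const measurable_compose[OF shift hm])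
    also have "\<dots> = f (x th) * (LINT v|(gau J a). lik J X a v th * h v)"
      unfolding lik_def using gau_tilt[OF finJ a hm, of "\<lambda>j. X j th"] by simp
    also have "\<dots> = (LINT v|(gau J a). h v * (f (x th) * lik J X a v th))"
      unfolding integral_mult_right_zero[symmetric] by (simp only: mult_ac)
    finally show "(LINT u|(gau J (\<lambda>_. 1)). F (x th, u)) = (LINT v|(gau J a). h v * (f (x th) * lik J X a v th))" .
  qed
  also have "\<dots> = (LINT v|(gau J a). (LINT th|M. h v * (f (x th) * lik J X a v th)))"
    by (rule weighted_lik_pair(3)[OF a f hm h, symmetric])
  finally show ?thesis by simp
qed

lemma evidence_nonneg: "0 \<le> evidence M J X a v"
  unfolding evidence_def by (intro lint_nonneg less_imp_le[OF lik_pos])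

lemma evidence_pos_AE: "AE v in gau J a. 0 < evidence M J X a v"
proof -
  have "AE v in gau J a. integrable M (lik J X a v)"
    using weighted_lik(1)[OF a, of "\<lambda>_. 1"] by simp
  then show ?thesis
  proof eventually_elim
    case (elim v)
    have "evidence M J X a v \<noteq> 0"
    proof
      assume "evidence M J X a v = 0"
      then have "AE th in M. lik J X a v th = 0"
        unfolding evidence_def using elim
        by (subst (asm) integral_nonneg_eq_0_iff_AE) (auto intro: less_imp_le[OF lik_pos])
      then have "AE th in M. False" by eventually_elim (use lik_pos[of J X a v] in \<open>simp add: less_le\<close>)
      then show False by simp
    qed
    then show ?case using evidence_nonneg[of v] by simp
  qed
qed

lemma outcome_law: "distr M (coords J) (outcome a) = density (gau J a) (\<lambda>v. ennreal (evidence M J X a v))"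
proof (rule measure_eqI)
  have [measurable]: "evidence M J X a \<in> borel_measurable (coords J)" by (rule evidence_measurable[OF a])
  fix B assume "B \<in> sets (distr M (coords J) (outcome a))"
  then have B [measurable]: "B \<in> sets (coords J)" by simp
  have intE: "integrable (gau J a) (evidence M J X a)"
    using weighted_lik(2)[OF a, of "\<lambda>_. 1"] by (simp add: evidence_def[abs_def])
  have "measure M (outcome a -` B \<inter> space M) = expectation (\<lambda>th. (1::real) * indicator B (outcome a th))"
  proof -
    have "expectation (\<lambda>th. (1::real) * indicator B (outcome a th)) = expectation (indicator (outcome a -` B \<inter> space M))"
      by (intro lint_cong) (auto simp: indicator_def)
    then show ?thesis by simp
  qed
  also have "\<dots> = (LINT v|(gau J a). indicator B v * (LINT th|M. 1 * lik J X a v th))"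
    by (rule outcome_integral[of "\<lambda>_. 1" "indicator B" 1]) auto
  also have "\<dots> = (LINT v|(gau J a). evidence M J X a v * indicator B v)" by (simp add: evidence_def mult.commute)
  finally have m: "measure M (outcome a -` B \<inter> space M) = (LINT v|(gau J a). evidence M J X a v * indicator B v)" .
  have "emeasure (distr M (coords J) (outcome a)) B = emeasure M (outcome a -` B \<inter> space M)"
    by (rule emeasure_distr) measurable
  also have "\<dots> = ennreal (LINT v|(gau J a). evidence M J X a v * indicator B v)"
    by (simp add: emeasure_eq_measure m)
  also have "\<dots> = (\<integral>\<^sup>+v. ennreal (evidence M J X a v * indicator B v) \<partial>gau J a)"
    using intE evidence_nonneg by (intro nn_integral_eq_integral[symmetric] integrable_real_mult_indicator) auto
  also have "\<dots> = emeasure (density (gau J a) (\<lambda>v. ennreal (evidence M J X a v))) B"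
    by (subst emeasure_density) (auto intro!: nn_integral_cong simp: indicator_def)
  finally show "emeasure (distr M (coords J) (outcome a)) B = emeasure (density (gau J a) (\<lambda>v. ennreal (evidence M J X a v))) B" .
qed simp

lemma estimate_measurable [measurable]: "i \<in> J \<Longrightarrow> estimate a i \<in> borel_measurable M"
proof -
  assume i: "i \<in> J"
  have [measurable]: "evidence M J X a \<in> borel_measurable (coords J)" "numer M J X a i \<in> borel_measurable (coords J)"
    using evidence_measurable[OF a] numer_measurable[OF a i] by auto
  show ?thesis unfolding estimate_def by measurable
qed

lemma estimate_sq:
  assumes i: "i \<in> J"
  shows "integrable M (\<lambda>th. (estimate a i th)\<^sup>2)" "expectation (\<lambda>th. (estimate a i th)\<^sup>2) = explained M J X {i} a"
proof -
  have [measurable]: "evidence M J X a \<in> borel_measurable (coords J)" "numer M J X a i \<in> borel_measurable (coords J)"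
    using evidence_measurable[OF a] numer_measurable[OF a i] by auto
  define g where "g v = (numer M J X a i v / evidence M J X a v)\<^sup>2" for v
  have [measurable]: "g \<in> borel_measurable (coords J)" unfolding g_def by measurable
  have Zg: "evidence M J X a v * g v = (\<Sum>i\<in>{i}. (numer M J X a i v)\<^sup>2) / evidence M J X a v" for v
    by (simp add: g_def power2_eq_square)
  obtain n where n: "0 < prob (trunc (real n))" using trunc_prob_eventually by (auto simp: eventually_sequentially)
  have int: "integrable (gau J a) (\<lambda>v. evidence M J X a v * g v)"
    unfolding Zg using i by (intro explained_integrable[OF _ n a]) auto
  have "integrable (distr M (coords J) (outcome a)) g"
    unfolding outcome_law using int evidence_nonneg by (subst integrable_density) auto
  then show "integrable M (\<lambda>th. (estimate a i th)\<^sup>2)"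
    by (subst (asm) integrable_distr_eq) (auto simp: g_def estimate_def)
  have "expectation (\<lambda>th. (estimate a i th)\<^sup>2) = integral\<^sup>L (distr M (coords J) (outcome a)) g"
    by (subst integral_distr) (auto simp: g_def estimate_def)
  also have "\<dots> = (LINT v|(gau J a). evidence M J X a v *\<^sub>R g v)"
    unfolding outcome_law using evidence_nonneg by (intro integral_density) auto
  also have "\<dots> = explained M J X {i} a" by (simp only: real_scaleR_def Zg explained_def)
  finally show "expectation (\<lambda>th. (estimate a i th)\<^sup>2) = explained M J X {i} a" .
qed

lemma estimate_orthogonal_bounded:
  assumes i: "i \<in> J" and h [measurable]: "h \<in> borel_measurable (coords J)" and hC: "\<And>v. \<bar>h v\<bar> \<le> C"
  shows "expectation (\<lambda>th. X i th * h (outcome a th)) = expectation (\<lambda>th. estimate a i th * h (outcome a th))"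
proof -
  have [measurable]: "evidence M J X a \<in> borel_measurable (coords J)" "numer M J X a i \<in> borel_measurable (coords J)"
    using evidence_measurable[OF a] numer_measurable[OF a i] by auto
  have Xi: "X i = (\<lambda>th. \<xi> i (x th))" using X_eq[OF i] by auto
  have "expectation (\<lambda>th. X i th * h (outcome a th)) = (LINT v|(gau J a). h v * numer M J X a i v)"
    using outcome_integral[of "\<xi> i" h C] i X_integrable(1)[OF i] hC by (simp add: Xi numer_def \<xi>)
  also have "\<dots> = (LINT v|(gau J a). evidence M J X a v *\<^sub>R (numer M J X a i v / evidence M J X a v * h v))"
    using evidence_pos_AE by (intro integral_cong_AE) (auto elim!: eventually_mono)
  also have "\<dots> = integral\<^sup>L (distr M (coords J) (outcome a)) (\<lambda>v. numer M J X a i v / evidence M J X a v * h v)"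
    unfolding outcome_law using evidence_nonneg by (intro integral_density[symmetric]) auto
  also have "\<dots> = expectation (\<lambda>th. estimate a i th * h (outcome a th))"
    by (subst integral_distr) (auto simp: estimate_def)
  finally show ?thesis .
qed

text \<open>
  The analytic quantity \<open>explained\<close> is the power of the estimates: integrate their
  squares against the law of the outcome, which has density \<open>evidence\<close>.
\<close>

lemma explained_eq_sum_estimate_sq:
  assumes S: "S \<subseteq> J"
  shows "explained M J X S a = (\<Sum>i\<in>S. expectation (\<lambda>th. (estimate a i th)\<^sup>2))"
proof -
  obtain n where n: "0 < prob (trunc (real n))" using trunc_prob_eventually by (auto simp: eventually_sequentially)
  have int: "integrable (gau J a) (\<lambda>v. (numer M J X a i v)\<^sup>2 / evidence M J X a v)" if "i \<in> S" for i
    using explained_integrable[OF _ n a, of "{i}"] that S by auto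
  have "explained M J X S a = (LINT v|(gau J a). (\<Sum>i\<in>S. (numer M J X a i v)\<^sup>2 / evidence M J X a v))"
    by (simp add: explained_def sum_divide_distrib)
  also have "\<dots> = (\<Sum>i\<in>S. explained M J X {i} a)"
    using int by (subst lint_sum) (auto simp: explained_def)
  also have "\<dots> = (\<Sum>i\<in>S. expectation (\<lambda>th. (estimate a i th)\<^sup>2))"
    using S by (intro sum.cong refl) (simp add: estimate_sq(2) subset_eq)
  finally show ?thesis .
qed

end

end

section \<open>Conditional expectations of square integrable variables\<close>

text \<open>
  Measurability with respect to such an algebra is not affected by changes on null sets.
\<close>

definition full_subalgebra :: "'a measure \<Rightarrow> 'a measure \<Rightarrow> bool" where
  "full_subalgebra M F \<longleftrightarrow> subalgebra M F \<and> null_sets M \<subseteq> sets F"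

lemma AE_eq_measurable:
  fixes f :: "'a \<Rightarrow> 'b::topological_space"
  assumes F: "full_subalgebra M F" and f: "f \<in> borel_measurable M" and g: "g \<in> borel_measurable F"
    and ae: "AE x in M. f x = g x"
  shows "f \<in> borel_measurable F"
proof -
  have sp: "space F = space M" and sub: "sets F \<subseteq> sets M" and nul: "null_sets M \<subseteq> sets F"
    using F by (auto simp: full_subalgebra_def subalgebra_def)
  obtain N where N: "N \<in> null_sets M" "{x \<in> space M. f x \<noteq> g x} \<subseteq> N" using ae unfolding eventually_ae_filter by auto
  show ?thesis
  proof (rule measurableI)
    fix B :: "'b set" assume B: "B \<in> sets borel"
    have "f -` B \<inter> space M \<inter> N \<in> null_sets M"
      using N(1) measurable_sets[OF f B] by (intro null_set_Int1) auto
    then have 1: "f -` B \<inter> space M \<inter> N \<in> sets F" using nul by auto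
    have 2: "g -` B \<inter> space F - N \<in> sets F" using measurable_sets[OF g B] N(1) nul by auto
    have "f -` B \<inter> space F = (g -` B \<inter> space F - N) \<union> (f -` B \<inter> space M \<inter> N)"
      using N(2) sp by auto
    then show "f -` B \<inter> space F \<in> sets F" using 1 2 by auto
  qed (simp add: sp)
qed

lemma AE_limit_measurable:
  fixes f :: "'a \<Rightarrow> 'b::{banach, second_countable_topology}"
  assumes F: "full_subalgebra M F" and f: "f \<in> borel_measurable M" and s: "\<And>n. s n \<in> borel_measurable F"
    and lim: "AE x in M. (\<lambda>n. s n x) \<longlonglongrightarrow> f x"
  shows "f \<in> borel_measurable F"
proof (rule AE_eq_measurable[OF F f])
  show "(\<lambda>x. lim (\<lambda>n. s n x)) \<in> borel_measurable F" using s by (rule borel_measurable_lim_metric)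
  show "AE x in M. f x = lim (\<lambda>n. s n x)" using lim by eventually_elim (simp add: limI)
qed

context prob_space
begin

abbreviation mean_square :: "('a \<Rightarrow> 'h::real_normed_vector) \<Rightarrow> real" where
  "mean_square u \<equiv> expectation (\<lambda>th. (norm (u th))\<^sup>2)"

lemma L2_measurable_projection:
  fixes h :: "'a \<Rightarrow> 'h::{banach, real_inner, second_countable_topology}"
  assumes F: "full_subalgebra M F" and h: "h \<in> L2 M"
  shows "\<exists>z. is_L2_projection M {u \<in> L2 M. u \<in> borel_measurable F} h z"
proof (rule L2_projection_exists)
  have "(\<lambda>_. 0) \<in> {u \<in> L2 M. u \<in> borel_measurable F}" by (simp add: L2_def)
  then show "{u \<in> L2 M. u \<in> borel_measurable F} \<noteq> {}" by blast
qed (auto intro: L2_add L2_scaleR AE_limit_measurable[OF F] L2_measurable h)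

text \<open>
  The coordinates of a projection on measurable vectors are the scalar conditional expectations of the
  coordinates. This reduces Hilbert space valued estimation to scalar conditional expectations.
\<close>

lemma projection_real_cond_exp:
  fixes h :: "'a \<Rightarrow> 'h::{banach, real_inner, second_countable_topology}"
  assumes F: "full_subalgebra M F" and h: "h \<in> L2 M"
    and z: "is_L2_projection M {u \<in> L2 M. u \<in> borel_measurable F} h z"
  shows "AE th in M. real_cond_exp M F (\<lambda>th. h th \<bullet> c) th = z th \<bullet> c"
proof -
  have sub: "subalgebra M F" using F by (simp add: full_subalgebra_def)
  interpret finite_measure_subalgebra M F by unfold_locales (rule sub)
  have zL: "z \<in> L2 M" and zF [measurable]: "z \<in> borel_measurable F"
    and orth: "\<And>u. u \<in> L2 M \<Longrightarrow> u \<in> borel_measurable F \<Longrightarrow> expectation (\<lambda>th. (h th - z th) \<bullet> u th) = 0"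
    using z by (auto simp: is_L2_projection_def)
  have cL: "(\<lambda>_. c) \<in> L2 M" by (simp add: L2_def)
  note inth = L2_inner_integrable[OF h cL] and intz = L2_inner_integrable[OF zL cL]
  show ?thesis
  proof (rule real_cond_exp_charact)
    fix A assume A [measurable]: "A \<in> sets F"
    have AM [measurable]: "A \<in> sets M" using A sub by (auto simp: subalgebra_def)
    have u: "(\<lambda>th. indicator A th *\<^sub>R c) \<in> L2 M"
    proof -
      have "(norm (indicator A th *\<^sub>R c))\<^sup>2 = indicator A th *\<^sub>R (norm c)\<^sup>2" for th by (simp add: indicator_def)
      then show ?thesis by (simp add: L2_def emeasure_eq_measure)
    qed
    have "expectation (\<lambda>th. (h th - z th) \<bullet> (indicator A th *\<^sub>R c)) = 0" by (intro orth u) measurable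
    moreover have "expectation (\<lambda>th. (h th - z th) \<bullet> (indicator A th *\<^sub>R c))
       = expectation (\<lambda>th. indicator A th *\<^sub>R (h th \<bullet> c) - indicator A th *\<^sub>R (z th \<bullet> c))"
      by (simp add: inner_diff_left right_diff_distrib)
    moreover have "\<dots> = (\<integral>th\<in>A. h th \<bullet> c \<partial>M) - (\<integral>th\<in>A. z th \<bullet> c \<partial>M)"
      unfolding set_lebesgue_integral_def
      using integrable_mult_indicator[OF AM inth] integrable_mult_indicator[OF AM intz]
      by (rule Bochner_Integration.integral_diff)
    ultimately show "(\<integral>th\<in>A. h th \<bullet> c \<partial>M) = (\<integral>th\<in>A. z th \<bullet> c \<partial>M)" by simp
  qed (use inth intz in auto)
qed

lemma real_cond_exp_L2:
  fixes \<phi> :: "'a \<Rightarrow> real"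
  assumes F: "full_subalgebra M F" and \<phi>: "\<phi> \<in> L2 M"
  shows "real_cond_exp M F \<phi> \<in> L2 M"
proof -
  have sub: "subalgebra M F" using F by (simp add: full_subalgebra_def)
  obtain z where z: "is_L2_projection M {u \<in> L2 M. u \<in> borel_measurable F} \<phi> z"
    using L2_measurable_projection[OF F \<phi>] by blast
  have zL: "z \<in> L2 M" using z by (simp add: is_L2_projection_def)
  have "AE th in M. real_cond_exp M F \<phi> th = z th"
    using projection_real_cond_exp[OF F \<phi> z, of 1] by simp
  then have "AE th in M. z th = real_cond_exp M F \<phi> th" by eventually_elim simp
  then show ?thesis
    by (rule L2_AE_cong[OF zL measurable_from_subalg[OF sub borel_measurable_cond_exp]])
qed

lemma L2_mult_integrable:
  fixes u v :: "'a \<Rightarrow> real"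
  assumes "u \<in> L2 M" "v \<in> L2 M" shows "integrable M (\<lambda>th. u th * v th)"
  using L2_inner_integrable[OF assms] by (simp add: inner_real_def)

lemma L2_real_iff:
  fixes u :: "'a \<Rightarrow> real"
  shows "u \<in> L2 M \<longleftrightarrow> u \<in> borel_measurable M \<and> integrable M (\<lambda>th. (u th)\<^sup>2)"
  by (simp add: L2_def)

lemma real_cond_exp_mult:
  fixes \<phi> u :: "'a \<Rightarrow> real"
  assumes F: "full_subalgebra M F" and \<phi>: "\<phi> \<in> L2 M" and u: "u \<in> L2 M" "u \<in> borel_measurable F"
  shows "expectation (\<lambda>th. u th * real_cond_exp M F \<phi> th) = expectation (\<lambda>th. u th * \<phi> th)"
proof -
  interpret finite_measure_subalgebra M F by unfold_locales (use F in \<open>simp add: full_subalgebra_def\<close>)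
  show ?thesis
    by (rule real_cond_exp_intg(2)[OF L2_mult_integrable[OF u(1) \<phi>] u(2) L2_measurable[OF \<phi>]])
qed

text \<open>
  Martingale increments are orthogonal to the past.
\<close>

lemma real_cond_exp_sq_increment:
  fixes \<phi> :: "'a \<Rightarrow> real"
  assumes F: "full_subalgebra M F" and G: "full_subalgebra M G" and FG: "sets F \<subseteq> sets G" and \<phi>: "\<phi> \<in> L2 M"
  shows "expectation (\<lambda>th. (real_cond_exp M G \<phi> th - real_cond_exp M F \<phi> th)\<^sup>2)
    = expectation (\<lambda>th. (real_cond_exp M G \<phi> th)\<^sup>2) - expectation (\<lambda>th. (real_cond_exp M F \<phi> th)\<^sup>2)"
proof -
  let ?f = "real_cond_exp M F \<phi>" and ?g = "real_cond_exp M G \<phi>"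
  note f = real_cond_exp_L2[OF F \<phi>] and g = real_cond_exp_L2[OF G \<phi>]
  have "?f \<in> borel_measurable F" by simp
  moreover have "subalgebra G F" using F G FG by (auto simp: full_subalgebra_def subalgebra_def)
  ultimately have fG: "?f \<in> borel_measurable G" by (rule measurable_from_subalg[rotated])
  have 1: "expectation (\<lambda>th. ?f th * ?g th) = expectation (\<lambda>th. ?f th * \<phi> th)" by (rule real_cond_exp_mult[OF G \<phi> f fG])
  have 2: "expectation (\<lambda>th. ?f th * ?f th) = expectation (\<lambda>th. ?f th * \<phi> th)"
    by (rule real_cond_exp_mult[OF F \<phi> f]) simp
  have "expectation (\<lambda>th. (?g th - ?f th)\<^sup>2) = expectation (\<lambda>th. ?g th * ?g th - 2 * (?f th * ?g th) + ?f th * ?f th)"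
    by (intro lint_cong refl) (simp add: power2_eq_square algebra_simps)
  also have "\<dots> = expectation (\<lambda>th. ?g th * ?g th) - 2 * expectation (\<lambda>th. ?f th * ?g th) + expectation (\<lambda>th. ?f th * ?f th)"
    using L2_mult_integrable[OF g g] L2_mult_integrable[OF f g] L2_mult_integrable[OF f f] by simp
  finally show ?thesis using 1 2 by (simp add: power2_eq_square)
qed

lemma real_cond_exp_sq_le:
  fixes \<phi> :: "'a \<Rightarrow> real"
  assumes F: "full_subalgebra M F" and \<phi>: "\<phi> \<in> L2 M"
  shows "expectation (\<lambda>th. (real_cond_exp M F \<phi> th)\<^sup>2) \<le> expectation (\<lambda>th. (\<phi> th)\<^sup>2)"
proof -
  let ?f = "real_cond_exp M F \<phi>"
  note f = real_cond_exp_L2[OF F \<phi>]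
  have 2: "expectation (\<lambda>th. ?f th * ?f th) = expectation (\<lambda>th. ?f th * \<phi> th)"
    by (rule real_cond_exp_mult[OF F \<phi> f]) simp
  have "0 \<le> expectation (\<lambda>th. (\<phi> th - ?f th)\<^sup>2)" by (rule lint_nonneg) simp
  also have "\<dots> = expectation (\<lambda>th. \<phi> th * \<phi> th - 2 * (?f th * \<phi> th) + ?f th * ?f th)"
    by (intro lint_cong refl) (simp add: power2_eq_square algebra_simps)
  also have "\<dots> = expectation (\<lambda>th. \<phi> th * \<phi> th) - 2 * expectation (\<lambda>th. ?f th * \<phi> th) + expectation (\<lambda>th. ?f th * ?f th)"
    using L2_mult_integrable[OF \<phi> \<phi>] L2_mult_integrable[OF f \<phi>] L2_mult_integrable[OF f f] by simp
  finally show ?thesis using 2 by (simp add: power2_eq_square)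
qed

lemma L2_norm_tendsto:
  fixes u :: "nat \<Rightarrow> 'a \<Rightarrow> real"
  assumes u: "\<And>n. u n \<in> L2 M" and z: "z \<in> L2 M"
    and lim: "(\<lambda>n. expectation (\<lambda>th. (u n th - z th)\<^sup>2)) \<longlonglongrightarrow> 0" and v: "v \<in> L2 M"
  shows "(\<lambda>n. expectation (\<lambda>th. u n th * v th)) \<longlonglongrightarrow> expectation (\<lambda>th. z th * v th)"
proof -
  have v0: "0 \<le> expectation (\<lambda>th. (v th)\<^sup>2)" by (rule lint_nonneg) simp
  have bound: "\<bar>expectation (\<lambda>th. u n th * v th) - expectation (\<lambda>th. z th * v th)\<bar>
     \<le> expectation (\<lambda>th. (u n th - z th)\<^sup>2) / (2 * d) + d / 2 * expectation (\<lambda>th. (v th)\<^sup>2)" if d: "d > 0" for n d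
  proof -
    have i: "integrable M (\<lambda>th. (u n th - z th)\<^sup>2)" using L2_diff[OF u z] by (simp add: L2_real_iff)
    have iv: "integrable M (\<lambda>th. (v th)\<^sup>2)" using v by (simp add: L2_real_iff)
    have j: "integrable M (\<lambda>th. (u n th - z th) * v th)" by (rule L2_mult_integrable[OF L2_diff[OF u z] v])
    have "expectation (\<lambda>th. u n th * v th) - expectation (\<lambda>th. z th * v th) = expectation (\<lambda>th. (u n th - z th) * v th)"
      using L2_mult_integrable[OF u v] L2_mult_integrable[OF z v] by (simp add: left_diff_distrib)
    also have "\<bar>\<dots>\<bar> \<le> expectation (\<lambda>th. \<bar>(u n th - z th) * v th\<bar>)" by (rule integral_abs_bound)
    also have "\<dots> \<le> expectation (\<lambda>th. (u n th - z th)\<^sup>2 / (2 * d) + d / 2 * (v th)\<^sup>2)"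
    proof (rule integral_mono)
      show "integrable M (\<lambda>th. \<bar>(u n th - z th) * v th\<bar>)" by (rule integrable_abs[OF j])
      show "integrable M (\<lambda>th. (u n th - z th)\<^sup>2 / (2 * d) + d / 2 * (v th)\<^sup>2)" using i iv by simp
      fix th
      define p q where "p = \<bar>u n th - z th\<bar>" and "q = \<bar>v th\<bar>"
      have "p * q \<le> p\<^sup>2 / (2 * d) + d / 2 * q\<^sup>2"
        using sum_squares_bound[of p "d * q"] d by (simp add: power2_eq_square field_simps)
      then show "\<bar>(u n th - z th) * v th\<bar> \<le> (u n th - z th)\<^sup>2 / (2 * d) + d / 2 * (v th)\<^sup>2"
        by (simp add: p_def q_def abs_mult)
    qed
    also have "\<dots> = expectation (\<lambda>th. (u n th - z th)\<^sup>2) / (2 * d) + d / 2 * expectation (\<lambda>th. (v th)\<^sup>2)"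
      using i iv by simp
    finally show ?thesis .
  qed
  show ?thesis
  proof (rule LIMSEQ_I)
    fix e :: real assume e: "e > 0"
    define d where "d = e / (expectation (\<lambda>th. (v th)\<^sup>2) + 1)"
    have "0 < expectation (\<lambda>th. (v th)\<^sup>2) + 1" using v0 by linarith
    then have d: "d > 0" using e unfolding d_def by (rule divide_pos_pos[rotated])
    have dv: "d * expectation (\<lambda>th. (v th)\<^sup>2) \<le> e"
    proof -
      have "d * expectation (\<lambda>th. (v th)\<^sup>2) \<le> d * (expectation (\<lambda>th. (v th)\<^sup>2) + 1)" using d by (intro mult_left_mono) auto
      also have "\<dots> = e" using \<open>0 < expectation (\<lambda>th. (v th)\<^sup>2) + 1\<close> by (simp add: d_def)
      finally show ?thesis .
    qed
    obtain N where N: "\<And>n. n \<ge> N \<Longrightarrow> norm (expectation (\<lambda>th. (u n th - z th)\<^sup>2) - 0) < d * e"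
      using LIMSEQ_D[OF lim, of "d * e"] d e by auto
    show "\<exists>no. \<forall>n\<ge>no. norm (expectation (\<lambda>th. u n th * v th) - expectation (\<lambda>th. z th * v th)) < e"
    proof (intro exI[of _ N] allI impI)
      fix n assume "n \<ge> N"
      then have "expectation (\<lambda>th. (u n th - z th)\<^sup>2) < d * e" using N[of n] by simp
      then have "expectation (\<lambda>th. (u n th - z th)\<^sup>2) / (2 * d) < e / 2" using d by (simp add: field_simps)
      then show "norm (expectation (\<lambda>th. u n th * v th) - expectation (\<lambda>th. z th * v th)) < e"
        using bound[OF d, of n] dv by simp
    qed
  qed
qed

text \<open>
  Martingale convergence in \<open>L\<^sup>2\<close>. The second moments increase and are bounded, so
  by orthogonality of increments the conditional expectations are Cauchy; a Dynkin class argument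
  identifies the limit.
\<close>

lemma cond_exp_sq_tendsto:
  fixes \<phi> :: "'a \<Rightarrow> real" and C :: "nat \<Rightarrow> 'a measure"
  assumes C: "\<And>n. full_subalgebra M (C n)" and F: "full_subalgebra M F"
    and CF: "\<And>n. sets (C n) \<subseteq> sets F" and inc: "\<And>n. sets (C n) \<subseteq> sets (C (Suc n))"
    and gen: "sets F \<subseteq> sigma_sets (space M) (\<Union>n. sets (C n))" and \<phi>: "\<phi> \<in> L2 M"
  shows "(\<lambda>n. expectation (\<lambda>th. (real_cond_exp M (C n) \<phi> th)\<^sup>2)) \<longlonglongrightarrow> expectation (\<lambda>th. (real_cond_exp M F \<phi> th)\<^sup>2)"
proof -
  define Z where "Z n = real_cond_exp M (C n) \<phi>" for n
  define m where "m n = expectation (\<lambda>th. (Z n th)\<^sup>2)" for n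
  have ZL: "Z n \<in> L2 M" for n unfolding Z_def by (rule real_cond_exp_L2[OF C \<phi>])
  have subF: "subalgebra M F" and subC: "subalgebra M (C n)" for n
    using F C by (auto simp: full_subalgebra_def)
  have incn: "sets (C i) \<subseteq> sets (C j)" if "i \<le> j" for i j using lift_Suc_mono_le[of "\<lambda>n. sets (C n)", OF inc that] .
  have incr: "expectation (\<lambda>th. (Z j th - Z i th)\<^sup>2) = m j - m i" if "i \<le> j" for i j
    unfolding Z_def m_def by (rule real_cond_exp_sq_increment[OF C C incn[OF that] \<phi>])
  have mono: "m i \<le> m j" if "i \<le> j" for i j
  proof -
    have "0 \<le> expectation (\<lambda>th. (Z j th - Z i th)\<^sup>2)" by (rule lint_nonneg) simp
    then show ?thesis using incr[OF that] by simp
  qed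
  have "convergent m"
  proof (rule Bseq_mono_convergent)
    show "Bseq m"
    proof (rule BseqI'[of m "expectation (\<lambda>th. (\<phi> th)\<^sup>2)"])
      fix n
      have "0 \<le> m n" unfolding m_def by (rule lint_nonneg) simp
      then show "norm (m n) \<le> expectation (\<lambda>th. (\<phi> th)\<^sup>2)"
        using real_cond_exp_sq_le[OF C[of n] \<phi>] by (simp add: m_def Z_def)
    qed
  qed (use mono in blast)
  then have cau: "Cauchy m" by (rule convergent_Cauchy)
  obtain z r where z: "z \<in> L2 M" and r: "strict_mono r" and lim: "AE th in M. (\<lambda>n. Z (r n) th) \<longlonglongrightarrow> z th"
    and L2lim: "(\<lambda>n. mean_square (\<lambda>th. Z n th - z th)) \<longlonglongrightarrow> 0"
  proof (rule L2_Cauchy_AE_subseq[of Z])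
    fix e :: real assume "e > 0"
    then obtain N where N: "\<And>i j. i \<ge> N \<Longrightarrow> j \<ge> N \<Longrightarrow> norm (m i - m j) < e" using CauchyD[OF cau] by blast
    have "mean_square (\<lambda>th. Z i th - Z j th) = \<bar>m i - m j\<bar>" for i j
    proof (cases "i \<le> j")
      case True
      then show ?thesis using incr[OF True] mono[OF True] by (simp add: power2_commute)
    next
      case False
      then show ?thesis using incr[of j i] mono[of j i] by simp
    qed
    then show "\<exists>N. \<forall>i\<ge>N. \<forall>j\<ge>N. mean_square (\<lambda>th. Z i th - Z j th) < e"
      using N by (intro exI[of _ N]) simp
  qed (use ZL in auto)
  have zM [measurable]: "z \<in> borel_measurable M" using z by (rule L2_measurable)
  have ZF: "Z n \<in> borel_measurable F" for n
  proof -
    have "subalgebra F (C n)" using subF subC[of n] CF[of n] by (auto simp: subalgebra_def)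
    then show ?thesis unfolding Z_def by (rule measurable_from_subalg) simp
  qed
  have zF: "z \<in> borel_measurable F" by (rule AE_limit_measurable[OF F zM ZF lim])
  have L2lim': "(\<lambda>n. expectation (\<lambda>th. (Z n th - z th)\<^sup>2)) \<longlonglongrightarrow> 0" using L2lim by simp
  have ind: "(indicator A :: 'a \<Rightarrow> real) \<in> L2 M" if "A \<in> sets M" for A
    using that by (auto simp: L2_real_iff power2_eq_square indicator_inter_arith[symmetric] emeasure_eq_measure)
  have eqC: "expectation (\<lambda>th. z th * indicator A th) = expectation (\<lambda>th. \<phi> th * indicator A th)" if A: "A \<in> sets (C k)" for A k
  proof -
    have AM: "A \<in> sets M" using A subC[of k] by (auto simp: subalgebra_def)
    have "expectation (\<lambda>th. Z n th * indicator A th) = expectation (\<lambda>th. \<phi> th * indicator A th)" if "n \<ge> k" for n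
    proof -
      have "A \<in> sets (C n)" using A incn[OF that] by auto
      then have "indicator A \<in> borel_measurable (C n)" by simp
      then show ?thesis using real_cond_exp_mult[OF C \<phi> ind[OF AM], of n] by (simp add: Z_def mult.commute)
    qed
    then have "(\<lambda>n. expectation (\<lambda>th. Z n th * indicator A th)) \<longlonglongrightarrow> expectation (\<lambda>th. \<phi> th * indicator A th)"
      by (intro tendsto_eventually) (auto simp: eventually_sequentially)
    then show ?thesis using L2_norm_tendsto[OF ZL z L2lim' ind[OF AM]] LIMSEQ_unique by blast
  qed
  have intm: "integrable M (\<lambda>th. f th * indicator A th)" if "f \<in> L2 M" "A \<in> sets M" for f :: "'a \<Rightarrow> real" and A
    by (rule L2_mult_integrable[OF that(1) ind[OF that(2)]])
  define \<G> where "\<G> = (\<Union>n. sets (C n))"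
  have \<G>M: "\<G> \<subseteq> sets M" using subC by (auto simp: \<G>_def subalgebra_def)
  have "Int_stable \<G>"
  proof (rule Int_stableI)
    fix a b assume "a \<in> \<G>" "b \<in> \<G>"
    then obtain i j where ij: "a \<in> sets (C i)" "b \<in> sets (C j)" by (auto simp: \<G>_def)
    then have "a \<in> sets (C (max i j))" "b \<in> sets (C (max i j))"
      using incn[of i "max i j"] incn[of j "max i j"] by auto
    then have "a \<inter> b \<in> sets (C (max i j))" by blast
    then show "a \<inter> b \<in> \<G>" by (auto simp: \<G>_def)
  qed
  moreover have "\<G> \<subseteq> Pow (space M)" using \<G>M sets.sets_into_space by auto
  ultimately have eq: "expectation (\<lambda>th. z th * indicator A th) = expectation (\<lambda>th. \<phi> th * indicator A th)"
    if "A \<in> sigma_sets (space M) \<G>" for A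
    using that
  proof (induction rule: sigma_sets_induct_disjoint)
    case (basic A)
    then show ?case using eqC by (auto simp: \<G>_def)
  next
    case empty
    then show ?case by simp
  next
    case (compl A)
    have AM: "A \<in> sets M" using compl(1) sets.sigma_sets_subset[OF \<G>M] by auto
    have "space M \<in> sets (C 0)" using sets.top[of "C 0"] subC[of 0] by (metis subalgebra_def)
    note tot = eqC[OF this]
    have *: "expectation (\<lambda>th. f th * indicator (space M - A) th)
       = expectation (\<lambda>th. f th * indicator (space M) th) - expectation (\<lambda>th. f th * indicator A th)" if f: "f \<in> L2 M" for f :: "'a \<Rightarrow> real"
    proof -
      have "expectation (\<lambda>th. f th * indicator (space M - A) th)
        = expectation (\<lambda>th. f th * indicator (space M) th - f th * indicator A th)"
        using sets.sets_into_space[OF AM] by (intro lint_cong refl) (auto simp: indicator_def)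
      then show ?thesis using intm[OF f AM] intm[OF f sets.top] by simp
    qed
    show ?case using compl(2) tot by (simp add: *[OF z] *[OF \<phi>])
  next
    case (union A)
    have AM: "A i \<in> sets M" for i using union(2) sets.sigma_sets_subset[OF \<G>M] by auto
    have *: "expectation (\<lambda>th. f th * indicator (\<Union>i. A i) th) = (\<Sum>i. expectation (\<lambda>th. f th * indicator (A i) th))"
      if f: "f \<in> L2 M" for f :: "'a \<Rightarrow> real"
    proof -
      have "set_integrable M (\<Union>i. A i) f"
        using intm[OF f, of "\<Union>i. A i"] AM by (auto simp: set_integrable_def mult.commute)
      then have "set_lebesgue_integral M (\<Union>i. A i) f = (\<Sum>i. set_lebesgue_integral M (A i) f)"
        using AM union(1) by (intro lebesgue_integral_countable_add) (auto simp: disjoint_family_on_def)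
      then show ?thesis by (simp add: set_lebesgue_integral_def mult.commute)
    qed
    show ?case using union(3) by (simp add: *[OF z] *[OF \<phi>])
  qed
  interpret finite_measure_subalgebra M F by unfold_locales (rule subF)
  have "AE th in M. real_cond_exp M F \<phi> th = z th"
  proof (rule real_cond_exp_charact)
    fix A assume "A \<in> sets F"
    then have "A \<in> sigma_sets (space M) \<G>" using gen by (auto simp: \<G>_def)
    then show "(\<integral>th\<in>A. \<phi> th \<partial>M) = (\<integral>th\<in>A. z th \<partial>M)"
      using eq[of A] by (simp add: set_lebesgue_integral_def mult.commute)
  qed (auto intro: L2_imp_integrable \<phi> z zF)
  then have Ez: "expectation (\<lambda>th. (real_cond_exp M F \<phi> th)\<^sup>2) = expectation (\<lambda>th. (z th)\<^sup>2)"
    using subF by (intro integral_cong_AE) (auto elim!: eventually_mono intro: measurable_from_subalg)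
  have "(\<lambda>n. expectation (\<lambda>th. (Z n th - z th)\<^sup>2) + 2 * expectation (\<lambda>th. Z n th * z th) - expectation (\<lambda>th. z th * z th))
     \<longlonglongrightarrow> 0 + 2 * expectation (\<lambda>th. z th * z th) - expectation (\<lambda>th. z th * z th)"
    by (intro tendsto_intros L2lim' L2_norm_tendsto[OF ZL z L2lim' z])
  moreover have "expectation (\<lambda>th. (Z n th - z th)\<^sup>2) + 2 * expectation (\<lambda>th. Z n th * z th) - expectation (\<lambda>th. z th * z th) = m n" for n
  proof -
    have "expectation (\<lambda>th. (Z n th - z th)\<^sup>2) = expectation (\<lambda>th. Z n th * Z n th - 2 * (Z n th * z th) + z th * z th)"
      by (intro lint_cong refl) (simp add: power2_eq_square algebra_simps)
    also have "\<dots> = expectation (\<lambda>th. Z n th * Z n th) - 2 * expectation (\<lambda>th. Z n th * z th) + expectation (\<lambda>th. z th * z th)"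
      using L2_mult_integrable[OF ZL ZL] L2_mult_integrable[OF ZL z] L2_mult_integrable[OF z z] by simp
    finally show ?thesis by (simp add: m_def power2_eq_square)
  qed
  ultimately show ?thesis unfolding Ez m_def Z_def by (simp add: power2_eq_square)
qed

end

section \<open>White noise indexed by a dense subspace\<close>

text \<open>
  White noise \<open>W\<close> indexed by a dense subspace \<open>D\<close> of the signal space: a
  linear map of \<open>D\<close> into centered Gaussian variables with variance \<open>(norm
  h)\<^sup>2\<close>. The Gaussian property is recorded by the values of the characteristic function,
  and independence of \<open>x\<close> on finite families of coordinates. These families are indexed
  by pairs, since below a coordinate is given by a cell of a partition and a number within this cell.
\<close>

locale wiener_channel = prob_space M for M :: "'a measure" +
  fixes D :: "'h::{banach, real_inner, second_countable_topology} set"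
    and W :: "'h \<Rightarrow> 'a \<Rightarrow> real" and x :: "'a \<Rightarrow> 'h"
  assumes D: "subspace D" and D_dense: "closure D = UNIV"
    and W_L2: "\<And>h. h \<in> D \<Longrightarrow> W h \<in> L2 M"
    and W_add: "\<And>h k th. h \<in> D \<Longrightarrow> k \<in> D \<Longrightarrow> W (h + k) th = W h th + W k th"
    and W_scale: "\<And>h c th. h \<in> D \<Longrightarrow> W (c *\<^sub>R h) th = c * W h th"
    and W_sq: "\<And>h. h \<in> D \<Longrightarrow> expectation (\<lambda>th. (W h th)\<^sup>2) = (norm h)\<^sup>2"
    and W_cos: "\<And>h. h \<in> D \<Longrightarrow> expectation (\<lambda>th. cos (W h th)) = exp (- (norm h)\<^sup>2 / 2)"
    and W_sin: "\<And>h. h \<in> D \<Longrightarrow> expectation (\<lambda>th. sin (W h th)) = 0"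
    and x: "x \<in> L2 M"
    and indep: "\<And>(J :: (nat \<times> nat) set) e A B. finite J \<Longrightarrow> (\<And>j. j \<in> J \<Longrightarrow> e j \<in> D) \<Longrightarrow> A \<in> sets borel \<Longrightarrow>
      B \<in> sets (coords J) \<Longrightarrow>
      prob ((x -` A \<inter> space M) \<inter> ((\<lambda>th. \<lambda>j\<in>J. W (e j) th) -` B \<inter> space M))
        = prob (x -` A \<inter> space M) * prob ((\<lambda>th. \<lambda>j\<in>J. W (e j) th) -` B \<inter> space M)"
begin

lemma xM [measurable]: "x \<in> borel_measurable M" using x by (rule L2_measurable)

lemma WM: "h \<in> D \<Longrightarrow> W h \<in> borel_measurable M" using W_L2 L2_measurable by blast

definition obs :: "real \<Rightarrow> 'h \<Rightarrow> 'a \<Rightarrow> real" where "obs \<gamma> h th = sqrt \<gamma> * (x th \<bullet> h) + W h th"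

definition filt :: "real \<Rightarrow> 'h set \<Rightarrow> 'a measure" where
  "filt \<gamma> S = sigma (space M) ({obs \<gamma> h -` B \<inter> space M | h B. h \<in> S \<and> B \<in> sets borel} \<union> null_sets M)"

lemma obs_measurable: "h \<in> D \<Longrightarrow> obs \<gamma> h \<in> borel_measurable M"
proof -
  assume "h \<in> D"
  then have [measurable]: "W h \<in> borel_measurable M" by (rule WM)
  show ?thesis unfolding obs_def by measurable
qed

lemma obs_add: "h \<in> D \<Longrightarrow> k \<in> D \<Longrightarrow> obs \<gamma> (h + k) th = obs \<gamma> h th + obs \<gamma> k th"
  by (simp add: obs_def W_add inner_add_right algebra_simps)

lemma obs_scale: "h \<in> D \<Longrightarrow> obs \<gamma> (c *\<^sub>R h) th = c * obs \<gamma> h th"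
  by (simp add: obs_def W_scale algebra_simps)

lemma W_zero: "W 0 th = 0"
  using W_scale[OF subspace_0[OF D], of 0] by simp

lemma W_diff: "h \<in> D \<Longrightarrow> k \<in> D \<Longrightarrow> W (h - k) th = W h th - W k th"
  using W_add[of h "(-1) *\<^sub>R k"] W_scale[of k "-1"] subspace_scale[OF D, of k "-1"] by simp

lemma W_sum: "finite J \<Longrightarrow> (\<And>j. j \<in> J \<Longrightarrow> e j \<in> D) \<Longrightarrow> W (\<Sum>j\<in>J. c j *\<^sub>R e j) th = (\<Sum>j\<in>J. c j * W (e j) th)"
proof (induction J rule: finite_induct)
  case (insert j J)
  have "(\<Sum>j\<in>J. c j *\<^sub>R e j) \<in> D" using insert.prems by (intro subspace_sum[OF D] subspace_scale[OF D]) auto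
  then show ?case using insert by (simp add: W_add W_scale subspace_scale[OF D])
qed (simp add: W_zero)

context
  fixes S :: "'h set" and \<gamma> :: real
  assumes S: "S \<subseteq> D"
begin

lemma filt_generators: "{obs \<gamma> h -` B \<inter> space M | h B. h \<in> S \<and> B \<in> sets borel} \<union> null_sets M \<subseteq> sets M"
  using S measurable_sets[OF obs_measurable] by (auto simp: null_sets_def)

lemma filt_generators_Pow: "{obs \<gamma> h -` B \<inter> space M | h B. h \<in> S \<and> B \<in> sets borel} \<union> null_sets M \<subseteq> Pow (space M)"
  using filt_generators sets.sets_into_space by blast

lemma space_filt: "space (filt \<gamma> S) = space M"
  unfolding filt_def by (rule space_measure_of[OF filt_generators_Pow])

lemma sets_filt: "sets (filt \<gamma> S) = sigma_sets (space M) ({obs \<gamma> h -` B \<inter> space M | h B. h \<in> S \<and> B \<in> sets borel} \<union> null_sets M)"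
  unfolding filt_def by (rule sets_measure_of[OF filt_generators_Pow])

lemma filt_full: "full_subalgebra M (filt \<gamma> S)"
proof -
  have "sets (filt \<gamma> S) \<subseteq> sets M" unfolding sets_filt by (rule sets.sigma_sets_subset[OF filt_generators])
  moreover have "null_sets M \<subseteq> sets (filt \<gamma> S)" unfolding sets_filt by auto
  ultimately show ?thesis using space_filt by (simp add: full_subalgebra_def subalgebra_def)
qed

lemma obs_filt: "h \<in> S \<Longrightarrow> obs \<gamma> h \<in> borel_measurable (filt \<gamma> S)"
proof (rule measurableI)
  fix B :: "real set" assume "h \<in> S" "B \<in> sets borel"
  then show "obs \<gamma> h -` B \<inter> space (filt \<gamma> S) \<in> sets (filt \<gamma> S)"
    unfolding sets_filt space_filt by (intro sigma_sets.Basic) blast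
qed simp

lemma filt_least:
  assumes F: "full_subalgebra M F" and obs: "\<And>h. h \<in> S \<Longrightarrow> obs \<gamma> h \<in> borel_measurable F"
  shows "sets (filt \<gamma> S) \<subseteq> sets F"
proof -
  have sp: "space F = space M" using F by (simp add: full_subalgebra_def subalgebra_def)
  show ?thesis unfolding sets_filt sp[symmetric]
    using F measurable_sets[OF obs] by (intro sets.sigma_sets_subset) (auto simp: full_subalgebra_def)
qed

lemma obs_span: "h \<in> span S \<Longrightarrow> obs \<gamma> h \<in> borel_measurable (filt \<gamma> S)"
proof -
  let ?V = "{h \<in> D. obs \<gamma> h \<in> borel_measurable (filt \<gamma> S)}"
  have "obs \<gamma> 0 = (\<lambda>_. 0)" by (simp add: obs_def W_zero fun_eq_iff)
  moreover have "obs \<gamma> (h + k) = (\<lambda>th. obs \<gamma> h th + obs \<gamma> k th)" if "h \<in> D" "k \<in> D" for h k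
    using that by (simp add: obs_add fun_eq_iff)
  moreover have "obs \<gamma> (c *\<^sub>R h) = (\<lambda>th. c * obs \<gamma> h th)" if "h \<in> D" for h c
    using that by (simp add: obs_scale fun_eq_iff)
  ultimately have "subspace ?V"
    using subspace_0[OF D] subspace_add[OF D] subspace_scale[OF D] by (auto simp: subspace_def)
  moreover have "S \<subseteq> ?V" using S obs_filt by auto
  ultimately have "span S \<subseteq> ?V" by (intro span_minimal)
  then show "h \<in> span S \<Longrightarrow> obs \<gamma> h \<in> borel_measurable (filt \<gamma> S)" by auto
qed

end

lemma filt_mono: "S \<subseteq> S' \<Longrightarrow> S' \<subseteq> D \<Longrightarrow> sets (filt \<gamma> S) \<subseteq> sets (filt \<gamma> S')"
  by (intro filt_least filt_full obs_filt) auto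

text \<open>
  By the isometry \<open>W_sq\<close>, convergence in \<open>D\<close> entails convergence of the
  noise in the mean, and so almost surely along a subsequence.
\<close>

lemma obs_limit:
  assumes F: "full_subalgebra M F" and hD: "\<And>n. h n \<in> D" "l \<in> D" and lim: "h \<longlonglongrightarrow> l"
    and obs: "\<And>n. obs \<gamma> (h n) \<in> borel_measurable F"
  shows "obs \<gamma> l \<in> borel_measurable F"
proof -
  define u where "u n th = W (h n - l) th" for n th
  have uD: "h n - l \<in> D" for n using hD by (intro subspace_diff[OF D])
  have uL: "u n \<in> L2 M" for n unfolding u_def[abs_def] by (rule W_L2[OF uD])
  have usq: "expectation (\<lambda>th. (u n th)\<^sup>2) = (norm (h n - l))\<^sup>2" for n by (simp add: u_def W_sq uD)
  have u_int: "integrable M (u n)" for n by (rule L2_imp_integrable[OF uL])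
  have le: "expectation (\<lambda>th. norm (u n th)) \<le> norm (h n - l)" for n
  proof -
    have "integrable M (\<lambda>th. \<bar>u n th\<bar>)" "integrable M (\<lambda>th. \<bar>u n th\<bar>\<^sup>2)"
      using u_int[of n] uL[of n] by (simp_all add: L2_real_iff)
    then have "(expectation (\<lambda>th. \<bar>u n th\<bar>))\<^sup>2 \<le> expectation (\<lambda>th. \<bar>u n th\<bar>\<^sup>2)"
      using variance_eq[of "\<lambda>th. \<bar>u n th\<bar>"] variance_positive[of "\<lambda>th. \<bar>u n th\<bar>"] by linarith
    then have "(expectation (\<lambda>th. \<bar>u n th\<bar>))\<^sup>2 \<le> (norm (h n - l))\<^sup>2" using usq[of n] by simp
    then have "expectation (\<lambda>th. \<bar>u n th\<bar>) \<le> norm (h n - l)" by (rule power2_le_imp_le) simp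
    then show ?thesis by simp
  qed
  have "(\<lambda>n. expectation (\<lambda>th. norm (u n th))) \<longlonglongrightarrow> 0"
  proof (rule Lim_null_comparison)
    show "(\<lambda>n. norm (h n - l)) \<longlonglongrightarrow> 0" by (rule tendsto_norm_zero[OF LIM_zero[OF lim]])
    have "norm (expectation (\<lambda>th. norm (u n th))) \<le> norm (h n - l)" for n
      using le[of n] by (subst real_norm_def, subst abs_of_nonneg) (auto intro: lint_nonneg)
    then show "\<forall>\<^sub>F n in sequentially. norm (expectation (\<lambda>th. norm (u n th))) \<le> norm (h n - l)" by simp
  qed
  then obtain r where r: "strict_mono r" and "AE th in M. (\<lambda>n. u (r n) th) \<longlonglongrightarrow> 0"
    using tendsto_L1_AE_subseq[of M u, OF u_int] by blast
  from this(2) have "AE th in M. (\<lambda>n. obs \<gamma> (h (r n)) th) \<longlonglongrightarrow> obs \<gamma> l th"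
  proof eventually_elim
    case (elim th)
    have "(\<lambda>n. sqrt \<gamma> * (x th \<bullet> h (r n)) + (u (r n) th + W l th)) \<longlonglongrightarrow> sqrt \<gamma> * (x th \<bullet> l) + (0 + W l th)"
      using elim LIMSEQ_subseq_LIMSEQ[OF lim r] by (intro tendsto_intros) (auto simp: comp_def)
    then show ?case using hD by (simp add: obs_def u_def W_diff)
  qed
  then show ?thesis by (rule AE_limit_measurable[OF F obs_measurable[OF hD(2)] obs])
qed

context
  fixes J :: "(nat \<times> nat) set" and e :: "nat \<times> nat \<Rightarrow> 'h"
  assumes J: "finite J" and eD: "\<And>j. j \<in> J \<Longrightarrow> e j \<in> D"
    and orth: "\<And>i j. i \<in> J \<Longrightarrow> j \<in> J \<Longrightarrow> e i \<bullet> e j = (if i = j then 1 else 0)"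
begin

lemma norm_sum_sq: "(norm (\<Sum>j\<in>J. c j *\<^sub>R e j))\<^sup>2 = (\<Sum>j\<in>J. (c j)\<^sup>2)"
proof -
  have "(norm (\<Sum>j\<in>J. c j *\<^sub>R e j))\<^sup>2 = (\<Sum>j\<in>J. c j * ((\<Sum>i\<in>J. c i *\<^sub>R e i) \<bullet> e j))"
    by (simp add: power2_norm_eq_inner inner_sum_right)
  also have "\<dots> = (\<Sum>j\<in>J. c j * c j)"
  proof (rule sum.cong[OF refl])
    fix j assume j: "j \<in> J"
    have "(\<Sum>i\<in>J. c i *\<^sub>R e i) \<bullet> e j = (\<Sum>i\<in>J. if i = j then c i else 0)"
      unfolding inner_sum_left using j by (intro sum.cong refl) (simp add: orth)
    also have "\<dots> = c j" using j J by simp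
    finally show "c j * ((\<Sum>i\<in>J. c i *\<^sub>R e i) \<bullet> e j) = c j * c j" by simp
  qed
  finally show ?thesis by (simp add: power2_eq_square)
qed

lemma bessel: "(\<Sum>j\<in>J. (h \<bullet> e j)\<^sup>2) \<le> (norm h)\<^sup>2"
proof -
  let ?p = "\<Sum>j\<in>J. (h \<bullet> e j) *\<^sub>R e j"
  have "h \<bullet> ?p = (\<Sum>j\<in>J. (h \<bullet> e j)\<^sup>2)" by (simp add: inner_sum_right power2_eq_square)
  moreover have "(norm (h - ?p))\<^sup>2 = (norm h)\<^sup>2 - 2 * (h \<bullet> ?p) + (norm ?p)\<^sup>2"
    by (simp add: power2_norm_eq_inner inner_diff_left inner_diff_right inner_commute)
  moreover have "0 \<le> (norm (h - ?p))\<^sup>2" by simp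
  ultimately show ?thesis using norm_sum_sq[of "\<lambda>j. h \<bullet> e j"] by linarith
qed

text \<open>
  Linear combinations of the coordinates are again values of \<open>W\<close>, with known
  characteristic function.
\<close>

lemma noise_law: "distr M (coords J) (\<lambda>th. \<lambda>j\<in>J. W (e j) th) = gau J (\<lambda>_. 1)"
proof (rule standard_normal_vector_law[OF J prob_space_axioms])
  have inD: "(\<Sum>j\<in>J. t j *\<^sub>R e j) \<in> D" for t using eD by (intro subspace_sum[OF D] subspace_scale[OF D])
  show "expectation (\<lambda>th. cos (\<Sum>j\<in>J. t j * W (e j) th)) = exp (- (\<Sum>j\<in>J. (t j)\<^sup>2) / 2)" for t
    using W_cos[OF inD[of t]] by (simp add: W_sum[OF J eD] norm_sum_sq)
  show "expectation (\<lambda>th. sin (\<Sum>j\<in>J. t j * W (e j) th)) = 0" for t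
    using W_sin[OF inD[of t]] by (simp add: W_sum[OF J eD])
qed (use WM eD in auto)

lemma noise_vector_measurable: "(\<lambda>th. \<lambda>j\<in>J. W (e j) th) \<in> measurable M (coords J)"
  using WM eD by (intro measurable_restrict) auto

lemma joint_law:
  "distr M (borel \<Otimes>\<^sub>M coords J) (\<lambda>th. (x th, \<lambda>j\<in>J. W (e j) th)) = distr M borel x \<Otimes>\<^sub>M gau J (\<lambda>_. 1)"
proof (rule pair_measure_eqI[symmetric])
  interpret X: prob_space "distr M borel x" by (rule prob_space_distr) simp
  interpret G: prob_space "gau J (\<lambda>_. 1)" by (rule prob_space_gau)
  show "sigma_finite_measure (distr M borel x)" "sigma_finite_measure (gau J (\<lambda>_. 1))" by unfold_locales
  show "sets (distr M borel x \<Otimes>\<^sub>M gau J (\<lambda>_. 1)) = sets (distr M (borel \<Otimes>\<^sub>M coords J) (\<lambda>th. (x th, \<lambda>j\<in>J. W (e j) th)))"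
    by (simp cong: sets_pair_measure_cong)
  fix A B assume "A \<in> sets (distr M borel x)" "B \<in> sets (gau J (\<lambda>_. 1))"
  then have A [measurable]: "A \<in> sets borel" and B [measurable]: "B \<in> sets (coords J)" by auto
  note [measurable] = noise_vector_measurable
  have "emeasure (gau J (\<lambda>_. 1)) B = emeasure M ((\<lambda>th. \<lambda>j\<in>J. W (e j) th) -` B \<inter> space M)"
    unfolding noise_law[symmetric] by (rule emeasure_distr) measurable
  moreover have "emeasure (distr M borel x) A = emeasure M (x -` A \<inter> space M)" by (rule emeasure_distr) measurable
  moreover have "emeasure (distr M (borel \<Otimes>\<^sub>M coords J) (\<lambda>th. (x th, \<lambda>j\<in>J. W (e j) th))) (A \<times> B)
    = emeasure M ((x -` A \<inter> space M) \<inter> ((\<lambda>th. \<lambda>j\<in>J. W (e j) th) -` B \<inter> space M))"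
    by (subst emeasure_distr) (measurable, auto intro!: arg_cong[where f="emeasure M"])
  ultimately show "emeasure (distr M borel x) A * emeasure (gau J (\<lambda>_. 1)) B
    = emeasure (distr M (borel \<Otimes>\<^sub>M coords J) (\<lambda>th. (x th, \<lambda>j\<in>J. W (e j) th))) (A \<times> B)"
    using indep[OF J eD A B] by (simp add: emeasure_eq_measure ennreal_mult)
qed

lemma coordinate_observation:
  "gaussian_observation M J (\<lambda>j th. x th \<bullet> e j) (\<lambda>th. norm (x th)) x (\<lambda>j h. h \<bullet> e j) (\<lambda>j. W (e j))"
  by unfold_locales (use J bessel WM eD joint_law L2_integrable[OF x] in auto)

text \<open>
  The filtration of the coordinates in \<open>T\<close> coincides, up to null sets, with the algebra
  generated by the outcome at the level \<open>T\<close>, as the other coordinates of this outcome are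
  constant.
\<close>

lemma estimate_eq_real_cond_exp:
  assumes T: "T \<subseteq> J" and \<gamma>: "0 < \<gamma>" and i: "i \<in> J"
  shows "AE th in M. real_cond_exp M (filt \<gamma> (e ` T)) (\<lambda>th. x th \<bullet> e i) th
    = gaussian_observation.estimate M J (\<lambda>j th. x th \<bullet> e j) (\<lambda>j. W (e j)) (level T \<gamma>) i th"
proof -
  interpret G: gaussian_observation M J "\<lambda>j th. x th \<bullet> e j" "\<lambda>th. norm (x th)" x "\<lambda>j h. h \<bullet> e j" "\<lambda>j. W (e j)"
    by (rule coordinate_observation)
  let ?a = "level T \<gamma>" and ?C = "filt \<gamma> (e ` T)"
  have a: "\<forall>j\<in>J. 0 \<le> ?a j" using \<gamma> by (simp add: level_def)
  have eT: "e ` T \<subseteq> D" using T eD by auto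
  have subC: "subalgebra M ?C" using filt_full[OF eT] by (simp add: full_subalgebra_def)
  interpret finite_measure_subalgebra M ?C by unfold_locales (rule subC)
  have coord: "?a j * (x th \<bullet> e j) + sqrt (?a j) * W (e j) th = (if j \<in> T then sqrt \<gamma> * obs \<gamma> (e j) th else 0)" for j th
    using \<gamma> by (simp add: level_def obs_def algebra_simps)
  have outC [measurable]: "G.outcome ?a \<in> measurable ?C (coords J)"
    unfolding G.outcome_def coord
  proof (rule measurable_restrict)
    fix j assume "j \<in> J"
    show "(\<lambda>th. if j \<in> T then sqrt \<gamma> * obs \<gamma> (e j) th else 0) \<in> borel_measurable ?C"
      using obs_filt[OF eT, of "e j" \<gamma>] by (cases "j \<in> T") auto
  qed
  have estC: "G.estimate ?a i \<in> borel_measurable ?C"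
  proof -
    note [measurable] = G.evidence_measurable[OF a] G.numer_measurable[OF a i]
    show ?thesis unfolding G.estimate_def by measurable
  qed
  have estL: "G.estimate ?a i \<in> L2 M" using G.estimate_sq(1)[OF a i] G.estimate_measurable[OF a i] by (simp add: L2_real_iff)
  have approx: "\<exists>B\<in>sets (coords J). AE th in M. th \<in> A \<longleftrightarrow> G.outcome ?a th \<in> B"
    if "A \<in> sigma_sets (space M) ({obs \<gamma> h -` B \<inter> space M | h B. h \<in> e ` T \<and> B \<in> sets borel} \<union> null_sets M)" for A
    using that
  proof (induction rule: sigma_sets.induct)
    case (Basic A)
    then consider j B where "j \<in> T" "B \<in> sets borel" "A = obs \<gamma> (e j) -` B \<inter> space M" | "A \<in> null_sets M" by blast
    then show ?case
    proof cases
      case 1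
      have j: "j \<in> J" using 1 T by auto
      have "{v \<in> space (coords J). v j / sqrt \<gamma> \<in> B} \<in> sets (coords J)" using 1(2) j by measurable
      moreover have "th \<in> A \<longleftrightarrow> G.outcome ?a th \<in> {v \<in> space (coords J). v j / sqrt \<gamma> \<in> B}" if "th \<in> space M" for th
        using 1 that j \<gamma> measurable_space[OF G.outcome_measurable[of ?a] that] by (simp add: G.outcome_def coord)
      ultimately show ?thesis by (intro bexI AE_I2)
    next
      case 2
      then have "AE th in M. th \<notin> A" by (rule AE_not_in)
      then show ?thesis by (intro bexI[of _ "{}"]) auto
    qed
  next
    case Empty
    show ?case by (intro bexI[of _ "{}"]) auto
  next
    case (Compl A)
    then obtain B where B: "B \<in> sets (coords J)" and ae: "AE th in M. th \<in> A \<longleftrightarrow> G.outcome ?a th \<in> B" by blast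
    have "AE th in M. th \<in> space M - A \<longleftrightarrow> G.outcome ?a th \<in> space (coords J) - B"
      using ae AE_space
    proof eventually_elim
      case (elim th)
      then show ?case using measurable_space[OF G.outcome_measurable[of ?a]] by auto
    qed
    then show ?case using B by (intro bexI[of _ "space (coords J) - B"]) auto
  next
    case (Union A)
    then have "\<forall>k. \<exists>B. B \<in> sets (coords J) \<and> (AE th in M. th \<in> A k \<longleftrightarrow> G.outcome ?a th \<in> B)" by (simp add: Bex_def)
    from choice[OF this] obtain B where B: "\<And>k. B k \<in> sets (coords J)"
      and ae: "\<And>k. AE th in M. th \<in> A k \<longleftrightarrow> G.outcome ?a th \<in> B k" by blast
    have "AE th in M. \<forall>k. th \<in> A k \<longleftrightarrow> G.outcome ?a th \<in> B k" using ae by (simp add: AE_all_countable)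
    then have "AE th in M. th \<in> (\<Union>k. A k) \<longleftrightarrow> G.outcome ?a th \<in> (\<Union>k. B k)" by eventually_elim auto
    then show ?case using B by (intro bexI[of _ "\<Union>k. B k"]) auto
  qed
  show ?thesis
  proof (rule real_cond_exp_charact)
    fix A assume A: "A \<in> sets ?C"
    then have AM [measurable]: "A \<in> sets M" using subC by (auto simp: subalgebra_def)
    obtain B where B [measurable]: "B \<in> sets (coords J)" and ae: "AE th in M. th \<in> A \<longleftrightarrow> G.outcome ?a th \<in> B"
      using approx[of A] A unfolding sets_filt[OF eT] by blast
    have *: "(\<integral>th\<in>A. f th \<partial>M) = expectation (\<lambda>th. f th * indicator B (G.outcome ?a th))" if [measurable]: "f \<in> borel_measurable M" for f :: "'a \<Rightarrow> real"
      unfolding set_lebesgue_integral_def using ae by (intro integral_cong_AE) (auto elim!: eventually_mono simp: indicator_def)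
    note [measurable] = G.estimate_measurable[OF a i]
    show "(\<integral>th\<in>A. x th \<bullet> e i \<partial>M) = (\<integral>th\<in>A. G.estimate ?a i th \<partial>M)"
      using G.estimate_orthogonal_bounded[OF a i, of "indicator B" 1] by (simp add: * )
  qed (use estC L2_imp_integrable[OF estL] G.X_integrable(1)[OF i] in auto)
qed

lemma explained_eq_cond_exp:
  assumes T: "T \<subseteq> J" and S: "S \<subseteq> J" and \<gamma>: "0 < \<gamma>"
  shows "explained M J (\<lambda>j th. x th \<bullet> e j) S (level T \<gamma>)
    = (\<Sum>i\<in>S. expectation (\<lambda>th. (real_cond_exp M (filt \<gamma> (e ` T)) (\<lambda>th. x th \<bullet> e i) th)\<^sup>2))"
proof -
  interpret G: gaussian_observation M J "\<lambda>j th. x th \<bullet> e j" "\<lambda>th. norm (x th)" x "\<lambda>j h. h \<bullet> e j" "\<lambda>j. W (e j)"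
    by (rule coordinate_observation)
  have a: "\<forall>j\<in>J. 0 \<le> level T \<gamma> j" using \<gamma> by (simp add: level_def)
  have eT: "e ` T \<subseteq> D" using T eD by auto
  have "subalgebra M (filt \<gamma> (e ` T))" using filt_full[OF eT] by (simp add: full_subalgebra_def)
  then have [measurable]: "real_cond_exp M (filt \<gamma> (e ` T)) f \<in> borel_measurable M" for f
    by (rule measurable_from_subalg) simp
  show ?thesis unfolding G.explained_eq_sum_estimate_sq[OF a S]
  proof (rule sum.cong[OF refl])
    fix i assume "i \<in> S"
    then have i: "i \<in> J" using S by auto
    show "expectation (\<lambda>th. (G.estimate (level T \<gamma>) i th)\<^sup>2)
      = expectation (\<lambda>th. (real_cond_exp M (filt \<gamma> (e ` T)) (\<lambda>th. x th \<bullet> e i) th)\<^sup>2)"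
      using estimate_eq_real_cond_exp[OF T \<gamma> i] G.estimate_measurable[OF a i]
      by (intro integral_cong_AE) (auto elim!: eventually_mono)
  qed
qed

end

text \<open>
  The whole of a filtration is exhausted by finitely many observed vectors at a time, provided that
  their spans approximate each vector of \<open>S\<close>.
\<close>

lemma filt_cond_exp_tendsto:
  assumes T: "\<And>n. T n \<subseteq> S" "\<And>n. T n \<subseteq> T (Suc n)" and S: "S \<subseteq> D"
    and approx: "\<And>h. h \<in> S \<Longrightarrow> \<exists>s. (\<forall>n. s n \<in> span (T n)) \<and> s \<longlonglongrightarrow> h" and \<phi>: "\<phi> \<in> L2 M"
  shows "(\<lambda>n. expectation (\<lambda>th. (real_cond_exp M (filt \<gamma> (T n)) \<phi> th)\<^sup>2)) \<longlonglongrightarrow> expectation (\<lambda>th. (real_cond_exp M (filt \<gamma> S) \<phi> th)\<^sup>2)"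
proof -
  have TD: "T n \<subseteq> D" for n using T(1)[of n] S by auto
  have fullT: "full_subalgebra M (filt \<gamma> (T n))" for n by (rule filt_full[OF TD])
  define G where "G = sigma (space M) (\<Union>n. sets (filt \<gamma> (T n)))"
  have GP: "(\<Union>n. sets (filt \<gamma> (T n))) \<subseteq> sets M"
    using fullT by (auto simp: full_subalgebra_def subalgebra_def)
  have setsG: "sets G = sigma_sets (space M) (\<Union>n. sets (filt \<gamma> (T n)))"
    unfolding G_def using GP sets.sets_into_space by (intro sets_measure_of) blast
  have spG: "space G = space M" unfolding G_def using GP sets.sets_into_space by (intro space_measure_of) blast
  have subG: "sets (filt \<gamma> (T n)) \<subseteq> sets G" for n unfolding setsG by (auto intro: sigma_sets.Basic)
  have "null_sets M \<subseteq> sets G" using fullT[of 0] subG[of 0] unfolding full_subalgebra_def by blast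
  then have G: "full_subalgebra M G"
    using sets.sigma_sets_subset[OF GP] by (simp add: full_subalgebra_def subalgebra_def setsG spG)
  have "sets (filt \<gamma> S) \<subseteq> sets G"
  proof (rule filt_least[OF S G])
    fix h assume h: "h \<in> S"
    obtain s where s: "\<And>n. s n \<in> span (T n)" "s \<longlonglongrightarrow> h" using approx[OF h] by blast
    have sD: "s n \<in> D" for n using s(1)[of n] span_minimal[OF TD D, of n] by auto
    have "obs \<gamma> (s n) \<in> borel_measurable G" for n
    proof (rule measurable_from_subalg)
      show "subalgebra G (filt \<gamma> (T n))"
        using space_filt[OF TD[of n], of \<gamma>] subG by (simp add: subalgebra_def spG)
      show "obs \<gamma> (s n) \<in> borel_measurable (filt \<gamma> (T n))" by (rule obs_span[OF TD s(1)])
    qed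
    then show "obs \<gamma> h \<in> borel_measurable G" using h S by (intro obs_limit[OF G sD _ s(2)]) auto
  qed
  then show ?thesis
    unfolding setsG by (intro cond_exp_sq_tendsto filt_full TD S filt_mono T \<phi>)
qed

end

section \<open>Causal estimates between noncausal ones\<close>

lemma is_L2_projection_sq:
  fixes h z :: "'a \<Rightarrow> 'h::{real_inner, second_countable_topology}"
  assumes z: "is_L2_projection M K h z" and K: "K \<subseteq> L2 M" and h: "h \<in> L2 M"
  shows "(LINT th|M. (norm (z th))\<^sup>2) = (LINT th|M. h th \<bullet> z th)"
    and "(LINT th|M. (norm (h th - z th))\<^sup>2) = (LINT th|M. (norm (h th))\<^sup>2) - (LINT th|M. (norm (z th))\<^sup>2)"
    and "(LINT th|M. (norm (z th))\<^sup>2) \<le> (LINT th|M. (norm (h th))\<^sup>2)"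
proof -
  have zK: "z \<in> K" and orth: "(LINT th|M. (h th - z th) \<bullet> z th) = 0" using z by (auto simp: is_L2_projection_def)
  have zL: "z \<in> L2 M" using zK K by auto
  note int = L2_inner_integrable[OF h zL] L2_integrable[OF zL] L2_integrable[OF h]
  show 1: "(LINT th|M. (norm (z th))\<^sup>2) = (LINT th|M. h th \<bullet> z th)"
    using orth int by (simp add: inner_diff_left power2_norm_eq_inner)
  have "(LINT th|M. (norm (h th - z th))\<^sup>2) = (LINT th|M. (norm (h th))\<^sup>2 - 2 * (h th \<bullet> z th) + (norm (z th))\<^sup>2)"
    by (intro lint_cong refl)
      (simp add: power2_norm_eq_inner inner_diff_left inner_diff_right inner_commute)
  also have "\<dots> = (LINT th|M. (norm (h th))\<^sup>2) - 2 * (LINT th|M. h th \<bullet> z th) + (LINT th|M. (norm (z th))\<^sup>2)"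
    using int by simp
  finally show 2: "(LINT th|M. (norm (h th - z th))\<^sup>2) = (LINT th|M. (norm (h th))\<^sup>2) - (LINT th|M. (norm (z th))\<^sup>2)"
    using 1 by simp
  have "0 \<le> (LINT th|M. (norm (h th - z th))\<^sup>2)" by (rule lint_nonneg) simp
  then show "(LINT th|M. (norm (z th))\<^sup>2) \<le> (LINT th|M. (norm (h th))\<^sup>2)" using 2 by simp
qed

lemma is_L2_projection_diff:
  fixes h z :: "'a \<Rightarrow> 'h::{real_inner, second_countable_topology}"
  assumes z: "is_L2_projection M K h z" and z': "is_L2_projection M K h' z'" and K: "K \<subseteq> L2 M"
    and h: "h \<in> L2 M" "h' \<in> L2 M"
    and diff: "\<And>u v. u \<in> K \<Longrightarrow> v \<in> K \<Longrightarrow> (\<lambda>th. u th - v th) \<in> K"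
  shows "is_L2_projection M K (\<lambda>th. h th - h' th) (\<lambda>th. z th - z' th)"
  unfolding is_L2_projection_def
proof (intro conjI ballI)
  have zK: "z \<in> K" "z' \<in> K" using z z' by (auto simp: is_L2_projection_def)
  show "(\<lambda>th. z th - z' th) \<in> K" using zK by (rule diff)
  fix u assume u: "u \<in> K"
  have L: "u \<in> L2 M" "z \<in> L2 M" "z' \<in> L2 M" using u zK K by auto
  have "(LINT th|M. (h th - h' th - (z th - z' th)) \<bullet> u th) = (LINT th|M. (h th - z th) \<bullet> u th - (h' th - z' th) \<bullet> u th)"
    by (intro lint_cong refl) (simp add: inner_diff_left)
  also have "\<dots> = (LINT th|M. (h th - z th) \<bullet> u th) - (LINT th|M. (h' th - z' th) \<bullet> u th)"
    by (rule Bochner_Integration.integral_diff) (intro L2_inner_integrable L2_diff h L)+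
  also have "\<dots> = 0" using z z' u by (simp add: is_L2_projection_def)
  finally show "(LINT th|M. (h th - h' th - (z th - z' th)) \<bullet> u th) = 0" .
qed

lemma inner_le_half_squares: "a \<bullet> b \<le> ((norm a)\<^sup>2 + (norm b)\<^sup>2) / 2" for a b :: "'h::real_inner"
proof -
  have "0 \<le> (norm (a - b))\<^sup>2" by simp
  then show ?thesis by (simp add: power2_norm_eq_inner inner_diff_left inner_diff_right inner_commute)
qed

lemma norm_diff_sq_le: "(norm (a - b))\<^sup>2 \<le> 2 * (norm a)\<^sup>2 + 2 * (norm b)\<^sup>2" for a b :: "'h::real_inner"
proof -
  have "0 \<le> (norm (a + b))\<^sup>2" by simp
  then show ?thesis by (simp add: power2_norm_eq_inner inner_diff_left inner_diff_right inner_add_left inner_add_right inner_commute)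
qed

text \<open>
  The channel together with the time scale given by the projections.
\<close>

locale projected_channel = wiener_channel M D W x
  for M :: "'a measure" and D :: "'h::{banach, real_inner, second_countable_topology} set"
    and W :: "'h \<Rightarrow> 'a \<Rightarrow> real" and x :: "'a \<Rightarrow> 'h" +
  fixes \<pi> :: "real \<Rightarrow> 'h \<Rightarrow> 'h"
  assumes \<pi>_proj: "\<And>t. t \<in> {0..1} \<Longrightarrow> orthogonal_projection (\<pi> t)"
    and \<pi>_range: "\<And>s t. s \<in> {0..1} \<Longrightarrow> t \<in> {0..1} \<Longrightarrow> s \<le> t \<Longrightarrow> range (\<pi> s) \<subseteq> range (\<pi> t)"
    and \<pi>_cont: "\<And>h. continuous_on {0..1} (\<lambda>t. \<pi> t h)"
    and \<pi>_0: "\<And>h. \<pi> 0 h = 0" and \<pi>_1: "\<And>h. \<pi> 1 h = h"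
    and \<pi>_D: "\<And>t h. t \<in> {0..1} \<Longrightarrow> h \<in> D \<Longrightarrow> \<pi> t h \<in> D"
begin

lemma \<pi>_bounded_linear: "t \<in> {0..1} \<Longrightarrow> bounded_linear (\<pi> t)"
  using \<pi>_proj by (auto simp: orthogonal_projection_def)

lemma \<pi>_sym: "t \<in> {0..1} \<Longrightarrow> \<pi> t u \<bullet> v = u \<bullet> \<pi> t v"
  using \<pi>_proj by (auto simp: orthogonal_projection_def)

text \<open>
  Nested ranges mean that the projections commute, with the smaller one as product.
\<close>

lemma \<pi>_le:
  assumes st: "s \<in> {0..1}" "t \<in> {0..1}" "s \<le> t"
  shows "\<pi> t (\<pi> s u) = \<pi> s u" "\<pi> s (\<pi> t u) = \<pi> s u"
proof -
  have *: "\<pi> t (\<pi> s u) = \<pi> s u" for u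
  proof -
    obtain v where "\<pi> s u = \<pi> t v" using \<pi>_range[OF st] by blast
    moreover have "\<pi> t (\<pi> t v) = \<pi> t v" using \<pi>_proj[OF st(2)] by (auto simp: orthogonal_projection_def)
    ultimately show ?thesis by simp
  qed
  show "\<pi> t (\<pi> s u) = \<pi> s u" by (rule *)
  have "(\<pi> s (\<pi> t u) - \<pi> s u) \<bullet> v = 0" for v
  proof -
    have "\<pi> s (\<pi> t u) \<bullet> v = \<pi> t u \<bullet> \<pi> s v" using st by (intro \<pi>_sym)
    also have "\<dots> = u \<bullet> \<pi> t (\<pi> s v)" using st by (intro \<pi>_sym)
    also have "\<dots> = \<pi> s u \<bullet> v" using * \<pi>_sym[OF st(1), of u v] by simp
    finally show ?thesis by (simp add: inner_diff_left)
  qed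
  from this[of "\<pi> s (\<pi> t u) - \<pi> s u"] show "\<pi> s (\<pi> t u) = \<pi> s u" by simp
qed

definition past :: "real \<Rightarrow> real \<Rightarrow> 'a measure" where "past \<gamma> t = filt \<gamma> (\<pi> t ` D)"

definition noncausal_class :: "real \<Rightarrow> real \<Rightarrow> ('a \<Rightarrow> 'h) set" where
  "noncausal_class \<gamma> t = {u \<in> L2 M. u \<in> borel_measurable (past \<gamma> t)}"

text \<open>
  Adaptedness of \<open>u\<close> is a condition on the components \<open>\<pi> t u\<close>, tested
  against \<open>D\<close>.
\<close>

definition causal_class :: "real \<Rightarrow> ('a \<Rightarrow> 'h) set" where
  "causal_class \<gamma> = {u \<in> L2 M. \<forall>t\<in>{0..1}. \<forall>h\<in>D. (\<lambda>th. u th \<bullet> \<pi> t h) \<in> borel_measurable (past \<gamma> t)}"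

lemma \<pi>D: "t \<in> {0..1} \<Longrightarrow> \<pi> t ` D \<subseteq> D" using \<pi>_D by auto

lemma past_full: "t \<in> {0..1} \<Longrightarrow> full_subalgebra M (past \<gamma> t)"
  unfolding past_def by (rule filt_full[OF \<pi>D])

lemma past_mono: "s \<in> {0..1} \<Longrightarrow> t \<in> {0..1} \<Longrightarrow> s \<le> t \<Longrightarrow> sets (past \<gamma> s) \<subseteq> sets (past \<gamma> t)"
proof -
  assume st: "s \<in> {0..1}" "t \<in> {0..1}" "s \<le> t"
  have "\<pi> s ` D \<subseteq> \<pi> t ` D"
  proof
    fix v assume "v \<in> \<pi> s ` D"
    then obtain h where h: "h \<in> D" "v = \<pi> s h" by auto
    then have "v = \<pi> t (\<pi> s h)" using \<pi>_le(1)[OF st] by simp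
    then show "v \<in> \<pi> t ` D" using h \<pi>_D[OF st(1)] by blast
  qed
  then show ?thesis unfolding past_def using \<pi>D[OF st(2)] by (rule filt_mono)
qed

lemma past_measurable_mono:
  "s \<in> {0..1} \<Longrightarrow> t \<in> {0..1} \<Longrightarrow> s \<le> t \<Longrightarrow> f \<in> measurable (past \<gamma> s) N \<Longrightarrow> f \<in> measurable (past \<gamma> t) N"
  using past_mono[of s t \<gamma>] past_full[of s \<gamma>] past_full[of t \<gamma>]
  by (intro measurable_from_subalg[of "past \<gamma> t" "past \<gamma> s"]) (auto simp: subalgebra_def full_subalgebra_def)

lemma noncausal_class_L2: "noncausal_class \<gamma> t \<subseteq> L2 M" and causal_class_L2: "causal_class \<gamma> \<subseteq> L2 M"
  by (auto simp: noncausal_class_def causal_class_def)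

lemma noncausal_class_diff: "u \<in> noncausal_class \<gamma> t \<Longrightarrow> v \<in> noncausal_class \<gamma> t \<Longrightarrow> (\<lambda>th. u th - v th) \<in> noncausal_class \<gamma> t"
  by (auto simp: noncausal_class_def intro: L2_diff)

lemma causal_projection_exists: "\<exists>z. is_L2_projection M (causal_class \<gamma>) x z"
proof (rule L2_projection_exists[OF causal_class_L2 _ _ _ _ x])
  have "(\<lambda>_. 0) \<in> causal_class \<gamma>" by (simp add: causal_class_def L2_def)
  then show "causal_class \<gamma> \<noteq> {}" by blast
  show "(\<lambda>th. u th + v th) \<in> causal_class \<gamma>" if "u \<in> causal_class \<gamma>" "v \<in> causal_class \<gamma>" for u v
    using that by (auto simp: causal_class_def inner_add_left intro!: L2_add borel_measurable_add)
  show "(\<lambda>th. c *\<^sub>R u th) \<in> causal_class \<gamma>" if "u \<in> causal_class \<gamma>" for u c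
    using that by (auto simp: causal_class_def intro!: L2_scaleR borel_measurable_times)
  fix s l assume s: "\<And>n. s n \<in> causal_class \<gamma>" and l: "l \<in> L2 M" and lim: "AE th in M. (\<lambda>n. s n th) \<longlonglongrightarrow> l th"
  have "(\<lambda>th. l th \<bullet> \<pi> t h) \<in> borel_measurable (past \<gamma> t)" if tD: "t \<in> {0..1}" "h \<in> D" for t h
  proof (rule AE_limit_measurable[OF past_full[OF tD(1)]])
    show "(\<lambda>th. l th \<bullet> \<pi> t h) \<in> borel_measurable M" using L2_measurable[OF l] by simp
    show "(\<lambda>th. s n th \<bullet> \<pi> t h) \<in> borel_measurable (past \<gamma> t)" for n using s[of n] tD by (auto simp: causal_class_def)
    show "AE th in M. (\<lambda>n. s n th \<bullet> \<pi> t h) \<longlonglongrightarrow> l th \<bullet> \<pi> t h"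
      using lim by eventually_elim (intro tendsto_intros)
  qed
  then show "l \<in> causal_class \<gamma>" using l by (auto simp: causal_class_def)
qed

lemma noncausal_projection_exists: "t \<in> {0..1} \<Longrightarrow> h \<in> L2 M \<Longrightarrow> \<exists>z. is_L2_projection M (noncausal_class \<gamma> t) h z"
  unfolding noncausal_class_def by (rule L2_measurable_projection[OF past_full])

definition grid :: "nat \<Rightarrow> nat \<Rightarrow> real" where "grid n k = real k / real n"

text \<open>
  The projection on the part of the space between two consecutive times. The cells of a partition are
  mutually orthogonal and add up to the identity.
\<close>

definition cell :: "nat \<Rightarrow> nat \<Rightarrow> 'h \<Rightarrow> 'h" where "cell n k h = \<pi> (grid n (Suc k)) h - \<pi> (grid n k) h"

abbreviation lower_sum :: "nat \<Rightarrow> (real \<Rightarrow> 'a \<Rightarrow> 'h) \<Rightarrow> real" where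
  "lower_sum n z \<equiv> (\<Sum>k<n. mean_square (\<lambda>th. cell n k (z (grid n k) th)))"

abbreviation upper_sum :: "nat \<Rightarrow> (real \<Rightarrow> 'a \<Rightarrow> 'h) \<Rightarrow> real" where
  "upper_sum n z \<equiv> (\<Sum>k<n. mean_square (\<lambda>th. cell n k (z (grid n (Suc k)) th)))"

abbreviation jump :: "nat \<Rightarrow> nat \<Rightarrow> (real \<Rightarrow> 'a \<Rightarrow> 'h) \<Rightarrow> real" where
  "jump n k z \<equiv> mean_square (\<lambda>th. cell n k (z (grid n (Suc k)) th - z (grid n k) th))"

context
  fixes n :: nat
  assumes n: "0 < n"
begin

lemma grid_in: "k \<le> n \<Longrightarrow> grid n k \<in> {0..1}" using n by (auto simp: grid_def)

lemma grid_le: "j \<le> k \<Longrightarrow> grid n j \<le> grid n k" using n by (auto simp: grid_def divide_right_mono)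

lemma cell_bounded_linear: "k < n \<Longrightarrow> bounded_linear (cell n k)"
  unfolding cell_def[abs_def] using \<pi>_bounded_linear grid_in by (intro bounded_linear_sub) auto

lemma cell_sym: "k < n \<Longrightarrow> cell n k u \<bullet> v = u \<bullet> cell n k v"
  using \<pi>_sym[OF grid_in, of k u v] \<pi>_sym[OF grid_in, of "Suc k" u v] by (simp add: cell_def inner_diff_left inner_diff_right)

lemma cell_\<pi>:
  assumes k: "k < n" and t: "t \<in> {0..1}"
  shows "grid n (Suc k) \<le> t \<Longrightarrow> \<pi> t (cell n k u) = cell n k u"
    and "t \<le> grid n k \<Longrightarrow> cell n k (\<pi> t u) = 0"
    and "t \<le> grid n k \<Longrightarrow> \<pi> t (cell n k u) = 0"
proof -
  have g: "grid n k \<in> {0..1}" "grid n (Suc k) \<in> {0..1}" "grid n k \<le> grid n (Suc k)" using k grid_in grid_le by auto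
  interpret bounded_linear "\<pi> t" using t by (rule \<pi>_bounded_linear)
  show "grid n (Suc k) \<le> t \<Longrightarrow> \<pi> t (cell n k u) = cell n k u"
    using g t by (simp add: cell_def diff \<pi>_le(1))
  show "t \<le> grid n k \<Longrightarrow> cell n k (\<pi> t u) = 0" "t \<le> grid n k \<Longrightarrow> \<pi> t (cell n k u) = 0"
    using g t by (simp_all add: cell_def diff \<pi>_le)
qed

lemma cell_idem: "k < n \<Longrightarrow> cell n k (cell n k u) = cell n k u"
  using cell_\<pi>[of k "grid n (Suc k)" u] cell_\<pi>[of k "grid n k" u] grid_in[of k] grid_in[of "Suc k"]
  by (simp add: cell_def[of n k "cell n k u"])

lemma cell_cell: "j < n \<Longrightarrow> k < n \<Longrightarrow> j \<noteq> k \<Longrightarrow> cell n j (cell n k u) = 0"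
proof -
  have *: "cell n j (cell n k u) = 0" if jk: "j < k" "k < n" for j k u
    unfolding cell_def[of n j "cell n k u"]
    using cell_\<pi>(3)[of k "grid n (Suc j)" u] cell_\<pi>(3)[of k "grid n j" u] jk
      grid_in[of "Suc j"] grid_in[of j] grid_le[of "Suc j" k] grid_le[of j k] by simp
  assume jk: "j < n" "k < n" "j \<noteq> k"
  show ?thesis
  proof (cases "j < k")
    case False
    then have "k < j" using jk by simp
    then have "cell n j (cell n k u) \<bullet> v = 0" for v
      using *[of k j v] jk by (simp add: cell_sym)
    from this[of "cell n j (cell n k u)"] show ?thesis by simp
  qed (use * jk in auto)
qed

lemma cell_orth: "j < n \<Longrightarrow> k < n \<Longrightarrow> j \<noteq> k \<Longrightarrow> cell n j u \<bullet> cell n k v = 0"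
  by (simp add: cell_sym cell_cell)

lemma cell_sum: "m \<le> n \<Longrightarrow> (\<Sum>k<m. cell n k h) = \<pi> (grid n m) h"
  using sum_lessThan_telescope[of "\<lambda>k. \<pi> (grid n k) h" m] by (simp add: cell_def grid_def \<pi>_0)

lemma cell_sum_all: "(\<Sum>k<n. cell n k h) = h"
  using cell_sum[of n h] n by (simp add: grid_def \<pi>_1)

lemma inner_cells: "u \<bullet> v = (\<Sum>k<n. cell n k u \<bullet> cell n k v)"
proof -
  have "u \<bullet> v = (\<Sum>k<n. cell n k u) \<bullet> v" by (simp add: cell_sum_all)
  also have "\<dots> = (\<Sum>k<n. cell n k u \<bullet> cell n k v)"
    unfolding inner_sum_left
  proof (rule sum.cong[OF refl])
    fix k assume "k \<in> {..<n}"
    then have k: "k < n" by simp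
    show "cell n k u \<bullet> v = cell n k u \<bullet> cell n k v"
      using cell_sym[OF k, of "cell n k u" v] cell_idem[OF k, of u] by simp
  qed
  finally show ?thesis .
qed

lemma norm_cells: "(norm u)\<^sup>2 = (\<Sum>k<n. (norm (cell n k u))\<^sup>2)"
  by (simp add: power2_norm_eq_inner inner_cells[of u u])

lemma cell_D: "k < n \<Longrightarrow> h \<in> D \<Longrightarrow> cell n k h \<in> D"
  unfolding cell_def using grid_in[of k] grid_in[of "Suc k"] by (intro subspace_diff[OF D] \<pi>_D) auto

lemma cell_L2: "k < n \<Longrightarrow> u \<in> L2 M \<Longrightarrow> (\<lambda>th. cell n k (u th)) \<in> L2 M"
  by (rule L2_bounded_linear[OF cell_bounded_linear])

lemma cell_measurable: "k < n \<Longrightarrow> u \<in> borel_measurable F \<Longrightarrow> (\<lambda>th. cell n k (u th)) \<in> borel_measurable F"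
  by (rule measurable_compose[where N=borel])
    (auto intro!: borel_measurable_continuous_onI linear_continuous_on cell_bounded_linear)

lemma cell_noncausal: "k < n \<Longrightarrow> u \<in> noncausal_class \<gamma> t \<Longrightarrow> (\<lambda>th. cell n k (u th)) \<in> noncausal_class \<gamma> t"
  by (auto simp: noncausal_class_def intro: cell_L2 cell_measurable)

lemma cell_noncausal_projection:
  assumes k: "k < n" and z: "is_L2_projection M (noncausal_class \<gamma> t) h z"
  shows "is_L2_projection M (noncausal_class \<gamma> t) (\<lambda>th. cell n k (h th)) (\<lambda>th. cell n k (z th))"
  unfolding is_L2_projection_def
proof (intro conjI ballI)
  interpret bounded_linear "cell n k" by (rule cell_bounded_linear[OF k])
  show "(\<lambda>th. cell n k (z th)) \<in> noncausal_class \<gamma> t" using z k by (auto simp: is_L2_projection_def intro: cell_noncausal)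
  fix u assume "u \<in> noncausal_class \<gamma> t"
  then have "(\<lambda>th. cell n k (u th)) \<in> noncausal_class \<gamma> t" by (rule cell_noncausal[OF k])
  then have "expectation (\<lambda>th. (h th - z th) \<bullet> cell n k (u th)) = 0" using z by (auto simp: is_L2_projection_def)
  then show "expectation (\<lambda>th. (cell n k (h th) - cell n k (z th)) \<bullet> u th) = 0"
    by (simp add: diff[symmetric] cell_sym[OF k])
qed

text \<open>
  Here \<open>cell n k u \<bullet> h\<close> is the value of \<open>u\<close> at \<open>\<pi> t (cell
  n k h)\<close> with \<open>t\<close> the end point of the cell, so it is known at this time.
\<close>

lemma causal_cell:
  assumes u: "u \<in> causal_class \<gamma>" and k: "k < n"
  shows "(\<lambda>th. cell n k (u th)) \<in> noncausal_class \<gamma> (grid n (Suc k))"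
proof -
  let ?t = "grid n (Suc k)"
  have t: "?t \<in> {0..1}" using k grid_in[of "Suc k"] by auto
  have uL: "u \<in> L2 M" using u by (simp add: causal_class_def)
  interpret bounded_linear "cell n k" by (rule cell_bounded_linear[OF k])
  have inD: "(\<lambda>th. cell n k (u th) \<bullet> h) \<in> borel_measurable (past \<gamma> ?t)" if h: "h \<in> D" for h
  proof -
    have "cell n k (u th) \<bullet> h = u th \<bullet> \<pi> ?t (cell n k h)" for th
      using cell_\<pi>(1)[OF k t, of h] by (simp add: cell_sym[OF k])
    then show ?thesis using u t cell_D[OF k h] by (simp add: causal_class_def)
  qed
  have "(\<lambda>th. cell n k (u th)) \<in> borel_measurable (past \<gamma> ?t)"
  proof (rule weakly_measurable_imp_measurable)
    fix h :: 'h
    have "h \<in> closure D" using D_dense by simp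
    then obtain s where s: "\<And>i. s i \<in> D" "s \<longlonglongrightarrow> h" unfolding closure_sequential by blast
    show "(\<lambda>th. cell n k (u th) \<bullet> h) \<in> borel_measurable (past \<gamma> ?t)"
      by (rule borel_measurable_LIMSEQ_metric[of "\<lambda>i th. cell n k (u th) \<bullet> s i"]) (use inD s in \<open>auto intro!: tendsto_intros\<close>)
  qed
  then show ?thesis using cell_L2[OF k uL] by (simp add: noncausal_class_def)
qed

text \<open>
  The causal estimate lies between two sums of noncausal ones. In each cell it uses at least the
  observations before the cell and at most those before its end.
\<close>

lemma
  assumes c: "is_L2_projection M (causal_class \<gamma>) x c"
    and z: "\<And>t. t \<in> {0..1} \<Longrightarrow> is_L2_projection M (noncausal_class \<gamma> t) x (z t)"
  shows causal_upper: "mean_square c \<le> upper_sum n z"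
    and causal_lower: "lower_sum n z \<le> mean_square c"
proof -
  have cC: "c \<in> causal_class \<gamma>" and corth: "\<And>u. u \<in> causal_class \<gamma> \<Longrightarrow> expectation (\<lambda>th. (x th - c th) \<bullet> u th) = 0"
    using c by (auto simp: is_L2_projection_def)
  have cL: "c \<in> L2 M" using cC by (simp add: causal_class_def)
  have zK: "z t \<in> noncausal_class \<gamma> t" and zL: "z t \<in> L2 M"
    and zorth: "\<And>u. u \<in> noncausal_class \<gamma> t \<Longrightarrow> expectation (\<lambda>th. (x th - z t th) \<bullet> u th) = 0" if "t \<in> {0..1}" for t
    using z[OF that] noncausal_class_L2 by (auto simp: is_L2_projection_def)
  note g = grid_in[OF Suc_leI] grid_in[OF less_imp_le]
  have sq: "integrable M (\<lambda>th. (norm (cell n k (u th)))\<^sup>2)" if "k < n" "u \<in> L2 M" for k u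
    by (rule L2_integrable[OF cell_L2[OF that]])
  have swap: "expectation (\<lambda>th. x th \<bullet> u th) = expectation (\<lambda>th. z t th \<bullet> u th)"
    if t: "t \<in> {0..1}" and u: "u \<in> noncausal_class \<gamma> t" for t u
  proof -
    have uL: "u \<in> L2 M" using u noncausal_class_L2 by auto
    show ?thesis
      using zorth[OF t u] L2_inner_integrable[OF x uL] L2_inner_integrable[OF zL[OF t] uL] by (simp add: inner_diff_left)
  qed
  have sumsq: "mean_square u = (\<Sum>k<n. mean_square (\<lambda>th. cell n k (u th)))" if "u \<in> L2 M" for u
  proof -
    have "mean_square u = expectation (\<lambda>th. \<Sum>k<n. (norm (cell n k (u th)))\<^sup>2)"
      by (intro lint_cong refl norm_cells)
    also have "\<dots> = (\<Sum>k<n. mean_square (\<lambda>th. cell n k (u th)))"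
      by (rule lint_sum) (use sq[OF _ that] in auto)
    finally show ?thesis .
  qed
  \<comment> \<open>For the upper bound each cell of \<open>c\<close> is tested against the noncausal estimate at the
    end of the cell.\<close>
  have "mean_square c = expectation (\<lambda>th. x th \<bullet> c th)"
    by (rule is_L2_projection_sq(1)[OF c causal_class_L2 x])
  also have "\<dots> = (\<Sum>k<n. expectation (\<lambda>th. x th \<bullet> cell n k (c th)))"
  proof -
    have "x th \<bullet> c th = (\<Sum>k<n. x th \<bullet> cell n k (c th))" for th
      by (simp add: inner_sum_right[symmetric] cell_sum_all)
    then show ?thesis using L2_inner_integrable[OF x cell_L2[OF _ cL]] by simp
  qed
  also have "\<dots> \<le> (\<Sum>k<n. (mean_square (\<lambda>th. cell n k (z (grid n (Suc k)) th)) + mean_square (\<lambda>th. cell n k (c th))) / 2)"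
  proof (rule sum_mono)
    fix k assume "k \<in> {..<n}"
    then have k: "k < n" by simp
    let ?z = "z (grid n (Suc k))"
    have "expectation (\<lambda>th. x th \<bullet> cell n k (c th)) = expectation (\<lambda>th. ?z th \<bullet> cell n k (c th))"
      by (rule swap[OF g(1)[OF k] causal_cell[OF cC k]])
    also have "\<dots> = expectation (\<lambda>th. cell n k (?z th) \<bullet> cell n k (c th))"
      using cell_idem[OF k] cell_sym[OF k] by simp
    also have "\<dots> \<le> expectation (\<lambda>th. ((norm (cell n k (?z th)))\<^sup>2 + (norm (cell n k (c th)))\<^sup>2) / 2)"
      using sq[OF k zL[OF g(1)[OF k]]] sq[OF k cL] L2_inner_integrable[OF cell_L2[OF k zL[OF g(1)[OF k]]] cell_L2[OF k cL]]
      by (intro integral_mono inner_le_half_squares) auto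
    also have "\<dots> = (mean_square (\<lambda>th. cell n k (?z th)) + mean_square (\<lambda>th. cell n k (c th))) / 2"
      using sq[OF k zL[OF g(1)[OF k]]] sq[OF k cL] by simp
    finally show "expectation (\<lambda>th. x th \<bullet> cell n k (c th))
      \<le> (mean_square (\<lambda>th. cell n k (?z th)) + mean_square (\<lambda>th. cell n k (c th))) / 2" .
  qed
  also have "\<dots> = (upper_sum n z + mean_square c) / 2"
    by (simp add: sumsq[OF cL] sum.distrib sum_divide_distrib[symmetric])
  finally show "mean_square c \<le> upper_sum n z"
    by simp
  \<comment> \<open>For the lower bound, the noncausal estimates at the beginnings of the cells are assembled to a
    causal competitor.\<close>
  define u where "u th = (\<Sum>k<n. cell n k (z (grid n k) th))" for th
  have uL: "u \<in> L2 M" unfolding u_def[abs_def] using cell_L2 zL[OF g(2)] by (intro L2_sum) auto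
  have cell_u: "cell n k (u th) = cell n k (z (grid n k) th)" if k: "k < n" for k th
  proof -
    interpret bounded_linear "cell n k" by (rule cell_bounded_linear[OF k])
    have "cell n k (u th) = (\<Sum>j<n. cell n k (cell n j (z (grid n j) th)))" by (simp add: u_def sum)
    also have "\<dots> = (\<Sum>j\<in>{k}. cell n k (cell n j (z (grid n j) th)))"
      using k cell_cell[OF k] by (intro sum.mono_neutral_right) auto
    finally show ?thesis by (simp add: cell_idem[OF k])
  qed
  have uC: "u \<in> causal_class \<gamma>"
    unfolding causal_class_def
  proof (intro CollectI conjI ballI uL)
    fix t h assume t: "t \<in> {0..1::real}" and h: "h \<in> D"
    have "(\<lambda>th. cell n k (z (grid n k) th) \<bullet> \<pi> t h) \<in> borel_measurable (past \<gamma> t)" if k: "k < n" for k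
    proof (cases "t \<le> grid n k")
      case True
      then have "cell n k (z (grid n k) th) \<bullet> \<pi> t h = 0" for th using cell_\<pi>(2)[OF k t True] by (simp add: cell_sym[OF k])
      then show ?thesis by simp
    next
      case False
      have "z (grid n k) \<in> borel_measurable (past \<gamma> (grid n k))" using zK[OF g(2)[OF k]] by (simp add: noncausal_class_def)
      then have "z (grid n k) \<in> borel_measurable (past \<gamma> t)" using False by (intro past_measurable_mono[OF g(2)[OF k] t]) auto
      then have "(\<lambda>th. cell n k (z (grid n k) th)) \<in> borel_measurable (past \<gamma> t)" by (rule cell_measurable[OF k])
      then show ?thesis by simp
    qed
    then show "(\<lambda>th. u th \<bullet> \<pi> t h) \<in> borel_measurable (past \<gamma> t)" by (simp add: u_def inner_sum_left)
  qed
  have Eu: "mean_square u = lower_sum n z"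
    unfolding sumsq[OF uL] by (intro sum.cong refl) (simp add: cell_u)
  have "mean_square u = (\<Sum>k<n. expectation (\<lambda>th. x th \<bullet> cell n k (z (grid n k) th)))"
    unfolding Eu
  proof (rule sum.cong[OF refl])
    fix k assume "k \<in> {..<n}"
    then have k: "k < n" by simp
    have "expectation (\<lambda>th. x th \<bullet> cell n k (z (grid n k) th)) = expectation (\<lambda>th. z (grid n k) th \<bullet> cell n k (z (grid n k) th))"
      by (rule swap[OF g(2)[OF k] cell_noncausal[OF k zK[OF g(2)[OF k]]]])
    also have "\<dots> = mean_square (\<lambda>th. cell n k (z (grid n k) th))"
      using cell_idem[OF k] cell_sym[OF k] by (simp add: power2_norm_eq_inner)
    finally show "mean_square (\<lambda>th. cell n k (z (grid n k) th)) = expectation (\<lambda>th. x th \<bullet> cell n k (z (grid n k) th))" by simp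
  qed
  also have "\<dots> = expectation (\<lambda>th. x th \<bullet> u th)"
    using L2_inner_integrable[OF x cell_L2[OF _ zL[OF g(2)]]] by (simp add: u_def inner_sum_right)
  also have "\<dots> = expectation (\<lambda>th. c th \<bullet> u th)"
    using corth[OF uC] L2_inner_integrable[OF x uL] L2_inner_integrable[OF cL uL] by (simp add: inner_diff_left)
  also have "\<dots> \<le> expectation (\<lambda>th. ((norm (c th))\<^sup>2 + (norm (u th))\<^sup>2) / 2)"
    using L2_integrable[OF cL] L2_integrable[OF uL] L2_inner_integrable[OF cL uL]
    by (intro integral_mono inner_le_half_squares) auto
  also have "\<dots> = (mean_square c + mean_square u) / 2"
    using L2_integrable[OF cL] L2_integrable[OF uL] by simp
  finally show "lower_sum n z \<le> mean_square c"
    using Eu by simp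
qed

end

end

section \<open>Refining the partition\<close>

text \<open>
  Simple functions have finitely many values, to which the continuity of the projections applies
  uniformly.
\<close>

lemma (in prob_space) L2_simple_approximation:
  fixes h :: "'a \<Rightarrow> 'h::{banach, real_inner, second_countable_topology}"
  assumes h: "h \<in> L2 M" and e: "0 < e"
  obtains I :: "'h set" and A :: "'h \<Rightarrow> 'a set"
  where "finite I" "\<And>c. A c \<in> sets M" "(\<lambda>th. \<Sum>c\<in>I. indicator (A c) th *\<^sub>R c) \<in> L2 M"
    "mean_square (\<lambda>th. h th - (\<Sum>c\<in>I. indicator (A c) th *\<^sub>R c)) < e"
proof -
  have hM [measurable]: "h \<in> borel_measurable M" using h by (rule L2_measurable)
  obtain F where F: "\<And>i. simple_function M (F i)" "\<And>th. th \<in> space M \<Longrightarrow> (\<lambda>i. F i th) \<longlonglongrightarrow> h th"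
    "\<And>i th. th \<in> space M \<Longrightarrow> dist (F i th) 0 \<le> 2 * dist (h th) 0"
    using borel_measurable_implies_sequence_metric[OF hM, of 0] by blast
  have FM [measurable]: "F i \<in> borel_measurable M" for i using F(1) by (rule borel_measurable_simple_function)
  have lim: "(\<lambda>i. mean_square (\<lambda>th. h th - F i th)) \<longlonglongrightarrow> expectation (\<lambda>th. 0)"
  proof (rule integral_dominated_convergence)
    show "integrable M (\<lambda>th. 9 * (norm (h th))\<^sup>2)" using L2_integrable[OF h] by simp
    show "AE th in M. (\<lambda>i. (norm (h th - F i th))\<^sup>2) \<longlonglongrightarrow> 0"
    proof (rule AE_I2)
      fix th assume "th \<in> space M"
      then have "(\<lambda>i. (norm (h th - F i th))\<^sup>2) \<longlonglongrightarrow> (norm (h th - h th))\<^sup>2" by (intro tendsto_intros F(2))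
      then show "(\<lambda>i. (norm (h th - F i th))\<^sup>2) \<longlonglongrightarrow> 0" by simp
    qed
    show "AE th in M. norm ((norm (h th - F i th))\<^sup>2) \<le> 9 * (norm (h th))\<^sup>2" for i
    proof (rule AE_I2)
      fix th assume "th \<in> space M"
      then have "norm (h th - F i th) \<le> 3 * norm (h th)"
        using norm_triangle_ineq4[of "h th" "F i th"] F(3)[of th i] by simp
      then have "(norm (h th - F i th))\<^sup>2 \<le> (3 * norm (h th))\<^sup>2" by (intro power_mono) auto
      then show "norm ((norm (h th - F i th))\<^sup>2) \<le> 9 * (norm (h th))\<^sup>2" by (simp add: power_mult_distrib)
    qed
  qed measurable
  then obtain i where i: "mean_square (\<lambda>th. h th - F i th) < e"
    using order_tendstoD(2)[OF lim, of e] e by (auto simp: eventually_sequentially)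
  define I where "I = F i ` space M"
  define A where "A c = F i -` {c} \<inter> space M" for c
  have fin: "finite I" using simple_functionD(1)[OF F(1)[of i]] by (simp add: I_def)
  have AM: "A c \<in> sets M" for c unfolding A_def using simple_functionD(2)[OF F(1)[of i]] .
  have rep: "(\<Sum>c\<in>I. indicator (A c) th *\<^sub>R c) = F i th" if "th \<in> space M" for th
  proof -
    have "(\<Sum>c\<in>I. indicator (A c) th *\<^sub>R c) = (\<Sum>c\<in>{F i th}. indicator (A c) th *\<^sub>R c)"
      using fin that by (intro sum.mono_neutral_right) (auto simp: I_def A_def)
    then show ?thesis using that by (simp add: A_def)
  qed
  have "(\<lambda>th. \<Sum>c\<in>I. indicator (A c) th *\<^sub>R c) \<in> L2 M"
  proof (rule L2_sum)
    fix c
    have "(norm (indicator (A c) th *\<^sub>R c))\<^sup>2 = indicator (A c) th *\<^sub>R (norm c)\<^sup>2" for th by (simp add: indicator_def)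
    then show "(\<lambda>th. indicator (A c) th *\<^sub>R c) \<in> L2 M" using AM[of c] by (simp add: L2_def emeasure_eq_measure)
  qed
  moreover have "mean_square (\<lambda>th. h th - (\<Sum>c\<in>I. indicator (A c) th *\<^sub>R c)) < e"
    using i rep by (subst lint_cong[OF refl, of M _ "\<lambda>th. (norm (h th - F i th))\<^sup>2"]) auto
  ultimately show ?thesis using that fin AM by blast
qed

context projected_channel
begin

context
  fixes n :: nat and \<gamma> :: real and y :: "'a \<Rightarrow> 'h" and z :: "real \<Rightarrow> 'a \<Rightarrow> 'h"
  assumes n: "0 < n" and y: "y \<in> L2 M"
    and z: "\<And>t. t \<in> {0..1} \<Longrightarrow> is_L2_projection M (noncausal_class \<gamma> t) y (z t)"
begin

lemma z_class: "t \<in> {0..1} \<Longrightarrow> z t \<in> noncausal_class \<gamma> t"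
  using z by (auto simp: is_L2_projection_def)

lemma z_L2: "t \<in> {0..1} \<Longrightarrow> z t \<in> L2 M"
  using z_class noncausal_class_L2 by blast

text \<open>
  The estimate at the later time splits orthogonally into the estimate at the earlier time and the
  innovation.
\<close>

lemma cell_increment:
  assumes k: "k < n"
  shows "jump n k z
    = mean_square (\<lambda>th. cell n k (z (grid n (Suc k)) th)) - mean_square (\<lambda>th. cell n k (z (grid n k) th))"
proof -
  have g: "grid n k \<in> {0..1}" "grid n (Suc k) \<in> {0..1}" "grid n k \<le> grid n (Suc k)"
    using k grid_in[OF n] grid_le[OF n] by auto
  let ?a = "z (grid n k)" and ?b = "z (grid n (Suc k))"
  define u where "u th = cell n k (?a th)" for th
  note lin = cell_bounded_linear[OF n k]
  interpret bounded_linear "cell n k" by (rule lin)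
  have uK: "u \<in> noncausal_class \<gamma> (grid n k)" unfolding u_def[abs_def] by (rule cell_noncausal[OF n k z_class[OF g(1)]])
  then have uL: "u \<in> L2 M" using noncausal_class_L2 by blast
  have uK': "u \<in> noncausal_class \<gamma> (grid n (Suc k))"
    using uK past_measurable_mono[OF g] by (auto simp: noncausal_class_def)
  have "expectation (\<lambda>th. (y th - ?a th) \<bullet> u th) = 0" "expectation (\<lambda>th. (y th - ?b th) \<bullet> u th) = 0"
    using z[OF g(1)] z[OF g(2)] uK uK' by (auto simp: is_L2_projection_def)
  then have ab: "expectation (\<lambda>th. ?b th \<bullet> u th) = expectation (\<lambda>th. ?a th \<bullet> u th)"
    using L2_inner_integrable[OF y uL] L2_inner_integrable[OF z_L2[OF g(1)] uL] L2_inner_integrable[OF z_L2[OF g(2)] uL]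
    by (simp add: inner_diff_left)
  have uu: "?a th \<bullet> u th = (norm (u th))\<^sup>2" for th
    unfolding u_def power2_norm_eq_inner using cell_idem[OF n k, of "?a th"] cell_sym[OF n k, of "?a th" "cell n k (?a th)"] by simp
  have bu: "?b th \<bullet> u th = cell n k (?b th) \<bullet> u th" for th
    unfolding u_def using cell_idem[OF n k, of "?a th"] cell_sym[OF n k, of "?b th" "cell n k (?a th)"] by simp
  have bL: "(\<lambda>th. cell n k (?b th)) \<in> L2 M" by (rule cell_L2[OF n k z_L2[OF g(2)]])
  have "mean_square (\<lambda>th. cell n k (?b th - ?a th))
    = expectation (\<lambda>th. (norm (cell n k (?b th)))\<^sup>2 - 2 * (cell n k (?b th) \<bullet> u th) + (norm (u th))\<^sup>2)"
    by (intro lint_cong refl)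
      (simp add: diff u_def power2_norm_eq_inner inner_diff_left inner_diff_right inner_commute)
  also have "\<dots> = mean_square (\<lambda>th. cell n k (?b th)) - 2 * expectation (\<lambda>th. cell n k (?b th) \<bullet> u th) + mean_square u"
    using L2_integrable[OF bL] L2_integrable[OF uL] L2_inner_integrable[OF bL uL] by simp
  also have "expectation (\<lambda>th. cell n k (?b th) \<bullet> u th) = mean_square u"
    using ab by (simp add: uu bu)
  finally show ?thesis by (simp add: u_def)
qed

text \<open>
  The innovations in all cells together are controlled by \<open>y\<close>, uniformly in the
  partition. Hence \<open>x\<close> may be replaced by a simple function.
\<close>

lemma cell_increment_total_le:
  "(\<Sum>k<n. jump n k z) \<le> mean_square y"
proof -
  have "(\<Sum>k<n. jump n k z)
     \<le> (\<Sum>k<n. mean_square (\<lambda>th. cell n k (y th)))"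
  proof (rule sum_mono)
    fix k assume "k \<in> {..<n}"
    then have k: "k < n" by simp
    have g: "grid n (Suc k) \<in> {0..1}" using k grid_in[OF n, of "Suc k"] by simp
    have "0 \<le> mean_square (\<lambda>th. cell n k (z (grid n k) th))" by (rule lint_nonneg) simp
    moreover have "mean_square (\<lambda>th. cell n k (z (grid n (Suc k)) th)) \<le> mean_square (\<lambda>th. cell n k (y th))"
      by (rule is_L2_projection_sq(3)[OF cell_noncausal_projection[OF n k z[OF g]] noncausal_class_L2 cell_L2[OF n k y]])
    ultimately show "jump n k z \<le> mean_square (\<lambda>th. cell n k (y th))"
      unfolding cell_increment[OF k] by linarith
  qed
  also have "\<dots> = expectation (\<lambda>th. \<Sum>k<n. (norm (cell n k (y th)))\<^sup>2)"
    by (rule lint_sum[symmetric]) (use L2_integrable[OF cell_L2[OF n _ y]] in auto)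
  also have "\<dots> = mean_square y"
    by (intro lint_cong refl norm_cells[OF n, symmetric])
  finally show ?thesis .
qed

end

lemma indicator_L2: "A \<in> sets M \<Longrightarrow> (indicator A :: 'a \<Rightarrow> real) \<in> L2 M"
  by (auto simp: L2_real_iff power2_eq_square indicator_inter_arith[symmetric] emeasure_eq_measure)

text \<open>
  For a simple signal the estimate is a combination of the vectors \<open>c\<close> with conditional
  probabilities as coefficients.
\<close>

lemma simple_projection:
  assumes I: "finite I" and A: "\<And>c. A c \<in> sets M" and t: "t \<in> {0..1}"
  shows "is_L2_projection M (noncausal_class \<gamma> t) (\<lambda>th. \<Sum>c\<in>I. indicator (A c) th *\<^sub>R c)
    (\<lambda>th. \<Sum>c\<in>I. real_cond_exp M (past \<gamma> t) (indicator (A c)) th *\<^sub>R c)"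
proof -
  let ?r = "\<lambda>c. real_cond_exp M (past \<gamma> t) (indicator (A c))"
  note F = past_full[OF t, of \<gamma>]
  have rL: "?r c \<in> L2 M" for c by (rule real_cond_exp_L2[OF F indicator_L2[OF A]])
  have vL: "(\<lambda>th. f th *\<^sub>R c) \<in> L2 M" if "f \<in> L2 M" for f :: "'a \<Rightarrow> real" and c :: 'h
    using that by (auto simp: L2_def power_mult_distrib)
  show ?thesis unfolding is_L2_projection_def
  proof (intro conjI ballI)
    show "(\<lambda>th. \<Sum>c\<in>I. ?r c th *\<^sub>R c) \<in> noncausal_class \<gamma> t"
      using rL by (auto simp: noncausal_class_def intro!: L2_sum vL)
    fix u assume u: "u \<in> noncausal_class \<gamma> t"
    then have uL: "u \<in> L2 M" and um [measurable]: "u \<in> borel_measurable (past \<gamma> t)" by (auto simp: noncausal_class_def)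
    have cu: "(\<lambda>th. c \<bullet> u th) \<in> L2 M" for c
      using L2_bounded_linear[OF bounded_linear_inner_right uL] .
    have cum: "(\<lambda>th. c \<bullet> u th) \<in> borel_measurable (past \<gamma> t)" for c by measurable
    have "expectation (\<lambda>th. ((\<Sum>c\<in>I. indicator (A c) th *\<^sub>R c) - (\<Sum>c\<in>I. ?r c th *\<^sub>R c)) \<bullet> u th)
      = expectation (\<lambda>th. \<Sum>c\<in>I. ((c \<bullet> u th) * indicator (A c) th - (c \<bullet> u th) * ?r c th))"
      by (intro lint_cong refl) (simp add: inner_diff_left inner_sum_left sum_subtractf mult.commute)
    also have "\<dots> = (\<Sum>c\<in>I. expectation (\<lambda>th. (c \<bullet> u th) * indicator (A c) th - (c \<bullet> u th) * ?r c th))"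
      by (rule lint_sum)
        (intro Bochner_Integration.integrable_diff L2_mult_integrable cu rL indicator_L2 A)
    also have "\<dots> = (\<Sum>c\<in>I. 0)"
    proof (rule sum.cong[OF refl])
      fix c
      have "expectation (\<lambda>th. (c \<bullet> u th) * indicator (A c) th - (c \<bullet> u th) * ?r c th)
        = expectation (\<lambda>th. (c \<bullet> u th) * indicator (A c) th) - expectation (\<lambda>th. (c \<bullet> u th) * ?r c th)"
        by (rule Bochner_Integration.integral_diff) (intro L2_mult_integrable cu rL indicator_L2 A)+
      then show "expectation (\<lambda>th. (c \<bullet> u th) * indicator (A c) th - (c \<bullet> u th) * ?r c th) = 0"
        using real_cond_exp_mult[OF F indicator_L2[OF A] cu cum] by simp
    qed
    finally show "expectation (\<lambda>th. ((\<Sum>c\<in>I. indicator (A c) th *\<^sub>R c) - (\<Sum>c\<in>I. ?r c th *\<^sub>R c)) \<bullet> u th) = 0" by simp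
  qed
qed

text \<open>
  The vectors \<open>c\<close> have small components in every cell, while the squared increments of
  each conditional probability add up to at most one.
\<close>

lemma simple_increment_le:
  fixes \<gamma> :: real and A :: "'h \<Rightarrow> 'a set"
  assumes n: "0 < n" and I: "finite I" and A: "\<And>c. A c \<in> sets M"
    and \<delta>: "\<And>c k. c \<in> I \<Longrightarrow> k < n \<Longrightarrow> (norm (cell n k c))\<^sup>2 \<le> \<delta>" and \<delta>0: "0 \<le> \<delta>"
  defines "\<zeta> \<equiv> \<lambda>t th. \<Sum>c\<in>I. real_cond_exp M (past \<gamma> t) (indicator (A c)) th *\<^sub>R c"
  shows "(\<Sum>k<n. jump n k \<zeta>) \<le> (real (card I))\<^sup>2 * \<delta>"
proof -
  let ?r = "\<lambda>k c. real_cond_exp M (past \<gamma> (grid n k)) (indicator (A c))"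
  define d where "d k c th = ?r (Suc k) c th - ?r k c th" for k c th
  define m where "m k c = expectation (\<lambda>th. (?r k c th)\<^sup>2)" for k c
  have F: "full_subalgebra M (past \<gamma> (grid n k))" if "k \<le> n" for k by (rule past_full[OF grid_in[OF n that]])
  have rL: "?r k c \<in> L2 M" if "k \<le> n" for k c by (rule real_cond_exp_L2[OF F[OF that] indicator_L2[OF A]])
  have dsq: "integrable M (\<lambda>th. (d k c th)\<^sup>2)" if "k < n" for k c
    using L2_diff[OF rL rL, of "Suc k" k c c] that by (simp add: L2_real_iff d_def)
  have Ed: "expectation (\<lambda>th. (d k c th)\<^sup>2) = m (Suc k) c - m k c" if k: "k < n" for k c
    unfolding d_def m_def
    using k grid_in[OF n] grid_le[OF n] by (intro real_cond_exp_sq_increment F past_mono indicator_L2 A) auto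
  have pt: "(norm (cell n k (\<zeta> (grid n (Suc k)) th - \<zeta> (grid n k) th)))\<^sup>2 \<le> real (card I) * \<delta> * (\<Sum>c\<in>I. (d k c th)\<^sup>2)" if k: "k < n" for k th
  proof -
    interpret bounded_linear "cell n k" by (rule cell_bounded_linear[OF n k])
    have "\<zeta> (grid n (Suc k)) th - \<zeta> (grid n k) th = (\<Sum>c\<in>I. d k c th *\<^sub>R c)"
      by (simp add: \<zeta>_def d_def scaleR_diff_left sum_subtractf)
    then have "cell n k (\<zeta> (grid n (Suc k)) th - \<zeta> (grid n k) th) = (\<Sum>c\<in>I. d k c th *\<^sub>R cell n k c)"
      by (simp add: sum scaleR)
    then have "(norm (cell n k (\<zeta> (grid n (Suc k)) th - \<zeta> (grid n k) th)))\<^sup>2 \<le> (\<Sum>c\<in>I. norm (d k c th *\<^sub>R cell n k c))\<^sup>2"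
      by (simp add: power_mono norm_sum del: norm_scaleR)
    also have "\<dots> \<le> (\<Sum>c\<in>I. (norm (d k c th *\<^sub>R cell n k c))\<^sup>2) * real (card I)"
      using sum_squared_le_sum_of_squares[of "\<lambda>c. norm (d k c th *\<^sub>R cell n k c)" I] by simp
    also have "\<dots> \<le> (\<Sum>c\<in>I. (d k c th)\<^sup>2 * \<delta>) * real (card I)"
      using \<delta>[OF _ k] by (intro mult_right_mono sum_mono) (auto simp: power_mult_distrib intro!: mult_left_mono)
    finally show ?thesis by (simp add: sum_distrib_left mult.commute mult.left_commute mult.assoc)
  qed
  have "(\<Sum>k<n. jump n k \<zeta>)
     \<le> (\<Sum>k<n. real (card I) * \<delta> * (\<Sum>c\<in>I. m (Suc k) c - m k c))"
  proof (rule sum_mono)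
    fix k assume "k \<in> {..<n}"
    then have k: "k < n" by simp
    have "jump n k \<zeta>
      \<le> expectation (\<lambda>th. real (card I) * \<delta> * (\<Sum>c\<in>I. (d k c th)\<^sup>2))"
      using dsq[OF k] pt[OF k] \<delta>0 by (intro integral_mono') (auto intro!: mult_nonneg_nonneg sum_nonneg)
    also have "\<dots> = real (card I) * \<delta> * (\<Sum>c\<in>I. m (Suc k) c - m k c)"
      using dsq[OF k] Ed[OF k] by simp
    finally show "jump n k \<zeta>
      \<le> real (card I) * \<delta> * (\<Sum>c\<in>I. m (Suc k) c - m k c)" .
  qed
  also have "\<dots> = real (card I) * \<delta> * (\<Sum>c\<in>I. \<Sum>k<n. m (Suc k) c - m k c)"
    by (subst sum.swap) (simp add: sum_distrib_left)
  also have "\<dots> = real (card I) * \<delta> * (\<Sum>c\<in>I. m n c - m 0 c)" by (simp only: sum_lessThan_telescope[of "\<lambda>k. m k _"])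
  also have "\<dots> \<le> real (card I) * \<delta> * (\<Sum>c\<in>I. 1)"
  proof (intro mult_left_mono sum_mono)
    fix c
    have "m n c \<le> expectation (\<lambda>th. (indicator (A c) th)\<^sup>2)"
      unfolding m_def by (rule real_cond_exp_sq_le[OF F[OF order_refl] indicator_L2[OF A]])
    also have "\<dots> \<le> expectation (\<lambda>th. 1)"
      using indicator_L2[OF A, of c] by (intro integral_mono) (auto simp: L2_real_iff indicator_def)
    also have "\<dots> = 1" by (simp add: prob_space)
    finally have "m n c \<le> 1" .
    moreover have "0 \<le> m 0 c" unfolding m_def by (rule lint_nonneg) simp
    ultimately show "m n c - m 0 c \<le> 1" by simp
  qed (use \<delta>0 in auto)
  finally show ?thesis by (simp add: power2_eq_square mult_ac)
qed

lemma cell_uniformly_small: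
  assumes e: "0 < e"
  shows "\<forall>\<^sub>F n in sequentially. \<forall>k<n. (norm (cell n k c))\<^sup>2 \<le> e"
proof -
  have "uniformly_continuous_on {0..1} (\<lambda>t. \<pi> t c)" by (rule compact_uniformly_continuous[OF \<pi>_cont compact_Icc])
  then obtain d where d: "0 < d" "\<And>s t. s \<in> {0..1} \<Longrightarrow> t \<in> {0..1} \<Longrightarrow> dist s t < d \<Longrightarrow> dist (\<pi> s c) (\<pi> t c) < sqrt e"
    unfolding uniformly_continuous_on_def using e by (metis real_sqrt_gt_zero)
  obtain N where N: "1 / real (Suc N) < d" using nat_approx_posE[OF d(1)] by auto
  have "(norm (cell n k c))\<^sup>2 \<le> e" if nk: "Suc N \<le> n" "k < n" for n k
  proof -
    have n: "0 < n" using nk by simp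
    have "dist (grid n (Suc k)) (grid n k) = 1 / real n"
      using n by (simp add: grid_def dist_real_def diff_divide_distrib[symmetric])
    also have "\<dots> \<le> 1 / real (Suc N)" using nk n by (intro divide_left_mono) auto
    also have "\<dots> < d" by (rule N)
    finally have "dist (\<pi> (grid n (Suc k)) c) (\<pi> (grid n k) c) < sqrt e"
      using nk grid_in[OF n] by (intro d(2)) auto
    then have "norm (cell n k c) \<le> sqrt e" by (simp add: cell_def dist_norm)
    then have "(norm (cell n k c))\<^sup>2 \<le> (sqrt e)\<^sup>2" by (intro power_mono) auto
    then show ?thesis using e by simp
  qed
  then show ?thesis unfolding eventually_sequentially by blast
qed

text \<open>
  The difference of the sums in \<open>causal_upper\<close> and \<open>causal_lower\<close> is the
  total power of the innovations. For a simple signal it vanishes as the partition is refined, and the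
  general case follows by approximation.
\<close>

lemma gap_tendsto:
  assumes z: "\<And>t. t \<in> {0..1} \<Longrightarrow> is_L2_projection M (noncausal_class \<gamma> t) x (z t)"
  shows "(\<lambda>n. upper_sum n z
    - lower_sum n z) \<longlonglongrightarrow> 0"
proof (rule LIMSEQ_I)
  fix e :: real assume e: "0 < e"
  have e4: "0 < e / 4" using e by simp
  obtain I A where I: "finite I" and A: "\<And>c. A c \<in> sets M"
    and sL: "(\<lambda>th. \<Sum>c\<in>I. indicator (A c) th *\<^sub>R c) \<in> L2 M"
    and close: "mean_square (\<lambda>th. x th - (\<Sum>c\<in>I. indicator (A c) th *\<^sub>R c)) < e / 4"
    by (rule L2_simple_approximation[OF x e4], rule that) assumption+
  define s where "s th = (\<Sum>c\<in>I. indicator (A c) th *\<^sub>R c)" for th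
  define \<zeta> where "\<zeta> t th = (\<Sum>c\<in>I. real_cond_exp M (past \<gamma> t) (indicator (A c)) th *\<^sub>R c)" for t th
  define \<delta> where "\<delta> = e / (8 * ((real (card I))\<^sup>2 + 1))"
  have \<delta>: "0 < \<delta>" using e unfolding \<delta>_def by (intro divide_pos_pos mult_pos_pos add_nonneg_pos) auto
  have \<delta>c: "(real (card I))\<^sup>2 * \<delta> < e / 4"
  proof -
    have "(real (card I))\<^sup>2 * \<delta> \<le> ((real (card I))\<^sup>2 + 1) * \<delta>" using \<delta> by (intro mult_right_mono) auto
    also have "\<dots> = e / 8"
    proof -
      have "(real (card I))\<^sup>2 + 1 \<noteq> 0" using zero_le_power2[of "real (card I)"] by linarith
      have "a * (e / (8 * a)) = e / 8" if "a \<noteq> 0" for a :: real using that by simp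
      then show ?thesis using \<open>(real (card I))\<^sup>2 + 1 \<noteq> 0\<close> unfolding \<delta>_def by blast
    qed
    finally show ?thesis using e by simp
  qed
  have sL': "s \<in> L2 M" using sL by (simp add: s_def[abs_def])
  have \<zeta>: "is_L2_projection M (noncausal_class \<gamma> t) s (\<zeta> t)" if "t \<in> {0..1}" for t
    unfolding s_def[abs_def] \<zeta>_def[abs_def] by (rule simple_projection[OF I A that])
  have \<rho>: "is_L2_projection M (noncausal_class \<gamma> t) (\<lambda>th. x th - s th) (\<lambda>th. z t th - \<zeta> t th)" if "t \<in> {0..1}" for t
    by (rule is_L2_projection_diff[OF z[OF that] \<zeta>[OF that] noncausal_class_L2 x sL' noncausal_class_diff])
  have "\<forall>\<^sub>F n in sequentially. \<forall>c\<in>I. \<forall>k<n. (norm (cell n k c))\<^sup>2 \<le> \<delta>"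
    using cell_uniformly_small[OF \<delta>] I by (intro eventually_ball_finite) auto
  then obtain N where N: "\<And>n c k. n \<ge> N \<Longrightarrow> c \<in> I \<Longrightarrow> k < n \<Longrightarrow> (norm (cell n k c))\<^sup>2 \<le> \<delta>"
    unfolding eventually_sequentially by blast
  show "\<exists>no. \<forall>n\<ge>no. norm (upper_sum n z
    - lower_sum n z - 0) < e"
  proof (intro exI[of _ "Suc N"] allI impI)
    fix n assume "Suc N \<le> n"
    then have n: "0 < n" "N \<le> n" by auto
    note g = grid_in[OF n(1)]
    define Z where "Z k = jump n k z" for k
    define P where "P k = jump n k \<zeta>" for k
    define Q where "Q k = mean_square (\<lambda>th. cell n k ((z (grid n (Suc k)) th - \<zeta> (grid n (Suc k)) th) - (z (grid n k) th - \<zeta> (grid n k) th)))" for k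
    have diff: "upper_sum n z
      - lower_sum n z = (\<Sum>k<n. Z k)"
      unfolding sum_subtractf[symmetric] Z_def
      by (intro sum.cong refl cell_increment[OF n(1) x z, symmetric]) auto
    have "Z k \<le> 2 * P k + 2 * Q k" if k: "k < n" for k
    proof -
      interpret bounded_linear "cell n k" by (rule cell_bounded_linear[OF n(1) k])
      have t: "grid n k \<in> {0..1}" "grid n (Suc k) \<in> {0..1}" using g k by auto
      have L: "z t \<in> L2 M" "\<zeta> t \<in> L2 M" if "t \<in> {0..1}" for t
        using z[OF that] \<zeta>[OF that] noncausal_class_L2 by (auto simp: is_L2_projection_def)
      have iP: "integrable M (\<lambda>th. (norm (cell n k (\<zeta> (grid n (Suc k)) th - \<zeta> (grid n k) th)))\<^sup>2)"
        by (intro L2_integrable cell_L2 n(1) k L2_diff L t)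
      have iQ: "integrable M (\<lambda>th. (norm (cell n k ((z (grid n (Suc k)) th - \<zeta> (grid n (Suc k)) th) - (z (grid n k) th - \<zeta> (grid n k) th))))\<^sup>2)"
        by (intro L2_integrable cell_L2 n(1) k L2_diff L t)
      have "Z k \<le> expectation (\<lambda>th. 2 * (norm (cell n k (\<zeta> (grid n (Suc k)) th - \<zeta> (grid n k) th)))\<^sup>2
        + 2 * (norm (cell n k ((z (grid n (Suc k)) th - \<zeta> (grid n (Suc k)) th) - (z (grid n k) th - \<zeta> (grid n k) th))))\<^sup>2)"
        unfolding Z_def
      proof (rule integral_mono')
        show "integrable M (\<lambda>th. 2 * (norm (cell n k (\<zeta> (grid n (Suc k)) th - \<zeta> (grid n k) th)))\<^sup>2
          + 2 * (norm (cell n k ((z (grid n (Suc k)) th - \<zeta> (grid n (Suc k)) th) - (z (grid n k) th - \<zeta> (grid n k) th))))\<^sup>2)"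
          using iP iQ by simp
        fix th
        let ?p = "cell n k (\<zeta> (grid n (Suc k)) th - \<zeta> (grid n k) th)"
          and ?q = "cell n k ((z (grid n (Suc k)) th - \<zeta> (grid n (Suc k)) th) - (z (grid n k) th - \<zeta> (grid n k) th))"
        have "cell n k (z (grid n (Suc k)) th - z (grid n k) th) = ?p - (- ?q)" by (simp add: diff)
        then show "(norm (cell n k (z (grid n (Suc k)) th - z (grid n k) th)))\<^sup>2 \<le> 2 * (norm ?p)\<^sup>2 + 2 * (norm ?q)\<^sup>2"
          using norm_diff_sq_le[of ?p "- ?q"] by simp
      qed simp
      then show ?thesis using iP iQ by (simp add: P_def Q_def)
    qed
    then have "(\<Sum>k<n. Z k) \<le> 2 * (\<Sum>k<n. P k) + 2 * (\<Sum>k<n. Q k)"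
      unfolding sum_distrib_left sum.distrib[symmetric] by (intro sum_mono) auto
    moreover have "(\<Sum>k<n. P k) \<le> (real (card I))\<^sup>2 * \<delta>"
      unfolding P_def \<zeta>_def[abs_def] using N[OF n(2)] \<delta> by (intro simple_increment_le[OF n(1) I A]) auto
    moreover have "(\<Sum>k<n. Q k) \<le> mean_square (\<lambda>th. x th - s th)"
      unfolding Q_def by (rule cell_increment_total_le[OF n(1) L2_diff[OF x sL'] \<rho>])
    ultimately have "(\<Sum>k<n. Z k) < e" using \<delta>c close by (simp add: s_def)
    moreover have "0 \<le> (\<Sum>k<n. Z k)" unfolding Z_def by (intro sum_nonneg lint_nonneg) simp
    ultimately show "norm (upper_sum n z
      - lower_sum n z - 0) < e"
      unfolding diff by simp
  qed
qed

end

section \<open>From finitely many coordinates to the whole past\<close>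

text \<open>
  A diagonal argument that needs no uniformity: \<open>c M N\<close> is the part of \<open>b N\<close>
  due to the first \<open>M\<close> coordinates, and the limits may be taken one after the other.
\<close>

lemma tendsto_of_lower_approximations:
  fixes b :: "nat \<Rightarrow> real"
  assumes up: "\<And>N. b N \<le> L" and low: "\<And>M N. M \<le> N \<Longrightarrow> c M N \<le> b N"
    and inner: "\<And>M. (\<lambda>N. c M N) \<longlonglongrightarrow> c' M" and outer: "c' \<longlonglongrightarrow> L"
  shows "b \<longlonglongrightarrow> L"
proof (rule order_tendstoI)
  fix a assume "a < L"
  then have "\<forall>\<^sub>F M in sequentially. a < c' M" by (rule order_tendstoD(1)[OF outer])
  then obtain M where M: "a < c' M" by (auto simp: eventually_sequentially)
  have "\<forall>\<^sub>F N in sequentially. a < c M N" by (rule order_tendstoD(1)[OF inner M])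
  moreover have "\<forall>\<^sub>F N in sequentially. M \<le> N" by (rule eventually_ge_at_top)
  ultimately show "\<forall>\<^sub>F N in sequentially. a < b N"
  proof eventually_elim
    case (elim N)
    then show ?case using low[of M N] by linarith
  qed
next
  fix a assume "L < a"
  then have "b N < a" for N using up[of N] by linarith
  then show "\<forall>\<^sub>F N in sequentially. b N < a" by simp
qed

context projected_channel
begin

text \<open>
  The part of the power of the coordinate \<open>h\<close> of the signal that is predicted from the
  observations in \<open>S\<close>.
\<close>

definition predicted_power :: "real \<Rightarrow> 'h set \<Rightarrow> 'h \<Rightarrow> real" where
  "predicted_power \<beta> S h = expectation (\<lambda>th. (real_cond_exp M (filt \<beta> S) (\<lambda>th. x th \<bullet> h) th)\<^sup>2)"

lemma x_inner_L2: "(\<lambda>th. x th \<bullet> h) \<in> L2 M"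
  by (rule L2_bounded_linear[OF bounded_linear_inner_left x])

lemma predicted_power_nonneg: "0 \<le> predicted_power \<beta> S h"
  unfolding predicted_power_def by (rule lint_nonneg) simp

lemma predicted_power_0: "S \<subseteq> D \<Longrightarrow> predicted_power \<beta> S 0 = 0"
  by (rule antisym[OF _ predicted_power_nonneg])
    (use real_cond_exp_sq_le[OF filt_full x_inner_L2, of S \<beta> 0] in \<open>simp add: predicted_power_def\<close>)

lemma predicted_power_mono:
  assumes "S \<subseteq> S'" "S' \<subseteq> D"
  shows "predicted_power \<beta> S h \<le> predicted_power \<beta> S' h"
proof -
  have S: "S \<subseteq> D" using assms by auto
  have "0 \<le> expectation (\<lambda>th. (real_cond_exp M (filt \<beta> S') (\<lambda>th. x th \<bullet> h) th - real_cond_exp M (filt \<beta> S) (\<lambda>th. x th \<bullet> h) th)\<^sup>2)"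
    by (rule lint_nonneg) simp
  then show ?thesis
    unfolding predicted_power_def real_cond_exp_sq_increment[OF filt_full[OF S] filt_full[OF assms(2)] filt_mono[OF assms] x_inner_L2] by simp
qed

lemma predicted_power_past:
  assumes t: "t \<in> {0..1}" and z: "is_L2_projection M (noncausal_class \<beta> t) x z"
  shows "predicted_power \<beta> (\<pi> t ` D) h = expectation (\<lambda>th. (z th \<bullet> h)\<^sup>2)"
proof -
  have F: "full_subalgebra M (filt \<beta> (\<pi> t ` D))" by (rule filt_full[OF \<pi>D[OF t]])
  have zL: "z \<in> L2 M" using z noncausal_class_L2 by (auto simp: is_L2_projection_def)
  have "AE th in M. real_cond_exp M (filt \<beta> (\<pi> t ` D)) (\<lambda>th. x th \<bullet> h) th = z th \<bullet> h"
    using z unfolding noncausal_class_def past_def by (rule projection_real_cond_exp[OF F x])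
  moreover have "real_cond_exp M (filt \<beta> (\<pi> t ` D)) (\<lambda>th. x th \<bullet> h) \<in> borel_measurable M"
    by (rule L2_measurable[OF real_cond_exp_L2[OF F x_inner_L2]])
  ultimately show ?thesis unfolding predicted_power_def using L2_measurable[OF zL]
    by (intro integral_cong_AE) (auto elim!: eventually_mono)
qed

context
  fixes n :: nat and e :: "nat \<Rightarrow> nat \<Rightarrow> 'h"
  assumes n: "0 < n"
    and e_on: "\<And>k. k < n \<Longrightarrow> orthonormal_or_zero (e k)"
    and e_cell: "\<And>k m. k < n \<Longrightarrow> e k m \<in> cell n k ` D"
    and e_complete: "\<And>k v. k < n \<Longrightarrow> v \<in> closure (cell n k ` D) \<Longrightarrow> (\<lambda>N. \<Sum>m<N. (v \<bullet> e k m) *\<^sub>R e k m) \<longlonglongrightarrow> v"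
begin

definition vec :: "nat \<times> nat \<Rightarrow> 'h" where "vec p = e (fst p) (snd p)"

text \<open>
  The indices of the first \<open>N\<close> basis vectors in the cell \<open>k\<close>. Zero vectors
  are skipped because coordinates of a finite system have unit length.
\<close>

definition block :: "nat \<Rightarrow> nat \<Rightarrow> (nat \<times> nat) set" where
  "block N k = Pair k ` {m. m < N \<and> e k m \<noteq> 0}"

definition blocks :: "nat \<Rightarrow> nat \<Rightarrow> (nat \<times> nat) set" where
  "blocks N m = (\<Union>k<m. block N k)"

lemma finite_block: "finite (block N k)" and finite_blocks: "finite (blocks N m)"
  by (auto simp: block_def blocks_def)

lemma block_sum:
  assumes f: "f 0 = (0::real)"
  shows "(\<Sum>p\<in>block N k. f (vec p)) = (\<Sum>m<N. f (e k m))"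
proof -
  have "(\<Sum>p\<in>block N k. f (vec p)) = (\<Sum>m\<in>{m. m < N \<and> e k m \<noteq> 0}. f (e k m))"
    unfolding block_def by (subst sum.reindex) (auto simp: inj_on_def vec_def)
  also have "\<dots> = (\<Sum>m<N. f (e k m))" using f by (intro sum.mono_neutral_left) auto
  finally show ?thesis .
qed

lemma blocks_mono: "N \<le> N' \<Longrightarrow> m \<le> m' \<Longrightarrow> blocks N m \<subseteq> blocks N' m'"
  unfolding blocks_def block_def by fastforce

lemma e_D: "k < n \<Longrightarrow> e k m \<in> D"
  using e_cell[of k m] cell_D[OF n] by auto

lemma vec_D: "m \<le> n \<Longrightarrow> p \<in> blocks N m \<Longrightarrow> vec p \<in> D"
  using e_D by (auto simp: blocks_def block_def vec_def)

lemma cell_e: "k < n \<Longrightarrow> cell n k (e k m) = e k m"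
  using e_cell[of k m] cell_idem[OF n] by auto

lemma inner_e: "k < n \<Longrightarrow> cell n k h \<bullet> e k m = h \<bullet> e k m"
  using cell_sym[OF n, of k h "e k m"] cell_e[of k m] by simp

lemma vec_orth:
  assumes i: "i \<in> blocks N n" and j: "j \<in> blocks N n"
  shows "vec i \<bullet> vec j = (if i = j then 1 else 0)"
proof -
  obtain k l k' l' where ij: "i = (k, l)" "j = (k', l')" "k < n" "k' < n" "e k l \<noteq> 0" "e k' l' \<noteq> 0"
    using i j by (auto simp: blocks_def block_def)
  show ?thesis
  proof (cases "k = k'")
    case True
    have "norm (e k l) = 1" using e_on[OF ij(3)] ij(5) by (auto simp: orthonormal_or_zero_def)
    then have "e k l \<bullet> e k l = 1" by (simp add: norm_eq_1)
    then show ?thesis using e_on[OF ij(3)] ij True by (auto simp: vec_def orthonormal_or_zero_def)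
  next
    case False
    then show ?thesis using cell_orth[OF n ij(3,4) False, of "e k l" "e k' l'"] ij by (simp add: vec_def cell_e)
  qed
qed

lemma e_expansion:
  assumes k: "k < n"
  shows "(\<lambda>N. \<Sum>m<N. (h \<bullet> e k m) *\<^sub>R e k m) \<longlonglongrightarrow> cell n k h"
proof -
  have "h \<in> closure D" using D_dense by simp
  then obtain s where s: "\<And>i. s i \<in> D" "s \<longlonglongrightarrow> h" unfolding closure_sequential by blast
  have "(\<lambda>i. cell n k (s i)) \<longlonglongrightarrow> cell n k h" by (rule bounded_linear.tendsto[OF cell_bounded_linear[OF n k] s(2)])
  then have "cell n k h \<in> closure (cell n k ` D)" unfolding closure_sequential
    using s(1) by (intro exI[of _ "\<lambda>i. cell n k (s i)"]) auto
  from e_complete[OF k this] show ?thesis by (simp add: inner_e[OF k])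
qed

lemma parseval:
  assumes k: "k < n"
  shows "(\<lambda>N. \<Sum>m<N. (h \<bullet> e k m)\<^sup>2) \<longlonglongrightarrow> (norm (cell n k h))\<^sup>2"
proof -
  have "(\<lambda>N. h \<bullet> (\<Sum>m<N. (h \<bullet> e k m) *\<^sub>R e k m)) \<longlonglongrightarrow> h \<bullet> cell n k h"
    by (intro tendsto_intros e_expansion k)
  moreover have "h \<bullet> cell n k h = (norm (cell n k h))\<^sup>2"
    using cell_sym[OF n k, of h "cell n k h"] cell_idem[OF n k, of h] by (simp add: power2_norm_eq_inner)
  ultimately show ?thesis by (simp add: inner_sum_right power2_eq_square)
qed

lemma bessel_e: "k < n \<Longrightarrow> (\<Sum>m<N. (h \<bullet> e k m)\<^sup>2) \<le> (norm (cell n k h))\<^sup>2"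
  by (rule incseq_le[OF _ parseval]) (auto intro: incseq_SucI)

context
  fixes \<beta> t :: real and z :: "'a \<Rightarrow> 'h" and m k :: nat
  assumes m: "m \<le> n" and k: "k < n" and t: "t = grid n m"
    and z: "is_L2_projection M (noncausal_class \<beta> t) x z"
begin

lemma t_in: "t \<in> {0..1}" using grid_in[OF n m] t by simp

lemma z_sq_tendsto: "(\<lambda>N. \<Sum>i<N. predicted_power \<beta> (\<pi> t ` D) (e k i)) \<longlonglongrightarrow> mean_square (\<lambda>th. cell n k (z th))"
proof -
  have zL: "z \<in> L2 M" using z noncausal_class_L2 by (auto simp: is_L2_projection_def)
  note [measurable] = L2_measurable[OF zL] L2_measurable[OF cell_L2[OF n k zL]]
  have "(\<lambda>N. expectation (\<lambda>th. \<Sum>i<N. (z th \<bullet> e k i)\<^sup>2)) \<longlonglongrightarrow> mean_square (\<lambda>th. cell n k (z th))"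
  proof (rule integral_dominated_convergence)
    show "integrable M (\<lambda>th. (norm (cell n k (z th)))\<^sup>2)" by (rule L2_integrable[OF cell_L2[OF n k zL]])
    show "AE th in M. (\<lambda>N. \<Sum>i<N. (z th \<bullet> e k i)\<^sup>2) \<longlonglongrightarrow> (norm (cell n k (z th)))\<^sup>2"
      by (intro AE_I2 parseval k)
    show "AE th in M. norm (\<Sum>i<N. (z th \<bullet> e k i)\<^sup>2) \<le> (norm (cell n k (z th)))\<^sup>2" for N
      using bessel_e[OF k] by (intro AE_I2) (simp add: sum_nonneg)
  qed measurable
  moreover have "expectation (\<lambda>th. \<Sum>i<N. (z th \<bullet> e k i)\<^sup>2) = (\<Sum>i<N. predicted_power \<beta> (\<pi> t ` D) (e k i))" for N
  proof -
    have "(\<lambda>th. z th \<bullet> e k i) \<in> L2 M" for i by (rule L2_bounded_linear[OF bounded_linear_inner_left zL])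
    then have "integrable M (\<lambda>th. (z th \<bullet> e k i)\<^sup>2)" for i by (simp add: L2_real_iff)
    then show ?thesis by (simp add: predicted_power_past[OF t_in z])
  qed
  ultimately show ?thesis by simp
qed

lemma blocks_past: "vec ` blocks N m \<subseteq> \<pi> t ` D"
proof
  fix v assume "v \<in> vec ` blocks N m"
  then obtain j i where ji: "j < m" "v = e j i" by (auto simp: blocks_def block_def vec_def)
  have j: "j < n" using ji m by simp
  have "grid n (Suc j) \<le> t" using ji t grid_le[OF n, of "Suc j" m] by simp
  then have "\<pi> t (cell n j v) = cell n j v" by (rule cell_\<pi>(1)[OF n j t_in])
  then have "v = \<pi> t v" using cell_e[OF j, of i] ji by simp
  then show "v \<in> \<pi> t ` D" using e_D[OF j, of i] ji by auto
qed

lemma predicted_power_blocks_tendsto: "(\<lambda>N. predicted_power \<beta> (vec ` blocks N m) h) \<longlonglongrightarrow> predicted_power \<beta> (\<pi> t ` D) h"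
  unfolding predicted_power_def
proof (rule filt_cond_exp_tendsto[OF blocks_past _ \<pi>D[OF t_in] _ x_inner_L2])
  show "vec ` blocks N m \<subseteq> vec ` blocks (Suc N) m" for N by (intro image_mono blocks_mono) auto
  fix h assume "h \<in> \<pi> t ` D"
  then have h: "\<pi> t h = h" using \<pi>_le(1)[OF t_in t_in order_refl] by auto
  define s where "s N = (\<Sum>j<m. \<Sum>i<N. (h \<bullet> e j i) *\<^sub>R e j i)" for N
  have "s \<longlonglongrightarrow> (\<Sum>j<m. cell n j h)"
    unfolding s_def[abs_def] using m by (intro tendsto_sum e_expansion) auto
  then have "s \<longlonglongrightarrow> h" using cell_sum[OF n m, of h] h t by simp
  moreover have "s N \<in> span (vec ` blocks N m)" for N
    unfolding s_def
  proof (intro span_sum span_scale)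
    fix j i assume "j \<in> {..<m}" "i \<in> {..<N}"
    then show "e j i \<in> span (vec ` blocks N m)"
      by (cases "e j i = 0") (auto intro!: span_base image_eqI[of _ _ "(j, i)"] simp: span_zero blocks_def block_def vec_def)
  qed
  ultimately show "\<exists>s. (\<forall>N. s N \<in> span (vec ` blocks N m)) \<and> s \<longlonglongrightarrow> h" by blast
qed

lemma block_power_le: "(\<Sum>i<N. predicted_power \<beta> (vec ` blocks N m) (e k i)) \<le> mean_square (\<lambda>th. cell n k (z th))"
proof -
  have "(\<Sum>i<N. predicted_power \<beta> (vec ` blocks N m) (e k i)) \<le> (\<Sum>i<N. predicted_power \<beta> (\<pi> t ` D) (e k i))"
    by (intro sum_mono predicted_power_mono blocks_past \<pi>D t_in)
  also have "\<dots> \<le> mean_square (\<lambda>th. cell n k (z th))"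
    by (rule incseq_le[OF _ z_sq_tendsto]) (rule incseq_SucI, simp add: predicted_power_nonneg)
  finally show ?thesis .
qed

text \<open>
  Two limits are combined: with more observed vectors the predicted powers approach those of the whole
  past, and with more coordinates they add up to the power of the whole cell.
\<close>

lemma block_power_tendsto:
  "(\<lambda>N. \<Sum>i<N. predicted_power \<beta> (vec ` blocks N m) (e k i)) \<longlonglongrightarrow> mean_square (\<lambda>th. cell n k (z th))"
proof (rule tendsto_of_lower_approximations[OF block_power_le _ _ z_sq_tendsto])
  show "(\<Sum>i<M'. predicted_power \<beta> (vec ` blocks N m) (e k i)) \<le> (\<Sum>i<N. predicted_power \<beta> (vec ` blocks N m) (e k i))" if "M' \<le> N" for M' N
    using that predicted_power_nonneg by (intro sum_mono2) auto
  show "(\<lambda>N. \<Sum>i<M'. predicted_power \<beta> (vec ` blocks N m) (e k i)) \<longlonglongrightarrow> (\<Sum>i<M'. predicted_power \<beta> (\<pi> t ` D) (e k i))" for M'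
    by (intro tendsto_sum predicted_power_blocks_tendsto)
qed

end

abbreviation partial_explained :: "nat \<Rightarrow> (nat \<times> nat) set \<Rightarrow> ((nat \<times> nat) \<Rightarrow> real) \<Rightarrow> real" where
  "partial_explained N \<equiv> explained M (blocks N n) (\<lambda>p th. x th \<bullet> vec p)"

lemma signal: "square_signal M (blocks N n) (\<lambda>p th. x th \<bullet> vec p) (\<lambda>th. norm (x th))"
  using coordinate_observation[OF finite_blocks vec_D[OF order_refl] vec_orth] by (rule gaussian_observation.axioms(1))

abbreviation total_explained :: "nat \<Rightarrow> real \<Rightarrow> real" where
  "total_explained N \<beta> \<equiv> partial_explained N (blocks N n) (level (blocks N n) \<beta>)"

lemma partial_explained_block:
  assumes m: "m \<le> n" and k: "k < n" and \<beta>: "0 < \<beta>"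
  shows "partial_explained N (block N k) (level (blocks N m) \<beta>) = (\<Sum>i<N. predicted_power \<beta> (vec ` blocks N m) (e k i))"
proof -
  have sub: "blocks N m \<subseteq> blocks N n" "block N k \<subseteq> blocks N n"
    using blocks_mono[OF order_refl m] k by (auto simp: blocks_def)
  have "vec ` blocks N m \<subseteq> D" using vec_D[OF m] by auto
  then have "(\<Sum>p\<in>block N k. predicted_power \<beta> (vec ` blocks N m) (vec p)) = (\<Sum>i<N. predicted_power \<beta> (vec ` blocks N m) (e k i))"
    by (intro block_sum predicted_power_0)
  then show ?thesis
    unfolding predicted_power_def using explained_eq_cond_exp[OF finite_blocks vec_D[OF order_refl] vec_orth sub \<beta>] by simp
qed

lemma total_explained_eq:
  assumes \<beta>: "0 < \<beta>"
  shows "total_explained N \<beta> = (\<Sum>k<n. \<Sum>i<N. predicted_power \<beta> (vec ` blocks N n) (e k i))"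
proof -
  have "total_explained N \<beta> = (\<Sum>p\<in>blocks N n. predicted_power \<beta> (vec ` blocks N n) (vec p))"
    unfolding predicted_power_def by (rule explained_eq_cond_exp[OF finite_blocks vec_D[OF order_refl] vec_orth order_refl order_refl \<beta>])
  also have "\<dots> = (\<Sum>k<n. \<Sum>p\<in>block N k. predicted_power \<beta> (vec ` blocks N n) (vec p))"
    unfolding blocks_def[of N n] using finite_block by (intro sum.UNION_disjoint) (auto simp: block_def)
  also have "\<dots> = (\<Sum>k<n. \<Sum>i<N. predicted_power \<beta> (vec ` blocks N n) (e k i))"
  proof -
    have "vec ` blocks N n \<subseteq> D" using vec_D[OF order_refl] by auto
    then show ?thesis by (intro sum.cong refl block_sum predicted_power_0)
  qed
  finally show ?thesis .
qed

context
  fixes z :: "real \<Rightarrow> real \<Rightarrow> 'a \<Rightarrow> 'h"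
  assumes z: "\<And>\<beta> t. 0 < \<beta> \<Longrightarrow> t \<in> {0..1} \<Longrightarrow> is_L2_projection M (noncausal_class \<beta> t) x (z \<beta> t)"
begin

lemma z_cells: "0 < \<beta> \<Longrightarrow> mean_square (z \<beta> 1) = (\<Sum>k<n. mean_square (\<lambda>th. cell n k (z \<beta> 1 th)))"
proof -
  assume "0 < \<beta>"
  then have zL: "z \<beta> 1 \<in> L2 M" using z[of \<beta> 1] noncausal_class_L2 by (auto simp: is_L2_projection_def)
  have "mean_square (z \<beta> 1) = expectation (\<lambda>th. \<Sum>k<n. (norm (cell n k (z \<beta> 1 th)))\<^sup>2)"
    by (intro lint_cong refl norm_cells n)
  also have "\<dots> = (\<Sum>k<n. mean_square (\<lambda>th. cell n k (z \<beta> 1 th)))"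
    by (rule lint_sum) (use L2_integrable[OF cell_L2[OF n _ zL]] in auto)
  finally show ?thesis .
qed

lemma total_explained_bounds:
  assumes \<beta>: "0 < \<beta>"
  shows "0 \<le> total_explained N \<beta>"
    and "total_explained N \<beta> \<le> mean_square x"
    and "(\<lambda>N. total_explained N \<beta>) \<longlonglongrightarrow> mean_square (z \<beta> 1)"
proof -
  have g: "1 = grid n n" using n by (simp add: grid_def)
  have z1: "is_L2_projection M (noncausal_class \<beta> 1) x (z \<beta> 1)" using \<beta> by (intro z) auto
  show "0 \<le> total_explained N \<beta>"
    unfolding total_explained_eq[OF \<beta>] by (intro sum_nonneg predicted_power_nonneg)
  have "total_explained N \<beta> \<le> mean_square (z \<beta> 1)"
    unfolding total_explained_eq[OF \<beta>] z_cells[OF \<beta>] using block_power_le[OF order_refl _ g z1] by (intro sum_mono) auto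
  also have "\<dots> \<le> mean_square x" by (rule is_L2_projection_sq(3)[OF z1 noncausal_class_L2 x])
  finally show "total_explained N \<beta> \<le> mean_square x" .
  show "(\<lambda>N. total_explained N \<beta>) \<longlonglongrightarrow> mean_square (z \<beta> 1)"
    unfolding total_explained_eq[OF \<beta>] z_cells[OF \<beta>] using block_power_tendsto[OF order_refl _ g z1] by (intro tendsto_sum) auto
qed

text \<open>
  The block inequalities for the first \<open>N\<close> basis vectors of each cell, as
  \<open>N\<close> tends to infinity.
\<close>

lemma integral_sandwich:
  assumes \<gamma>: "0 < \<gamma>"
  defines "F \<equiv> \<lambda>\<beta>. if \<beta> = 0 then 0 else mean_square (z \<beta> 1)"
  shows "F integrable_on {0..\<gamma>}"
    and "\<gamma> * lower_sum n (z \<gamma>) \<le> integral {0..\<gamma>} F"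
    and "integral {0..\<gamma>} F \<le> \<gamma> * upper_sum n (z \<gamma>)"
proof -
  define f where "f N \<beta> = total_explained N \<beta>" for N \<beta>
  \<comment> \<open>The convergence of \<open>f N \<beta>\<close> is known for positive \<open>\<beta>\<close>; a change
    at one point leaves the integrals unchanged.\<close>
  define g where "g N \<beta> = (if \<beta> = 0 then 0 else f N \<beta>)" for N \<beta>
  have f: "f N integrable_on {0..\<gamma>}" for N
    unfolding f_def[abs_def] by (rule square_signal.explained_level_integrable[OF signal])
  have "g N integrable_on {0..\<gamma>}" for N
    by (rule integrable_spike[OF f[of N], of "{0}"]) (auto simp: g_def)
  moreover have "(\<lambda>_. mean_square x) integrable_on {0..\<gamma>}" by (rule integrable_const_ivl)
  moreover have "norm (g N \<beta>) \<le> mean_square x" if "\<beta> \<in> {0..\<gamma>}" for N \<beta>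
    using total_explained_bounds(1,2)[of \<beta> N] that by (auto simp: g_def f_def)
  moreover have "(\<lambda>N. g N \<beta>) \<longlonglongrightarrow> F \<beta>" if "\<beta> \<in> {0..\<gamma>}" for \<beta>
    using total_explained_bounds(3)[of \<beta>] that by (auto simp: g_def f_def F_def)
  ultimately have F: "F integrable_on {0..\<gamma>}" and lim: "(\<lambda>N. integral {0..\<gamma>} (g N)) \<longlonglongrightarrow> integral {0..\<gamma>} F"
    using dominated_convergence[of g "{0..\<gamma>}" "\<lambda>_. mean_square x" F] by blast+
  show "F integrable_on {0..\<gamma>}" by (rule F)
  have gf: "integral {0..\<gamma>} (g N) = integral {0..\<gamma>} (f N)" for N
    by (rule integral_spike[of "{0}"]) (auto simp: g_def)
  have disj: "block N i \<inter> block N k = {}" if "i < k" for N i k using that by (auto simp: block_def)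
  have U: "(\<Union>i<m. block N i) = blocks N m" "(\<Union>i\<le>m. block N i) = blocks N (Suc m)" for N m
    by (auto simp: blocks_def less_Suc_eq_le)
  have lo: "\<gamma> * (\<Sum>k<n. \<Sum>i<N. predicted_power \<gamma> (vec ` blocks N k) (e k i)) \<le> integral {0..\<gamma>} (g N)" for N
  proof -
    have "(\<Sum>k<n. partial_explained N (block N k) (level (blocks N k) \<gamma>)) = (\<Sum>k<n. \<Sum>i<N. predicted_power \<gamma> (vec ` blocks N k) (e k i))"
      using \<gamma> by (intro sum.cong refl partial_explained_block) auto
    then show ?thesis
      using square_signal.explained_blocks_lower[OF signal disj U(1) less_imp_le[OF \<gamma>], of N] by (simp add: gf f_def[abs_def] U)
  qed
  have up: "integral {0..\<gamma>} (g N) \<le> \<gamma> * (\<Sum>k<n. \<Sum>i<N. predicted_power \<gamma> (vec ` blocks N (Suc k)) (e k i))" for N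
  proof -
    have "(\<Sum>k<n. partial_explained N (block N k) (level (blocks N (Suc k)) \<gamma>)) = (\<Sum>k<n. \<Sum>i<N. predicted_power \<gamma> (vec ` blocks N (Suc k)) (e k i))"
      using \<gamma> by (intro sum.cong refl partial_explained_block) auto
    then show ?thesis
      using square_signal.explained_blocks_upper[OF signal disj U(1) less_imp_le[OF \<gamma>], of N] by (simp add: gf f_def[abs_def] U)
  qed
  have tl: "(\<lambda>N. \<Sum>i<N. predicted_power \<gamma> (vec ` blocks N m) (e k i)) \<longlonglongrightarrow> mean_square (\<lambda>th. cell n k (z \<gamma> (grid n m) th))"
    if "m \<le> n" "k < n" for m k
    by (rule block_power_tendsto[OF that refl z[OF \<gamma> grid_in[OF n that(1)]]])
  show "\<gamma> * lower_sum n (z \<gamma>) \<le> integral {0..\<gamma>} F"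
  proof (rule LIMSEQ_le[OF tendsto_mult_left[OF tendsto_sum] lim])
    show "(\<lambda>N. \<Sum>i<N. predicted_power \<gamma> (vec ` blocks N k) (e k i)) \<longlonglongrightarrow> mean_square (\<lambda>th. cell n k (z \<gamma> (grid n k) th))"
      if "k \<in> {..<n}" for k using that by (intro tl) auto
  qed (use lo in blast)
  show "integral {0..\<gamma>} F \<le> \<gamma> * upper_sum n (z \<gamma>)"
  proof (rule LIMSEQ_le[OF lim tendsto_mult_left[OF tendsto_sum]])
    show "(\<lambda>N. \<Sum>i<N. predicted_power \<gamma> (vec ` blocks N (Suc k)) (e k i)) \<longlonglongrightarrow> mean_square (\<lambda>th. cell n k (z \<gamma> (grid n (Suc k)) th))"
      if "k \<in> {..<n}" for k using that by (intro tl) auto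
  qed (use up in blast)
qed

lemma noncausal_mono:
  assumes st: "0 < s" "s \<le> t"
  shows "mean_square (z s 1) \<le> mean_square (z t 1)"
proof -
  have "total_explained N s \<le> total_explained N t" for N
    using st by (intro square_signal.explained_level_mono[OF signal]) auto
  then show ?thesis using st by (intro LIMSEQ_le[OF total_explained_bounds(3) total_explained_bounds(3)]) auto
qed

text \<open>
  The modulus of the finite systems is independent of \<open>N\<close> and passes to the limit.
\<close>

lemma noncausal_modulus:
  assumes "0 \<le> K" "0 < prob (square_signal.trunc M (\<lambda>th. norm (x th)) K)"
    and st: "0 < s" "s \<le> t" "8 * K\<^sup>2 * (t - s) \<le> 1"
  shows "mean_square (z t 1) - mean_square (z s 1)
    \<le> 6 * square_signal.tail M (\<lambda>th. norm (x th)) K + 128 * K ^ 4 * (t - s)"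
proof (rule LIMSEQ_le_const2)
  show "(\<lambda>N. total_explained N t - total_explained N s)
    \<longlonglongrightarrow> mean_square (z t 1) - mean_square (z s 1)"
    using st by (intro tendsto_diff total_explained_bounds(3)) auto
  show "\<exists>N0. \<forall>N\<ge>N0. total_explained N t - total_explained N s
    \<le> 6 * square_signal.tail M (\<lambda>th. norm (x th)) K + 128 * K ^ 4 * (t - s)"
    using square_signal.explained_modulus[OF signal assms(1,2) less_imp_le[OF st(1)] st(2,3)] by blast
qed

end

end

lemma cell_systems_exist:
  assumes n: "0 < n"
  obtains e where "\<And>k. k < n \<Longrightarrow> orthonormal_or_zero (e k)" "\<And>k m. k < n \<Longrightarrow> e k m \<in> cell n k ` D"
    "\<And>k v. k < n \<Longrightarrow> v \<in> closure (cell n k ` D) \<Longrightarrow> (\<lambda>N. \<Sum>m<N. (v \<bullet> e k m) *\<^sub>R e k m) \<longlonglongrightarrow> v"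
proof -
  let ?P = "\<lambda>k g. orthonormal_or_zero g \<and> (\<forall>m. g m \<in> cell n k ` D)
    \<and> (\<forall>v. v \<in> closure (cell n k ` D) \<longrightarrow> (\<lambda>N. \<Sum>m<N. (v \<bullet> g m) *\<^sub>R g m) \<longlonglongrightarrow> v)"
  have "\<exists>g. ?P k g" if k: "k < n" for k
  proof -
    have "subspace (cell n k ` D)"
      by (rule linear_subspace_image[OF bounded_linear.linear[OF cell_bounded_linear[OF n k]] D])
    then obtain g where "orthonormal_or_zero g" "\<And>m. g m \<in> cell n k ` D"
      "\<And>v. v \<in> closure (cell n k ` D) \<Longrightarrow> (\<lambda>N. \<Sum>m<N. (v \<bullet> g m) *\<^sub>R g m) \<longlonglongrightarrow> v"
      by (rule exists_complete_orthonormal_in_subspace) blast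
    then show ?thesis by (intro exI[of _ g]) simp
  qed
  then have "\<forall>k. \<exists>g. k < n \<longrightarrow> ?P k g" by blast
  from choice[OF this] obtain e where e: "\<And>k. k < n \<Longrightarrow> ?P k (e k)" by blast
  show ?thesis by (rule that[of e]) (use e in auto)
qed

context
  fixes z :: "real \<Rightarrow> real \<Rightarrow> 'a \<Rightarrow> 'h"
  assumes z: "\<And>\<beta> t. 0 < \<beta> \<Longrightarrow> t \<in> {0..1} \<Longrightarrow> is_L2_projection M (noncausal_class \<beta> t) x (z \<beta> t)"
begin

lemma noncausal_increasing: "mono_on {0<..} (\<lambda>\<beta>. mean_square (z \<beta> 1))"
proof -
  have n: "0 < (1::nat)" by simp
  obtain e where e: "\<And>k. k < 1 \<Longrightarrow> orthonormal_or_zero (e k)" "\<And>k m. k < 1 \<Longrightarrow> e k m \<in> cell 1 k ` D"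
    "\<And>k v. k < 1 \<Longrightarrow> v \<in> closure (cell 1 k ` D) \<Longrightarrow> (\<lambda>N. \<Sum>m<N. (v \<bullet> e k m) *\<^sub>R e k m) \<longlonglongrightarrow> v"
    using cell_systems_exist[OF n] by blast
  show ?thesis by (rule mono_onI) (use noncausal_mono[OF n e z] in auto)
qed

lemma noncausal_continuous: "continuous_on {0<..} (\<lambda>\<beta>. mean_square (z \<beta> 1))"
proof (rule one_sided_modulus_imp_continuous_on)
  fix \<epsilon> :: real assume "0 < \<epsilon>"
  have n: "0 < (1::nat)" by simp
  obtain e where e: "\<And>k. k < 1 \<Longrightarrow> orthonormal_or_zero (e k)" "\<And>k m. k < 1 \<Longrightarrow> e k m \<in> cell 1 k ` D"
    "\<And>k v. k < 1 \<Longrightarrow> v \<in> closure (cell 1 k ` D) \<Longrightarrow> (\<lambda>N. \<Sum>m<N. (v \<bullet> e k m) *\<^sub>R e k m) \<longlonglongrightarrow> v"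
    using cell_systems_exist[OF n] by blast
  let ?F = "\<lambda>\<beta>. mean_square (z \<beta> 1)"
  let ?p = "\<lambda>K. prob (square_signal.trunc M (\<lambda>th. norm (x th)) K)" and ?t = "square_signal.tail M (\<lambda>th. norm (x th))"
  obtain K d where K: "0 \<le> K" "0 < ?p K" "0 < d" "8 * K\<^sup>2 * d \<le> 1" "6 * ?t K + 128 * K ^ 4 * d < \<epsilon>"
    using square_signal.modulus_exists[OF signal[OF n e, of 0] \<open>0 < \<epsilon>\<close>] by blast
  have "\<bar>?F t - ?F s\<bar> < \<epsilon>" if st: "0 < s" "s \<le> t" "t - s < d" for s t
  proof -
    have le: "8 * K\<^sup>2 * (t - s) \<le> 8 * K\<^sup>2 * d" "128 * K ^ 4 * (t - s) \<le> 128 * K ^ 4 * d"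
      using st K(1) by (auto intro!: mult_left_mono)
    then have "8 * K\<^sup>2 * (t - s) \<le> 1" using K(4) by linarith
    from noncausal_modulus[OF n e z K(1,2) st(1,2) this] noncausal_mono[OF n e z st(1,2)]
    show ?thesis using le K(5) by linarith
  qed
  then show "\<exists>d>0. \<forall>s\<in>{0<..}. \<forall>t\<in>{0<..}. s \<le> t \<longrightarrow> t - s < d \<longrightarrow> \<bar>?F t - ?F s\<bar> < \<epsilon>"
    using K(3) by (intro exI[of _ d]) auto
qed

text \<open>
  The causal second moment at \<open>\<gamma>\<close> is the average over \<open>0..\<gamma>\<close>
  of the noncausal ones: both lie between the same lower and upper sums, whose difference vanishes as
  the partition is refined.
\<close>

lemma causal_eq_average:
  assumes \<gamma>: "0 < \<gamma>" and c: "is_L2_projection M (causal_class \<gamma>) x c"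
  defines "F \<equiv> \<lambda>\<beta>. if \<beta> = 0 then 0 else mean_square (z \<beta> 1)"
  shows "F integrable_on {0..\<gamma>}" and "\<gamma> * mean_square c = integral {0..\<gamma>} F"
proof -
  define lo where "lo n = lower_sum n (z \<gamma>)" for n
  define up where "up n = upper_sum n (z \<gamma>)" for n
  let ?c = "mean_square c"
  have sandwich: "F integrable_on {0..\<gamma>} \<and> \<gamma> * lo n \<le> integral {0..\<gamma>} F \<and> integral {0..\<gamma>} F \<le> \<gamma> * up n" if n: "0 < n" for n
  proof -
    obtain e where e: "\<And>k. k < n \<Longrightarrow> orthonormal_or_zero (e k)" "\<And>k m. k < n \<Longrightarrow> e k m \<in> cell n k ` D"
      "\<And>k v. k < n \<Longrightarrow> v \<in> closure (cell n k ` D) \<Longrightarrow> (\<lambda>N. \<Sum>m<N. (v \<bullet> e k m) *\<^sub>R e k m) \<longlonglongrightarrow> v"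
      using cell_systems_exist[OF n] by blast
    show ?thesis unfolding F_def lo_def up_def using integral_sandwich[OF n e z \<gamma>] by blast
  qed
  show "F integrable_on {0..\<gamma>}" using sandwich[of 1] by simp
  have causal: "lo n \<le> ?c" "?c \<le> up n" if n: "0 < n" for n
    unfolding lo_def up_def by (rule causal_lower[OF n c z[OF \<gamma>]], simp) (rule causal_upper[OF n c z[OF \<gamma>]], simp)
  have "\<bar>\<gamma> * ?c - integral {0..\<gamma>} F\<bar> \<le> \<gamma> * (up n - lo n)" if n: "0 < n" for n
  proof -
    have "\<gamma> * lo n \<le> \<gamma> * ?c" "\<gamma> * ?c \<le> \<gamma> * up n" using causal[OF n] \<gamma> by (auto intro!: mult_left_mono)
    then show ?thesis using sandwich[OF n] by (simp add: right_diff_distrib abs_le_iff)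
  qed
  then have "\<forall>\<^sub>F n in sequentially. \<bar>\<gamma> * ?c - integral {0..\<gamma>} F\<bar> \<le> \<gamma> * (up n - lo n)"
    using eventually_gt_at_top[of 0] by (rule eventually_mono[rotated])
  moreover have "(\<lambda>n. \<gamma> * (up n - lo n)) \<longlonglongrightarrow> \<gamma> * 0"
    unfolding up_def lo_def by (intro tendsto_mult_left gap_tendsto[of \<gamma> "z \<gamma>"] z[OF \<gamma>])
  ultimately have "\<bar>\<gamma> * ?c - integral {0..\<gamma>} F\<bar> \<le> \<gamma> * 0"
    by (intro tendsto_lowerbound[of _ "\<gamma> * 0" sequentially]) auto
  then show "\<gamma> * ?c = integral {0..\<gamma>} F" by simp
qed

end

end

section \<open>Versions of conditional expectations\<close>

context prob_space
begin

context
  fixes F :: "'a measure" and h z :: "'a \<Rightarrow> 'h::{banach, real_inner, second_countable_topology}"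
  assumes F: "full_subalgebra M F" and h: "h \<in> L2 M"
    and z: "is_L2_projection M {u \<in> L2 M. u \<in> borel_measurable F} h z"
begin

lemma L2_projection_is_cond_exp: "is_cond_exp M F h z"
  unfolding is_cond_exp_def
proof (intro conjI ballI)
  have zL: "z \<in> L2 M" and zF: "z \<in> borel_measurable F" using z by (auto simp: is_L2_projection_def)
  show "z \<in> borel_measurable F" "integrable M z" using zF L2_imp_integrable[OF zL] by auto
  fix A assume A: "A \<in> sets F"
  then have AM: "A \<in> sets M" using F by (auto simp: full_subalgebra_def subalgebra_def)
  have int: "integrable M (\<lambda>th. indicator A th *\<^sub>R u th)" if "u \<in> L2 M" for u :: "'a \<Rightarrow> 'h"
    using integrable_mult_indicator[OF AM L2_imp_integrable[OF that]] .
  have eq: "set_lebesgue_integral M A z \<bullet> c = set_lebesgue_integral M A h \<bullet> c" for c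
  proof -
    have uL: "(\<lambda>th. indicator A th *\<^sub>R c) \<in> L2 M"
    proof -
      have "(norm (indicator A th *\<^sub>R c))\<^sup>2 = indicator A th *\<^sub>R (norm c)\<^sup>2" for th by (simp add: indicator_def)
      then show ?thesis using AM by (simp add: L2_def emeasure_eq_measure)
    qed
    moreover have "(\<lambda>th. indicator A th *\<^sub>R c) \<in> borel_measurable F" using A by measurable
    ultimately have "(\<lambda>th. indicator A th *\<^sub>R c) \<in> {u \<in> L2 M. u \<in> borel_measurable F}" by simp
    with z have "expectation (\<lambda>th. (h th - z th) \<bullet> (indicator A th *\<^sub>R c)) = 0"
      unfolding is_L2_projection_def by (rule conjunct2[THEN bspec])
    then have "expectation (\<lambda>th. h th \<bullet> (indicator A th *\<^sub>R c)) = expectation (\<lambda>th. z th \<bullet> (indicator A th *\<^sub>R c))"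
      unfolding inner_diff_left using L2_inner_integrable[OF h uL] L2_inner_integrable[OF zL uL] by simp
    moreover have "expectation (\<lambda>th. u th \<bullet> (indicator A th *\<^sub>R c)) = set_lebesgue_integral M A u \<bullet> c" if "u \<in> L2 M" for u :: "'a \<Rightarrow> 'h"
    proof -
      have "expectation (\<lambda>th. u th \<bullet> (indicator A th *\<^sub>R c)) = expectation (\<lambda>th. (indicator A th *\<^sub>R u th) \<bullet> c)"
        by (simp only: inner_scaleR_left inner_scaleR_right)
      also have "\<dots> = set_lebesgue_integral M A u \<bullet> c"
        unfolding set_lebesgue_integral_def by (rule integral_bounded_linear[OF bounded_linear_inner_left int[OF that]])
      finally show ?thesis .
    qed
    ultimately show ?thesis using h zL by simp
  qed
  have "(set_lebesgue_integral M A z - set_lebesgue_integral M A h) \<bullet> (set_lebesgue_integral M A z - set_lebesgue_integral M A h) = 0"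
    unfolding inner_diff_left by (simp only: eq diff_self)
  then show "set_lebesgue_integral M A z = set_lebesgue_integral M A h" by simp
qed

text \<open>
  Two versions of a vector valued conditional expectation agree in every coordinate of a countable
  complete system.
\<close>

lemma is_cond_exp_AE_projection:
  assumes v: "is_cond_exp M F h v"
  shows "AE th in M. v th = z th"
proof -
  have sub: "subalgebra M F" using F by (simp add: full_subalgebra_def)
  interpret finite_measure_subalgebra M F by unfold_locales (rule sub)
  have vF: "v \<in> borel_measurable F" and vi: "integrable M v"
    and vA: "\<And>A. A \<in> sets F \<Longrightarrow> set_lebesgue_integral M A v = set_lebesgue_integral M A h"
    using v by (auto simp: is_cond_exp_def)
  have hi: "integrable M h" by (rule L2_imp_integrable[OF h])
  have scalar: "AE th in M. v th \<bullet> c = z th \<bullet> c" for c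
  proof -
    have "AE th in M. real_cond_exp M F (\<lambda>th. h th \<bullet> c) th = v th \<bullet> c"
    proof (rule real_cond_exp_charact)
      fix A assume A: "A \<in> sets F"
      then have AM: "A \<in> sets M" using sub by (auto simp: subalgebra_def)
      have "(\<integral>th\<in>A. u th \<bullet> c \<partial>M) = set_lebesgue_integral M A u \<bullet> c" if u: "integrable M u" for u
      proof -
        have "(\<integral>th\<in>A. u th \<bullet> c \<partial>M) = expectation (\<lambda>th. (indicator A th *\<^sub>R u th) \<bullet> c)"
          unfolding set_lebesgue_integral_def by (simp only: inner_scaleR_left real_scaleR_def)
        also have "\<dots> = set_lebesgue_integral M A u \<bullet> c"
          unfolding set_lebesgue_integral_def
          by (rule integral_bounded_linear[OF bounded_linear_inner_left integrable_mult_indicator[OF AM u]])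
        finally show ?thesis .
      qed
      then show "(\<integral>th\<in>A. h th \<bullet> c \<partial>M) = (\<integral>th\<in>A. v th \<bullet> c \<partial>M)" using hi vi vA[OF A] by simp
    qed (use hi vi vF in auto)
    moreover have "AE th in M. real_cond_exp M F (\<lambda>th. h th \<bullet> c) th = z th \<bullet> c"
      by (rule projection_real_cond_exp[OF F h z])
    ultimately show ?thesis by eventually_elim simp
  qed
  obtain g :: "nat \<Rightarrow> 'h" where g: "\<And>a. (\<lambda>n. \<Sum>k<n. (a \<bullet> g k) *\<^sub>R g k) \<longlonglongrightarrow> a"
    using exists_complete_orthonormal_in_subspace[OF subspace_UNIV] by (metis UNIV_I closure_UNIV)
  have "AE th in M. \<forall>k. v th \<bullet> g k = z th \<bullet> g k" using scalar by (simp add: AE_all_countable)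
  then show ?thesis
  proof eventually_elim
    case (elim th)
    then have "(\<lambda>n. \<Sum>k<n. (v th \<bullet> g k) *\<^sub>R g k) \<longlonglongrightarrow> z th" using g[of "z th"] by simp
    then show ?case using g[of "v th"] by (rule LIMSEQ_unique[rotated])
  qed
qed

end

end

section \<open>Calculus of averages\<close>

text \<open>
  The perspective of a concave function; the weights in the proof are those of \<open>1 / (u * a + v *
  b)\<close> between \<open>1 / a\<close> and \<open>1 / b\<close>.
\<close>

lemma perspective_concave:
  fixes g :: "real \<Rightarrow> real"
  assumes \<Psi>: "concave_on {0<..} \<Psi>" and g: "\<And>\<eta>. 0 < \<eta> \<Longrightarrow> g \<eta> = \<eta> * \<Psi> (1 / \<eta>)"
  shows "concave_on {0<..} g"
  unfolding concave_on_iff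
proof (intro conjI ballI allI impI convex_real_interval)
  fix a b u v :: real
  assume ab: "a \<in> {0<..}" "b \<in> {0<..}" and uv: "0 \<le> u" "0 \<le> v" "u + v = 1"
  define c where "c = u * a + v * b"
  have c: "0 < c"
  proof (cases "u = 0")
    case False
    then have "0 < u * a" using ab uv by simp
    moreover have "0 \<le> v * b" using ab uv by simp
    ultimately show ?thesis by (simp add: c_def)
  qed (use ab uv in \<open>simp add: c_def\<close>)
  have 0: "0 \<le> u * a / c" "0 \<le> v * b / c" "u * a / c + v * b / c = 1"
    using c ab uv by (auto simp: add_divide_distrib[symmetric] c_def[symmetric])
  have conc: "p * \<Psi> x + q * \<Psi> y \<le> \<Psi> (p *\<^sub>R x + q *\<^sub>R y)"
    if "x \<in> {0<..}" "y \<in> {0<..}" "0 \<le> p" "0 \<le> q" "p + q = 1" for x y p q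
    using \<Psi> that unfolding concave_on_iff by blast
  have "(u * a / c) *\<^sub>R (1 / a) + (v * b / c) *\<^sub>R (1 / b) = (u + v) / c"
    using ab by (simp add: add_divide_distrib)
  then have "1 / c = (u * a / c) *\<^sub>R (1 / a) + (v * b / c) *\<^sub>R (1 / b)" using uv by simp
  moreover have "\<Psi> ((u * a / c) *\<^sub>R (1 / a) + (v * b / c) *\<^sub>R (1 / b)) \<ge> (u * a / c) * \<Psi> (1 / a) + (v * b / c) * \<Psi> (1 / b)"
    by (rule conc) (use 0 ab in auto)
  ultimately have "c * \<Psi> (1 / c) \<ge> c * ((u * a / c) * \<Psi> (1 / a) + (v * b / c) * \<Psi> (1 / b))"
    using c by (intro mult_left_mono) auto
  also have "c * ((u * a / c) * \<Psi> (1 / a) + (v * b / c) * \<Psi> (1 / b)) = u * (a * \<Psi> (1 / a)) + v * (b * \<Psi> (1 / b))"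
    using c by (simp add: distrib_left)
  finally show "u * g a + v * g b \<le> g (u *\<^sub>R a + v *\<^sub>R b)"
    using ab c g by (simp add: c_def)
qed

context
  fixes a b :: "real \<Rightarrow> real" and C :: real
  assumes cont: "continuous_on {0<..} b" and anti: "\<And>s t. 0 < s \<Longrightarrow> s \<le> t \<Longrightarrow> b t \<le> b s"
    and bound: "\<And>t. 0 < t \<Longrightarrow> \<bar>b t\<bar> \<le> C"
    and avg: "\<And>t. 0 < t \<Longrightarrow> ((\<lambda>\<beta>. if \<beta> = 0 then 0 else b \<beta>) has_integral t * a t) {0..t}"
begin

text \<open>
  Here \<open>a\<close> is the running average of \<open>b\<close>. Only the values of
  \<open>b\<close> at positive arguments are controlled, so the integrand is set to zero at zero.
\<close>

lemma average_increment:
  assumes st: "0 \<le> s" "s \<le> t" "0 < t"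
  shows "(b has_integral t * a t - s * a s) {s..t}"
proof -
  let ?B = "\<lambda>\<beta>. if \<beta> = 0 then 0 else b \<beta>"
  have int: "?B integrable_on {0..t}" using avg[OF st(3)] by blast
  have "integral {0..s} ?B = s * a s"
    using avg[of s] st by (cases "s = 0") (auto simp: integral_unique)
  then have "integral {s..t} ?B = t * a t - s * a s"
    using Henstock_Kurzweil_Integration.integral_combine[OF st(1,2) int] integral_unique[OF avg[OF st(3)]] by linarith
  moreover have "?B integrable_on {s..t}" using integrable_subinterval_real[OF int, of s t] st by auto
  ultimately have "(?B has_integral t * a t - s * a s) {s..t}" by (simp add: has_integral_iff)
  then show ?thesis by (rule has_integral_spike_finite[rotated 2, of _ _ _ "{0}"]) auto
qed

lemma average_derivative:
  assumes \<gamma>: "0 < \<gamma>"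
  shows "((\<lambda>t. t * a t) has_real_derivative b \<gamma>) (at \<gamma>)"
proof -
  let ?s = "\<gamma> / 2"
  have "continuous_on {?s..2 * \<gamma>} b" by (rule continuous_on_subset[OF cont]) (use \<gamma> in auto)
  then have "((\<lambda>u. integral {?s..u} b) has_real_derivative b \<gamma>) (at \<gamma> within {?s..2 * \<gamma>})"
    by (rule integral_has_real_derivative) (use \<gamma> in auto)
  then have "((\<lambda>u. integral {?s..u} b) has_real_derivative b \<gamma>) (at \<gamma>)"
    using at_within_Icc_at[of ?s \<gamma> "2 * \<gamma>"] \<gamma> by simp
  then have "((\<lambda>u. ?s * a ?s + integral {?s..u} b) has_real_derivative 0 + b \<gamma>) (at \<gamma>)"
    by (intro DERIV_add DERIV_const)
  then have "((\<lambda>u. ?s * a ?s + integral {?s..u} b) has_real_derivative b \<gamma>) (at \<gamma>)" by simp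
  then show ?thesis
  proof (rule has_field_derivative_transform_within_open[of _ _ _ "{?s<..}"])
    fix u assume "u \<in> {?s<..}"
    then show "?s * a ?s + integral {?s..u} b = u * a u"
      using integral_unique[OF average_increment[of ?s u]] \<gamma> by simp
  qed (use \<gamma> in auto)
qed

text \<open>
  The function \<open>\<lambda>t. t * a t\<close> is concave because its derivative \<open>b\<close>
  decreases, and \<open>\<lambda>\<eta>. a (1 / \<eta>)\<close> is its perspective.
\<close>

lemma average_concave: "concave_on {0<..} (\<lambda>\<eta>. a (1 / \<eta>))"
proof -
  have "convex_on {0<..} (\<lambda>t. - (t * a t))"
  proof (rule convex_on_realI[where f' = "\<lambda>t. - b t"])
    show "connected {0::real<..}" by (rule convex_connected) simp
    show "((\<lambda>t. - (t * a t)) has_real_derivative - b t) (at t)" if "t \<in> {0<..}" for t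
      using average_derivative[of t] that by (intro DERIV_minus) auto
  qed (use anti in auto)
  then have "concave_on {0<..} (\<lambda>t. t * a t)" by (simp add: concave_on_def)
  then show ?thesis by (rule perspective_concave) simp
qed

lemma average_interval_integral:
  assumes \<gamma>: "0 < \<gamma>" and s: "0 \<le> s"
  shows "interval_lebesgue_integrable lborel (ereal s) (ereal \<gamma>) b"
    and "a \<gamma> = s * a s / \<gamma> + 1 / \<gamma> * (LBINT \<beta>=ereal s..ereal \<gamma>. b \<beta>)"
proof -
  have bor: "(\<lambda>\<beta>. indicator {0<..} \<beta> *\<^sub>R b \<beta>) \<in> borel_measurable borel"
    by (rule borel_measurable_continuous_on_indicator[OF _ cont]) simp
  have set: "set_integrable lborel {u..v} b" if uv: "0 \<le> u" for u v
  proof -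
    have "integrable lborel (\<lambda>\<beta>. indicator {u..v} \<beta> *\<^sub>R (indicator {0<..} \<beta> *\<^sub>R b \<beta>))"
    proof (rule integrableI_bounded_set_indicator[where B = C])
      have "0 \<le> C" using bound[of 1] abs_ge_zero[of "b 1"] by linarith
      then show "AE \<beta> in lborel. \<beta> \<in> {u..v} \<longrightarrow> norm (indicator {0<..} \<beta> *\<^sub>R b \<beta>) \<le> C"
        using bound by (intro AE_I2) (auto simp: indicator_def)
    qed (use bor in \<open>auto simp: emeasure_lborel_Icc_eq\<close>)
    moreover have "integrable lborel (\<lambda>\<beta>. indicator ({u..v} \<inter> {0}) \<beta> *\<^sub>R b 0)"
      by (rule integrable_scaleR_left) (auto intro!: integrable_real_indicator intro: le_less_trans[OF emeasure_mono[of _ "{0}"]])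
    ultimately have "integrable lborel (\<lambda>\<beta>. indicator {u..v} \<beta> *\<^sub>R (indicator {0<..} \<beta> *\<^sub>R b \<beta>) + indicator ({u..v} \<inter> {0}) \<beta> *\<^sub>R b 0)"
      by (rule Bochner_Integration.integrable_add)
    moreover have "indicator {u..v} \<beta> *\<^sub>R (indicator {0<..} \<beta> *\<^sub>R b \<beta>) + indicator ({u..v} \<inter> {0}) \<beta> *\<^sub>R b 0 = indicator {u..v} \<beta> *\<^sub>R b \<beta>" for \<beta>
      using uv by (auto simp: indicator_def)
    ultimately show ?thesis by (simp add: set_integrable_def)
  qed
  have ivl: "interval_lebesgue_integrable lborel (ereal u) (ereal v) b" if "0 \<le> u" "u \<le> v" for u v
  proof -
    have "set_integrable lborel {u<..<v} b" by (rule set_integrable_subset[OF set[OF that(1), of v]]) auto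
    then show ?thesis using that by (simp add: interval_lebesgue_integrable_def)
  qed
  have val: "(LBINT \<beta>=ereal u..ereal v. b \<beta>) = v * a v - u * a u" if "0 \<le> u" "u \<le> v" "0 < v" for u v
    using interval_integral_eq_integral[OF that(2) set[OF that(1)]] integral_unique[OF average_increment[OF that]] by simp
  show "interval_lebesgue_integrable lborel (ereal s) (ereal \<gamma>) b"
    using ivl[of s \<gamma>] ivl[of \<gamma> s] \<gamma> s interval_integrable_endpoints_reverse[of "ereal s" "ereal \<gamma>" b] by (cases "s \<le> \<gamma>") auto
  have "(LBINT \<beta>=ereal s..ereal \<gamma>. b \<beta>) = \<gamma> * a \<gamma> - s * a s"
  proof (cases "s \<le> \<gamma>")
    case False
    then show ?thesis using val[of \<gamma> s] \<gamma> s interval_integral_endpoints_reverse[of "ereal s" "ereal \<gamma>" b] by simp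
  qed (use val \<gamma> s in auto)
  then show "a \<gamma> = s * a s / \<gamma> + 1 / \<gamma> * (LBINT \<beta>=ereal s..ereal \<gamma>. b \<beta>)" using \<gamma> by (simp add: diff_divide_distrib)
qed

end

section \<open>The abstract Wiener space\<close>

lemma (in prob_space) centered_normal:
  assumes X: "distributed M lborel X (normal_density 0 \<sigma>)" and \<sigma>: "0 < \<sigma>"
  shows "integrable M (\<lambda>th. (X th)\<^sup>2)" "expectation (\<lambda>th. (X th)\<^sup>2) = \<sigma>\<^sup>2"
    and "expectation (\<lambda>th. cos (X th)) = exp (- \<sigma>\<^sup>2 / 2)" "expectation (\<lambda>th. sin (X th)) = 0"
proof -
  have Xm [measurable]: "X \<in> borel_measurable M" using X by (simp add: distributed_def)
  show "integrable M (\<lambda>th. (X th)\<^sup>2)"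
    using distributed_integrable[OF X, of "\<lambda>x. x\<^sup>2"] integrable_normal_moment[OF \<sigma>, of 0 2] by simp
  show "expectation (\<lambda>th. (X th)\<^sup>2) = \<sigma>\<^sup>2"
    using normal_distributed_variance[OF \<sigma> X] normal_distributed_expectation[OF \<sigma> X] by simp
  let ?Z = "\<lambda>th. (X th - 0) / \<sigma>"
  have "distributed M lborel ?Z std_normal_density"
    using X normal_standard_normal_convert[OF \<sigma>, of X 0] by simp
  then have Z: "distr M lborel ?Z = std_normal_distribution" by (simp add: distributed_def)
  have [simp]: "cmod (iexp r) = 1" for r by simp
  have int: "integrable M (\<lambda>th. iexp (X th))" by (rule integrable_const_bound[of _ 1]) auto
  have "expectation (\<lambda>th. iexp (X th)) = (LINT v|(distr M lborel ?Z). iexp (\<sigma> * v))"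
    using \<sigma> by (subst integral_distr) auto
  also have "\<dots> = complex_of_real (exp (- \<sigma>\<^sup>2 / 2))"
    unfolding Z using char_std_normal_distribution by (simp add: char_def fun_eq_iff)
  finally have E: "expectation (\<lambda>th. iexp (X th)) = complex_of_real (exp (- \<sigma>\<^sup>2 / 2))" .
  have ie: "iexp r = cis r" for r by (simp add: cis_conv_exp)
  have "expectation (\<lambda>th. Re (iexp (X th))) = exp (- \<sigma>\<^sup>2 / 2)"
    using integral_bounded_linear[OF bounded_linear_Re int] E by simp
  then show "expectation (\<lambda>th. cos (X th)) = exp (- \<sigma>\<^sup>2 / 2)" by (simp add: ie)
  have "expectation (\<lambda>th. Im (iexp (X th))) = 0"
    using integral_bounded_linear[OF bounded_linear_Im int] E by simp
  then show "expectation (\<lambda>th. sin (X th)) = 0" by (simp add: ie)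
qed

text \<open>
  The hypotheses on the Wiener space, the projections and the signal. They make the functionals on the
  large space, embedded in the signal space by \<open>dual_to_H\<close>, the dense subspace of a
  \<open>projected_channel\<close>.
\<close>

locale white_noise_channel = prob_space M
  for M :: "'a measure" +
  fixes w :: "'a \<Rightarrow> 'o::{banach, second_countable_topology}"
    and \<iota> :: "'h::{banach, real_inner, second_countable_topology} \<Rightarrow> 'o"
    and \<pi> :: "real \<Rightarrow> 'h \<Rightarrow> 'h" and x :: "'a \<Rightarrow> 'h"
  assumes wiener: "abstract_wiener_space M w \<iota>" and family: "projection_family \<iota> \<pi>"
    and signal_L2: "x \<in> L2 M" and independent: "independent_rvs M x w"
begin

lemma \<iota>: "bounded_linear \<iota>" "inj \<iota>" "closure (range \<iota>) = UNIV"
  using wiener by (auto simp: abstract_wiener_space_def)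

lemma w_measurable: "w \<in> borel_measurable M"
  using wiener by (simp add: abstract_wiener_space_def centered_nondegenerate_gaussian_def)

abbreviation dual :: "('o \<Rightarrow>\<^sub>L real) \<Rightarrow> 'h" where "dual \<equiv> dual_to_H \<iota>"

lemma dual_eqI: "(\<And>h. k \<bullet> h = blinfun_apply l (\<iota> h)) \<Longrightarrow> dual l = k"
  unfolding dual_to_H_def
proof (rule the_equality)
  fix k' assume k: "\<And>h. k \<bullet> h = blinfun_apply l (\<iota> h)" and k': "\<forall>h. k' \<bullet> h = blinfun_apply l (\<iota> h)"
  then have "(k' - k) \<bullet> (k' - k) = 0" by (simp only: inner_diff_left diff_self)
  then show "k' = k" by simp
qed auto

lemma dual_inner: "dual l \<bullet> h = blinfun_apply l (\<iota> h)"
proof -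
  have "bounded_linear (\<lambda>h. blinfun_apply l (\<iota> h))" by (rule bounded_linear_compose[OF blinfun.bounded_linear_right \<iota>(1)])
  then obtain k where k: "\<And>h. k \<bullet> h = blinfun_apply l (\<iota> h)" using riesz_representation by blast
  then have "dual l = k" by (rule dual_eqI)
  then show ?thesis using k by simp
qed

lemma dual_add: "dual (l + l') = dual l + dual l'" and dual_scale: "dual (c *\<^sub>R l) = c *\<^sub>R dual l"
  by (rule dual_eqI; simp add: inner_add_left dual_inner blinfun.add_left blinfun.scaleR_left)+

lemma inj_dual: "inj dual"
proof (rule injI)
  fix l l' assume eq: "dual l = dual l'"
  have "closed {v. blinfun_apply l v = blinfun_apply l' v}"
    by (intro closed_Collect_eq linear_continuous_on blinfun.bounded_linear_right)
  moreover have "range \<iota> \<subseteq> {v. blinfun_apply l v = blinfun_apply l' v}"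
    using dual_inner[of l] dual_inner[of l'] eq by auto
  ultimately have "closure (range \<iota>) \<subseteq> {v. blinfun_apply l v = blinfun_apply l' v}" by (rule closure_minimal[rotated])
  then show "l = l'" using \<iota>(3) by (intro blinfun_eqI) auto
qed

lemma subspace_dual: "subspace (range dual)"
proof -
  have "linear dual" by (rule linearI) (simp_all add: dual_add dual_scale)
  then show ?thesis by (rule linear_subspace_image[OF _ subspace_UNIV])
qed

text \<open>
  A vector orthogonal to all functionals is mapped to zero by \<open>\<iota>\<close>, since
  functionals separate points.
\<close>

lemma dense_dual: "closure (range dual) = UNIV"
proof -
  have "a \<in> closure (range dual)" for a
  proof -
    obtain p where p: "p \<in> closure (range dual)" "\<And>v. v \<in> closure (range dual) \<Longrightarrow> (a - p) \<bullet> v = 0"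
      using closed_subspace_projection[OF subspace_closure[OF subspace_dual] closed_closure, of a] by blast
    have "blinfun_apply l (\<iota> (a - p)) = 0" for l :: "'o \<Rightarrow>\<^sub>L real"
      using p(2)[of "dual l"] closure_subset[of "range dual"] dual_inner[of l "a - p"] by (auto simp: inner_commute)
    then have "\<iota> (a - p) = 0" using exists_functional_nonzero by blast
    then have "a - p = 0" using \<iota>(2) linear_0[OF bounded_linear.linear[OF \<iota>(1)]] by (metis injD)
    then show ?thesis using p(1) by simp
  qed
  then show ?thesis by auto
qed

text \<open>
  The functional represented by \<open>h\<close>, evaluated at the noise.
\<close>

definition W :: "'h \<Rightarrow> 'a \<Rightarrow> real" where "W h th = blinfun_apply (inv dual h) (w th)"

lemma W_dual: "W (dual l) th = blinfun_apply l (w th)"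
  by (simp add: W_def inj_dual)

lemma functional_measurable: "blinfun_apply (l :: 'o \<Rightarrow>\<^sub>L real) \<in> borel_measurable borel"
  by (intro borel_measurable_continuous_onI linear_continuous_on blinfun.bounded_linear_right)

lemma W_measurable: "W h \<in> borel_measurable M"
  unfolding W_def[abs_def] by (rule measurable_compose[OF w_measurable functional_measurable])

lemma W_normal:
  shows "integrable M (\<lambda>th. (W (dual l) th)\<^sup>2)" "expectation (\<lambda>th. (W (dual l) th)\<^sup>2) = (norm (dual l))\<^sup>2"
    and "expectation (\<lambda>th. cos (W (dual l) th)) = exp (- (norm (dual l))\<^sup>2 / 2)" "expectation (\<lambda>th. sin (W (dual l) th)) = 0"
proof -
  have sq: "expectation (\<lambda>th. (W (dual l) th)\<^sup>2) = (norm (dual l))\<^sup>2"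
    using wiener by (simp add: abstract_wiener_space_def W_dual power2_eq_square power2_norm_eq_inner[unfolded power2_eq_square])
  have "integrable M (\<lambda>th. (W (dual l) th)\<^sup>2) \<and> expectation (\<lambda>th. cos (W (dual l) th)) = exp (- (norm (dual l))\<^sup>2 / 2)
    \<and> expectation (\<lambda>th. sin (W (dual l) th)) = 0"
  proof (cases "l = 0")
    case True
    have "dual l = 0" using dual_scale[of 0 0] True by simp
    moreover have "W (dual l) th = 0" for th using True by (simp add: W_dual)
    ultimately show ?thesis by (simp add: prob_space)
  next
    case False
    then obtain \<sigma> where \<sigma>: "0 < \<sigma>" "distributed M lborel (\<lambda>th. blinfun_apply l (w th)) (normal_density 0 \<sigma>)"
      using wiener by (auto simp: abstract_wiener_space_def centered_nondegenerate_gaussian_def)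
    then have "distributed M lborel (W (dual l)) (normal_density 0 \<sigma>)" by (simp add: W_dual[abs_def])
    from centered_normal[OF this \<sigma>(1)] show ?thesis using sq by simp
  qed
  then show "integrable M (\<lambda>th. (W (dual l) th)\<^sup>2)" "expectation (\<lambda>th. (W (dual l) th)\<^sup>2) = (norm (dual l))\<^sup>2"
    and "expectation (\<lambda>th. cos (W (dual l) th)) = exp (- (norm (dual l))\<^sup>2 / 2)" "expectation (\<lambda>th. sin (W (dual l) th)) = 0"
    using sq by auto
qed

lemma W_independent:
  fixes J :: "(nat \<times> nat) set"
  assumes A: "A \<in> sets borel" and B: "B \<in> sets (coords J)"
  shows "prob ((x -` A \<inter> space M) \<inter> ((\<lambda>th. \<lambda>j\<in>J. W (e j) th) -` B \<inter> space M))
    = prob (x -` A \<inter> space M) * prob ((\<lambda>th. \<lambda>j\<in>J. W (e j) th) -` B \<inter> space M)"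
proof -
  let ?\<Phi> = "\<lambda>v. \<lambda>j\<in>J. blinfun_apply (inv dual (e j)) v"
  have "?\<Phi> \<in> measurable borel (coords J)" by (intro measurable_restrict functional_measurable)
  then have "?\<Phi> -` B \<inter> space borel \<in> sets borel" using B by (rule measurable_sets)
  then have B': "?\<Phi> -` B \<in> sets borel" by simp
  have eq: "(\<lambda>th. \<lambda>j\<in>J. W (e j) th) -` B \<inter> space M = w -` (?\<Phi> -` B) \<inter> space M" by (auto simp: W_def)
  have "indep_set {x -` A \<inter> space M | A. A \<in> sets borel} {w -` B \<inter> space M | B. B \<in> sets borel}"
    using independent by (simp add: independent_rvs_def)
  from indep_setD[OF this, of "x -` A \<inter> space M" "w -` (?\<Phi> -` B) \<inter> space M"] show ?thesis
    unfolding eq using A B' by blast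
qed

lemma family_props:
  shows "t \<in> {0..1} \<Longrightarrow> orthogonal_projection (\<pi> t)"
    and "s \<in> {0..1} \<Longrightarrow> t \<in> {0..1} \<Longrightarrow> s \<le> t \<Longrightarrow> range (\<pi> s) \<subseteq> range (\<pi> t)"
    and "continuous_on {0..1} (\<lambda>t. \<pi> t h)" "\<pi> 0 h = 0" "\<pi> 1 h = h"
    and "t \<in> {0..1} \<Longrightarrow> h \<in> range dual \<Longrightarrow> \<pi> t h \<in> range dual"
proof -
  show "s \<in> {0..1} \<Longrightarrow> t \<in> {0..1} \<Longrightarrow> s \<le> t \<Longrightarrow> range (\<pi> s) \<subseteq> range (\<pi> t)"
    using family by (cases "s = t") (auto simp: projection_family_def psubset_eq less_le)
qed (use family in \<open>auto simp: projection_family_def\<close>)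

sublocale C: projected_channel M "range dual" W x \<pi>
proof unfold_locales
  show "W h \<in> L2 M" if "h \<in> range dual" for h
    using that W_normal(1) W_measurable by (auto simp: L2_real_iff)
  show "W (h + k) th = W h th + W k th" if "h \<in> range dual" "k \<in> range dual" for h k th
    using that by (auto simp: W_dual dual_add[symmetric] blinfun.add_left)
  show "W (c *\<^sub>R h) th = c * W h th" if "h \<in> range dual" for h c th
    using that by (auto simp: W_dual dual_scale[symmetric] blinfun.scaleR_left)
  show "expectation (\<lambda>th. (W h th)\<^sup>2) = (norm h)\<^sup>2" "expectation (\<lambda>th. cos (W h th)) = exp (- (norm h)\<^sup>2 / 2)"
    "expectation (\<lambda>th. sin (W h th)) = 0" if "h \<in> range dual" for h
    using that W_normal by auto
  show "prob ((x -` A \<inter> space M) \<inter> ((\<lambda>th. \<lambda>j\<in>J. W (e j) th) -` B \<inter> space M))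
    = prob (x -` A \<inter> space M) * prob ((\<lambda>th. \<lambda>j\<in>J. W (e j) th) -` B \<inter> space M)"
    if "A \<in> sets borel" "B \<in> sets (coords J)" for J :: "(nat \<times> nat) set" and e A B
    using that by (rule W_independent)
qed (use subspace_dual dense_dual signal_L2 family_props in \<open>simp_all\<close>)

text \<open>
  The generators of both algebras are the same functions, since \<open>\<pi> t (dual l)\<close>
  represents \<open>dual_proj \<iota> \<pi> t l\<close>.
\<close>

lemma filtration_eq_past:
  assumes t: "t \<in> {0..1}"
  shows "filtration M \<iota> \<pi> (observation \<iota> x w \<gamma>) t = C.past \<gamma> t"
proof -
  have obs: "(\<lambda>th. blinfun_apply (dual_proj \<iota> \<pi> t l) (observation \<iota> x w \<gamma> th)) = C.obs \<gamma> (\<pi> t (dual l))" for l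
  proof
    fix th
    obtain l' where l': "\<pi> t (dual l) = dual l'" using family_props(6)[OF t, of "dual l"] by blast
    then have "dual_proj \<iota> \<pi> t l = l'" unfolding dual_proj_def using inj_dual by (intro the_equality) (auto dest: injD)
    then show "blinfun_apply (dual_proj \<iota> \<pi> t l) (observation \<iota> x w \<gamma> th) = C.obs \<gamma> (\<pi> t (dual l)) th"
      by (simp add: observation_def C.obs_def l' W_dual blinfun.add_right blinfun.scaleR_right dual_inner[symmetric] inner_commute)
  qed
  have "{(\<lambda>th. blinfun_apply (dual_proj \<iota> \<pi> t l) (observation \<iota> x w \<gamma> th)) -` B \<inter> space M | l B. B \<in> sets borel}
    = {C.obs \<gamma> h -` B \<inter> space M | h B. h \<in> \<pi> t ` range dual \<and> B \<in> sets borel}"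
    unfolding obs by blast
  then show ?thesis unfolding filtration_def C.past_def C.filt_def by simp
qed

lemma adapted_eq_causal: "{u \<in> L2 M. adapted M \<iota> \<pi> (observation \<iota> x w \<gamma>) u} = C.causal_class \<gamma>"
  unfolding adapted_def C.causal_class_def by (auto simp: filtration_eq_past)

lemma causal_estimator_projection:
  "is_L2_projection M (C.causal_class \<gamma>) x (causal_estimator M \<iota> \<pi> (observation \<iota> x w \<gamma>) x)"
  unfolding causal_estimator_def adapted_eq_causal by (rule someI_ex[OF C.causal_projection_exists])

lemma causal_error_eq:
  "causal_error M \<iota> \<pi> x w \<gamma> = mean_square x
    - mean_square (causal_estimator M \<iota> \<pi> (observation \<iota> x w \<gamma>) x)"
  unfolding causal_error_def by (rule is_L2_projection_sq(2)[OF causal_estimator_projection C.causal_class_L2 signal_L2])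

text \<open>
  A conditional expectation is unique up to null sets, so the error does not depend on the version
  that was chosen.
\<close>

lemma noncausal_error_eq:
  assumes z: "is_L2_projection M (C.noncausal_class \<gamma> 1) x z"
  shows "noncausal_error M \<iota> \<pi> x w \<gamma> = mean_square x - mean_square z"
proof -
  have 1: "(1::real) \<in> {0..1}" by simp
  let ?F = "filtration M \<iota> \<pi> (observation \<iota> x w \<gamma>) 1" and ?v = "noncausal_estimator M \<iota> \<pi> (observation \<iota> x w \<gamma>) x"
  note F = C.past_full[OF 1, of \<gamma>] and z' = z[unfolded C.noncausal_class_def]
  have "\<exists>v. is_cond_exp M (C.past \<gamma> 1) x v" using L2_projection_is_cond_exp[OF F signal_L2 z'] by blast
  then have v: "is_cond_exp M (C.past \<gamma> 1) x ?v"
    unfolding noncausal_estimator_def filtration_eq_past[OF 1] by (rule someI_ex)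
  then have ae: "AE th in M. ?v th = z th" by (rule is_cond_exp_AE_projection[OF F signal_L2 z'])
  have [measurable]: "?v \<in> borel_measurable M" "z \<in> borel_measurable M"
    using v z C.noncausal_class_L2 by (auto simp: is_cond_exp_def is_L2_projection_def intro: borel_measurable_integrable L2_measurable)
  have "noncausal_error M \<iota> \<pi> x w \<gamma> = mean_square (\<lambda>th. x th - z th)"
    unfolding noncausal_error_def using ae L2_measurable[OF signal_L2]
    by (intro integral_cong_AE) (auto elim!: eventually_mono)
  also have "\<dots> = mean_square x - mean_square z"
    by (rule is_L2_projection_sq(2)[OF z C.noncausal_class_L2 signal_L2])
  finally show ?thesis .
qed

lemma
  shows noncausal_error_continuous: "continuous_on {0<..} (noncausal_error M \<iota> \<pi> x w)"
    and noncausal_error_antimono: "\<And>s t. 0 < s \<Longrightarrow> s \<le> t \<Longrightarrow> noncausal_error M \<iota> \<pi> x w t \<le> noncausal_error M \<iota> \<pi> x w s"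
    and noncausal_error_bound: "\<And>t. 0 < t \<Longrightarrow> \<bar>noncausal_error M \<iota> \<pi> x w t\<bar> \<le> mean_square x"
    and causal_error_average: "\<And>t. 0 < t \<Longrightarrow>
      ((\<lambda>\<beta>. if \<beta> = 0 then 0 else noncausal_error M \<iota> \<pi> x w \<beta>) has_integral t * causal_error M \<iota> \<pi> x w t) {0..t}"
proof -
  define z where "z \<beta> t = (SOME z. is_L2_projection M (C.noncausal_class \<beta> t) x z)" for \<beta> t
  have z: "is_L2_projection M (C.noncausal_class \<beta> t) x (z \<beta> t)" if "t \<in> {0..1}" for \<beta> t
    unfolding z_def by (rule someI_ex[OF C.noncausal_projection_exists[OF that signal_L2]])
  let ?E = "mean_square x" and ?f = "\<lambda>\<beta>. mean_square (z \<beta> 1)"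
  have z1: "is_L2_projection M (C.noncausal_class \<beta> 1) x (z \<beta> 1)" for \<beta> by (rule z) simp
  have err: "noncausal_error M \<iota> \<pi> x w \<beta> = ?E - ?f \<beta>" for \<beta> by (rule noncausal_error_eq[OF z1])
  show "continuous_on {0<..} (noncausal_error M \<iota> \<pi> x w)"
    unfolding err[abs_def] by (intro continuous_intros C.noncausal_continuous[of z, OF z])
  show "noncausal_error M \<iota> \<pi> x w t \<le> noncausal_error M \<iota> \<pi> x w s" if "0 < s" "s \<le> t" for s t
    unfolding err using mono_onD[OF C.noncausal_increasing[of z, OF z], of s t] that by simp
  show "\<bar>noncausal_error M \<iota> \<pi> x w t\<bar> \<le> ?E" for t
  proof -
    have "0 \<le> ?f t" by (rule lint_nonneg) simp
    then show ?thesis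
      unfolding err using is_L2_projection_sq(3)[OF z1 C.noncausal_class_L2 signal_L2, of t] by linarith
  qed
  show "((\<lambda>\<beta>. if \<beta> = 0 then 0 else noncausal_error M \<iota> \<pi> x w \<beta>) has_integral t * causal_error M \<iota> \<pi> x w t) {0..t}" if t: "0 < t" for t
  proof -
    let ?c = "causal_estimator M \<iota> \<pi> (observation \<iota> x w t) x"
    let ?F = "\<lambda>\<beta>. if \<beta> = 0 then 0 else ?f \<beta>"
    have "(?F has_integral t * mean_square ?c) {0..t}"
      using C.causal_eq_average[of z, OF z t causal_estimator_projection] by (simp add: has_integral_iff)
    moreover have "((\<lambda>_. ?E) has_integral t * ?E) {0..t}" using has_integral_const_real[of ?E 0 t] t by simp
    ultimately have "((\<lambda>\<beta>. ?E - ?F \<beta>) has_integral t * ?E - t * mean_square ?c) {0..t}"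
      by (intro has_integral_diff)
    then have "((\<lambda>\<beta>. ?E - ?F \<beta>) has_integral t * causal_error M \<iota> \<pi> x w t) {0..t}"
      unfolding causal_error_eq by (simp add: right_diff_distrib)
    then show ?thesis by (rule has_integral_spike_finite[rotated 2, of _ _ _ "{0}"]) (auto simp: err)
  qed
qed

end

theorem corollary3p3:
  fixes M :: "'a measure"
    and w :: "'a \<Rightarrow> 'o::{banach, second_countable_topology}"
    and \<iota> :: "'h::{banach, real_inner, second_countable_topology} \<Rightarrow> 'o"
    and \<pi> :: "real \<Rightarrow> 'h \<Rightarrow> 'h"
    and x :: "'a \<Rightarrow> 'h"
  assumes "prob_space M" and "complete_measure M"
    and "abstract_wiener_space M w \<iota>"
    and "projection_family \<iota> \<pi>"
    and "x \<in> L2 M"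
    and "independent_rvs M x w"
  shows "(\<forall>\<gamma>>0. ((\<lambda>\<gamma>. \<gamma> * causal_error M \<iota> \<pi> x w \<gamma>) has_real_derivative
                   noncausal_error M \<iota> \<pi> x w \<gamma>) (at \<gamma>))
       \<and> (\<forall>\<gamma>>0. \<forall>\<gamma>0\<ge>0.
            interval_lebesgue_integrable lborel (ereal \<gamma>0) (ereal \<gamma>) (noncausal_error M \<iota> \<pi> x w) \<and>
            causal_error M \<iota> \<pi> x w \<gamma> =
              \<gamma>0 * causal_error M \<iota> \<pi> x w \<gamma>0 / \<gamma>
              + 1 / \<gamma> * (LBINT \<beta>=ereal \<gamma>0..ereal \<gamma>. noncausal_error M \<iota> \<pi> x w \<beta>))
       \<and> concave_on {0<..} (\<lambda>\<eta>. causal_error M \<iota> \<pi> x w (1 / \<eta>))"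
proof -
  interpret prob_space M by fact
  interpret white_noise_channel M w \<iota> \<pi> x by unfold_locales (fact assms)+
  note err = noncausal_error_continuous noncausal_error_antimono noncausal_error_bound causal_error_average
  show ?thesis
    using average_derivative[OF err] average_interval_integral[OF err] average_concave[OF err] by blast
qed

end
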